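(* For every $\sigma \in \left(\frac{1}{2},1\right)$ there exists a constant $c_1(\sigma)$ such that for every $X \geq c_1(\sigma)$ there exists a fundamental discriminant $d \in \mathbb{N}$ with $X \leq d \leq \frac{5}{2} X$ and \[ 0<|L(\sigma,\chi_d)|\leq \exp\left(-\left(4\sigma+o(1)\right)\frac{(\log X)^{\frac{1-\sigma}{2\sigma}}}{\log\log X}\right), \] where $o(1)$ denotes a quantity tending to $0$ as $X\to+\infty$. In particular, for every real $\sigma \in \left( \frac{1}{2}, 1 \right)$ we have $\inf(h_{\sigma}(\mathcal{N})) = 0$, and $h_\sigma$ does not have the Bogomolov property.
   Context: For a fundamental discriminant $d$, $\chi_d(n) := \left(\frac{d}{n}\right)$ is the real primitive character given by the Kronecker symbol, and $L(s,\chi_d)$ is its Dirichlet $L$-function (entire). $\mathcal{N}$ denotes the set of isomorphism classes of number fields; for a number field $K$ and $s\in\mathbb{C}$, $\zeta_K^\ast(s)$ is the first non-vanishing coefficient of the Laurent expansion of the Dedekind zeta function $\zeta_K$ at $s$, and $h_s([K]) := \lvert\zeta_K^\ast(s)\rvert$. A function $h\colon\mathcal{N}\to\mathbb{R}_{\ge 0}$ has the Bogomolov property if $\inf h(\mathcal{N})$ is isolated in $h(\mathcal{N})$, i.e. there is $\varepsilon>0$ with $h(\mathcal{N})\cap(\inf h(\mathcal{N}),\inf h(\mathcal{N})+\varepsilon)=\emptyset$. *)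

theory Defs
  imports
    "HOL-Complex_Analysis.Complex_Analysis"
    "HOL-Computational_Algebra.Squarefree"
    "HOL-Number_Theory.Residues"
    "HOL-Algebra.Algebraic_Closure_Type"
begin

(* The case d = 1, whose character is principal, is excluded: fundamental discriminants
   are the discriminants of quadratic fields. *)
definition fundamental_discriminant :: "int \<Rightarrow> bool" where
  "fundamental_discriminant d \<longleftrightarrow> d \<noteq> 1 \<and>
     (d mod 4 = 1 \<and> squarefree d \<or>
      (\<exists>m. d = 4 * m \<and> (m mod 4 = 2 \<or> m mod 4 = 3) \<and> squarefree m))"

definition kronecker_prime :: "int \<Rightarrow> nat \<Rightarrow> int" where
  "kronecker_prime d p =
     (if p = 2 then (if even d then 0 else if d mod 8 = 1 \<or> d mod 8 = 7 then 1 else -1)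
      else Legendre d (int p))"

definition kronecker :: "int \<Rightarrow> nat \<Rightarrow> int" where
  "kronecker d n =
     (if n = 0 then (if \<bar>d\<bar> = 1 then 1 else 0)
      else (\<Prod>p\<in>#prime_factorization n. kronecker_prime d p))"

(* The meromorphic continuation to the whole plane of a function given on Re s > 1.
   It is unique by the identity theorem, since the predicate nicely_meromorphic_on
   prescribes the value 0 at poles and removes removable singularities. *)
definition meromorphic_continuation :: "(complex \<Rightarrow> complex) \<Rightarrow> complex \<Rightarrow> complex" where
  "meromorphic_continuation f =
     (THE F. F nicely_meromorphic_on UNIV \<and> (\<forall>s. Re s > 1 \<longrightarrow> F s = f s))"

definition Dirichlet_L :: "(nat \<Rightarrow> int) \<Rightarrow> complex \<Rightarrow> complex" where
  "Dirichlet_L f = meromorphic_continuation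
     (\<lambda>s. \<Sum>n. of_int (f (Suc n)) * of_nat (Suc n) powr (-s))"

abbreviation complex_subring :: "complex set \<Rightarrow> complex ring" where
  "complex_subring A \<equiv> ring_of_type_algebra\<lparr>carrier := A\<rparr>"

(* Every number field embeds into the complex numbers, so the number fields inside the
   complex numbers represent all isomorphism classes. *)
definition number_field :: "complex set \<Rightarrow> bool" where
  "number_field K \<longleftrightarrow> subfield K ring_of_type_algebra \<and>
     ring.finite_dimension ring_of_type_algebra \<rat> K"

definition number_field_classes :: "complex set set set" where
  "number_field_classes = {K. number_field K} //
     {(K, L). number_field K \<and> number_field L \<and> complex_subring K \<simeq> complex_subring L}"

definition ring_of_integers :: "complex set \<Rightarrow> complex ring" where
  "ring_of_integers K = complex_subring {x \<in> K. algebraic_int x}"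

definition ideal_norm :: "complex set \<Rightarrow> complex set \<Rightarrow> nat" where
  "ideal_norm K I = card (carrier (ring_of_integers K Quot I))"

definition dedekind_zeta :: "complex set \<Rightarrow> complex \<Rightarrow> complex" where
  "dedekind_zeta K = meromorphic_continuation
     (\<lambda>s. \<Sum>\<^sub>\<infinity>I\<in>{I. ideal I (ring_of_integers K) \<and> I \<noteq> {0}}. of_nat (ideal_norm K I) powr (-s))"

definition first_laurent_coeff :: "(complex \<Rightarrow> complex) \<Rightarrow> complex \<Rightarrow> complex" where
  "first_laurent_coeff f s =
     fls_nth (laurent_expansion f s) (fls_subdegree (laurent_expansion f s))"

(* The value does not depend on the chosen representative of the isomorphism class C. *)
definition zeta_height :: "complex \<Rightarrow> complex set set \<Rightarrow> real" where
  "zeta_height s C = norm (first_laurent_coeff (dedekind_zeta (SOME K. K \<in> C)) s)"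

definition bogomolov_property :: "('a \<Rightarrow> real) \<Rightarrow> 'a set \<Rightarrow> bool" where
  "bogomolov_property h N \<longleftrightarrow>
     (\<exists>\<epsilon>>0. h ` N \<inter> {Inf (h ` N)<..<Inf (h ` N) + \<epsilon>} = {})"

end

theory Submission
  imports Defs "HOL-Number_Theory.Number_Theory" "HOL-Real_Asymp.Real_Asymp"
begin

text \<open>
  Prescribe \<open>d mod 8 = 5\<close> and \<open>\<chi>\<^sub>d(p) = -1\<close> for all primes \<open>p \<le> y\<close>, with \<open>y\<close> a power of \<open>log X\<close> whose exponent
  lies strictly between \<open>1/(2\<sigma>)\<close> and \<open>1\<close>. Removing the Euler factors of these primes from \<open>L(\<sigma>, \<chi>\<^sub>d)\<close> leaves a
  factor that is close to 1 in mean square over the squarefree \<open>d\<close> of this residue class in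
  \<open>[X, 5X/2]\<close>. So for some \<open>d\<close> it is positive and bounded, and \<open>L(\<sigma>, \<chi>\<^sub>d)\<close> is positive and at most a
  constant times the product of \<open>1/(1 + 1/p\<^sup>\<sigma>)\<close> over \<open>p \<le> y\<close>. The mean square is computed on the
  Mellin representation, in which \<open>L(\<sigma>, \<chi>\<^sub>d) \<Gamma>(\<sigma>)\<close> is the integral of \<open>\<psi>\<^sub>d(u) u\<^sup>\<sigma>\<^sup>-\<^sup>1\<close> with
  \<open>\<psi>\<^sub>d(u) = \<Sum> \<chi>\<^sub>d(n) exp(-n u)\<close>: the Polya-Vinogradov inequality handles large \<open>u\<close>, and the reflection
  formula for \<open>\<psi>\<^sub>d\<close>, which follows from Gauss sums, handles small \<open>u\<close>.

  The nonzero ideals of the maximal order of \<open>K = \<rat>(\<surd>d)\<close> are the lattices \<open>g(\<int>a + \<int>(b + \<omega>))\<close> with \<open>a\<close>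
  dividing the norm of \<open>b + \<omega>\<close>. Counting them by index gives \<open>\<zeta>\<^sub>K(s) = \<zeta>(s) L(s, \<chi>\<^sub>d)\<close>, so the height of
  \<open>K\<close> at \<open>\<sigma>\<close> is a positive constant, independent of \<open>d\<close>, times \<open>\<bar>L(\<sigma>, \<chi>\<^sub>d)\<bar>\<close>.
\<close>

text \<open>A mean value is used because nothing excludes a zero of an individual L-function in
  (1/2, 1): averaging makes the sieved factor close to 1 for some d, which gives non-vanishing and
  the upper bound at once. Prescribing the signs costs a modulus of size up to 4 y^y, which must
  stay below a small power of X; hence the exponent of log X in y is below 1. The gain is about
  exp(c y^(1-\<sigma>) / log y), and an exponent above 1/(2\<sigma>) makes it beat the required
  bound whatever the constant in front, so the o(1) can be taken to be 0. Correlations of characters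
  cost the square root of the modulus m n, so sums over n are affordable up to length about X^(1/2);
  cutting the Mellin integral at u = X^(-1/2) gives this length on both sides of the reflection.
  Reflection exists only for the complete character, so for small u the primes up to y are put back
  one at a time. Taking d = 5 mod 8 makes 2 inert, turns \<chi>_d into a Jacobi symbol in n, and
  makes (1 + sqrt d)/2 a generator of the maximal order.\<close>

hide_const (open) Divisibility.prime Coset.order

text \<open>The Jacobi symbol. At even m the prime 2 enters through \<open>Legendre a 2\<close>,
  which is 1 for every odd a; the Kronecker symbol is different there, so the two are compared at
  odd arguments.\<close>

definition jac :: "int \<Rightarrow> nat \<Rightarrow> int" where
  "jac a m = (\<Prod>p\<in>#prime_factorization m. Legendre a (int p))"

lemma Legendre_values: "Legendre a p \<in> {-1, 0, 1}"
  by (simp add: Legendre_def)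

lemma Legendre_eq_0_iff: "Legendre a p = 0 \<longleftrightarrow> p dvd a"
  by (simp add: Legendre_def cong_0_iff)

lemma Legendre_cong: "[a = b] (mod p) \<Longrightarrow> Legendre a p = Legendre b p"
  by (simp add: Legendre_def QuadRes_def cong_def)

text \<open>Euler's criterion makes both sides congruent modulo p; two numbers in {-1, 0, 1} differ
  by at most 2, so they agree once p > 2.\<close>

lemma Legendre_mult:
  assumes "prime (p::nat)" "p > 2"
  shows "Legendre (a * b) (int p) = Legendre a (int p) * Legendre b (int p)"
proof -
  have "[Legendre (a * b) (int p) = (a * b) ^ ((p - 1) div 2)] (mod (int p))"
    using euler_criterion[OF assms] by simp
  also have "[(a * b) ^ ((p - 1) div 2) = Legendre a (int p) * Legendre b (int p)] (mod (int p))"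
    unfolding power_mult_distrib
    by (intro cong_mult cong_sym[OF euler_criterion[OF assms]])
  finally have "int p dvd Legendre (a * b) (int p) - Legendre a (int p) * Legendre b (int p)" (is "_ dvd ?D")
    by (simp add: cong_iff_dvd_diff)
  moreover have "\<bar>?D\<bar> \<le> 2"
    using Legendre_values[of "a*b" "int p"] Legendre_values[of a "int p"] Legendre_values[of b "int p"] by auto
  ultimately have "?D = 0" using assms(2) dvd_imp_le_int[of ?D "int p"] by auto
  thus ?thesis by simp
qed

lemma jac_1_right [simp]: "jac a 1 = 1" "jac a (Suc 0) = 1" by (simp_all add: jac_def)

lemma jac_prime: "prime p \<Longrightarrow> jac a p = Legendre a (int p)"
  by (simp add: jac_def prime_factorization_prime)

lemma jac_mult_right: "m > 0 \<Longrightarrow> n > 0 \<Longrightarrow> jac a (m * n) = jac a m * jac a n"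
  by (simp add: jac_def prime_factorization_mult)

lemma jac_mult_left: assumes "odd m" shows "jac (a * b) m = jac a m * jac b m"
proof -
  have "jac (a * b) m = (\<Prod>p\<in>#prime_factorization m. Legendre a (int p) * Legendre b (int p))"
    unfolding jac_def
  proof (intro arg_cong[of _ _ prod_mset] image_mset_cong)
    fix p assume "p \<in># prime_factorization m"
    hence "prime p" "p dvd m" by auto
    with assms have "p > 2" by (metis dvd_trans even_numeral prime_nat_iff le_neq_implies_less prime_ge_2_nat)
    thus "Legendre (a * b) (int p) = Legendre a (int p) * Legendre b (int p)"
      using Legendre_mult \<open>prime p\<close> by blast
  qed
  thus ?thesis by (simp add: jac_def prod_mset.distrib)
qed

lemma jac_cong: assumes "[a = b] (mod int m)" shows "jac a m = jac b m"
  unfolding jac_def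
proof (intro arg_cong[of _ _ prod_mset] image_mset_cong)
  fix p assume "p \<in># prime_factorization m"
  hence "int p dvd int m" by auto
  thus "Legendre a (int p) = Legendre b (int p)"
    using assms by (metis Legendre_cong cong_iff_dvd_diff dvd_trans)
qed

lemma jac_mod: "jac (a mod int m) m = jac a m"
  by (rule jac_cong) (simp add: cong_def)

lemma odd_nat_induct [consumes 1, case_names one factor]:
  assumes "odd (n::nat)" "P 1"
    "\<And>p n. prime p \<Longrightarrow> odd p \<Longrightarrow> odd n \<Longrightarrow> P n \<Longrightarrow> P (p * n)"
  shows "P n"
  using assms(1)
proof (induction n rule: prime_divisors_induct)
  case zero thus ?case by simp
next
  case (unit x) thus ?case using assms(2) by simp
next
  case (factor p x) thus ?case using assms(3)[of p x] by simp
qed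

lemma jac_values: "jac a m \<in> {-1, 0, 1}"
proof (cases "m = 0")
  case True thus ?thesis by (simp add: jac_def)
next
  case False thus ?thesis
  proof (induction m rule: prime_divisors_induct)
    case (factor p x)
    hence "jac a (p * x) = Legendre a (int p) * jac a x"
      using jac_mult_right[of p x a] by (auto simp: jac_prime prime_gt_0_nat)
    thus ?case using factor Legendre_values[of a "int p"] by auto
  qed auto
qed

lemma abs_jac_le: "\<bar>jac a m\<bar> \<le> 1" using jac_values[of a m] by auto

lemma jac_eq_0_iff: "m > 0 \<Longrightarrow> jac a m = 0 \<longleftrightarrow> \<not> coprime a (int m)"
proof (induction m rule: prime_divisors_induct)
  case (factor p x)
  hence *: "jac a (p * x) = Legendre a (int p) * jac a x"
    using jac_mult_right[of p x a] by (auto simp: jac_prime prime_gt_0_nat)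
  have "coprime a (int p) \<longleftrightarrow> \<not> int p dvd a"
    using factor(1) by (metis coprime_commute prime_imp_coprime prime_nat_int_transfer coprime_absorb_left prime_int_iff not_prime_unit)
  thus ?case using factor * by (auto simp: Legendre_eq_0_iff)
qed auto

lemma jac_sq: "m > 0 \<Longrightarrow> jac a m * jac a m = (if coprime a (int m) then 1 else 0)"
  using jac_values[of a m] jac_eq_0_iff[of m a] by auto

lemma jac_one_left [simp]: "odd m \<Longrightarrow> jac 1 m = 1"
  using jac_mult_left[of m 1 1] jac_eq_0_iff[of m 1] by (auto simp: odd_pos)

subsection \<open>Reciprocity\<close>

text \<open>For odd arguments this is the reciprocity sign (-1)^((m-1)/2 * (n-1)/2). Written with
  residues modulo 4, its multiplicativity is a finite check.\<close>

definition rsgn :: "nat \<Rightarrow> nat \<Rightarrow> int" where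
  "rsgn m n = (if m mod 4 = 3 \<and> n mod 4 = 3 then -1 else 1)"

lemma odd_mod4: "odd (n::nat) \<Longrightarrow> n mod 4 = 1 \<or> n mod 4 = 3" by presburger

lemma rsgn_mult: assumes "odd a" "odd b" shows "rsgn (a * b) n = rsgn a n * rsgn b n"
proof -
  have "(a * b) mod 4 = ((a mod 4) * (b mod 4)) mod 4" by (simp add: mod_mult_eq)
  thus ?thesis using odd_mod4[OF assms(1)] odd_mod4[OF assms(2)]
    unfolding rsgn_def by (elim disjE) (simp_all only:, simp_all)
qed

lemma rsgn_commute: "rsgn a b = rsgn b a" by (auto simp: rsgn_def)

lemma Legendre_reciprocity:
  assumes "prime p" "prime q" "odd p" "odd q"
  shows "Legendre (int p) (int q) = rsgn p q * Legendre (int q) (int p)"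
proof (cases "p = q")
  case True thus ?thesis by (simp add: Legendre_eq_0_iff[THEN iffD2])
next
  case False
  have g: "2 < p" "2 < q" using assms by (metis even_numeral le_neq_implies_less prime_ge_2_nat)+
  have e: "(-1::int) ^ ((p - 1) div 2 * ((q - 1) div 2)) = rsgn p q"
  proof -
    have "odd ((p - 1) div 2) \<longleftrightarrow> p mod 4 = 3" "odd ((q - 1) div 2) \<longleftrightarrow> q mod 4 = 3"
      using assms g by presburger+
    thus ?thesis unfolding rsgn_def by (auto simp: minus_one_power_iff)
  qed
  have "\<not> int p dvd int q" using assms False by (metis int_dvd_int_iff primes_dvd_imp_eq)
  hence "Legendre (int q) (int p) * Legendre (int q) (int p) = 1"
    using Legendre_eq_0_iff[of "int q" "int p"] Legendre_values[of "int q" "int p"] by auto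
  moreover have "Legendre (int p) (int q) * Legendre (int q) (int p) = rsgn p q"
    using Quadratic_Reciprocity[OF assms(1) g(1) assms(2) g(2) False] e by simp
  ultimately show ?thesis by (metis mult.assoc mult.right_neutral)
qed

text \<open>Two nested inductions over prime factors, the outer one on n and the inner one on m
  against a single prime q, reduce the claim to two primes, because the symbols and
  \<open>rsgn\<close> are multiplicative in each argument.\<close>

lemma jac_reciprocity:
  assumes "odd m" "odd n"
  shows "jac (int m) n = rsgn m n * jac (int n) m"
  using assms(2)
proof (induction n rule: odd_nat_induct)
  case one
  thus ?case using assms(1) by (auto simp: rsgn_def)
next
  case (factor q n)
  have *: "Legendre (int m) (int q) = rsgn m q * jac (int q) m"
    using assms(1)
  proof (induction m rule: odd_nat_induct)
    case one
    thus ?case using jac_one_left[of q] factor by (auto simp: rsgn_def jac_prime)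
  next
    case (factor p m)
    have "Legendre (int (p * m)) (int q) = Legendre (int p) (int q) * Legendre (int m) (int q)"
      using jac_mult_left[of q "int p" "int m"] \<open>prime q\<close> \<open>odd q\<close> by (simp add: jac_prime)
    also have "\<dots> = rsgn p q * jac (int q) p * (rsgn m q * jac (int q) m)"
      using factor Legendre_reciprocity[of p q] \<open>prime q\<close> \<open>odd q\<close> by (simp add: jac_prime)
    finally show ?case using factor rsgn_mult[of p m q] by (simp add: jac_mult_right odd_pos)
  qed
  have "jac (int m) (q * n) = Legendre (int m) (int q) * jac (int m) n"
    using factor by (simp add: jac_mult_right jac_prime odd_pos)
  also have "\<dots> = rsgn m q * rsgn m n * (jac (int q) m * jac (int n) m)"
    using factor * by simp
  also have "jac (int q) m * jac (int n) m = jac (int (q * n)) m"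
    using assms(1) by (simp add: jac_mult_left)
  finally show ?case using factor rsgn_mult[of q n m] by (simp add: rsgn_commute)
qed

lemma jac_minus_one: assumes "odd m" shows "jac (-1) m = (if m mod 4 = 3 then -1 else 1)"
  using assms
proof (induction m rule: odd_nat_induct)
  case (factor p n)
  have p2: "2 < p" using factor by (metis even_numeral le_neq_implies_less prime_ge_2_nat)
  have "[Legendre (-1) (int p) = (-1) ^ ((p - 1) div 2)] (mod (int p))"
    using euler_criterion[of p "-1"] factor p2 by simp
  moreover have "(-1::int) ^ ((p - 1) div 2) = (if p mod 4 = 3 then -1 else 1)"
  proof -
    have "odd ((p - 1) div 2) \<longleftrightarrow> p mod 4 = 3" using \<open>odd p\<close> p2 by presburger
    thus ?thesis by (auto simp: minus_one_power_iff)
  qed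
  ultimately have "int p dvd Legendre (-1) (int p) - (if p mod 4 = 3 then -1 else 1)" (is "_ dvd ?D")
    by (simp add: cong_iff_dvd_diff)
  moreover have "\<bar>?D\<bar> \<le> 2" using Legendre_values[of "-1" "int p"] by auto
  ultimately have "?D = 0" using p2 dvd_imp_le_int[of ?D "int p"] by linarith
  \<comment> \<open>The sign of -1 is the reciprocity sign against 3, so \<open>rsgn_mult\<close>
    supplies its multiplicativity.\<close>
  hence *: "Legendre (-1) (int p) = rsgn p 3" by (simp add: rsgn_def)
  have "jac (-1) (p * n) = rsgn p 3 * rsgn n 3"
    using factor * by (simp add: jac_mult_right jac_prime odd_pos) (simp add: rsgn_def)
  also have "\<dots> = rsgn (p * n) 3" using factor by (simp add: rsgn_mult)
  finally show ?case by (simp add: rsgn_def)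
qed auto

text \<open>The supplementary law for 2 follows from reciprocity alone. With d = 4 k + 1, passing
  through d + 2 gives (2/d) = ((d+2)/d) = (d/(d+2)) = (-2/(d+2)) = -(2/(d+2)), and the same detour
  from d + 2 to d + 4 has no sign; so the symbol flips each time k increases by 1.\<close>

lemma jac_two: "jac 2 (4 * k + 1) = (-1) ^ k"
proof (induction k)
  case 0 thus ?case by simp
next
  case (Suc k)
  define d where "d = 4 * k + 1"
  have odd: "odd d" "odd (d+2)" "odd (d+4)" and m4: "d mod 4 = 1" "(d+2) mod 4 = 3" "(d+4) mod 4 = 1"
    unfolding d_def by presburger+
  have "jac 2 d = jac (int (d+2)) d" by (rule jac_cong) (simp add: cong_def)
  also have "\<dots> = jac (int d) (d+2)" using jac_reciprocity[of "d+2" d] odd m4 by (simp add: rsgn_def)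
  also have "\<dots> = jac (-1 * 2) (d+2)" by (rule jac_cong) (simp add: cong_iff_dvd_diff algebra_simps)
  also have "\<dots> = - jac 2 (d+2)" using odd m4 by (subst jac_mult_left) (auto simp: jac_minus_one)
  also have "jac 2 (d+2) = jac (int (d+4)) (d+2)" by (rule jac_cong, rule cong_sym) (simp add: cong_iff_dvd_diff algebra_simps)
  also have "\<dots> = jac (int (d+2)) (d+4)" using jac_reciprocity[of "d+4" "d+2"] odd m4 by (simp add: rsgn_def)
  also have "\<dots> = jac (-1 * 2) (d+4)" by (rule jac_cong) (simp add: cong_iff_dvd_diff algebra_simps)
  also have "\<dots> = jac 2 (d+4)" using odd m4 by (subst jac_mult_left) (auto simp: jac_minus_one)
  finally have "jac 2 (d+4) = - jac 2 d" by simp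
  thus ?case using Suc unfolding d_def by (simp add: algebra_simps)
qed

section \<open>The Kronecker symbol as a Jacobi symbol\<close>

lemma kronecker_odd: "odd n \<Longrightarrow> kronecker d n = jac d n"
  unfolding kronecker_def jac_def
  by (auto simp: kronecker_prime_def odd_pos intro!: arg_cong[of _ _ prod_mset] image_mset_cong)

lemma kronecker_mult: "m > 0 \<Longrightarrow> n > 0 \<Longrightarrow> kronecker d (m * n) = kronecker d m * kronecker d n"
  by (simp add: kronecker_def prime_factorization_mult)

lemma kronecker_prime_eq: "prime p \<Longrightarrow> kronecker d p = kronecker_prime d p"
  by (auto simp: kronecker_def prime_factorization_prime)

lemma kronecker_1 [simp]: "kronecker d 1 = 1" "kronecker d (Suc 0) = 1" by (simp_all add: kronecker_def)

text \<open>For d = 1 mod 4 reciprocity carries no sign, and \<open>jac_two\<close> matches the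
  value prescribed at 2. Exchanging the arguments is what shows that the Kronecker symbol is
  periodic in n.\<close>

lemma kronecker_eq_jac:
  assumes d: "d mod 4 = 1" and n: "n > 0"
  shows "kronecker (int d) n = jac (int n) d"
proof -
  have od: "odd d" using d by presburger
  show ?thesis
  using n
proof (induction n rule: prime_divisors_induct)
  case (factor p n)
  have "kronecker_prime (int d) p = jac (int p) d"
  proof (cases "p = 2")
    case True
    define k where "k = d div 4"
    have dk: "d = 4 * k + 1" using d unfolding k_def by presburger
    have "even k \<longleftrightarrow> d mod 8 = 1" "odd k \<longleftrightarrow> d mod 8 = 5" unfolding dk by presburger+
    moreover have "int d mod 8 = int (d mod 8)" by (simp add: zmod_int)
    ultimately show ?thesis using jac_two[of k] True dk od
      by (cases "even k") (auto simp: kronecker_prime_def)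
  next
    case False
    hence "odd p" using factor(1) by (metis prime_prime_factor two_is_prime_nat dvd_refl primes_dvd_imp_eq)
    thus ?thesis using False jac_reciprocity[OF od, of p] factor(1) d
      by (simp add: kronecker_prime_def jac_prime rsgn_def)
  qed
  thus ?case using factor od
    by (auto simp: kronecker_mult prime_gt_0_nat kronecker_prime_eq jac_mult_left)
qed (use od in auto)
qed

lemma kronecker_values: "kronecker d n \<in> {-1, 0, 1}"
proof (cases "n = 0")
  case False thus ?thesis
  proof (induction n rule: prime_divisors_induct)
    case (factor p x)
    hence "kronecker d (p * x) = kronecker_prime d p * kronecker d x"
      using kronecker_mult[of p x d] by (auto simp: kronecker_prime_eq prime_gt_0_nat)
    thus ?case using factor Legendre_values[of d "int p"] by (auto simp: kronecker_prime_def)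
  qed auto
qed (auto simp: kronecker_def)

subsection \<open>Gauss sums\<close>

definition ek :: "nat \<Rightarrow> int \<Rightarrow> complex" where
  "ek m n = cis (2 * pi * of_int n / of_nat m)"

lemma ek_add: "ek m (a + b) = ek m a * ek m b"
  by (simp add: ek_def cis_mult ring_distribs add_divide_distrib)

lemma ek_0 [simp]: "ek m 0 = 1" by (simp add: ek_def)

lemma norm_ek [simp]: "norm (ek m n) = 1" by (simp add: ek_def)

lemma cnj_ek: "cnj (ek m n) = ek m (-n)" by (simp add: ek_def cis_cnj)

lemma ek_mult_period [simp]: "m > 0 \<Longrightarrow> ek m (int m * k) = 1"
proof -
  assume "m > 0"
  hence "ek m (int m * k) = cis (2 * pi * of_int k)" by (simp add: ek_def field_simps)
  thus ?thesis by (simp add: complex_eq_iff)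
qed

lemma ek_cong: "m > 0 \<Longrightarrow> [a = b] (mod int m) \<Longrightarrow> ek m a = ek m b"
proof -
  assume m: "m > 0" and "[a = b] (mod int m)"
  then obtain k where "a = b + int m * k" by (metis cong_iff_lin cong_sym)
  thus ?thesis using m by (simp add: ek_add)
qed

lemma ek_power: "ek m (int i * n) = ek m n ^ i"
  by (induction i) (simp_all add: ring_distribs ek_add)

lemma ek_eq_1_iff: "m > 0 \<Longrightarrow> ek m n = 1 \<longleftrightarrow> int m dvd n"
proof
  assume m: "m > 0" and "ek m n = 1"
  hence "cos (2 * pi * of_int n / of_nat m) = 1" by (simp add: ek_def complex_eq_iff)
  then obtain k :: int where "2 * pi * of_int n / of_nat m = of_int k * 2 * pi"
    by (auto simp: cos_one_2pi_int)
  hence "real_of_int n = real_of_int (k * int m)" using m by (simp add: field_simps)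
  hence "n = k * int m" by (simp only: of_int_eq_iff)
  thus "int m dvd n" by simp
qed (auto elim!: dvdE)

lemma sum_int_atLeastLessThan: 
  "(\<Sum>a\<in>{A..<B::int}. f a) = (\<Sum>i<nat (B - A). f (A + int i))"
  by (rule sum.reindex_bij_witness[of _ "\<lambda>i. A + int i" "\<lambda>a. nat (a - A)"]) auto

lemma sum_ek: assumes m: "m > 0" 
  shows "(\<Sum>a\<in>{0..<int m}. ek m (a * n)) = (if int m dvd n then of_nat m else 0)"
proof -
  have "(\<Sum>a\<in>{0..<int m}. ek m (a * n)) = (\<Sum>i<m. ek m n ^ i)"
    by (simp add: sum_int_atLeastLessThan ek_power)
  also have "\<dots> = (if int m dvd n then of_nat m else 0)"
  proof (cases "int m dvd n")
    case True thus ?thesis using ek_eq_1_iff[OF m, of n] by simp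
  next
    case False
    hence "ek m n \<noteq> 1" using ek_eq_1_iff[OF m] by simp
    moreover have "ek m n ^ m = 1" using ek_power[of m m n] m by simp
    ultimately show ?thesis using False by (simp add: geometric_sum)
  qed
  finally show ?thesis .
qed

lemma sum_mod_mult:
  fixes f :: "int \<Rightarrow> 'a::comm_monoid_add"
  assumes m: "m > 0" and f: "\<And>x. f (x mod m) = f x" and c: "coprime c m"
  shows "(\<Sum>a\<in>{0..<m}. f (c * a)) = (\<Sum>a\<in>{0..<m}. f a)"
proof -
  have inj: "inj_on (\<lambda>a. c * a mod m) {0..<m}"
  proof (rule inj_onI)
    fix x y assume xy: "x \<in> {0..<m}" "y \<in> {0..<m}" "c * x mod m = c * y mod m"
    hence "[c * x = c * y] (mod m)" by (simp add: cong_def)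
    hence "[x = y] (mod m)" using c by (simp add: cong_mult_lcancel)
    thus "x = y" using xy by (simp add: cong_def)
  qed
  have "(\<lambda>a. c * a mod m) ` {0..<m} = {0..<m}"
    by (rule endo_inj_surj[OF _ _ inj]) (use m in auto)
  hence "(\<Sum>a\<in>{0..<m}. f a) = (\<Sum>a\<in>{0..<m}. f (c * a mod m))"
    using sum.reindex[OF inj, of f] by (simp add: o_def)
  thus ?thesis by (simp add: f)
qed

text \<open>If every nonzero residue were a square, squaring would be onto the nonzero residues,
  hence injective on them; but 1 and -1 have the same square.\<close>

lemma ex_nonresidue:
  assumes "prime p" "odd p"
  shows "\<exists>u. Legendre u (int p) = -1"
proof (rule ccontr)
  assume "\<nexists>u. Legendre u (int p) = -1"
  hence L: "Legendre u (int p) \<in> {0, 1}" for u using Legendre_values[of u "int p"] by auto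
  have p2: "p > 2" using assms by (metis even_numeral le_neq_implies_less prime_ge_2_nat)
  let ?f = "\<lambda>y::int. y ^ 2 mod int p"
  have surj: "{1..<int p} \<subseteq> ?f ` {1..<int p}"
  proof
    fix u assume u: "u \<in> {1..<int p}"
    hence nd: "\<not> int p dvd u" using zdvd_not_zless by auto
    hence "Legendre u (int p) = 1" using L[of u] by (auto simp: Legendre_eq_0_iff)
    then obtain y where y: "[y^2 = u] (mod int p)"
      by (auto simp: Legendre_def QuadRes_def split: if_splits)
    have yu: "(y mod int p) ^ 2 mod int p = u" using y u by (simp add: cong_def power_mod)
    moreover have "y mod int p \<noteq> 0" using yu u by (intro notI) auto
    moreover have "y mod int p \<ge> 0" "y mod int p < int p" using p2 by auto
    ultimately show "u \<in> ?f ` {1..<int p}" by (intro image_eqI[of _ _ "y mod int p"]) auto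
  qed
  have "card (?f ` {1..<int p}) \<ge> card {1..<int p}" by (rule card_mono[OF _ surj]) auto
  hence "card (?f ` {1..<int p}) = card {1..<int p}" 
    using card_image_le[of "{1..<int p}" ?f] by simp
  hence "inj_on ?f {1..<int p}" by (rule eq_card_imp_inj_on[rotated]) auto
  moreover have "?f 1 = ?f (int p - 1)"
    by (simp add: power2_eq_square algebra_simps mod_eq_dvd_iff)
  ultimately have "1 = int p - 1" using p2 by (auto dest!: inj_onD[where x = 1 and y = "int p - 1"])
  thus False using p2 by simp
qed

definition gauss_sum :: "nat \<Rightarrow> int \<Rightarrow> complex" where
  "gauss_sum m n = (\<Sum>a\<in>{0..<int m}. of_int (jac a m) * ek m (a * n))"

lemma gauss_sum_coprime:
  assumes m: "odd m" and c: "coprime n (int m)"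
  shows "gauss_sum m n = of_int (jac n m) * gauss_sum m 1"
proof -
  have m0: "m > 0" using m by (simp add: odd_pos)
  have sq: "jac n m * jac n m = 1" using jac_sq[OF m0, of n] c by simp
  have "gauss_sum m n = (\<Sum>a\<in>{0..<int m}. of_int (jac n m) * (of_int (jac (n * a) m) * ek m (n * a)))"
    unfolding gauss_sum_def
  proof (intro sum.cong refl)
    fix a
    have "jac a m = jac n m * jac (n * a) m" using sq m by (simp add: jac_mult_left)
    thus "complex_of_int (jac a m) * ek m (a * n) = of_int (jac n m) * (of_int (jac (n * a) m) * ek m (n * a))"
      by (simp add: mult_ac)
  qed
  also have "\<dots> = of_int (jac n m) * (\<Sum>a\<in>{0..<int m}. of_int (jac (n * a) m) * ek m (n * a))"
    by (simp add: sum_distrib_left)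
  also have "(\<Sum>a\<in>{0..<int m}. of_int (jac (n * a) m) * ek m (n * a)) = gauss_sum m 1"
    unfolding gauss_sum_def mult_1_right
    by (rule sum_mod_mult[where f = "\<lambda>x. of_int (jac x m) * ek m x"])
       (use m0 c in \<open>auto simp: jac_mod intro!: arg_cong2[of _ _ _ _ "(*)"] ek_cong cong_mod_leftI\<close>)
  finally show ?thesis .
qed

text \<open>Let p be a common prime factor of n and m = p k. A multiplier c that is a nonresidue
  modulo p and 1 modulo k leaves every exponential unchanged, since m divides (c - 1) n, but flips
  the sign of the symbol. The sum therefore equals its negative. Squarefreeness makes p and k
  coprime, so that c exists.\<close>

lemma gauss_sum_not_coprime:
  assumes m: "odd m" "squarefree m" and c: "\<not> coprime n (int m)"
  shows "gauss_sum m n = 0"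
proof -
  have m0: "m > 0" using m by (simp add: odd_pos)
  have "gcd n (int m) \<noteq> 1" "gcd n (int m) \<ge> 0" using c by (auto simp: coprime_iff_gcd_eq_1)
  hence "nat (gcd n (int m)) \<noteq> 1" by auto
  then obtain p where p: "prime p" "p dvd nat (gcd n (int m))" using prime_factor_nat by blast
  have "int p dvd gcd n (int m)" using p(2) by (metis gcd_ge_0_int int_dvd_int_iff nat_0_le)
  hence pn: "int p dvd n" and pm: "p dvd m" by (auto simp: int_dvd_int_iff)
  then obtain k where k: "m = p * k" by (auto elim: dvdE)
  have op: "odd p" and ok: "odd k" using m k by auto
  have "\<not> p dvd k"
  proof
    assume "p dvd k" hence "p ^ 2 dvd m" unfolding k power2_eq_square by simp
    hence "p dvd 1" using m(2) by (auto dest: squarefreeD)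
    thus False using p(1) by simp
  qed
  hence cop: "coprime (int p) (int k)" using p(1) by (simp add: prime_imp_coprime)
  obtain u where u: "Legendre u (int p) = -1" using ex_nonresidue[OF p(1) op] by blast
  obtain c where c: "[c = u] (mod int p)" "[c = 1] (mod int k)"
    using binary_chinese_remainder_int[OF cop, of u 1] by blast
  have jc: "jac c m = -1"
    using p(1) ok u jac_cong[OF c(2)] Legendre_cong[OF c(1)] 
    by (simp add: k jac_mult_right prime_gt_0_nat odd_pos jac_prime)
  have cc: "coprime c (int m)" using jac_eq_0_iff[OF m0, of c] jc by simp
  have "int m dvd (c - 1) * n"
  proof -
    have "int k dvd c - 1" using c(2) by (simp add: cong_iff_dvd_diff)
    hence "int k * int p dvd (c - 1) * n" using pn by (rule mult_dvd_mono)
    thus ?thesis unfolding k by (metis mult.commute of_nat_mult)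
  qed
  hence e: "ek m (c * a * n) = ek m (a * n)" for a
    using m0 by (intro ek_cong) (auto simp: cong_iff_dvd_diff algebra_simps 
       dest: dvd_mult[of _ _ a])
  have "gauss_sum m n = (\<Sum>a\<in>{0..<int m}. of_int (jac (c * a) m) * ek m ((c * a) * n))"
    unfolding gauss_sum_def
    by (rule sum_mod_mult[symmetric, where f = "\<lambda>x. of_int (jac x m) * ek m (x * n)"])
       (use m0 cc in \<open>auto simp: jac_mod intro!: arg_cong2[of _ _ _ _ "(*)"] ek_cong cong_mult cong_mod_leftI\<close>)
  also have "\<dots> = - gauss_sum m n"
    unfolding gauss_sum_def using m jc by (simp add: e jac_mult_left sum_negf)
  finally show ?thesis by simp
qed

lemma gauss_sum_eq:
  assumes m: "odd m" "squarefree m"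
  shows "gauss_sum m n = of_int (jac n m) * gauss_sum m 1"
proof (cases "coprime n (int m)")
  case False
  thus ?thesis using gauss_sum_not_coprime[OF m False] m jac_eq_0_iff[of m n] by (simp add: odd_pos)
next
  case True
  thus ?thesis using gauss_sum_coprime m by blast
qed

text \<open>The sum over n of |G(n)|^2 is computed twice: \<open>gauss_sum_eq\<close> gives P
  |G(1)|^2, orthogonality of the additive characters gives m P, where P counts the units modulo
  m.\<close>

lemma norm_gauss_sum:
  assumes m: "odd m" "squarefree m"
  shows "norm (gauss_sum m 1) = sqrt (real m)"
proof -
  have m0: "m > 0" using m by (simp add: odd_pos)
  let ?I = "{0..<int m}"
  define P where "P = (\<Sum>n\<in>?I. of_int (jac n m * jac n m) :: complex)"
  have P: "P \<noteq> 0"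
  proof -
    have "(\<Sum>n\<in>?I. jac n m * jac n m) > 0"
    proof (rule sum_pos2[of _ "1 mod int m"])
      show "0 < jac (1 mod int m) m * jac (1 mod int m) m" using m by (simp add: jac_mod)
    qed (use m0 in auto)
    moreover have "P = of_int (\<Sum>n\<in>?I. jac n m * jac n m)" by (simp add: P_def)
    ultimately show ?thesis by (metis of_int_eq_0_iff less_irrefl)
  qed
  have "(\<Sum>n\<in>?I. gauss_sum m n * cnj (gauss_sum m n)) = P * (gauss_sum m 1 * cnj (gauss_sum m 1))"
    unfolding P_def sum_distrib_right
  proof (intro sum.cong refl)
    fix n
    have "gauss_sum m n = of_int (jac n m) * gauss_sum m 1" by (rule gauss_sum_eq[OF m])
    thus "gauss_sum m n * cnj (gauss_sum m n) = of_int (jac n m * jac n m) * (gauss_sum m 1 * cnj (gauss_sum m 1))"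
      by (simp add: mult_ac)
  qed
  moreover have "(\<Sum>n\<in>?I. gauss_sum m n * cnj (gauss_sum m n)) = of_nat m * P"
  proof -
    have "(\<Sum>n\<in>?I. gauss_sum m n * cnj (gauss_sum m n)) =
      (\<Sum>n\<in>?I. \<Sum>a\<in>?I. \<Sum>b\<in>?I. of_int (jac a m * jac b m) * ek m (n * (a - b)))"
    proof (rule sum.cong[OF refl])
      fix n
      have e: "ek m (n * (a - b)) = ek m (a * n) * cnj (ek m (b * n))" for a b
        by (simp add: cnj_ek ek_add[symmetric] algebra_simps)
      show "gauss_sum m n * cnj (gauss_sum m n) =
        (\<Sum>a\<in>?I. \<Sum>b\<in>?I. of_int (jac a m * jac b m) * ek m (n * (a - b)))"
        unfolding gauss_sum_def cnj_sum sum_product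
        by (intro sum.cong refl) (simp add: e mult_ac)
    qed
    also have "\<dots> = (\<Sum>a\<in>?I. \<Sum>n\<in>?I. \<Sum>b\<in>?I. of_int (jac a m * jac b m) * ek m (n * (a - b)))"
      by (rule sum.swap)
    also have "\<dots> = (\<Sum>a\<in>?I. \<Sum>b\<in>?I. \<Sum>n\<in>?I. of_int (jac a m * jac b m) * ek m (n * (a - b)))"
      by (rule sum.cong[OF refl], rule sum.swap)
    also have "\<dots> = (\<Sum>a\<in>?I. \<Sum>b\<in>?I. of_int (jac a m * jac b m) * (if int m dvd (a - b) then of_nat m else 0))"
      by (simp add: sum_distrib_left[symmetric] sum_ek[OF m0])
    also have "\<dots> = (\<Sum>a\<in>?I. \<Sum>b\<in>?I. if b = a then of_int (jac a m * jac a m) * of_nat m else 0)"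
    proof (intro sum.cong refl)
      fix a b assume ab: "a \<in> ?I" "b \<in> ?I"
      have "int m dvd (a - b) \<longleftrightarrow> b = a"
      proof
        assume "int m dvd a - b"
        hence "a mod int m = b mod int m" by (simp add: mod_eq_dvd_iff)
        thus "b = a" using ab by simp
      qed auto
      thus "of_int (jac a m * jac b m) * (if int m dvd (a - b) then of_nat m else 0) =
            (if b = a then of_int (jac a m * jac a m) * of_nat m else 0 :: complex)" by simp
    qed
    also have "\<dots> = of_nat m * P" by (simp add: P_def sum_distrib_left mult.commute)
    finally show ?thesis .
  qed
  ultimately have "gauss_sum m 1 * cnj (gauss_sum m 1) = of_nat m" using P by simp
  hence "complex_of_real ((norm (gauss_sum m 1))\<^sup>2) = of_real (real m)"
    using complex_norm_square[of "gauss_sum m 1"] by simp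
  hence "(norm (gauss_sum m 1))\<^sup>2 = real m" by (simp only: of_real_eq_iff)
  thus ?thesis by (metis norm_ge_zero real_sqrt_unique)
qed

subsection \<open>The Polya-Vinogradov inequality for Jacobi symbols\<close>

text \<open>Up to pi/3 the derivative cos x - 1/2 of sin x - x/2 is nonnegative; beyond pi/3 the
  sine is at least sqrt 3 / 2, which exceeds pi/4.\<close>

lemma half_le_sin: assumes "0 \<le> x" "x \<le> pi / 2" shows "x / 2 \<le> sin (x::real)"
proof (cases "x \<le> pi / 3")
  case True
  have "(\<lambda>x. sin x - x / 2) 0 \<le> (\<lambda>x. sin x - x / 2) x"
  proof (rule DERIV_nonneg_imp_nondecreasing[OF assms(1)])
    fix y assume y: "0 \<le> y" "y \<le> x"
    have "cos (pi/3) \<le> cos y" using y True pi_gt_zero by (intro cos_monotone_0_pi_le) auto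
    hence "0 \<le> cos y - 1/2" by (simp add: cos_60)
    moreover have "((\<lambda>x. sin x - x / 2) has_real_derivative (cos y - 1/2)) (at y)"
      by (auto intro!: derivative_eq_intros)
    ultimately show "\<exists>z. ((\<lambda>x. sin x - x / 2) has_real_derivative z) (at y) \<and> 0 \<le> z" by blast
  qed
  thus ?thesis by simp
next
  case False
  have "sin (pi/3) \<le> sin x" using False assms pi_gt_zero by (intro sin_monotone_2pi_le) auto
  hence "sqrt 3 / 2 \<le> sin x" by (simp add: sin_60)
  moreover have "sqrt 3 \<ge> 17/10" by (rule real_le_rsqrt) (simp add: power2_eq_square)
  moreover have "pi < 34/10" using pi_less_4 pi_approx by simp
  ultimately show ?thesis using assms by linarith
qed

lemma le_two_abs_sin: "0 \<le> x \<Longrightarrow> x \<le> pi / 2 \<Longrightarrow> x \<le> 2 * \<bar>sin (x::real)\<bar>"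
  using half_le_sin[of x] by linarith

lemma norm_one_minus_cis: "norm (1 - cis t) = 2 * \<bar>sin (t / 2)\<bar>"
proof -
  have "(norm (1 - cis t))\<^sup>2 = (1 - cos t)\<^sup>2 + (sin t)\<^sup>2" by (simp add: cmod_power2)
  also have "\<dots> = 2 - 2 * cos t" using sin_cos_squared_add[of t] by (simp add: power2_eq_square algebra_simps)
  also have "cos t = 1 - 2 * (sin (t/2))\<^sup>2" using cos_double_sin[of "t/2"] by simp
  finally have "(norm (1 - cis t))\<^sup>2 = (2 * \<bar>sin (t / 2)\<bar>)\<^sup>2" by (simp add: power2_eq_square)
  thus ?thesis by (rule power2_eq_imp_eq) auto
qed

text \<open>The norm equals 2 |sin(pi a / m)|, which is at least its argument in the first quadrant,
  up to the crude factor just proved; the reflection a -> m - a handles the second half.\<close>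

lemma norm_one_minus_ek_ge:
  assumes "0 < a" "a < int m"
  shows "norm (1 - ek m a) \<ge> min a (int m - a) / m"
proof -
  have m: "m > 0" using assms by auto
  let ?x = "pi * a / m"
  have eq: "norm (1 - ek m a) = 2 * \<bar>sin ?x\<bar>" by (simp add: ek_def norm_one_minus_cis)
  show ?thesis
  proof (cases "2 * a \<le> int m")
    case True
    hence "real_of_int (2 * a) \<le> real_of_int (int m)" by (simp only: of_int_le_iff)
    hence "?x \<le> pi / 2" using m by (simp add: field_simps)
    hence "?x \<le> norm (1 - ek m a)" unfolding eq using assms by (intro le_two_abs_sin) auto
    moreover have "a / m \<le> ?x" using pi_ge_two assms m by (simp add: divide_right_mono)
    ultimately show ?thesis using True by simp
  next
    case False
    hence "real_of_int (2 * a) \<ge> real_of_int (int m)" by (simp only: of_int_le_iff)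
    let ?y = "pi * (int m - a) / m"
    have "sin ?x = sin (pi - ?x)" by simp
    also have "pi - ?x = ?y" using m by (simp add: field_simps)
    finally have eq2: "sin ?x = sin ?y" .
    have "?y \<le> pi / 2" using m \<open>real_of_int (2 * a) \<ge> _\<close> by (simp add: field_simps)
    moreover have "?y \<ge> 0" using assms m by (simp add: field_simps)
    ultimately have "?y \<le> norm (1 - ek m a)" unfolding eq eq2 by (intro le_two_abs_sin)
    moreover have "(int m - a) / m \<le> ?y" using pi_ge_two assms m by (simp add: divide_right_mono)
    ultimately show ?thesis using False by simp
  qed
qed

lemma harm_le_one_plus_ln: "n > 0 \<Longrightarrow> harm n \<le> 1 + ln (real n)"
proof -
  assume "n > 0"
  then obtain k where k: "n = Suc k" by (cases n) auto
  have "harm (Suc k) - ln (real (Suc k)) \<le> harm (Suc 0) - ln (real (Suc 0))"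
    using decseq_harm_diff_ln by (rule decseqD) simp
  thus ?thesis unfolding k by (simp add: harm_def)
qed

lemma norm_sum_ek_le:
  assumes "0 < a" "a < int m"
  shows "norm (\<Sum>j\<in>{A..<B}. ek m (j * a)) \<le> 2 * m / min a (int m - a)"
proof -
  have m: "m > 0" using assms by auto
  have ne: "ek m a \<noteq> 1" using assms zdvd_not_zless by (subst ek_eq_1_iff[OF m]) auto
  have "(\<Sum>j\<in>{A..<B}. ek m (j * a)) = ek m (A * a) * (\<Sum>i<nat (B - A). ek m a ^ i)"
    by (simp add: sum_int_atLeastLessThan ring_distribs ek_add ek_power sum_distrib_left)
  also have "norm \<dots> = norm (ek m a ^ nat (B - A) - 1) / norm (ek m a - 1)"
    using ne by (simp add: geometric_sum norm_mult norm_divide)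
  also have "\<dots> \<le> 2 / norm (ek m a - 1)"
    using norm_triangle_ineq4[of "ek m a ^ nat (B - A)" 1] 
    by (intro divide_right_mono) (auto simp: norm_power)
  also have "\<dots> \<le> 2 / (min a (int m - a) / m)"
  proof (rule divide_left_mono[OF _ _ mult_pos_pos])
    show "min a (int m - a) / m \<le> norm (ek m a - 1)"
      using norm_one_minus_ek_ge[OF assms] by (simp add: norm_minus_commute)
  qed (use assms m ne in auto)
  finally show ?thesis by (simp add: min_def split: if_splits)
qed

text \<open>Multiplying by the Gauss sum, of modulus sqrt m, replaces \<open>jac j m\<close> by
  additive characters, whose sums over an interval are geometric. What is left is a harmonic sum
  over a, the source of the logarithm.\<close>

lemma Polya_Vinogradov:
  assumes m: "odd m" "squarefree m" "m > 1"
  shows "\<bar>real_of_int (\<Sum>j\<in>{A..<B}. jac j m)\<bar> \<le> 4 * sqrt m * (1 + ln m)"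
proof -
  let ?I = "{1..<int m}"
  have m0: "m > 0" using m by simp
  have j0: "jac 0 m = 0" using jac_eq_0_iff[OF m0, of 0] m(3) by simp
  have "norm (of_int (\<Sum>j\<in>{A..<B}. jac j m) * gauss_sum m 1)
      = norm (\<Sum>j\<in>{A..<B}. gauss_sum m j)"
    by (subst (2) gauss_sum_eq[OF m(1,2)]) (simp add: sum_distrib_right)
  also have "(\<Sum>j\<in>{A..<B}. gauss_sum m j) = (\<Sum>j\<in>{A..<B}. \<Sum>a\<in>?I. of_int (jac a m) * ek m (j * a))"
  proof (intro sum.cong refl)
    fix j
    have "{0..<int m} = insert 0 ?I" using m0 by auto
    thus "gauss_sum m j = (\<Sum>a\<in>?I. of_int (jac a m) * ek m (j * a))"
      unfolding gauss_sum_def by (simp add: j0 mult.commute)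
  qed
  also have "\<dots> = (\<Sum>a\<in>?I. of_int (jac a m) * (\<Sum>j\<in>{A..<B}. ek m (j * a)))"
    by (subst sum.swap) (simp add: sum_distrib_left)
  also have "norm \<dots> \<le> (\<Sum>a\<in>?I. 2 * m / min a (int m - a))"
  proof (rule order_trans[OF norm_sum sum_mono])
    fix a assume "a \<in> ?I"
    hence "norm (\<Sum>j\<in>{A..<B}. ek m (j * a)) \<le> 2 * m / min a (int m - a)" 
      using norm_sum_ek_le[of a m A B] by auto
    moreover have "\<bar>real_of_int (jac a m)\<bar> \<le> 1" using abs_jac_le[of a m] by linarith
    ultimately have "\<bar>real_of_int (jac a m)\<bar> * norm (\<Sum>j\<in>{A..<B}. ek m (j * a)) \<le> 1 * (2 * m / min a (int m - a))"
      by (intro mult_mono) auto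
    thus "norm (of_int (jac a m) * (\<Sum>j\<in>{A..<B}. ek m (j * a))) \<le> 2 * m / min a (int m - a)"
      by (simp add: norm_mult)
  qed
  \<comment> \<open>The reciprocal of a minimum is at most the sum of the reciprocals, and the two
    resulting sums are exchanged by a -> m - a.\<close>
  also have "\<dots> \<le> (\<Sum>a\<in>?I. 2 * m * (1 / a + 1 / (int m - a)))"
  proof (rule sum_mono)
    fix a assume "a \<in> ?I"
    thus "2 * m / min a (int m - a) \<le> 2 * m * (1 / a + 1 / (int m - a))"
      by (cases "a \<le> int m - a") (auto simp: min_def ring_distribs)
  qed
  also have "\<dots> = 2 * m * ((\<Sum>a\<in>?I. 1 / a) + (\<Sum>a\<in>?I. 1 / (int m - a)))"
    by (simp add: sum_distrib_left sum.distrib ring_distribs)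
  also have "(\<Sum>a\<in>?I. 1 / (int m - a)) = (\<Sum>a\<in>?I. 1 / a)"
    by (rule sum.reindex_bij_witness[of _ "\<lambda>a. int m - a" "\<lambda>a. int m - a"]) auto
  also have "(\<Sum>a\<in>?I. 1 / real_of_int a) = harm (m - 1)"
    unfolding harm_def
    by (rule sum.reindex_bij_witness[of _ int nat]) (auto simp: field_simps)
  also have "2 * m * (harm (m - 1) + harm (m - 1)) \<le> 2 * m * ((1 + ln m) + (1 + ln m))"
  proof (intro mult_left_mono add_mono)
    have "harm (m - 1) \<le> 1 + ln (real (m - 1))" using m by (intro harm_le_one_plus_ln) auto
    also have "\<dots> \<le> 1 + ln m" using m by simp
    finally show "harm (m - 1) \<le> 1 + ln m" "harm (m - 1) \<le> 1 + ln m" by simp_all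
  qed auto
  finally have "norm (of_int (\<Sum>j\<in>{A..<B}. jac j m) * gauss_sum m 1) \<le> 2 * m * ((1 + ln m) + (1 + ln m))" .
  hence "\<bar>real_of_int (\<Sum>j\<in>{A..<B}. jac j m)\<bar> * sqrt m \<le> 2 * m * ((1 + ln m) + (1 + ln m))"
    by (simp only: norm_mult norm_gauss_sum[OF m(1,2)] norm_of_int)
  also have "\<dots> = (4 * sqrt m * (1 + ln m)) * sqrt m"
  proof -
    define s where "s = sqrt m"
    have "s * s = real m" by (simp add: s_def)
    thus ?thesis unfolding s_def[symmetric] by (simp add: algebra_simps flip: \<open>s * s = real m\<close>)
  qed
  finally show ?thesis using m0 by (simp only: mult_le_cancel_right) auto
qed

section \<open>Character sums over residue classes and for nonsquare moduli\<close>

lemma le_mult_int_iff: "q > 0 \<Longrightarrow> x \<le> q * j \<longleftrightarrow> - ((- x) div q) \<le> (j::int)"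
proof -
  assume q: "q > 0"
  have "x \<le> q * j \<longleftrightarrow> (- j) * q \<le> - x" by (simp add: mult.commute)
  also have "\<dots> \<longleftrightarrow> - j \<le> (- x) div q"
  proof
    assume "- j * q \<le> - x"
    from zdiv_mono1[OF this q] show "- j \<le> (- x) div q" using q by (metis nonzero_mult_div_cancel_right less_irrefl)
  next
    assume "- j \<le> (- x) div q"
    hence "- j * q \<le> (- x) div q * q" using q by (intro mult_right_mono) auto
    also have "\<dots> = - x - (- x) mod q" by (simp add: minus_mod_eq_div_mult)
    also have "\<dots> \<le> - x" using q by simp
    finally show "- j * q \<le> - x" .
  qed
  finally show ?thesis by linarith
qed

text \<open>With d = q j + r' and q inverted modulo m, the symbol becomes \<open>jac q m\<close>
  times that of j + q' r', so the sum over the class is, up to sign, a sum over an interval.\<close>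

lemma Polya_Vinogradov_progression:
  assumes m: "odd m" "squarefree m" "m > 1" and q: "q > 0" "coprime q (int m)"
  shows "\<bar>real_of_int (\<Sum>d | d \<in> {A..<B} \<and> [d = r] (mod q). jac d m)\<bar> \<le> 4 * sqrt m * (1 + ln m)"
proof -
  obtain q' where q': "[q * q' = 1] (mod (int m))" using q(2) cong_solve_coprime_int by blast
  \<comment> \<open>Negating twice around \<open>div\<close> gives ceilings: A' and B' are (A -
    r')/q and (B - r')/q rounded up.\<close>
  define r' A' B' where "r' = r mod q" and "A' = - (- (A - r') div q)" and "B' = - (- (B - r') div q)"
  have "(\<Sum>d | d \<in> {A..<B} \<and> [d = r] (mod q). jac d m) = (\<Sum>j\<in>{A'..<B'}. jac (q * j + r') m)"
  proof (rule sum.reindex_bij_witness[of _ "\<lambda>j. q * j + r'" "\<lambda>d. d div q"])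
    fix d assume d: "d \<in> {d. d \<in> {A..<B} \<and> [d = r] (mod q)}"
    hence "d mod q = r'" by (simp add: cong_def r'_def)
    thus eq: "q * (d div q) + r' = d" by (metis mult_div_mod_eq)
    show "d div q \<in> {A'..<B'}"
      using d eq le_mult_int_iff[OF q(1), of "A - r'" "d div q"] le_mult_int_iff[OF q(1), of "B - r'" "d div q"]
      unfolding A'_def B'_def by auto
    show "jac (q * (d div q) + r') m = jac d m" using eq by simp
  next
    fix j assume j: "j \<in> {A'..<B'}"
    have "r' mod q = r'" "r' div q = 0" using q by (auto simp: r'_def)
    thus "(q * j + r') div q = j" using q by simp
    show "q * j + r' \<in> {d. d \<in> {A..<B} \<and> [d = r] (mod q)}"
      using j le_mult_int_iff[OF q(1), of "A - r'" j] le_mult_int_iff[OF q(1), of "B - r'" j]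
      unfolding A'_def B'_def by (auto simp: cong_def r'_def)
  qed
  also have "\<dots> = (\<Sum>j\<in>{A'..<B'}. jac q m * jac (j + q' * r') m)"
  proof (intro sum.cong refl)
    fix j
    have "jac (q * j + r') m = jac (q * (j + q' * r')) m"
    proof (rule jac_cong)
      have "[q * j + 1 * r' = q * j + q * q' * r'] (mod (int m))"
        by (intro cong_add cong_refl cong_mult cong_sym[OF q'])
      thus "[q * j + r' = q * (j + q' * r')] (mod (int m))" by (simp add: algebra_simps)
    qed
    thus "jac (q * j + r') m = jac q m * jac (j + q' * r') m" using m by (simp add: jac_mult_left)
  qed
  also have "\<dots> = jac q m * (\<Sum>j\<in>{A'..<B'}. jac (j + q' * r') m)" by (simp add: sum_distrib_left)
  also have "(\<Sum>j\<in>{A'..<B'}. jac (j + q' * r') m) = (\<Sum>j\<in>{A' + q' * r'..<B' + q' * r'}. jac j m)"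
    by (rule sum.reindex_bij_witness[of _ "\<lambda>j. j - q' * r'" "\<lambda>j. j + q' * r'"]) auto
  finally have "\<bar>\<Sum>d | d \<in> {A..<B} \<and> [d = r] (mod q). jac d m\<bar> \<le> 1 * \<bar>\<Sum>j\<in>{A' + q' * r'..<B' + q' * r'}. jac j m\<bar>"
    using abs_jac_le[of q m] by (simp add: abs_mult mult_right_mono del: mult_1)
  hence "real_of_int \<bar>\<Sum>d | d \<in> {A..<B} \<and> [d = r] (mod q). jac d m\<bar> \<le> real_of_int \<bar>\<Sum>j\<in>{A' + q' * r'..<B' + q' * r'}. jac j m\<bar>"
    by (simp only: of_int_le_iff mult_1)
  also have "\<dots> \<le> 4 * sqrt m * (1 + ln m)"
    using Polya_Vinogradov[OF m, of "A' + q' * r'" "B' + q' * r'"] by simp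
  finally show ?thesis by simp
qed

text \<open>Inclusion and exclusion one prime at a time: the terms divisible by p are d = p e, with
  \<open>jac p m\<close> in front and e in another class modulo q under the same conditions for the
  remaining primes. Each prime doubles the bound.\<close>

lemma Polya_Vinogradov_sieved:
  assumes m: "odd m" "squarefree m" "m > 1" and q: "q > 0" "coprime q (int m)"
  assumes S: "finite S" "\<And>p. p \<in> S \<Longrightarrow> prime p \<and> coprime (int p) q"
  shows "\<bar>real_of_int (\<Sum>d | d \<in> {A..<B} \<and> [d = r] (mod q) \<and> (\<forall>p\<in>S. \<not> int p dvd d). jac d m)\<bar> \<le> 2 ^ card S * (4 * sqrt m * (1 + ln m))"
  using S
proof (induction S arbitrary: A B r rule: finite_induct)
  case empty
  show ?case using Polya_Vinogradov_progression[OF m q, of A B r] by simp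
next
  case (insert p S)
  have p: "prime p" "coprime (int p) q" "int p > 0" using insert.prems[of p] by (auto simp: prime_gt_0_nat)
  define U where "U A B r = {d. d \<in> {A..<B} \<and> [d = r] (mod q) \<and> (\<forall>p\<in>S. \<not> int p dvd d)}" for A B r
  define C where "C = 4 * sqrt m * (1 + ln m)"
  have IH: "\<bar>real_of_int (\<Sum>d\<in>U A B r. jac d m)\<bar> \<le> 2 ^ card S * C" for A B r
    unfolding U_def C_def using insert.prems by (intro insert.IH) auto
  have fin: "finite (U A B r)" for A B r unfolding U_def by (rule finite_subset[of _ "{A..<B}"]) auto
  obtain p' where p': "[int p * p' = 1] (mod q)" using p(2) cong_solve_coprime_int by blast
  define A' B' where "A' = - (- A div int p)" and "B' = - (- B div int p)"
  have eqv: "int p * e \<in> U A B r \<longleftrightarrow> e \<in> U A' B' (p' * r)" for e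
    proof -
      have "A \<le> int p * e \<longleftrightarrow> A' \<le> e" "\<not> (B \<le> int p * e) \<longleftrightarrow> \<not> (B' \<le> e)"
        using le_mult_int_iff[OF p(3)] unfolding A'_def B'_def by auto
      moreover have "[int p * e = r] (mod q) \<longleftrightarrow> [e = p' * r] (mod q)"
      proof
        assume "[int p * e = r] (mod q)"
        hence "[p' * (int p * e) = p' * r] (mod q)" by (intro cong_mult cong_refl)
        moreover have "[(int p * p') * e = 1 * e] (mod q)" using p' by (intro cong_mult cong_refl)
        ultimately show "[e = p' * r] (mod q)" by (simp add: mult_ac cong_def)
      next
        assume "[e = p' * r] (mod q)"
        hence "[int p * e = int p * (p' * r)] (mod q)" by (intro cong_mult cong_refl)
        moreover have "[(int p * p') * r = 1 * r] (mod q)" using p' by (intro cong_mult cong_refl)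
        ultimately show "[int p * e = r] (mod q)" by (simp add: mult_ac cong_def)
      qed
      moreover have "int s dvd int p * e \<longleftrightarrow> int s dvd e" if "s \<in> S" for s
      proof -
        have "prime s" "s \<noteq> p" using that insert by auto
        hence "coprime (int s) (int p)" using p(1) by (simp add: primes_coprime)
        thus ?thesis by (simp add: coprime_dvd_mult_right_iff)
      qed
      ultimately show ?thesis unfolding U_def by auto
    qed
  have "(\<Sum>d\<in>U A B r. jac d m) = (\<Sum>d\<in>{d\<in>U A B r. int p dvd d}. jac d m) + (\<Sum>d\<in>{d\<in>U A B r. \<not> int p dvd d}. jac d m)"
    using sum.union_disjoint[of "{d\<in>U A B r. int p dvd d}" "{d\<in>U A B r. \<not> int p dvd d}" "\<lambda>d. jac d m"] fin
    by (subst sum.union_disjoint[symmetric]) (auto intro!: sum.cong)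
  also have "{d\<in>U A B r. \<not> int p dvd d} = {d. d \<in> {A..<B} \<and> [d = r] (mod q) \<and> (\<forall>p\<in>insert p S. \<not> int p dvd d)}"
    unfolding U_def by auto
  also have "(\<Sum>d\<in>{d\<in>U A B r. int p dvd d}. jac d m) = (\<Sum>e\<in>U A' B' (p' * r). jac (int p * e) m)"
  proof (rule sum.reindex_bij_witness[of _ "\<lambda>e. int p * e" "\<lambda>d. d div int p"])
    fix d assume d: "d \<in> {d \<in> U A B r. int p dvd d}"
    show eq: "int p * (d div int p) = d" using d by auto
    show "d div int p \<in> U A' B' (p' * r)" using d eq eqv[of "d div int p"] by auto
    show "jac (int p * (d div int p)) m = jac d m" by (simp only: eq)
  next
    fix e assume e: "e \<in> U A' B' (p' * r)"
    show "int p * e div int p = e" using p by auto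
    show "int p * e \<in> {d \<in> U A B r. int p dvd d}" using e eqv[of e] by simp
  qed
  also have "\<dots> = jac (int p) m * (\<Sum>e\<in>U A' B' (p' * r). jac e m)"
    using m by (simp add: jac_mult_left sum_distrib_left)
  finally have eq: "(\<Sum>d | d \<in> {A..<B} \<and> [d = r] (mod q) \<and> (\<forall>p\<in>insert p S. \<not> int p dvd d). jac d m) =
      (\<Sum>d\<in>U A B r. jac d m) - jac (int p) m * (\<Sum>e\<in>U A' B' (p' * r). jac e m)" by simp
  have "\<bar>real_of_int (jac (int p) m)\<bar> * \<bar>real_of_int (\<Sum>e\<in>U A' B' (p' * r). jac e m)\<bar> \<le> 1 * (2 ^ card S * C)"
    using IH[of A' B' "p' * r"] abs_jac_le[of "int p" m] by (intro mult_mono) linarith+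
  hence "\<bar>real_of_int (jac (int p) m * (\<Sum>e\<in>U A' B' (p' * r). jac e m))\<bar> \<le> 2 ^ card S * C"
    by (simp add: abs_mult)
  thus ?case using IH[of A B r] insert.hyps unfolding eq C_def[symmetric] by simp
qed

text \<open>The sieve over the primes of t loses a power of 2. This bounds the loss by t, which is
  exactly the factor by which sqrt(k t^2) exceeds sqrt k.\<close>

lemma two_power_card_prime_factors_le: assumes "t > 0" shows "2 ^ card (prime_factors t) \<le> (t::nat)"
  using assms
proof (induction t rule: prime_divisors_induct)
  case (factor p t)
  hence t: "t > 0" and p: "p \<ge> 2" by (auto simp: prime_ge_2_nat)
  have "prime_factors (p * t) = insert p (prime_factors t)"
    using factor t by (simp add: prime_factorization_mult prime_factorization_prime prime_gt_0_nat)
  hence "card (prime_factors (p * t)) \<le> Suc (card (prime_factors t))" by (simp add: card_insert_if)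
  hence "(2::nat) ^ card (prime_factors (p * t)) \<le> 2 ^ Suc (card (prime_factors t))" by (intro power_increasing) auto
  also have "\<dots> \<le> p * t" using factor t p by (simp add: mult_mono)
  finally show ?case .
qed auto

text \<open>Write m = k t^2 with k squarefree; k > 1 because m is not a square. Then
  \<open>jac d m\<close> is \<open>jac d k\<close> restricted to d coprime to t, and the sieved
  Polya-Vinogradov bound for k applies.\<close>

theorem character_sum_nonsquare:
  assumes m: "odd m" "\<not> is_square m" and q: "q > 0" "coprime q (int m)"
  shows "\<bar>real_of_int (\<Sum>d | d \<in> {A..<B} \<and> [d = r] (mod q). jac d m)\<bar> \<le> 4 * sqrt m * (1 + ln m)"
proof -
  define k t where "k = squarefree_part m" and "t = square_part m"
  have mk: "m = k * t ^ 2" unfolding k_def t_def by (rule squarefree_decompose)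
  have m0: "m > 0" using m by (simp add: odd_pos)
  have t0: "t > 0" and k0: "k > 0" using mk m0 by (auto intro!: Nat.gr0I)
  have sf: "squarefree k" by (simp add: k_def)
  have k1: "k > 1" using k0 mk m(2) by (cases "k = 1") auto
  have odd: "odd k" "odd t" using m(1) mk by auto
  have cop: "coprime q (int k)" "coprime q (int t)" using q(2) mk by (auto simp: power2_eq_square)
  let ?S = "prime_factors t"
  have S: "prime p \<and> coprime (int p) q" if "p \<in> ?S" for p
  proof
    show "prime p" using that by auto
    have "int p dvd int t" using that by auto
    thus "coprime (int p) q" using cop(2) by (meson coprime_commute coprime_divisors dvd_refl)
  qed
  have "(\<Sum>d | d \<in> {A..<B} \<and> [d = r] (mod q). jac d m) = (\<Sum>d | d \<in> {A..<B} \<and> [d = r] (mod q) \<and> (\<forall>p\<in>?S. \<not> int p dvd d). jac d k)"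
  proof (rule sum.mono_neutral_cong_right)
    show "finite {d. d \<in> {A..<B} \<and> [d = r] (mod q)}" by (rule finite_subset[of _ "{A..<B}"]) auto
    have eq: "jac d m = jac d k * (jac d t * jac d t)" for d
      using k0 t0 unfolding mk power2_eq_square by (simp add: jac_mult_right)
    have iff: "coprime d (int t) \<longleftrightarrow> (\<forall>p\<in>?S. \<not> int p dvd d)" for d
    proof
      assume c: "coprime d (int t)"
      show "\<forall>p\<in>?S. \<not> int p dvd d"
      proof
        fix p assume "p \<in> ?S"
        hence "prime p" "int p dvd int t" by auto
        thus "\<not> int p dvd d" using c by (metis coprime_common_divisor not_prime_unit prime_nat_int_transfer)
      qed
    next
      assume n: "\<forall>p\<in>?S. \<not> int p dvd d"
      show "coprime d (int t)"
      proof (rule ccontr)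
        assume "\<not> coprime d (int t)"
        hence "nat (gcd d (int t)) \<noteq> 1" by (auto simp: coprime_iff_gcd_eq_1)
        then obtain p where p: "prime p" "p dvd nat (gcd d (int t))" using prime_factor_nat by blast
        have "int p dvd gcd d (int t)" using p(2) by (metis gcd_ge_0_int int_dvd_int_iff nat_0_le)
        hence "int p dvd d" "p dvd t" by (auto simp: int_dvd_int_iff)
        thus False using n p(1) t0 by (auto simp: in_prime_factors_iff)
      qed
    qed
    show "\<forall>i\<in>{d. d \<in> {A..<B} \<and> [d = r] (mod q)} - {d. d \<in> {A..<B} \<and> [d = r] (mod q) \<and> (\<forall>p\<in>?S. \<not> int p dvd d)}. jac i m = 0"
      using iff by (auto simp: eq jac_eq_0_iff[OF t0])
    show "jac d m = jac d k" if "d \<in> {d. d \<in> {A..<B} \<and> [d = r] (mod q) \<and> (\<forall>p\<in>?S. \<not> int p dvd d)}" for d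
      using that iff[of d] by (simp add: eq jac_sq[OF t0])
  qed auto
  also have "\<bar>real_of_int \<dots>\<bar> \<le> 2 ^ card ?S * (4 * sqrt k * (1 + ln k))"
    by (rule Polya_Vinogradov_sieved[OF odd(1) sf k1 q(1) cop(1)]) (use S in auto)
  also have "\<dots> \<le> t * (4 * sqrt k * (1 + ln m))"
  proof (intro mult_mono)
    have "real (2 ^ card ?S) \<le> real t" using two_power_card_prime_factors_le[OF t0] by (simp only: of_nat_le_iff)
    thus "2 ^ card ?S \<le> real t" by simp
    have "k \<le> m" using t0 unfolding mk by simp
    thus "1 + ln (real k) \<le> 1 + ln (real m)" using k0 m0 by simp
  qed (use k1 in auto)
  also have "\<dots> = 4 * sqrt m * (1 + ln m)" unfolding mk by (simp add: real_sqrt_mult)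
  finally show ?thesis .
qed

subsection \<open>Meromorphic continuation\<close>

text \<open>By the identity theorem the difference vanishes outside a discrete set. At the remaining
  points a nicely meromorphic function is either continuous or has a pole and value 0, so its value
  there is determined by a punctured neighbourhood.\<close>

lemma nicely_meromorphic_unique:
  assumes F: "F nicely_meromorphic_on UNIV" and G: "G nicely_meromorphic_on UNIV"
    and eq: "\<And>s. Re s > c \<Longrightarrow> F s = G s"
  shows "F = G"
proof
  fix z
  let ?D = "\<lambda>s. F s - G s"
  have mero: "?D meromorphic_on UNIV"
    using F G unfolding nicely_meromorphic_on_def by (intro meromorphic_on_diff) auto
  have "(\<forall>\<^sub>\<approx>s\<in>UNIV. ?D s = 0) \<or> (\<forall>\<^sub>\<approx>s\<in>UNIV. ?D s \<noteq> 0)"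
    by (rule meromorphic_imp_constant_or_avoid[OF mero]) auto
  moreover have "\<not> (\<forall>\<^sub>\<approx>s\<in>UNIV. ?D s \<noteq> 0)"
  proof
    assume "\<forall>\<^sub>\<approx>s\<in>UNIV. ?D s \<noteq> 0"
    hence "eventually (\<lambda>s. ?D s \<noteq> 0) (at (of_real (c + 1)))"
      by (simp add: eventually_cosparse_open_eq)
    moreover have "eventually (\<lambda>s. s \<in> {s. Re s > c}) (at (of_real (c + 1)))"
      by (intro eventually_at_in_open' open_halfspace_Re_gt) auto
    ultimately have "eventually (\<lambda>s. False) (at (complex_of_real (c + 1)))"
      by eventually_elim (use eq in auto)
    thus False by simp
  qed
  ultimately have "\<forall>\<^sub>\<approx>s\<in>UNIV. ?D s = 0" by blast
  hence ev: "eventually (\<lambda>s. F s = G s) (at z)" by (simp add: eventually_cosparse_open_eq)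
  have "is_pole F z \<longleftrightarrow> is_pole G z" by (rule is_pole_cong) (use ev in auto)
  moreover have "(is_pole F z \<and> F z = 0) \<or> F \<midarrow>z\<rightarrow> F z" "(is_pole G z \<and> G z = 0) \<or> G \<midarrow>z\<rightarrow> G z"
    using F G unfolding nicely_meromorphic_on_def by auto
  moreover have "(F \<midarrow>z\<rightarrow> F z) \<longleftrightarrow> (G \<midarrow>z\<rightarrow> F z)" by (rule tendsto_cong[OF ev])
  moreover have "\<not> (is_pole H z \<and> H \<midarrow>z\<rightarrow> l)" for H l
    using not_tendsto_and_filterlim_at_infinity[of "at z" H l] by (auto simp: is_pole_def)
  ultimately show "F z = G z" by (metis LIM_unique)
qed

text \<open>A meromorphic expression may take arbitrary values at its singularities;
  \<open>remove_sings\<close> restores the normalisation under which the continuation is unique. On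
  Re s > 1 it changes nothing, because f is holomorphic there.\<close>

lemma meromorphic_continuation_eqI:
  assumes G: "G meromorphic_on UNIV" and eq: "\<And>s. Re s > 1 \<Longrightarrow> G s = f s"
    and hol: "f holomorphic_on {s. Re s > 1}"
  shows "meromorphic_continuation f = remove_sings G"
  unfolding meromorphic_continuation_def
proof (rule the_equality)
  have "remove_sings G s = f s" if "Re s > 1" for s
  proof -
    have "G holomorphic_on {s. Re s > 1}" using hol by (rule holomorphic_transform) (use eq in auto)
    hence "G analytic_on {s}"
      using that analytic_at[of G s] open_halfspace_Re_gt[of 1] by blast
    thus ?thesis using eq[OF that] by simp
  qed
  thus *: "remove_sings G nicely_meromorphic_on UNIV \<and> (\<forall>s. 1 < Re s \<longrightarrow> remove_sings G s = f s)"
    using remove_sings_nicely_meromorphic[OF G] by auto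
  fix F assume "F nicely_meromorphic_on UNIV \<and> (\<forall>s. 1 < Re s \<longrightarrow> F s = f s)"
  thus "F = remove_sings G" using * by (intro nicely_meromorphic_unique[where c = 1]) auto
qed

subsection \<open>Gamma integrals over the positive reals\<close>

lemma set_integrable_Gamma:
  assumes "Re s > 0" "a > 0"
  shows "set_integrable lborel {0<..} (\<lambda>u. complex_of_real u powr (s - 1) * of_real (exp (- a * u)))"
proof -
  have "set_integrable lebesgue {0<..} (\<lambda>u. complex_of_real u powr (s - 1) / of_real (exp (a * u)))"
    using absolutely_integrable_Gamma_integral[OF assms] by simp
  hence "integrable lebesgue (\<lambda>u. indicator {0<..} u *\<^sub>R (complex_of_real u powr (s - 1) * of_real (exp (- a * u))))"
    by (simp add: set_integrable_def exp_minus field_simps)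
  thus ?thesis unfolding set_integrable_def
    using integrable_completion[of "\<lambda>u. indicator {0<..} u *\<^sub>R (complex_of_real u powr (s - 1) * of_real (exp (- a * u)))" lborel]
    by simp
qed

lemma LBINT_Gamma_1:
  assumes "Re s > 0"
  shows "(LBINT u:{0<..}. complex_of_real u powr (s - 1) * of_real (exp (- u))) = Gamma s"
proof -
  have "(LBINT u:{0<..}. complex_of_real u powr (s - 1) * of_real (exp (- u))) =
      integral {0<..} (\<lambda>u. complex_of_real u powr (s - 1) * of_real (exp (- u)))"
    using set_integrable_Gamma[OF assms, of 1] by (intro set_borel_integral_eq_integral) simp
  also have "\<dots> = integral {0..} (\<lambda>u. complex_of_real u powr (s - 1) * of_real (exp (- u)))"
    by (rule integral_spike_set; rule negligible_subset[of "{0}"]; auto)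
  also have "\<dots> = integral {0..} (\<lambda>u. complex_of_real u powr (s - 1) / of_real (exp u))"
    by (simp add: exp_minus field_simps)
  also have "\<dots> = Gamma s"
    using Gamma_integral_complex[OF assms] by (rule integral_unique)
  finally show ?thesis .
qed

lemma LBINT_Gamma:
  assumes "Re s > 0" "a > 0"
  shows "(LBINT u:{0<..}. complex_of_real u powr (s - 1) * of_real (exp (- a * u))) = Gamma s * of_real a powr (- s)"
proof -
  let ?f = "\<lambda>u. indicator {0<..} u *\<^sub>R (complex_of_real u powr (s - 1) * of_real (exp (- u)))"
  have "Gamma s = (\<integral>u. ?f u \<partial>lborel)"
    using LBINT_Gamma_1[OF assms(1)] by (simp add: set_lebesgue_integral_def)
  also have "\<dots> = a *\<^sub>R (\<integral>u. ?f (0 + a * u) \<partial>lborel)"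
    using lborel_integral_real_affine[of a ?f 0] assms by simp
  also have "(\<integral>u. ?f (0 + a * u) \<partial>lborel) = (\<integral>u. of_real a powr (s - 1) *
     (indicator {0<..} u *\<^sub>R (complex_of_real u powr (s - 1) * of_real (exp (- a * u)))) \<partial>lborel)"
    using assms by (intro Bochner_Integration.integral_cong refl)
      (auto simp: indicator_def zero_less_mult_iff powr_times_real)
  also have "\<dots> = of_real a powr (s - 1) * (LBINT u:{0<..}. complex_of_real u powr (s - 1) * of_real (exp (- a * u)))"
    by (simp only: set_lebesgue_integral_def integral_mult_right_zero)
  finally have *: "Gamma s = of_real a * of_real a powr (s - 1) * (LBINT u:{0<..}. complex_of_real u powr (s - 1) * of_real (exp (- a * u)))"
    by (simp add: scaleR_conv_of_real)
  have "complex_of_real a * of_real a powr (s - 1) = of_real a powr s"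
    using assms by (simp add: powr_diff)
  moreover have "complex_of_real a powr s * of_real a powr (-s) = 1"
    using assms by (simp add: powr_minus)
  ultimately show ?thesis unfolding * by (simp add: mult_ac)
qed

lemma set_integrable_real_Gamma:
  fixes x a :: real
  assumes "x > 0" "a > 0"
  shows "set_integrable lborel {0<..} (\<lambda>u. u powr (x - 1) * exp (- a * u))"
proof -
  have "set_integrable lborel {0<..} (\<lambda>u. complex_of_real u powr (of_real x - 1) * of_real (exp (- a * u)))"
    using assms by (intro set_integrable_Gamma) auto
  hence "set_integrable lborel {0<..} (\<lambda>u. norm (complex_of_real u powr (of_real x - 1) * of_real (exp (- a * u))))"
    by (rule set_integrable_norm)
  thus ?thesis
    by (rule set_integrable_cong[THEN iffD1, rotated -1]) (auto simp: norm_mult norm_powr_real_powr)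
qed

lemma LBINT_real_Gamma:
  fixes x a :: real
  assumes "x > 0" "a > 0"
  shows "(LBINT u:{0<..}. u powr (x - 1) * exp (- a * u)) = Gamma x * a powr (- x)"
proof -
  have "complex_of_real (LBINT u:{0<..}. u powr (x - 1) * exp (- a * u)) = 
     (LBINT u:{0<..}. complex_of_real (u powr (x - 1) * exp (- a * u)))"
    unfolding set_lebesgue_integral_def by (simp add: scaleR_conv_of_real flip: integral_complex_of_real)
  also have "\<dots> = (LBINT u:{0<..}. complex_of_real u powr (of_real x - 1) * of_real (exp (- a * u)))"
    by (intro set_lebesgue_integral_cong) (auto simp flip: powr_of_real)
  also have "\<dots> = Gamma (of_real x) * of_real a powr (- of_real x)"
    using assms by (intro LBINT_Gamma) auto
  also have "\<dots> = complex_of_real (Gamma x * a powr (- x))"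
    using assms by (simp add: Gamma_complex_of_real powr_of_real flip: of_real_minus)
  finally show ?thesis by (simp only: of_real_eq_iff)
qed

text \<open>On (0, b] the integrand is at most exp b times a Gamma integrand, which gives
  integrability; the value comes from the antiderivative, whose contribution at 0 vanishes because
  Re z > 0.\<close>

lemma LBINT_powr_0:
  assumes z: "Re z > 0" and b: "b > 0"
  shows "set_integrable lborel {0<..b} (\<lambda>u. complex_of_real u powr (z - 1))"
    and "(LBINT u:{0<..b}. complex_of_real u powr (z - 1)) = of_real b powr z / z"
    and "(LBINT u:{0<..b}. u powr (Re z - 1)) = b powr Re z / Re z"
proof -
  have int: "set_integrable lborel {0<..b} (\<lambda>u. complex_of_real u powr (z - 1))" if z: "Re z > 0" for z
  proof (rule set_integrable_bound)
    have "set_integrable lborel {0<..} (\<lambda>u. exp b * norm (complex_of_real u powr (z - 1) * of_real (exp (- 1 * u))))"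
      using set_integrable_Gamma[OF z, of 1] by (intro set_integrable_mult_right set_integrable_norm) auto
    thus "set_integrable lborel {0<..b} (\<lambda>u. exp b * norm (complex_of_real u powr (z - 1) * of_real (exp (- 1 * u))))"
      by (rule set_integrable_subset) auto
    show "set_borel_measurable lborel {0<..b} (\<lambda>u. complex_of_real u powr (z - 1))"
      unfolding set_borel_measurable_def by measurable
    show "AE x in lborel. x \<in> {0<..b} \<longrightarrow> norm (complex_of_real x powr (z - 1)) \<le>
        norm (exp b * norm (complex_of_real x powr (z - 1) * of_real (exp (- 1 * x))))"
    proof (intro AE_I2 impI)
      fix x assume x: "x \<in> {0<..b}"
      have "1 \<le> exp b * exp (- x)" using x by (simp flip: exp_add)
      hence "norm (complex_of_real x powr (z - 1)) * 1 \<le> norm (complex_of_real x powr (z - 1)) * (exp b * exp (-x))"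
        by (intro mult_left_mono) auto
      thus "norm (complex_of_real x powr (z - 1)) \<le> norm (exp b * norm (complex_of_real x powr (z - 1) * of_real (exp (- 1 * x))))"
        by (simp add: norm_mult mult_ac)
    qed
  qed
  show "set_integrable lborel {0<..b} (\<lambda>u. complex_of_real u powr (z - 1))" by (rule int[OF z])
  have val: "(LBINT u:{0<..b}. complex_of_real u powr (z - 1)) = of_real b powr z / z" if z: "Re z > 0" for z
  proof -
    have "((\<lambda>t. complex_of_real t powr (z - 1)) has_integral
            (of_real b powr z / z - of_real 0 powr z / z)) {0..b}" using z b
      by (intro fundamental_theorem_of_calculus_interior)
         (auto intro!: continuous_intros derivative_eq_intros has_vector_derivative_real_field)
    hence "((\<lambda>t. complex_of_real t powr (z - 1)) has_integral (of_real b powr z / z)) {0..b}" by simp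
    hence "integral {0..b} (\<lambda>t. complex_of_real t powr (z - 1)) = of_real b powr z / z"
      by (rule integral_unique)
    moreover have "integral {0..b} (\<lambda>t. complex_of_real t powr (z - 1)) = integral {0<..b} (\<lambda>t. complex_of_real t powr (z - 1))"
      by (rule integral_spike_set; rule negligible_subset[of "{0}"]; auto)
    moreover have "(LBINT u:{0<..b}. complex_of_real u powr (z - 1)) = integral {0<..b} (\<lambda>t. complex_of_real t powr (z - 1))"
      by (rule set_borel_integral_eq_integral(2)[OF int[OF z]])
    ultimately show ?thesis by simp
  qed
  show "(LBINT u:{0<..b}. complex_of_real u powr (z - 1)) = of_real b powr z / z" by (rule val[OF z])
  have "complex_of_real (LBINT u:{0<..b}. u powr (Re z - 1)) = (LBINT u:{0<..b}. complex_of_real (u powr (Re z - 1)))"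
    unfolding set_lebesgue_integral_def by (simp add: scaleR_conv_of_real flip: integral_complex_of_real)
  also have "\<dots> = (LBINT u:{0<..b}. complex_of_real u powr (of_real (Re z) - 1))"
    by (intro set_lebesgue_integral_cong) (auto simp flip: powr_of_real)
  also have "\<dots> = complex_of_real (b powr Re z / Re z)"
    using val[of "of_real (Re z)"] z b by (simp add: powr_of_real)
  finally show "(LBINT u:{0<..b}. u powr (Re z - 1)) = b powr Re z / Re z" by (simp only: of_real_eq_iff)
qed


subsection \<open>Continuation of Mellin transforms\<close>

text \<open>The hypotheses needed to split a Mellin integral at \<delta>: a power series near 0 and
  exponential decay. The series is that of u \<psi>(u), since \<psi> itself may have a simple pole
  at 0, as happens for coefficients with nonzero mean.\<close>

locale mellin_setup =
  fixes \<psi> :: "real \<Rightarrow> real" and c :: "nat \<Rightarrow> complex" and \<delta> C :: real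
  assumes \<delta>: "\<delta> > 0" and C: "C \<ge> 0"
    and meas: "\<psi> \<in> borel_measurable borel"
    and summ: "summable (\<lambda>k. norm (c k) * \<delta> ^ k)"
    and expand: "\<And>u. 0 < u \<Longrightarrow> u \<le> \<delta> \<Longrightarrow> (\<lambda>k. c k * of_real u ^ k) sums of_real (u * \<psi> u)"
    and decay: "\<And>u. u > \<delta> \<Longrightarrow> \<bar>\<psi> u\<bar> \<le> C * exp (- (1 / 2) * u)"
begin

definition mellin_tail :: "complex \<Rightarrow> complex" where
  "mellin_tail s = (LBINT u:{\<delta><..}. of_real (\<psi> u) * of_real u powr (s - 1))"

text \<open>On (0, \<delta>] the term c_k u^(k-1) u^(s-1) integrates to \<delta>^(s+k-1) / (s+k-1),
  an expression that makes sense for every s other than 1 - k; the tail is entire.\<close>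

definition mellin_cont :: "complex \<Rightarrow> complex" where
  "mellin_cont s = of_real \<delta> powr (s - 1) * (\<Sum>k. c k * of_real \<delta> ^ k / (s + of_nat k - 1)) + mellin_tail s"

text \<open>A majorant of |\<psi>(u)| exp(r |ln u|) for u > \<delta>: whatever the sign of ln u, the
  exponential is at most u^r + \<delta>^(-r).\<close>

definition wt :: "real \<Rightarrow> real \<Rightarrow> real" where
  "wt r u = C * (exp (- (1 / 2) * u) * (u powr r + \<delta> powr (- r)))"

lemma wt_integrable: assumes "r \<ge> 0" shows "set_integrable lborel {\<delta><..} (wt r)"
proof -
  have "set_integrable lborel {0<..} (\<lambda>u. C * (u powr ((r + 1) - 1) * exp (- (1/2) * u) + \<delta> powr (-r) * (u powr (1 - 1) * exp (- (1/2) * u))))"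
    using assms by (intro set_integrable_mult_right set_integral_add set_integrable_real_Gamma) auto
  hence "set_integrable lborel {\<delta><..} (\<lambda>u. C * (u powr ((r + 1) - 1) * exp (- (1/2) * u) + \<delta> powr (-r) * (u powr (1 - 1) * exp (- (1/2) * u))))"
    by (rule set_integrable_subset) (use \<delta> in auto)
  thus ?thesis
    by (rule set_integrable_cong[THEN iffD1, rotated -1]) (use \<delta> in \<open>auto simp: wt_def algebra_simps\<close>)
qed

lemma exp_ln_le_wt:
  assumes "u > \<delta>" "r \<ge> 0" shows "\<bar>\<psi> u\<bar> * exp (r * \<bar>ln u\<bar>) \<le> wt r u"
proof -
  have u: "u > 0" using assms \<delta> by simp
  have "exp (r * \<bar>ln u\<bar>) \<le> u powr r + \<delta> powr (-r)"
  proof (cases "ln u \<ge> 0")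
    case True
    thus ?thesis using u by (simp add: powr_def)
  next
    case False
    hence "exp (r * \<bar>ln u\<bar>) = u powr (-r)" using u by (simp add: powr_def)
    also have "\<dots> \<le> \<delta> powr (-r)" using assms \<delta> by (intro powr_mono2') auto
    finally show ?thesis by (simp add: add_increasing)
  qed
  hence "\<bar>\<psi> u\<bar> * exp (r * \<bar>ln u\<bar>) \<le> (C * exp (- (1/2) * u)) * (u powr r + \<delta> powr (-r))"
    using decay[OF assms(1)] C by (intro mult_mono) auto
  thus ?thesis by (simp add: wt_def mult_ac)
qed

text \<open>Expanding u^z = exp(z ln u) and integrating termwise under the majorant
  \<open>wt\<close> gives a power series around 1 that converges for every z, so the tail is
  entire.\<close>

lemma mellin_tail_sums:
  "(\<lambda>j. (LBINT u:{\<delta><..}. of_real (\<psi> u * ln u ^ j / fact j)) * z ^ j) sums mellin_tail (1 + z)"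
proof -
  define f where "f = (\<lambda>j u. indicator {\<delta><..} u *\<^sub>R (of_real (\<psi> u) * ((z * of_real (ln u)) ^ j / fact j)) :: complex)"
  define g where "g = (\<lambda>u. indicator {\<delta><..} u *\<^sub>R (of_real (\<psi> u) * complex_of_real u powr z))"
  note [measurable] = meas
  have partial: "norm (\<Sum>j<n. f j u) \<le> indicator {\<delta><..} u *\<^sub>R wt (norm z) u" for n u
  proof (cases "u > \<delta>")
    case True
    have "norm (\<Sum>j<n. f j u) \<le> (\<Sum>j<n. norm (f j u))" by (rule norm_sum)
    also have "\<dots> = \<bar>\<psi> u\<bar> * (\<Sum>j<n. (norm z * \<bar>ln u\<bar>) ^ j / fact j)"
      using True by (simp add: f_def norm_mult norm_divide norm_power sum_distrib_left power_mult_distrib)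
    also have "(\<Sum>j<n. (norm z * \<bar>ln u\<bar>) ^ j / fact j) \<le> exp (norm z * \<bar>ln u\<bar>)"
    proof -
      have "(\<Sum>j<n. (norm z * \<bar>ln u\<bar>) ^ j /\<^sub>R fact j) \<le> (\<Sum>j. (norm z * \<bar>ln u\<bar>) ^ j /\<^sub>R fact j)"
        by (intro sum_le_suminf summable_exp_generic) auto
      thus ?thesis by (simp add: exp_def field_simps)
    qed
    also have "\<bar>\<psi> u\<bar> * exp (norm z * \<bar>ln u\<bar>) \<le> wt (norm z) u" using True by (intro exp_ln_le_wt) auto
    finally show ?thesis using True by (simp add: mult_left_mono)
  qed (auto simp: f_def)
  have wint: "integrable lborel (\<lambda>u. indicator {\<delta><..} u *\<^sub>R wt (norm z) u)"
    using wt_integrable[of "norm z"] by (simp add: set_integrable_def)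
  have fm: "f j \<in> borel_measurable lborel" for j unfolding f_def by measurable
  have fint: "integrable lborel (f j)" for j
  \<comment> \<open>A single term is the difference of two partial sums, so twice the majorant
    dominates it.\<close>
  proof (rule Bochner_Integration.integrable_bound[OF Bochner_Integration.integrable_add[OF wint wint] fm], rule AE_I2)
    fix u
    have "f j u = (\<Sum>i<Suc j. f i u) - (\<Sum>i<j. f i u)" by simp
    hence "norm (f j u) \<le> norm (\<Sum>i<Suc j. f i u) + norm (\<Sum>i<j. f i u)"
      by (metis norm_triangle_ineq4)
    also have "\<dots> \<le> indicator {\<delta><..} u *\<^sub>R wt (norm z) u + indicator {\<delta><..} u *\<^sub>R wt (norm z) u"
      by (intro add_mono partial)
    finally show "norm (f j u) \<le> norm (indicator {\<delta><..} u *\<^sub>R wt (norm z) u + indicator {\<delta><..} u *\<^sub>R wt (norm z) u)"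
      by simp
  qed
  have "(\<lambda>n. \<integral>u. (\<Sum>j<n. f j u) \<partial>lborel) \<longlonglongrightarrow> (\<integral>u. g u \<partial>lborel)"
  proof (rule integral_dominated_convergence[OF _ _ wint])
    show "g \<in> borel_measurable lborel" unfolding g_def by measurable
    show "(\<lambda>u. \<Sum>j<n. f j u) \<in> borel_measurable lborel" for n using fm by measurable
    show "AE u in lborel. norm (\<Sum>j<n. f j u) \<le> indicator {\<delta><..} u *\<^sub>R wt (norm z) u" for n
      by (intro AE_I2 partial)
    show "AE u in lborel. (\<lambda>n. \<Sum>j<n. f j u) \<longlonglongrightarrow> g u"
    proof (rule AE_I2)
      fix u
      show "(\<lambda>n. \<Sum>j<n. f j u) \<longlonglongrightarrow> g u"
      proof (cases "u > \<delta>")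
        case True
        have "(\<lambda>j. (z * of_real (ln u)) ^ j /\<^sub>R fact j) sums exp (z * complex_of_real (ln u))"
          by (rule exp_converges)
        hence "(\<lambda>j. of_real (\<psi> u) * ((z * of_real (ln u)) ^ j / fact j)) sums (of_real (\<psi> u) * exp (z * complex_of_real (ln u)))"
          by (intro sums_mult) (simp add: scaleR_conv_of_real field_simps)
        thus ?thesis using True \<delta> unfolding f_def g_def sums_def
          by (simp add: powr_def Ln_of_real)
      qed (simp_all add: f_def g_def)
    qed
  qed
  also have "(\<lambda>n. \<integral>u. (\<Sum>j<n. f j u) \<partial>lborel) = (\<lambda>n. \<Sum>j<n. \<integral>u. f j u \<partial>lborel)"
    using fint by (intro ext Bochner_Integration.integral_sum) auto
  also have "(\<integral>u. g u \<partial>lborel) = mellin_tail (1 + z)"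
    by (simp add: mellin_tail_def g_def set_lebesgue_integral_def)
  also have "(\<lambda>n. \<Sum>j<n. \<integral>u. f j u \<partial>lborel) = (\<lambda>n. \<Sum>j<n. (LBINT u:{\<delta><..}. of_real (\<psi> u * ln u ^ j / fact j)) * z ^ j)"
  proof (intro ext sum.cong refl)
    fix j
    have "(\<integral>u. f j u \<partial>lborel) = (\<integral>u. z ^ j * (indicator {\<delta><..} u *\<^sub>R complex_of_real (\<psi> u * ln u ^ j / fact j)) \<partial>lborel)"
      by (intro Bochner_Integration.integral_cong refl) (simp add: f_def power_mult_distrib scaleR_conv_of_real)
    thus "(\<integral>u. f j u \<partial>lborel) = (LBINT u:{\<delta><..}. of_real (\<psi> u * ln u ^ j / fact j)) * z ^ j"
      by (simp only: integral_mult_right_zero set_lebesgue_integral_def mult.commute)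
  qed
  finally show ?thesis unfolding sums_def .
qed

lemma mellin_tail_holomorphic: "mellin_tail holomorphic_on UNIV"
proof -
  have "mellin_tail holomorphic_on ball 1 r" for r
  proof (rule power_series_holomorphic)
    fix w
    show "(\<lambda>n. (LBINT u:{\<delta><..}. of_real (\<psi> u * ln u ^ n / fact n)) * (w - 1) ^ n) sums mellin_tail w"
      using mellin_tail_sums[of "w - 1"] by simp
  qed
  hence "mellin_tail analytic_on {z}" for z
    by (subst analytic_at) (auto intro!: exI[of _ "ball 1 (dist 1 z + 1)"])
  hence "mellin_tail analytic_on UNIV" by (subst analytic_on_analytic_at) auto
  thus ?thesis by (rule analytic_imp_holomorphic)
qed

lemma summable_mellin_terms: "summable (\<lambda>k. norm (c k * of_real \<delta> ^ k / (s + of_nat k - 1)))"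
proof (rule summable_comparison_test_ev[OF _ summ])
  obtain N :: nat where N: "norm (s - 1) + 1 < real N" using reals_Archimedean2 by blast
  show "eventually (\<lambda>k. norm (norm (c k * of_real \<delta> ^ k / (s + of_nat k - 1))) \<le> norm (c k) * \<delta> ^ k) sequentially"
    using eventually_ge_at_top[of N]
  proof eventually_elim
    case (elim k)
    have "norm (of_nat k - (1 - s)) \<ge> norm (of_nat k :: complex) - norm (1 - s)" by (rule norm_triangle_ineq2)
    hence "1 \<le> norm (s + of_nat k - 1)" using N elim by (simp add: norm_minus_commute algebra_simps)
    hence "norm (c k) * \<delta> ^ k / norm (s + of_nat k - 1) \<le> norm (c k) * \<delta> ^ k / 1"
      using \<delta> by (intro divide_left_mono) auto
    thus ?case using \<delta> by (simp add: norm_mult norm_divide norm_power)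
  qed
qed

text \<open>Past the first N terms every denominator has real part above 1 on Re s > 2 - N, so the
  rest converges uniformly there and only finitely many explicit fractions can have poles in that
  half-plane.\<close>

definition mellin_rest :: "nat \<Rightarrow> complex \<Rightarrow> complex" where
  "mellin_rest N s = (\<Sum>k. c (k + N) * of_real \<delta> ^ (k + N) / (s + of_nat (k + N) - 1))"

lemma mellin_rest_holomorphic: "mellin_rest N holomorphic_on {s. Re s > 2 - real N}"
proof (rule holomorphic_uniform_sequence)
  show "open {s. Re s > 2 - real N}" by (rule open_halfspace_Re_gt)
  have den: "1 \<le> norm (s + of_nat (k + N) - 1)" if "Re s > 2 - real N" for s k
    using that complex_Re_le_cmod[of "s + of_nat (k + N) - 1"] by simp
  show "(\<lambda>s. \<Sum>k<n. c (k + N) * of_real \<delta> ^ (k + N) / (s + of_nat (k + N) - 1)) holomorphic_on {s. Re s > 2 - real N}" for n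
  proof (intro holomorphic_intros)
    fix k s assume "s \<in> {s. Re s > 2 - real N}"
    thus "s + of_nat (k + N) - 1 \<noteq> 0" using den[of s k] by auto
  qed
  fix x assume x: "x \<in> {s. Re s > 2 - real N}"
  obtain d where d: "d > 0" "cball x d \<subseteq> {s. Re s > 2 - real N}"
    using x open_halfspace_Re_gt[of "2 - real N"] open_contains_cball by blast
  have "uniform_limit (cball x d) (\<lambda>n s. \<Sum>k<n. c (k + N) * of_real \<delta> ^ (k + N) / (s + of_nat (k + N) - 1)) 
    (\<lambda>s. \<Sum>k. c (k + N) * of_real \<delta> ^ (k + N) / (s + of_nat (k + N) - 1)) sequentially"
  proof (rule Weierstrass_m_test)
    show "summable (\<lambda>k. norm (c (k + N)) * \<delta> ^ (k + N))" by (rule summable_ignore_initial_segment[OF summ])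
    fix k s assume "s \<in> cball x d"
    hence "1 \<le> norm (s + of_nat (k + N) - 1)" using d den by auto
    hence "norm (c (k + N)) * \<delta> ^ (k + N) / norm (s + of_nat (k + N) - 1) \<le> norm (c (k + N)) * \<delta> ^ (k + N) / 1"
      using \<delta> by (intro divide_left_mono) auto
    thus "norm (c (k + N) * of_real \<delta> ^ (k + N) / (s + of_nat (k + N) - 1)) \<le> norm (c (k + N)) * \<delta> ^ (k + N)"
      using \<delta> by (simp add: norm_mult norm_divide norm_power)
  qed
  thus "\<exists>d>0. cball x d \<subseteq> {s. Re s > 2 - real N} \<and> uniform_limit (cball x d) (\<lambda>n s. \<Sum>k<n. c (k + N) * of_real \<delta> ^ (k + N) / (s + of_nat (k + N) - 1)) (mellin_rest N) sequentially"
    unfolding mellin_rest_def[abs_def] using d by blast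
qed

lemma mellin_cont_split:
  "mellin_cont s = of_real \<delta> powr (s - 1) * (mellin_rest N s + (\<Sum>k<N. c k * of_real \<delta> ^ k / (s + of_nat k - 1))) + mellin_tail s"
  unfolding mellin_cont_def mellin_rest_def
  by (subst suminf_split_initial_segment[OF summable_norm_cancel[OF summable_mellin_terms], of _ N]) simp

lemma mellin_rest_analytic: "Re z > 2 - real N \<Longrightarrow> mellin_rest N analytic_on {z}"
  using mellin_rest_holomorphic[of N] open_halfspace_Re_gt[of "2 - real N"] analytic_at by blast

lemma mellin_tail_analytic: "mellin_tail analytic_on {z}"
  using mellin_tail_holomorphic analytic_at open_UNIV by blast

lemma mellin_cont_meromorphic: "mellin_cont meromorphic_on UNIV"
proof -
  have "mellin_cont meromorphic_on {z}" for z
  proof -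
    obtain N :: nat where "2 - Re z < real N" using reals_Archimedean2 by blast
    hence N: "Re z > 2 - real N" by simp
    have "(\<lambda>s. of_real \<delta> powr (s - 1) * (mellin_rest N s + (\<Sum>k<N. c k * of_real \<delta> ^ k / (s + of_nat k - 1))) + mellin_tail s) meromorphic_on {z}"
      using mellin_rest_analytic[OF N] mellin_tail_analytic[of z] \<delta>
      by (intro meromorphic_intros analytic_on_imp_meromorphic_on[of "\<lambda>s. of_real \<delta> powr (s - 1)"] 
          analytic_on_imp_meromorphic_on[of mellin_tail] analytic_on_imp_meromorphic_on[of "mellin_rest N"]) 
         (auto intro!: analytic_intros)
    thus ?thesis unfolding mellin_cont_split[of _ N, abs_def, symmetric] by (simp add: mellin_cont_split[of _ N, symmetric])
  qed
  thus ?thesis unfolding meromorphic_on_def by auto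
qed

lemma mellin_cont_analytic:
  assumes "\<And>k. c k \<noteq> 0 \<Longrightarrow> z + of_nat k - 1 \<noteq> 0"
  shows "mellin_cont analytic_on {z}"
proof -
  obtain N :: nat where "2 - Re z < real N" using reals_Archimedean2 by blast
  hence N: "Re z > 2 - real N" by simp
  have *: "(\<lambda>s. c k * of_real \<delta> ^ k / (s + of_nat k - 1)) analytic_on {z}" for k
  proof (cases "c k = 0")
    case False
    thus ?thesis using assms[of k] by (intro analytic_intros) auto
  qed auto
  have "(\<lambda>s. of_real \<delta> powr (s - 1) * (mellin_rest N s + (\<Sum>k<N. c k * of_real \<delta> ^ k / (s + of_nat k - 1))) + mellin_tail s) analytic_on {z}"
    using mellin_rest_analytic[OF N] mellin_tail_analytic[of z] \<delta>
    by (intro analytic_on_add analytic_on_mult analytic_on_sum *) (auto intro!: analytic_intros)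
  thus ?thesis by (simp add: mellin_cont_split[of _ N, symmetric])
qed

text \<open>The condition concerns only those k with a nonzero coefficient. If
  \<open>c 0 = 0\<close>, it is satisfied on all of Re s > 0, and this is how the integral
  representation reaches into the critical strip. On (0, \<delta>] sum and integral are exchanged by
  absolute convergence.\<close>

lemma mellin_cont_eq:
  assumes s: "\<And>k. c k \<noteq> 0 \<Longrightarrow> Re s + real k - 1 > 0"
  shows "set_integrable lborel {0<..} (\<lambda>u. of_real (\<psi> u) * complex_of_real u powr (s - 1))"
    and "mellin_cont s = (LBINT u:{0<..}. of_real (\<psi> u) * complex_of_real u powr (s - 1))"
proof -
  define f where "f = (\<lambda>k u. indicator {0<..\<delta>} u *\<^sub>R (c k * complex_of_real u powr ((s + of_nat k - 1) - 1)))"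
  have fint: "integrable lborel (f k)" for k
  proof (cases "c k = 0")
    case False
    hence "set_integrable lborel {0<..\<delta>} (\<lambda>u. c k * complex_of_real u powr ((s + of_nat k - 1) - 1))"
      using s[of k] \<delta> by (intro set_integrable_mult_right LBINT_powr_0) auto
    thus ?thesis by (simp add: f_def set_integrable_def)
  qed (simp add: f_def)
  have fval: "(\<integral>u. f k u \<partial>lborel) = of_real \<delta> powr (s - 1) * (c k * of_real \<delta> ^ k / (s + of_nat k - 1))" for k
  proof (cases "c k = 0")
    case False
    have "(\<integral>u. f k u \<partial>lborel) = c k * (LBINT u:{0<..\<delta>}. complex_of_real u powr ((s + of_nat k - 1) - 1))"
      unfolding f_def set_lebesgue_integral_def by (simp add: scaleR_conv_of_real mult.left_commute)
    also have "(LBINT u:{0<..\<delta>}. complex_of_real u powr ((s + of_nat k - 1) - 1)) = of_real \<delta> powr (s + of_nat k - 1) / (s + of_nat k - 1)"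
      using s[OF False] \<delta> by (intro LBINT_powr_0) auto
    also have "complex_of_real \<delta> powr (s + of_nat k - 1) = of_real \<delta> powr (s - 1) * of_real \<delta> ^ k"
    proof -
      have "s + of_nat k - 1 = (s - 1) + of_nat k" by simp
      thus ?thesis using \<delta> by (simp only: powr_add) (simp add: powr_nat')
    qed
    finally show ?thesis by simp
  qed (simp add: f_def)
  have fnorm: "(\<integral>u. norm (f k u) \<partial>lborel) = norm (c k) * (\<delta> powr (Re s + real k - 1) / (Re s + real k - 1))" for k
  proof (cases "c k = 0")
    case False
    have "(\<integral>u. norm (f k u) \<partial>lborel) = (\<integral>u. norm (c k) * (indicator {0<..\<delta>} u *\<^sub>R u powr ((Re (s + of_nat k - 1)) - 1)) \<partial>lborel)"
      unfolding f_def by (intro Bochner_Integration.integral_cong refl) (auto simp: norm_mult indicator_def norm_powr_real_powr)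
    also have "\<dots> = norm (c k) * (LBINT u:{0<..\<delta>}. u powr ((Re (s + of_nat k - 1)) - 1))"
      by (simp only: integral_mult_right_zero set_lebesgue_integral_def)
    also have "(LBINT u:{0<..\<delta>}. u powr ((Re (s + of_nat k - 1)) - 1)) = \<delta> powr Re (s + of_nat k - 1) / Re (s + of_nat k - 1)"
      using s[OF False] \<delta> by (intro LBINT_powr_0) auto
    finally show ?thesis by simp
  qed (simp add: f_def)
  have sumn: "summable (\<lambda>k. \<integral>u. norm (f k u) \<partial>lborel)"
  proof (rule summable_comparison_test_ev[OF _ summable_mult[OF summ, of "\<delta> powr (Re s - 1)"]])
    obtain N :: nat where N: "2 - Re s < real N" using reals_Archimedean2 by blast
    show "eventually (\<lambda>k. norm (\<integral>u. norm (f k u) \<partial>lborel) \<le> \<delta> powr (Re s - 1) * (norm (c k) * \<delta> ^ k)) sequentially"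
      using eventually_ge_at_top[of N]
    proof eventually_elim
      case (elim k)
      hence 1: "1 \<le> Re s + real k - 1" using N by simp
      have "\<delta> powr (Re s + real k - 1) = \<delta> powr (Re s - 1) * \<delta> ^ k"
      proof -
        have "Re s + real k - 1 = (Re s - 1) + real k" by simp
        thus ?thesis using \<delta> by (simp only: powr_add) (simp add: powr_realpow)
      qed
      moreover have "\<delta> powr (Re s + real k - 1) / (Re s + real k - 1) \<le> \<delta> powr (Re s + real k - 1) / 1"
        using 1 by (intro divide_left_mono) auto
      ultimately have "norm (c k) * (\<delta> powr (Re s + real k - 1) / (Re s + real k - 1)) \<le> norm (c k) * (\<delta> powr (Re s - 1) * \<delta> ^ k)"
        by (intro mult_left_mono) auto
      thus ?case unfolding fnorm using 1 by (simp add: mult_ac)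
    qed
  qed
  have fsums: "(\<lambda>k. f k u) sums (indicator {0<..\<delta>} u *\<^sub>R (of_real (\<psi> u) * complex_of_real u powr (s - 1)))" for u
  proof (cases "u \<in> {0<..\<delta>}")
    case True
    have "(\<lambda>k. (complex_of_real u powr (s - 1) / of_real u) * (c k * of_real u ^ k)) sums ((complex_of_real u powr (s - 1) / of_real u) * of_real (u * \<psi> u))"
      using True by (intro sums_mult expand) auto
    moreover have "(complex_of_real u powr (s - 1) / of_real u) * (c k * of_real u ^ k) = f k u" for k
    proof -
      have "(s + of_nat k - 1) - 1 = (s - 1) - 1 + of_nat k" by simp
      hence "complex_of_real u powr ((s + of_nat k - 1) - 1) = of_real u powr (s - 1) / of_real u * of_real u ^ k"
        using True by (simp only: powr_add powr_diff) (simp add: powr_nat')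
      thus ?thesis using True by (simp add: f_def)
    qed
    ultimately show ?thesis using True by (simp add: mult.commute)
  qed (auto simp: f_def)
  have sn: "AE u in lborel. summable (\<lambda>k. norm (f k u))"
  proof (rule AE_I2)
    fix u
    show "summable (\<lambda>k. norm (f k u))"
    proof (cases "u \<in> {0<..\<delta>}")
      case True
      have "summable (\<lambda>k. norm (complex_of_real u powr (s - 1) / of_real u) * (norm (c k) * u ^ k))"
      proof (intro summable_mult summable_comparison_test[OF _ summ] exI[of _ 0] allI impI)
        fix k show "norm (norm (c k) * u ^ k) \<le> norm (c k) * \<delta> ^ k"
          using True by (auto intro!: mult_left_mono power_mono)
      qed
      moreover have "norm (complex_of_real u powr (s - 1) / of_real u) * (norm (c k) * u ^ k) = norm (f k u)" for k
      proof -
        have "(s + of_nat k - 1) - 1 = (s - 1) - 1 + of_nat k" by simp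
        hence "complex_of_real u powr ((s + of_nat k - 1) - 1) = of_real u powr (s - 1) / of_real u * of_real u ^ k"
          using True by (simp only: powr_add powr_diff) (simp add: powr_nat')
        thus ?thesis using True by (simp add: f_def norm_mult norm_divide norm_power)
      qed
      ultimately show ?thesis by simp
    qed (auto simp: f_def)
  qed
  have I1: "integrable lborel (\<lambda>u. \<Sum>k. f k u)" by (rule integrable_suminf[OF fint sn sumn])
  have I2: "(\<integral>u. (\<Sum>k. f k u) \<partial>lborel) = (\<Sum>k. \<integral>u. f k u \<partial>lborel)" by (rule integral_suminf[OF fint sn sumn])
  have head: "set_integrable lborel {0<..\<delta>} (\<lambda>u. of_real (\<psi> u) * complex_of_real u powr (s - 1))"
    using I1 unfolding sums_unique[OF fsums, symmetric] by (simp add: set_integrable_def)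
  have headv: "(LBINT u:{0<..\<delta>}. of_real (\<psi> u) * complex_of_real u powr (s - 1)) = 
      of_real \<delta> powr (s - 1) * (\<Sum>k. c k * of_real \<delta> ^ k / (s + of_nat k - 1))"
    using I2 unfolding sums_unique[OF fsums, symmetric] fval
    by (simp only: set_lebesgue_integral_def suminf_mult[OF summable_norm_cancel[OF summable_mellin_terms]])
  have tail: "set_integrable lborel {\<delta><..} (\<lambda>u. of_real (\<psi> u) * complex_of_real u powr (s - 1))"
  proof (rule set_integrable_bound[OF wt_integrable[of "norm (s - 1)"]])
    note [measurable] = meas
    show "set_borel_measurable lborel {\<delta><..} (\<lambda>u. of_real (\<psi> u) * complex_of_real u powr (s - 1))"
      unfolding set_borel_measurable_def by measurable
    show "AE u in lborel. u \<in> {\<delta><..} \<longrightarrow> norm (of_real (\<psi> u) * complex_of_real u powr (s - 1)) \<le> norm (wt (norm (s - 1)) u)"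
    proof (intro AE_I2 impI)
      fix u assume u: "u \<in> {\<delta><..}"
      hence u0: "u > 0" using \<delta> by simp
      have "norm (of_real (\<psi> u) * complex_of_real u powr (s - 1)) = \<bar>\<psi> u\<bar> * exp (Re (s - 1) * ln u)"
        using u0 by (simp add: norm_mult norm_powr_real_powr powr_def)
      also have "\<dots> \<le> \<bar>\<psi> u\<bar> * exp (norm (s - 1) * \<bar>ln u\<bar>)"
      proof (intro mult_left_mono, subst exp_le_cancel_iff)
        have "Re (s - 1) * ln u \<le> \<bar>Re (s - 1)\<bar> * \<bar>ln u\<bar>" by (metis abs_ge_self abs_mult)
        also have "\<dots> \<le> norm (s - 1) * \<bar>ln u\<bar>" by (intro mult_right_mono abs_Re_le_cmod) auto
        finally show "Re (s - 1) * ln u \<le> norm (s - 1) * \<bar>ln u\<bar>" .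
      qed auto
      also have "\<dots> \<le> wt (norm (s - 1)) u" using u by (intro exp_ln_le_wt) auto
      finally show "norm (of_real (\<psi> u) * complex_of_real u powr (s - 1)) \<le> norm (wt (norm (s - 1)) u)" by simp
    qed
  qed auto
  have un: "{0<..} = {0<..\<delta>} \<union> {\<delta><..}" using \<delta> by auto
  show "set_integrable lborel {0<..} (\<lambda>u. of_real (\<psi> u) * complex_of_real u powr (s - 1))"
    unfolding un using head tail by (rule set_integrable_Un) auto
  show "mellin_cont s = (LBINT u:{0<..}. of_real (\<psi> u) * complex_of_real u powr (s - 1))"
    unfolding un mellin_cont_def mellin_tail_def headv[symmetric]
    by (rule set_integral_Un[symmetric, OF _ head tail]) auto
qed

end


subsection \<open>Dirichlet series with periodic coefficients\<close>

definition psi :: "(nat \<Rightarrow> int) \<Rightarrow> real \<Rightarrow> real" where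
  "psi f u = (\<Sum>n. of_int (f (Suc n)) * exp (- real (Suc n) * u))"

lemma exp_geometric: "u > 0 \<Longrightarrow> (\<lambda>n. exp (- real (Suc n) * u)) sums (exp (-u) / (1 - exp (-u)))"
proof -
  assume u: "u > 0"
  have "(\<lambda>n. exp (-u) * exp (-u) ^ n) sums (exp (-u) * (1 / (1 - exp (-u))))"
    using u by (intro sums_mult geometric_sums) auto
  thus ?thesis by (simp add: exp_of_nat_mult[symmetric] exp_add[symmetric] algebra_simps)
qed

lemma norm_nat_powr: "norm (complex_of_nat (Suc n) powr s) = real (Suc n) powr Re s"
  by (subst norm_powr_real_powr) auto

locale bounded_coeffs =
  fixes f :: "nat \<Rightarrow> int"
  assumes f_le: "\<bar>f n\<bar> \<le> 1"
begin

lemma f_le': "\<bar>real_of_int (f n)\<bar> \<le> 1" using f_le[of n] by linarith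

lemma psi_summable_norm: assumes "u > 0" shows "summable (\<lambda>n. norm (of_int (f (Suc n)) * exp (- real (Suc n) * u)))"
proof (rule summable_comparison_test[OF _ sums_summable[OF exp_geometric[OF assms]]], intro exI allI impI)
  fix n
  show "norm (norm (of_int (f (Suc n)) * exp (- real (Suc n) * u))) \<le> exp (- real (Suc n) * u)"
    using mult_right_mono[OF f_le'[of "Suc n"], of "exp (- real (Suc n) * u)"] by (simp add: abs_mult)
qed

lemma psi_sums: "u > 0 \<Longrightarrow> (\<lambda>n. of_int (f (Suc n)) * exp (- real (Suc n) * u)) sums psi f u"
  unfolding psi_def by (rule summable_sums[OF summable_norm_cancel[OF psi_summable_norm]])

lemma psi_bound: assumes "u > 0" shows "\<bar>psi f u\<bar> \<le> exp (-u) / (1 - exp (-u))"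
proof -
  have "norm (psi f u) \<le> (\<Sum>n. norm (of_int (f (Suc n)) * exp (- real (Suc n) * u)))"
    unfolding psi_def by (rule summable_norm[OF psi_summable_norm[OF assms]])
  also have "\<dots> \<le> (\<Sum>n. exp (- real (Suc n) * u))"
  proof (rule suminf_le[OF _ psi_summable_norm[OF assms] sums_summable[OF exp_geometric[OF assms]]])
    fix n show "norm (of_int (f (Suc n)) * exp (- real (Suc n) * u)) \<le> exp (- real (Suc n) * u)"
      using mult_right_mono[OF f_le'[of "Suc n"], of "exp (- real (Suc n) * u)"] by (simp add: abs_mult)
  qed
  also have "\<dots> = exp (-u) / (1 - exp (-u))" using exp_geometric[OF assms] by (rule sums_unique[symmetric])
  finally show ?thesis by simp
qed

lemma psi_measurable [measurable]: "psi f \<in> borel_measurable borel"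
  unfolding psi_def[abs_def] by measurable

lemma summable_dirichlet:
  assumes "Re s > 1"
  shows "summable (\<lambda>n. norm (of_int (f (Suc n)) * of_nat (Suc n) powr (- s) :: complex))"
proof (rule summable_comparison_test)
  have "summable (\<lambda>n. real n powr (- Re s))" using assms by (subst summable_real_powr_iff) simp
  thus "summable (\<lambda>n. real (Suc n) powr (- Re s))" by (subst summable_Suc_iff)
  show "\<exists>N. \<forall>n\<ge>N. norm (norm (of_int (f (Suc n)) * of_nat (Suc n) powr (- s) :: complex)) \<le> real (Suc n) powr (- Re s)"
  proof (intro exI allI impI)
    fix n
    have "norm (of_nat (Suc n) powr (- s) :: complex) = real (Suc n) powr (- Re s)"
      using norm_nat_powr[of n "- s"] by simp
    thus "norm (norm (of_int (f (Suc n)) * of_nat (Suc n) powr (- s) :: complex)) \<le> real (Suc n) powr (- Re s)"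
      using mult_right_mono[OF f_le'[of "Suc n"], of "real (Suc n) powr (- Re s)"] by (simp add: norm_mult)
  qed
qed

lemma dirichlet_eq_mellin:
  assumes s: "Re s > 1"
  shows "(\<Sum>n. of_int (f (Suc n)) * of_nat (Suc n) powr (-s)) * Gamma s = (LBINT u:{0<..}. of_real (psi f u) * complex_of_real u powr (s - 1))"
proof -
  define g where "g = (\<lambda>n u. of_int (f (Suc n)) * (indicator {0<..} u *\<^sub>R (complex_of_real u powr (s - 1) * of_real (exp (- real (Suc n) * u)))))"
  have gint: "integrable lborel (g n)" for n
    using set_integrable_Gamma[of s "real (Suc n)"] s unfolding g_def set_integrable_def by (intro integrable_mult_right) auto
  have gval: "(\<integral>u. g n u \<partial>lborel) = (of_int (f (Suc n)) * of_nat (Suc n) powr (-s)) * Gamma s" for n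
  proof -
    have "(\<integral>u. g n u \<partial>lborel) = of_int (f (Suc n)) * (LBINT u:{0<..}. complex_of_real u powr (s - 1) * of_real (exp (- real (Suc n) * u)))"
      unfolding g_def set_lebesgue_integral_def by (rule integral_mult_right_zero)
    also have "(LBINT u:{0<..}. complex_of_real u powr (s - 1) * of_real (exp (- real (Suc n) * u))) = Gamma s * of_real (real (Suc n)) powr (-s)"
      using s by (intro LBINT_Gamma) auto
    finally show ?thesis by (simp only: of_real_of_nat_eq mult_ac)
  qed
  have gnorm: "(\<integral>u. norm (g n u) \<partial>lborel) = Gamma (Re s) * norm (of_int (f (Suc n)) * of_nat (Suc n) powr (- s) :: complex)" for n
  proof -
    have "(\<integral>u. norm (g n u) \<partial>lborel) = (\<integral>u. \<bar>of_int (f (Suc n))\<bar> * (indicator {0<..} u *\<^sub>R (u powr (Re s - 1) * exp (- real (Suc n) * u))) \<partial>lborel)"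
      by (intro Bochner_Integration.integral_cong refl) (auto simp: g_def norm_mult indicator_def norm_powr_real_powr simp del: of_nat_Suc)
    also have "\<dots> = \<bar>of_int (f (Suc n))\<bar> * (LBINT u:{0<..}. u powr (Re s - 1) * exp (- real (Suc n) * u))"
      by (simp only: integral_mult_right_zero set_lebesgue_integral_def)
    also have "(LBINT u:{0<..}. u powr (Re s - 1) * exp (- real (Suc n) * u)) = Gamma (Re s) * real (Suc n) powr (- Re s)"
      using s by (intro LBINT_real_Gamma) auto
    finally show ?thesis by (simp add: norm_mult norm_nat_powr del: of_nat_Suc)
  qed
  have sumn: "summable (\<lambda>n. \<integral>u. norm (g n u) \<partial>lborel)"
    unfolding gnorm by (intro summable_mult summable_dirichlet s)
  have gsums: "(\<lambda>n. g n u) sums (indicator {0<..} u *\<^sub>R (of_real (psi f u) * complex_of_real u powr (s - 1)))" for u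
  proof (cases "u > 0")
    case True
    have "(\<lambda>n. complex_of_real (of_int (f (Suc n)) * exp (- real (Suc n) * u)) * complex_of_real u powr (s - 1)) sums (of_real (psi f u) * complex_of_real u powr (s - 1))"
      by (intro sums_mult2 sums_of_real psi_sums True)
    thus ?thesis using True by (simp add: g_def mult_ac del: of_nat_Suc)
  qed (simp add: g_def)
  have sn: "AE u in lborel. summable (\<lambda>n. norm (g n u))"
  proof (rule AE_I2)
    fix u show "summable (\<lambda>n. norm (g n u))"
    proof (cases "u > 0")
      case True
      have "summable (\<lambda>n. norm (of_int (f (Suc n)) * exp (- real (Suc n) * u)) * norm (complex_of_real u powr (s - 1)))"
        by (intro summable_mult2 psi_summable_norm True)
      thus ?thesis using True by (simp add: g_def norm_mult mult_ac abs_mult del: of_nat_Suc)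
    qed (simp add: g_def)
  qed
  have "(\<integral>u. (\<Sum>n. g n u) \<partial>lborel) = (\<Sum>n. \<integral>u. g n u \<partial>lborel)" by (rule integral_suminf[OF gint sn sumn])
  thus ?thesis unfolding sums_unique[OF gsums, symmetric] gval
    by (simp only: set_lebesgue_integral_def suminf_mult2[OF summable_norm_cancel[OF summable_dirichlet[OF s]]])
qed

lemma dirichlet_holomorphic:
  "(\<lambda>s. \<Sum>n. of_int (f (Suc n)) * of_nat (Suc n) powr (-s) :: complex) holomorphic_on {s. Re s > 1}"
proof (rule holomorphic_uniform_sequence)
  show "open {s. Re s > 1}" by (rule open_halfspace_Re_gt)
  show "(\<lambda>s. \<Sum>n<m. of_int (f (Suc n)) * of_nat (Suc n) powr (-s) :: complex) holomorphic_on {s. Re s > 1}" for m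
    by (intro holomorphic_intros) (auto simp: complex_nonpos_Reals_iff)
  fix x assume x: "x \<in> {s. Re s > 1}"
  define d where "d = (Re x - 1) / 2"
  have d: "d > 0" using x by (simp add: d_def)
  have re: "Re y \<ge> 1 + d" if "y \<in> cball x d" for y
  proof -
    have "\<bar>Re x - Re y\<bar> \<le> d" using that abs_Re_le_cmod[of "x - y"] by (simp add: dist_norm)
    hence "Re x - Re y \<le> d" by linarith
    thus ?thesis by (simp add: d_def field_simps)
  qed
  have "uniform_limit (cball x d) (\<lambda>m s. \<Sum>n<m. of_int (f (Suc n)) * of_nat (Suc n) powr (-s) :: complex) 
      (\<lambda>s. \<Sum>n. of_int (f (Suc n)) * of_nat (Suc n) powr (-s)) sequentially"
  proof (rule Weierstrass_m_test)
    have "summable (\<lambda>n. real n powr (- (1 + d)))" using d by (subst summable_real_powr_iff) simp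
    thus "summable (\<lambda>n. real (Suc n) powr (- (1 + d)))" by (subst summable_Suc_iff)
    fix n s assume s: "s \<in> cball x d"
    have "norm (of_nat (Suc n) powr (- s) :: complex) = real (Suc n) powr (- Re s)"
      using norm_nat_powr[of n "- s"] by simp
    also have "\<dots> \<le> real (Suc n) powr (- (1 + d))" using re[OF s] by (intro powr_mono) auto
    finally have "\<bar>real_of_int (f (Suc n))\<bar> * norm (of_nat (Suc n) powr (- s) :: complex) \<le> 1 * real (Suc n) powr (- (1 + d))"
      by (intro mult_mono f_le') auto
    thus "norm (of_int (f (Suc n)) * of_nat (Suc n) powr (- s) :: complex) \<le> real (Suc n) powr (- (1 + d))"
      by (simp add: norm_mult del: of_nat_Suc)
  qed
  thus "\<exists>d>0. cball x d \<subseteq> {s. 1 < Re s} \<and> uniform_limit (cball x d) (\<lambda>m s. \<Sum>n<m. of_int (f (Suc n)) * of_nat (Suc n) powr (-s) :: complex) 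
      (\<lambda>s. \<Sum>n. of_int (f (Suc n)) * of_nat (Suc n) powr (-s)) sequentially"
    using d re by (intro exI[of _ d]) fastforce
qed

end

locale periodic_coeffs = bounded_coeffs +
  fixes q :: nat
  assumes q: "q > 0" and periodic: "f (n + q) = f n"
begin

lemma psi_closed_form:
  assumes u: "u > 0"
  shows "psi f u * (1 - exp (- real q * u)) = (\<Sum>r<q. of_int (f (Suc r)) * exp (- real (Suc r) * u))"
proof -
  let ?t = "\<lambda>n. of_int (f (Suc n)) * exp (- real (Suc n) * u)"
  note sm = sums_summable[OF psi_sums[OF u]]
  have "psi f u = (\<Sum>n. ?t (n + q)) + (\<Sum>n<q. ?t n)"
    unfolding psi_def by (rule suminf_split_initial_segment[OF sm])
  also have "(\<lambda>n. ?t (n + q)) = (\<lambda>n. exp (- real q * u) * ?t n)"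
  proof
    fix n
    have "f (Suc (n + q)) = f (Suc n)" using periodic[of "Suc n"] by simp
    moreover have "exp (- real (Suc (n + q)) * u) = exp (- real q * u) * exp (- real (Suc n) * u)"
      by (simp add: algebra_simps flip: exp_add)
    ultimately show "?t (n + q) = exp (- real q * u) * ?t n" by simp
  qed
  also have "(\<Sum>n. exp (- real q * u) * ?t n) = exp (- real q * u) * psi f u"
    unfolding psi_def by (rule suminf_mult[OF sm])
  finally have "psi f u = exp (- real q * u) * psi f u + (\<Sum>r<q. ?t r)" .
  moreover have "psi f u * (1 - exp (- real q * u)) = psi f u - exp (- real q * u) * psi f u"
    by (simp only: right_diff_distrib mult.commute mult_1)
  ultimately show ?thesis by linarith
qed

definition hnum :: "complex \<Rightarrow> complex" where
  "hnum z = (\<Sum>r<q. of_int (f (Suc r)) * exp (- of_nat (Suc r) * z))"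

text \<open>(1 - exp(-q z)) / z with its removable singularity filled in, spelled out in the shape
  that \<open>pole_lemma_open\<close> produces.\<close>

definition hden :: "complex \<Rightarrow> complex" where
  "hden z = (if z = 0 then deriv (\<lambda>z. 1 - exp (- of_nat q * z)) 0
     else ((1 - exp (- of_nat q * z)) - (1 - exp (- of_nat q * 0))) / (z - 0))"

lemma hden_0: "hden 0 = of_nat q"
proof -
  have "((\<lambda>z. 1 - exp (- of_nat q * z)) has_field_derivative (of_nat q :: complex)) (at 0)"
    by (auto intro!: derivative_eq_intros)
  thus ?thesis unfolding hden_def by (simp add: DERIV_imp_deriv)
qed

text \<open>The zeros of 1 - exp(-q z) are 2 pi i n / q, and those with n nonzero lie outside the
  disc of radius 3 / q because 3 < pi.\<close>

lemma hden_nz: assumes "norm z < 3 / q" shows "hden z \<noteq> 0"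
proof (cases "z = 0")
  case False
  have "exp (- of_nat q * z) \<noteq> 1"
  proof
    assume "exp (- of_nat q * z) = 1"
    then obtain n :: int where n: "Re (- of_nat q * z) = 0" "Im (- of_nat q * z) = of_int (2 * n) * pi"
      unfolding exp_eq_1 by auto
    have re0: "Re z = 0" using n q by simp
    have "norm (of_nat q * z) < 3" using assms q by (simp add: norm_mult field_simps)
    moreover have "\<bar>Im (of_nat q * z)\<bar> \<le> norm (of_nat q * z)" by (rule abs_Im_le_cmod)
    ultimately have "\<bar>of_int (2 * n) * pi\<bar> < 3" using n by simp
    moreover have "3 < pi" by (rule pi_gt3)
    ultimately have "n = 0"
    proof (cases "n = 0")
      case False
      hence "1 \<le> \<bar>real_of_int (2 * n)\<bar>" by linarith
      hence "1 * pi \<le> \<bar>real_of_int (2 * n)\<bar> * pi" by (intro mult_right_mono) auto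
      moreover have "\<bar>of_int (2 * n) * pi\<bar> = \<bar>real_of_int (2 * n)\<bar> * pi" by (simp only: abs_mult) simp
      ultimately show ?thesis using \<open>\<bar>of_int (2 * n) * pi\<bar> < 3\<close> \<open>3 < pi\<close> by linarith
    qed
    hence "Im z = 0" using n q by simp
    thus False using re0 False by (simp add: complex_eq_iff)
  qed
  thus ?thesis using False by (simp add: hden_def)
qed (use q in \<open>simp add: hden_0\<close>)

definition hquot :: "complex \<Rightarrow> complex" where "hquot z = hnum z / hden z"

lemma hquot_holomorphic: "hquot holomorphic_on ball 0 (3 / q)"
proof -
  have "hden holomorphic_on ball 0 (3 / q)"
    unfolding hden_def[abs_def] by (intro pole_lemma_open holomorphic_intros) auto
  moreover have "hnum holomorphic_on ball 0 (3 / q)"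
    unfolding hnum_def[abs_def] by (intro holomorphic_intros)
  ultimately show ?thesis unfolding hquot_def[abs_def]
    by (intro holomorphic_on_divide) (auto simp: hden_nz)
qed

definition hcoeff :: "nat \<Rightarrow> complex" where "hcoeff k = (deriv ^^ k) hquot 0 / fact k"

lemma hcoeff_sums: "norm z < 3 / q \<Longrightarrow> (\<lambda>k. hcoeff k * z ^ k) sums hquot z"
  using holomorphic_power_series[OF hquot_holomorphic, of z] by (simp add: hcoeff_def)

text \<open>The mean over a period is the coefficient responsible for the pole at s = 1. When it
  vanishes, \<open>mellin_cont_eq\<close> is available on Re s > 0.\<close>

lemma hcoeff_0: "hcoeff 0 = of_int (\<Sum>r<q. f (Suc r)) / of_nat q"
  by (simp add: hcoeff_def hquot_def hden_0 hnum_def)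

lemma hquot_eq: assumes u: "u > 0" shows "hquot (of_real u) = of_real (u * psi f u)"
proof -
  have "hnum (of_real u) = of_real (psi f u * (1 - exp (- real q * u)))"
    unfolding psi_closed_form[OF u] hnum_def by (simp flip: exp_of_real)
  moreover have "hden (of_real u) = of_real ((1 - exp (- real q * u)) / u)"
    using u by (simp add: hden_def flip: exp_of_real)
  ultimately have "hquot (of_real u) = of_real (psi f u * (1 - exp (- real q * u)) / ((1 - exp (- real q * u)) / u))"
    by (simp add: hquot_def)
  also have "psi f u * (1 - exp (- real q * u)) / ((1 - exp (- real q * u)) / u) = u * psi f u"
  proof -
    define B where "B = 1 - exp (- real q * u)"
    have "B \<noteq> 0" using u q by (simp add: B_def)
    thus ?thesis using u unfolding B_def[symmetric] by (simp add: field_simps)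
  qed
  finally show ?thesis .
qed

sublocale M: mellin_setup "psi f" hcoeff "1 / real q" "1 / (1 - exp (- (1 / real q)))"
proof
  show "1 / real q > 0" using q by simp
  show "0 \<le> 1 / (1 - exp (- (1 / real q)))" by simp
  have "summable (\<lambda>k. norm (hcoeff k * of_real (1 / q) ^ k))"
  proof (rule powser_insidea)
    \<comment> \<open>Absolute convergence at 1 / q follows from convergence at the larger point 2 /
      q, still inside the disc of radius 3 / q.\<close>
    have "norm (complex_of_real (2 / q)) < 3 / q" using q by (simp add: norm_divide divide_strict_right_mono)
    thus "summable (\<lambda>k. hcoeff k * of_real (2 / q) ^ k)" by (rule sums_summable[OF hcoeff_sums])
    show "norm (complex_of_real (1 / q)) < norm (complex_of_real (2 / q))"
      using q by (simp add: norm_divide divide_strict_right_mono)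
  qed
  thus "summable (\<lambda>k. norm (hcoeff k) * (1 / real q) ^ k)" by (simp add: norm_mult norm_power norm_divide)
  show "(\<lambda>k. hcoeff k * of_real u ^ k) sums of_real (u * psi f u)" if "0 < u" "u \<le> 1 / real q" for u
  proof -
    have "1 / real q < 3 / real q" using q by (simp add: divide_strict_right_mono)
    thus ?thesis using hcoeff_sums[of "of_real u"] hquot_eq[of u] that by simp
  qed
  show "\<bar>psi f u\<bar> \<le> 1 / (1 - exp (- (1 / real q))) * exp (- (1 / 2) * u)" if u: "u > 1 / real q" for u
  proof -
    have u0: "u > 0" using u q by (meson divide_pos_pos of_nat_0_less_iff less_trans zero_less_one)
    have "\<bar>psi f u\<bar> \<le> exp (-u) / (1 - exp (-u))" by (rule psi_bound[OF u0])
    also have "\<dots> \<le> exp (- (1/2) * u) / (1 - exp (- (1 / real q)))"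
      using u u0 q by (intro frac_le) auto
    finally show ?thesis by simp
  qed
qed measurable

lemma L_meromorphic: "(\<lambda>s. rGamma s * M.mellin_cont s) meromorphic_on UNIV"
  by (intro meromorphic_on_mult M.mellin_cont_meromorphic analytic_on_imp_meromorphic_on analytic_intros)

lemma L_eq:
  assumes "Re s > 1 \<or> Re s > 0 \<and> (\<Sum>r<q. f (Suc r)) = 0"
  shows "rGamma s * M.mellin_cont s * Gamma s = (LBINT u:{0<..}. of_real (psi f u) * complex_of_real u powr (s - 1))"
    and "set_integrable lborel {0<..} (\<lambda>u. of_real (psi f u) * complex_of_real u powr (s - 1))"
proof -
  have c: "Re s + real k - 1 > 0" if "hcoeff k \<noteq> 0" for k
    using assms that hcoeff_0 by (cases k) (auto simp del: of_int_sum)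
  have "s \<notin> \<int>\<^sub>\<le>\<^sub>0" using assms by (auto elim!: nonpos_Ints_cases)
  hence "rGamma s * Gamma s = 1" by (simp add: Gamma_def rGamma_eq_zero_iff)
  hence "rGamma s * M.mellin_cont s * Gamma s = M.mellin_cont s" by (metis mult.assoc mult.commute mult_1)
  thus "rGamma s * M.mellin_cont s * Gamma s = (LBINT u:{0<..}. of_real (psi f u) * complex_of_real u powr (s - 1))"
    using M.mellin_cont_eq(2)[OF c] by simp
  show "set_integrable lborel {0<..} (\<lambda>u. of_real (psi f u) * complex_of_real u powr (s - 1))"
    by (rule M.mellin_cont_eq(1)[OF c])
qed

lemma L_eq_series:
  assumes s: "Re s > 1"
  shows "rGamma s * M.mellin_cont s = (\<Sum>n. of_int (f (Suc n)) * of_nat (Suc n) powr (-s))"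
proof -
  have "s \<notin> \<int>\<^sub>\<le>\<^sub>0" using s by (auto elim!: nonpos_Ints_cases)
  hence G: "Gamma s \<noteq> 0" by (simp add: Gamma_eq_zero_iff)
  have "rGamma s * M.mellin_cont s * Gamma s = (\<Sum>n. of_int (f (Suc n)) * of_nat (Suc n) powr (-s)) * Gamma s"
    unfolding L_eq(1)[OF disjI1[OF s]] dirichlet_eq_mellin[OF s] by (rule refl)
  thus ?thesis by (rule mult_right_cancel[OF G, THEN iffD1])
qed

theorem Dirichlet_L_eq: "Dirichlet_L f = remove_sings (\<lambda>s. rGamma s * M.mellin_cont s)"
  unfolding Dirichlet_L_def
  by (rule meromorphic_continuation_eqI[OF L_meromorphic L_eq_series dirichlet_holomorphic])

theorem Dirichlet_L_meromorphic: "Dirichlet_L f nicely_meromorphic_on UNIV"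
  unfolding Dirichlet_L_eq by (rule remove_sings_nicely_meromorphic[OF L_meromorphic])

theorem Dirichlet_L_series:
  assumes "Re s > 1" shows "Dirichlet_L f s = (\<Sum>n. of_int (f (Suc n)) * of_nat (Suc n) powr (-s))"
proof -
  have "(\<lambda>s. rGamma s * M.mellin_cont s) analytic_on {s}"
    using assms by (intro analytic_intros M.mellin_cont_analytic) (auto simp: complex_eq_iff)
  thus ?thesis unfolding Dirichlet_L_eq using L_eq_series[OF assms] by simp
qed

theorem Dirichlet_L_mellin:
  assumes "Re s > 0" "(\<Sum>r<q. f (Suc r)) = 0"
  shows "Dirichlet_L f analytic_on {s}"
    and "Dirichlet_L f s * Gamma s = (LBINT u:{0<..}. of_real (psi f u) * complex_of_real u powr (s - 1))"
proof -
  have "z + of_nat k - 1 \<noteq> 0" if "Re z > 0" "hcoeff k \<noteq> 0" for k z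
    using that assms(2) hcoeff_0 by (cases k) (auto simp: complex_eq_iff simp del: of_int_sum)
  hence an: "(\<lambda>s. rGamma s * M.mellin_cont s) analytic_on {z}" if "Re z > 0" for z
    using that by (intro analytic_intros M.mellin_cont_analytic) auto
  show "Dirichlet_L f analytic_on {s}"
    unfolding Dirichlet_L_eq using an[OF assms(1)] by (rule remove_sings_analytic_on)
  show "Dirichlet_L f s * Gamma s = (LBINT u:{0<..}. of_real (psi f u) * complex_of_real u powr (s - 1))"
    unfolding Dirichlet_L_eq using an[OF assms(1)] L_eq(1)[of s] assms by simp
qed

end

subsection \<open>Mean squares\<close>

text \<open>Squaring out a partial sum and summing over d first leaves only correlations of
  coefficients. The hypothesis bounds all finite double sums uniformly, so the limit is taken only
  once, at the end.\<close>

lemma mean_square_le: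
  fixes x :: "'d \<Rightarrow> nat \<Rightarrow> real" and a :: "nat \<Rightarrow> real"
  assumes D: "finite D" and S: "\<And>d. d \<in> D \<Longrightarrow> (\<lambda>n. x d n * a n) sums S d"
    and a: "\<And>n. a n \<ge> 0"
    and K: "\<And>N. (\<Sum>m<N. \<Sum>n<N. a m * a n * \<bar>\<Sum>d\<in>D. x d m * x d n\<bar>) \<le> K"
  shows "(\<Sum>d\<in>D. (S d)\<^sup>2) \<le> K"
proof (rule LIMSEQ_le_const2)
  show "(\<lambda>N. \<Sum>d\<in>D. (\<Sum>n<N. x d n * a n)\<^sup>2) \<longlonglongrightarrow> (\<Sum>d\<in>D. (S d)\<^sup>2)"
    using S unfolding sums_def by (intro tendsto_sum tendsto_power) auto
  have "(\<Sum>d\<in>D. (\<Sum>n<N. x d n * a n)\<^sup>2) \<le> K" for N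
  proof -
    have "(\<Sum>d\<in>D. (\<Sum>n<N. x d n * a n)\<^sup>2) = (\<Sum>d\<in>D. \<Sum>m<N. \<Sum>n<N. a m * a n * (x d m * x d n))"
      unfolding power2_eq_square sum_product by (intro sum.cong refl) (simp add: mult_ac)
    also have "\<dots> = (\<Sum>m<N. \<Sum>n<N. \<Sum>d\<in>D. a m * a n * (x d m * x d n))"
      by (subst sum.swap, rule sum.cong[OF refl], rule sum.swap)
    also have "\<dots> = (\<Sum>m<N. \<Sum>n<N. a m * a n * (\<Sum>d\<in>D. x d m * x d n))"
      by (simp add: sum_distrib_left)
    also have "\<dots> \<le> (\<Sum>m<N. \<Sum>n<N. a m * a n * \<bar>\<Sum>d\<in>D. x d m * x d n\<bar>)"
      by (intro sum_mono mult_left_mono abs_ge_self mult_nonneg_nonneg a)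
    also note K
    finally show ?thesis .
  qed
  thus "\<exists>N. \<forall>n\<ge>N. (\<Sum>d\<in>D. (\<Sum>i<n. x d i * a i)\<^sup>2) \<le> K" by blast
qed

text \<open>Weighted Cauchy-Schwarz: the square of the integral of F is at most the integral of w
  times that of F^2 / w. The weight is free and is later chosen so that both factors converge; h
  bounds the sum of F^2 / w over d.\<close>

lemma Cauchy_Schwarz_mean_square:
  fixes F :: "'d \<Rightarrow> real \<Rightarrow> real"
  assumes D: "finite D" and A: "A \<in> sets borel"
    and F: "\<And>d. d \<in> D \<Longrightarrow> F d \<in> borel_measurable borel"
    and w: "set_integrable lborel A w" "\<And>u. u \<in> A \<Longrightarrow> w u > 0" "w \<in> borel_measurable borel"
    and h: "set_integrable lborel A h" "\<And>u. u \<in> A \<Longrightarrow> (\<Sum>d\<in>D. (F d u)\<^sup>2) \<le> h u * w u"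
    and P: "(LBINT u:A. w u) \<le> P" and H: "(LBINT u:A. h u) \<le> H"
  shows "(\<Sum>d\<in>D. (LBINT u:A. F d u)\<^sup>2) \<le> P * H"
proof -
  have [measurable]: "A \<in> sets lborel" "w \<in> borel_measurable lborel" using A w(3) by auto
  have h0: "h u \<ge> 0" if "u \<in> A" for u
  proof -
    have "0 \<le> (\<Sum>d\<in>D. (F d u)\<^sup>2)" by (intro sum_nonneg) auto
    hence "0 \<le> h u * w u" using h(2)[OF that] by linarith
    thus ?thesis using w(2)[OF that] by (simp add: zero_le_mult_iff)
  qed
  have "(LBINT u:A. w u) \<ge> 0" unfolding set_lebesgue_integral_def
    by (rule integral_nonneg_AE) (auto simp: indicator_def less_imp_le[OF w(2)] intro!: AE_I2)
  hence P0: "P \<ge> 0" using P by linarith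
  have "(LBINT u:A. h u) \<ge> 0" unfolding set_lebesgue_integral_def
    by (rule integral_nonneg_AE) (auto simp: indicator_def h0 intro!: AE_I2)
  hence H0: "H \<ge> 0" using H by linarith
  have Pn: "(\<integral>\<^sup>+u. ennreal (indicator A u * w u) \<partial>lborel) \<le> ennreal P"
  proof -
    have "(\<integral>\<^sup>+u. ennreal (indicator A u * w u) \<partial>lborel) = ennreal (\<integral>u. indicator A u * w u \<partial>lborel)"
      using w by (intro nn_integral_eq_integral) (auto simp: set_integrable_def indicator_def intro!: AE_I2 less_imp_le)
    thus ?thesis using P by (simp add: set_lebesgue_integral_def ennreal_leI)
  qed
  have Hn: "(\<integral>\<^sup>+u. ennreal (indicator A u * h u) \<partial>lborel) \<le> ennreal H"
  proof -
    have "(\<integral>\<^sup>+u. ennreal (indicator A u * h u) \<partial>lborel) = ennreal (\<integral>u. indicator A u * h u \<partial>lborel)"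
      using h h0 by (intro nn_integral_eq_integral) (auto simp: set_integrable_def indicator_def intro!: AE_I2)
    thus ?thesis using H by (simp add: set_lebesgue_integral_def ennreal_leI)
  qed
  let ?f = "\<lambda>u. ennreal (indicator A u * sqrt (w u))"
  let ?g = "\<lambda>d u. ennreal (indicator A u * (\<bar>F d u\<bar> / sqrt (w u)))"
  have one: "ennreal ((LBINT u:A. F d u)\<^sup>2) \<le> ennreal P * (\<integral>\<^sup>+u. (?g d u)\<^sup>2 \<partial>lborel)" if d: "d \<in> D" for d
  proof -
    have [measurable]: "F d \<in> borel_measurable lborel" using F[OF d] by simp
    have "ennreal \<bar>LBINT u:A. F d u\<bar> \<le> (\<integral>\<^sup>+u. ennreal (norm (indicator A u *\<^sub>R F d u)) \<partial>lborel)"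
    proof (cases "integrable lborel (\<lambda>u. indicator A u *\<^sub>R F d u)")
      case True
      thus ?thesis unfolding set_lebesgue_integral_def by (metis integral_norm_bound_ennreal real_norm_def)
    next
      \<comment> \<open>A function that is not integrable has Bochner integral 0 by default, so the
        bound is trivial.\<close>
      case False
      thus ?thesis unfolding set_lebesgue_integral_def by (simp add: not_integrable_integral_eq)
    qed
    also have "\<dots> = (\<integral>\<^sup>+u. ?f u * ?g d u \<partial>lborel)"
    proof (rule nn_integral_cong)
      fix u
      show "ennreal (norm (indicator A u *\<^sub>R F d u)) = ?f u * ?g d u"
      proof (cases "u \<in> A")
        case True
        hence "w u > 0" by (rule w(2))
        thus ?thesis using True by (simp add: ennreal_mult[symmetric])
      qed simp
    qed
    finally have "(ennreal \<bar>LBINT u:A. F d u\<bar>)\<^sup>2 \<le> (\<integral>\<^sup>+u. ?f u * ?g d u \<partial>lborel)\<^sup>2" by (intro power_mono) auto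
    also have "\<dots> \<le> (\<integral>\<^sup>+u. (?f u)\<^sup>2 \<partial>lborel) * (\<integral>\<^sup>+u. (?g d u)\<^sup>2 \<partial>lborel)"
      by (rule Cauchy_Schwarz_nn_integral) measurable
    also have "(\<integral>\<^sup>+u. (?f u)\<^sup>2 \<partial>lborel) = (\<integral>\<^sup>+u. ennreal (indicator A u * w u) \<partial>lborel)"
      using w(2) by (intro nn_integral_cong) (auto simp: indicator_def ennreal_power less_imp_le)
    also have "\<dots> * (\<integral>\<^sup>+u. (?g d u)\<^sup>2 \<partial>lborel) \<le> ennreal P * (\<integral>\<^sup>+u. (?g d u)\<^sup>2 \<partial>lborel)"
      by (intro mult_right_mono Pn) auto
    finally show ?thesis by (simp add: ennreal_power)
  qed
  have "ennreal (\<Sum>d\<in>D. (LBINT u:A. F d u)\<^sup>2) = (\<Sum>d\<in>D. ennreal ((LBINT u:A. F d u)\<^sup>2))"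
    by (simp add: sum_ennreal)
  also have "\<dots> \<le> (\<Sum>d\<in>D. ennreal P * (\<integral>\<^sup>+u. (?g d u)\<^sup>2 \<partial>lborel))" by (intro sum_mono one)
  also have "\<dots> = ennreal P * (\<integral>\<^sup>+u. (\<Sum>d\<in>D. (?g d u)\<^sup>2) \<partial>lborel)"
  proof (subst nn_integral_sum)
    fix d assume d: "d \<in> D"
    have [measurable]: "F d \<in> borel_measurable lborel" using F[OF d] by simp
    show "(\<lambda>u. (?g d u)\<^sup>2) \<in> borel_measurable lborel" by measurable
  qed (simp add: sum_distrib_left)
  also have "\<dots> \<le> ennreal P * (\<integral>\<^sup>+u. ennreal (indicator A u * h u) \<partial>lborel)"
  proof (intro mult_left_mono nn_integral_mono)
    fix u
    show "(\<Sum>d\<in>D. (?g d u)\<^sup>2) \<le> ennreal (indicator A u * h u)"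
    proof (cases "u \<in> A")
      case True
      hence wu: "w u > 0" by (rule w(2))
      have "(\<Sum>d\<in>D. (?g d u)\<^sup>2) = (\<Sum>d\<in>D. ennreal ((F d u)\<^sup>2 / w u))"
        using True wu by (intro sum.cong refl) (simp add: ennreal_power power_divide)
      also have "\<dots> = ennreal ((\<Sum>d\<in>D. (F d u)\<^sup>2) / w u)"
        using wu by (subst sum_ennreal) (auto simp: sum_divide_distrib)
      also have "\<dots> \<le> ennreal (h u)"
        using h(2)[OF True] wu by (intro ennreal_leI) (simp add: field_simps)
      finally show ?thesis using True by simp
    qed simp
  qed auto
  also have "\<dots> \<le> ennreal P * ennreal H" by (intro mult_left_mono Hn) auto
  also have "\<dots> = ennreal (P * H)" using P0 H0 by (simp add: ennreal_mult)
  finally show ?thesis using P0 H0 by (subst (asm) ennreal_le_iff) auto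
qed

subsection \<open>Pairs whose product is almost a square\<close>

text \<open>The value zeta(s) of the Riemann zeta function for real s > 1.\<close>

definition zsum :: "real \<Rightarrow> real" where "zsum s = (\<Sum>n. real (Suc n) powr (- s))"

lemma zsum_summable: "s > 1 \<Longrightarrow> summable (\<lambda>n. real (Suc n) powr (- s))"
  using summable_real_powr_iff[of "- s"] summable_Suc_iff[of "\<lambda>n. real n powr (- s)"] by simp

lemma sum_powr_le_zsum:
  assumes s: "s > 1" and M: "finite M" "\<And>n. n \<in> M \<Longrightarrow> n > 0"
  shows "(\<Sum>n\<in>M. real n powr (- s)) \<le> zsum s"
proof -
  have "(\<Sum>n\<in>M. real n powr (- s)) = (\<Sum>n\<in>(\<lambda>n. n - 1) ` M. real (Suc n) powr (- s))"
  proof (rule sum.reindex_bij_witness[of _ Suc "\<lambda>n. n - 1"])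
    fix n assume "n \<in> M" hence "n > 0" by (rule M(2))
    thus "Suc (n - 1) = n" "real (Suc (n - 1)) powr - s = real n powr - s" by simp_all
  next
    fix k assume "k \<in> (\<lambda>n. n - 1) ` M"
    then obtain n where "n \<in> M" "k = n - 1" by auto
    thus "Suc k \<in> M" using M(2)[of n] by simp
  qed auto
  also have "\<dots> \<le> zsum s" unfolding zsum_def
    using M(1) by (intro sum_le_suminf zsum_summable s) auto
  finally show ?thesis .
qed

lemma zsum_nonneg: "s > 1 \<Longrightarrow> zsum s \<ge> 0"
  using sum_powr_le_zsum[of s "{}"] by simp

text \<open>If m n is a square, every prime has the same parity of multiplicity in m and in n, so
  their squarefree parts coincide.\<close>

lemma square_pair_decompose:
  fixes m n :: nat
  assumes "m > 0" "n > 0" "is_square (m * n)"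
  shows "n = squarefree_part m * (square_part n)\<^sup>2"
proof -
  have "squarefree_part n = squarefree_part m"
  proof -
    obtain k where k: "m * n = k\<^sup>2" using assms(3) by (auto simp: is_nth_power_def)
    have k0: "k \<noteq> 0" using k assms(1,2) by (intro notI) simp
    have "multiplicity p m mod 2 = multiplicity p n mod 2" if "prime p" for p
    proof -
      have "multiplicity p (m * n) = 2 * multiplicity p k" using that k0
        unfolding k by (simp add: prime_elem_multiplicity_power_distrib)
      moreover have "multiplicity p (m * n) = multiplicity p m + multiplicity p n"
        using that assms by (intro prime_elem_multiplicity_mult_distrib) auto
      ultimately have "multiplicity p m + multiplicity p n = 2 * multiplicity p k" by simp
      thus ?thesis by presburger
    qed
    hence *: "multiplicity p (squarefree_part n) = multiplicity p (squarefree_part m)" if "prime p" for p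
      using that assms by (simp add: prime_multiplicity_squarefree_part)
    have "squarefree_part n > 0" "squarefree_part m > 0" by (simp_all add: zero_less_iff_neq_zero)
    thus ?thesis using * by (rule multiplicity_eq_nat)
  qed
  thus ?thesis using squarefree_decompose[of n] by simp
qed

text \<open>For fixed m the admissible n are s b^2 with s the squarefree part of t m, and b
  contributes one factor zeta(2 \<theta>). Writing t m = s a^2 gives one more factor from s and one
  from a. The case t = 2 is included because for d = 5 mod 8 a factor 2 contributes only a constant
  sign to \<chi>_d(m n), so such products fail to oscillate with d as well.\<close>

lemma sum_square_pairs_le:
  fixes \<theta> :: real
  assumes \<theta>: "\<theta> > 1/2" and t: "t \<in> {1,2}"
  shows "(\<Sum>m\<in>{1..N}. \<Sum>n | n \<in> {1..N} \<and> is_square (t * m * n). (real m * real n) powr (-\<theta>)) \<le> 2 powr \<theta> * zsum (2 * \<theta>) ^ 3"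
proof -
  let ?Z = "zsum (2 * \<theta>)"
  have Z: "?Z \<ge> 0" using \<theta> by (intro zsum_nonneg) auto
  have inner: "(\<Sum>n | n \<in> {1..N} \<and> is_square (t * m * n). real n powr (-\<theta>)) \<le> real (squarefree_part (t * m)) powr (-\<theta>) * ?Z"
    if m: "m \<in> {1..N}" for m
  proof -
    let ?s = "squarefree_part (t * m)"
    let ?M = "{n. n \<in> {1..N} \<and> is_square (t * m * n)}"
    have dec: "n = ?s * (square_part n)\<^sup>2" if "n \<in> ?M" for n
      using square_pair_decompose[of "t * m" n] that m t by auto
    have fin: "finite ?M" by (rule finite_subset[of _ "{1..N}"]) auto
    have inj: "inj_on square_part ?M"
      by (rule inj_onI) (metis dec)
    have "(\<Sum>n\<in>?M. real n powr (-\<theta>)) = (\<Sum>n\<in>?M. real ?s powr (-\<theta>) * real (square_part n) powr (- (2 * \<theta>)))"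
    proof (rule sum.cong[OF refl])
      fix n assume n: "n \<in> ?M"
      have "real n = real ?s * (real (square_part n) * real (square_part n))"
        by (subst dec[OF n]) (simp add: power2_eq_square)
      hence "real n powr (-\<theta>) = real ?s powr (-\<theta>) * (real (square_part n) powr (-\<theta>) * real (square_part n) powr (-\<theta>))"
        by (simp add: powr_mult)
      thus "real n powr (-\<theta>) = real ?s powr (-\<theta>) * real (square_part n) powr (- (2 * \<theta>))"
        by (simp flip: powr_add)
    qed
    also have "\<dots> = real ?s powr (-\<theta>) * (\<Sum>b\<in>square_part ` ?M. real b powr (- (2 * \<theta>)))"
      by (subst sum.reindex[OF inj]) (simp add: sum_distrib_left)
    also have "\<dots> \<le> real ?s powr (-\<theta>) * ?Z"
    proof (intro mult_left_mono sum_powr_le_zsum)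
      fix b assume "b \<in> square_part ` ?M"
      thus "b > 0" by (auto intro!: Nat.gr0I)
    qed (use \<theta> fin in auto)
    finally show ?thesis .
  qed
  have "(\<Sum>m\<in>{1..N}. \<Sum>n | n \<in> {1..N} \<and> is_square (t * m * n). (real m * real n) powr (-\<theta>))
     = (\<Sum>m\<in>{1..N}. real m powr (-\<theta>) * (\<Sum>n | n \<in> {1..N} \<and> is_square (t * m * n). real n powr (-\<theta>)))"
    by (simp add: powr_mult sum_distrib_left)
  also have "\<dots> \<le> (\<Sum>m\<in>{1..N}. real m powr (-\<theta>) * (real (squarefree_part (t * m)) powr (-\<theta>) * ?Z))"
    by (intro sum_mono mult_left_mono inner) auto
  also have "\<dots> = ?Z * (\<Sum>m\<in>{1..N}. real t powr \<theta> * (real (squarefree_part (t * m)) powr (- (2 * \<theta>)) * real (square_part (t * m)) powr (- (2 * \<theta>))))"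
    unfolding sum_distrib_left
  proof (rule sum.cong[OF refl])
    fix m assume m: "m \<in> {1..N}"
    let ?s = "squarefree_part (t * m)" and ?a = "square_part (t * m)"
    have "t * m = ?s * ?a\<^sup>2" by (rule squarefree_decompose)
    hence "real (t * m) = real (?s * ?a\<^sup>2)" by (simp only:)
    hence "real t * real m = real ?s * (real ?a * real ?a)" by (simp add: power2_eq_square)
    hence "(real t * real m) powr (-\<theta>) = (real ?s * (real ?a * real ?a)) powr (-\<theta>)" by simp
    hence "real t powr (-\<theta>) * real m powr (-\<theta>) = real ?s powr (-\<theta>) * (real ?a powr (-\<theta>) * real ?a powr (-\<theta>))"
      by (simp add: powr_mult)
    also have "real ?a powr (-\<theta>) * real ?a powr (-\<theta>) = real ?a powr (- (2 * \<theta>))" by (simp flip: powr_add)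
    finally have "real t powr \<theta> * (real t powr (-\<theta>) * real m powr (-\<theta>)) = real t powr \<theta> * (real ?s powr (-\<theta>) * real ?a powr (- (2 * \<theta>)))" by simp
    moreover have "real t powr \<theta> * real t powr (-\<theta>) = 1" using t by (auto simp flip: powr_add)
    ultimately have *: "real m powr (-\<theta>) = real t powr \<theta> * (real ?s powr (-\<theta>) * real ?a powr (- (2 * \<theta>)))"
      by (simp add: mult.assoc[symmetric])
    have **: "real ?s powr (- (2 * \<theta>)) = real ?s powr (-\<theta>) * real ?s powr (-\<theta>)" by (simp flip: powr_add)
    show "real m powr (-\<theta>) * (real ?s powr (-\<theta>) * ?Z) = ?Z * (real t powr \<theta> * (real ?s powr (- (2 * \<theta>)) * real ?a powr (- (2 * \<theta>))))"
      unfolding * ** by (simp only: mult_ac)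
  qed
  also have "\<dots> = ?Z * (real t powr \<theta> * (\<Sum>m\<in>{1..N}. real (squarefree_part (t * m)) powr (- (2 * \<theta>)) * real (square_part (t * m)) powr (- (2 * \<theta>))))"
    by (simp only: sum_distrib_left)
  also have "(\<Sum>m\<in>{1..N}. real (squarefree_part (t * m)) powr (- (2 * \<theta>)) * real (square_part (t * m)) powr (- (2 * \<theta>)))
     \<le> ?Z * ?Z"
  proof -
    let ?g = "\<lambda>m. (squarefree_part (t * m), square_part (t * m))"
    have inj: "inj_on ?g {1..N}"
    proof (rule inj_onI)
      fix x y assume "?g x = ?g y"
      hence "t * x = t * y" using squarefree_decompose[of "t * x"] squarefree_decompose[of "t * y"] by simp
      thus "x = y" using t by auto
    qed
    let ?A = "(\<lambda>m. squarefree_part (t * m)) ` {1..N}" and ?B = "(\<lambda>m. square_part (t * m)) ` {1..N}"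
    have "(\<Sum>m\<in>{1..N}. real (squarefree_part (t * m)) powr (- (2 * \<theta>)) * real (square_part (t * m)) powr (- (2 * \<theta>)))
      = (\<Sum>(a, b)\<in>?g ` {1..N}. real a powr (- (2 * \<theta>)) * real b powr (- (2 * \<theta>)))"
      by (subst sum.reindex[OF inj]) simp
    also have "\<dots> \<le> (\<Sum>(a, b)\<in>?A \<times> ?B. real a powr (- (2 * \<theta>)) * real b powr (- (2 * \<theta>)))"
      by (rule sum_mono2) auto
    also have "\<dots> = (\<Sum>a\<in>?A. real a powr (- (2 * \<theta>))) * (\<Sum>b\<in>?B. real b powr (- (2 * \<theta>)))"
      by (simp add: sum_product sum.cartesian_product)
    also have "\<dots> \<le> ?Z * ?Z"
    proof (intro mult_mono sum_powr_le_zsum Z sum_nonneg)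
      fix n assume "n \<in> ?A" thus "n > 0" by (auto intro!: Nat.gr0I)
    next
      fix n assume "n \<in> ?B" thus "n > 0" using t by (auto intro!: Nat.gr0I)
    qed (use \<theta> in auto)
    finally show ?thesis .
  qed
  also have "real t powr \<theta> \<le> 2 powr \<theta>" using t \<theta> by (intro powr_mono2) auto
  finally show ?thesis using Z by (simp add: power3_eq_cube mult_ac mult_left_mono mult_right_mono)
qed

subsection \<open>Correlations of Jacobi symbols\<close>

lemma one_plus_ln_le: "x \<ge> 1 \<Longrightarrow> \<epsilon> > 0 \<Longrightarrow> 1 + ln x \<le> (1 + 1 / \<epsilon>) * x powr (\<epsilon>::real)"
proof -
  assume x: "x \<ge> 1" and e: "\<epsilon> > 0"
  have "ln x \<le> x powr \<epsilon> / \<epsilon>" using x e by (rule ln_powr_bound)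
  moreover have "1 \<le> x powr \<epsilon>" using x e by (intro ge_one_powr_ge_zero) auto
  ultimately show ?thesis by (simp add: algebra_simps)
qed

lemma character_sum_powr:
  assumes m: "odd m" "\<not> is_square m" and q: "q > 0" "coprime q (int m)" and e: "\<epsilon> > 0"
  shows "\<bar>real_of_int (\<Sum>d | d \<in> {A..<B} \<and> [d = r] (mod q). jac d m)\<bar> \<le> 4 * (1 + 1 / \<epsilon>) * real m powr (1 / 2 + \<epsilon>)"
proof -
  have m1: "real m \<ge> 1" using m(1) by (simp add: odd_pos Suc_leI)
  have "\<bar>real_of_int (\<Sum>d | d \<in> {A..<B} \<and> [d = r] (mod q). jac d m)\<bar> \<le> 4 * sqrt m * (1 + ln m)"
    by (rule character_sum_nonsquare[OF m q])
  also have "\<dots> \<le> 4 * sqrt m * ((1 + 1 / \<epsilon>) * real m powr \<epsilon>)"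
    by (intro mult_left_mono one_plus_ln_le m1 e) auto
  also have "sqrt m = real m powr (1/2)" using m1 by (simp add: powr_half_sqrt)
  finally show ?thesis using m1 by (simp add: powr_add algebra_simps)
qed

lemma card_progression_le:
  fixes A B r q :: int
  assumes q: "q > 0" and AB: "A \<le> B"
  shows "real (card {d. d \<in> {A..<B} \<and> [d = r] (mod q)}) \<le> (B - A) / q + 1"
proof -
  let ?S = "{d. d \<in> {A..<B} \<and> [d = r] (mod q)}"
  let ?f = "\<lambda>d. (d - A) div q"
  have inj: "inj_on ?f ?S"
  proof (rule inj_onI)
    fix x y assume xy: "x \<in> ?S" "y \<in> ?S" "?f x = ?f y"
    hence "[x = y] (mod q)" by (auto intro: cong_trans cong_sym)
    hence "[x - A = y - A] (mod q)" by (intro cong_diff cong_refl)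
    hence "(x - A) mod q = (y - A) mod q" by (simp add: cong_def)
    hence "x - A = y - A" using xy(3) by (metis mult_div_mod_eq)
    thus "x = y" by simp
  qed
  have "?f ` ?S \<subseteq> {0..(B - A) div q}"
  proof safe
    fix d assume "d \<in> {A..<B}"
    thus "?f d \<in> {0..(B - A) div q}" using q by (auto intro!: zdiv_mono1 simp: pos_imp_zdiv_nonneg_iff)
  qed
  hence "card (?f ` ?S) \<le> card {0..(B - A) div q}" by (intro card_mono) auto
  hence "card ?S \<le> nat ((B - A) div q + 1)" unfolding card_image[OF inj] by simp
  moreover have "(B - A) div q \<ge> 0" using q AB by (simp add: pos_imp_zdiv_nonneg_iff)
  ultimately have "real (card ?S) \<le> real_of_int ((B - A) div q) + 1" by linarith
  also have "real_of_int ((B - A) div q) \<le> (B - A) / q" by (rule real_of_int_div4)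
  finally show ?thesis by simp
qed

lemma powr_four_le_exp: assumes x: "x > 0" and \<theta>: "0 \<le> \<theta>" "\<theta> \<le> 4"
  shows "exp (- x / 2) \<le> 400 * x powr (- \<theta> :: real)"
proof -
  have "x powr \<theta> \<le> 400 * exp (x / 2)"
  proof (cases "x \<le> 1")
    case True
    have "x powr \<theta> \<le> 1" using x True \<theta> by (intro powr_le1) auto
    also have "1 \<le> 400 * exp (x / 2)" using one_le_exp_iff[of "x/2"] x by linarith
    finally show ?thesis .
  next
    case False
    have "x powr \<theta> \<le> x powr 4" using False \<theta> by (intro powr_mono) auto
    also have "\<dots> = x ^ 4" using x by (simp add: powr_numeral)
    \<comment> \<open>The exponential exceeds its Taylor term (x/2)^4 / 24, and 16 * 24 = 384 is
      rounded up to 400.\<close>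
    also have "\<dots> \<le> 400 * exp (x / 2)"
    proof -
      have "(x / 2) ^ 4 / fact 4 \<le> exp (x / 2)"
        using x exp_lower_Taylor_quadratic[of "x/2"] sum_le_suminf[OF summable_exp_generic[of "x/2"], of "{4}"]
        by (simp add: exp_def field_simps)
      hence "x ^ 4 \<le> 384 * exp (x / 2)" using x by (simp add: fact_numeral power4_eq_xxxx field_simps)
      moreover have "384 * exp (x / 2) \<le> 400 * exp (x / 2)" by simp
      ultimately show ?thesis by linarith
    qed
    finally show ?thesis .
  qed
  hence "x powr \<theta> * exp (- (x / 2)) \<le> 400 * exp (x / 2) * exp (- (x / 2))" by (intro mult_right_mono) auto
  also have "\<dots> = 400" by (simp add: exp_minus)
  finally have "x powr (-\<theta>) * (x powr \<theta> * exp (- (x / 2))) \<le> x powr (-\<theta>) * 400" by (intro mult_left_mono) auto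
  moreover have "x powr (-\<theta>) * (x powr \<theta> * exp (- (x / 2))) = exp (- x / 2)"
    using x by (simp add: mult.assoc[symmetric] flip: powr_add)
  ultimately show ?thesis by simp
qed

text \<open>The two parts of the double sum: pairs with nearly square product are few, all other pairs are
  controlled by the Polya-Vinogradov inequality.\<close>

lemma correlation_sum_le:
  fixes c :: "nat \<Rightarrow> real"
  assumes c0: "\<And>n. c n \<ge> 0" and c_zero: "c 0 = 0" and e: "\<epsilon> > 0"
    and c1: "\<And>n. n > 0 \<Longrightarrow> c n \<le> K1 * real n powr (- (1 / 2 + \<epsilon>))"
    and c2: "\<And>n. n > 0 \<Longrightarrow> c n \<le> K2 * real n powr (- (3 / 2 + 2 * \<epsilon>))"
    and K: "K1 \<ge> 0" "K2 \<ge> 0" "R \<ge> 0" "C \<ge> 0"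
    and B: "\<And>m n. m > 0 \<Longrightarrow> n > 0 \<Longrightarrow> c m \<noteq> 0 \<Longrightarrow> c n \<noteq> 0 \<Longrightarrow> 
      b m n \<le> (if is_square (m * n) \<or> is_square (2 * m * n) then R else C * (real m * real n) powr (1 / 2 + \<epsilon>))"
  shows "(\<Sum>m<N. \<Sum>n<N. c m * c n * b m n) \<le> R * K1\<^sup>2 * (4 * 2 powr \<epsilon> * zsum (1 + 2 * \<epsilon>) ^ 3) + C * K2\<^sup>2 * (zsum (1 + \<epsilon>))\<^sup>2"
proof -
  let ?I = "{1..N}"
  let ?p = "\<lambda>m n. (real m * real n) powr (- (1 / 2 + \<epsilon>))"
  let ?sq = "\<lambda>t m n. if is_square (t * m * n) then R * K1\<^sup>2 * ?p m n else 0"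
  have sqn: "?sq t m n \<ge> 0" for t m n using K by simp
  have "(\<Sum>m<N. \<Sum>n<N. c m * c n * b m n) \<le> (\<Sum>m\<in>{..<N} - {0}. \<Sum>n\<in>{..<N} - {0}. c m * c n * b m n)"
  proof -
    have "(\<Sum>m<N. \<Sum>n<N. c m * c n * b m n) = (\<Sum>m\<in>{..<N} - {0}. \<Sum>n<N. c m * c n * b m n)"
      by (rule sum.mono_neutral_right) (auto simp: c_zero)
    also have "\<dots> = (\<Sum>m\<in>{..<N} - {0}. \<Sum>n\<in>{..<N} - {0}. c m * c n * b m n)"
      by (rule sum.cong[OF refl], rule sum.mono_neutral_right) (auto simp: c_zero)
    finally show ?thesis by simp
  qed
  also have "\<dots> \<le> (\<Sum>m\<in>{..<N} - {0}. \<Sum>n\<in>{..<N} - {0}. ?sq 1 m n + ?sq 2 m n + C * K2\<^sup>2 * (real m powr (- (1 + \<epsilon>)) * real n powr (- (1 + \<epsilon>))))"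
  proof (intro sum_mono)
    fix m n assume "m \<in> {..<N} - {0}" "n \<in> {..<N} - {0}"
    hence mn: "m > 0" "n > 0" by auto
    let ?off = "C * K2\<^sup>2 * (real m powr (- (1 + \<epsilon>)) * real n powr (- (1 + \<epsilon>)))"
    have off0: "?off \<ge> 0" using K by simp
    show "c m * c n * b m n \<le> ?sq 1 m n + ?sq 2 m n + ?off"
    proof (cases "c m = 0 \<or> c n = 0")
      case True
      thus ?thesis using off0 sqn[of 1 m n] sqn[of 2 m n] by auto
    next
      case False
      hence nz: "c m \<noteq> 0" "c n \<noteq> 0" by auto
      show ?thesis
      proof (cases "is_square (m * n) \<or> is_square (2 * m * n)")
        case True
        have "c m * c n * b m n \<le> c m * c n * R"
          using B[OF mn nz] True c0 by (intro mult_left_mono) auto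
        also have "\<dots> \<le> (K1 * real m powr (- (1 / 2 + \<epsilon>))) * (K1 * real n powr (- (1 / 2 + \<epsilon>))) * R"
          using K c0 mn by (intro mult_right_mono mult_mono c1) auto
        also have "\<dots> = R * K1\<^sup>2 * ?p m n"
          by (simp add: powr_mult power2_eq_square)
        also have "\<dots> \<le> ?sq 1 m n + ?sq 2 m n"
          using True sqn[of 1 m n] sqn[of 2 m n] by auto
        finally show ?thesis using off0 by linarith
      next
        case False
        have "c m * c n * b m n \<le> c m * c n * (C * (real m * real n) powr (1 / 2 + \<epsilon>))"
          using B[OF mn nz] False c0 by (intro mult_left_mono) auto
        also have "\<dots> \<le> (K2 * real m powr (- (3 / 2 + 2 * \<epsilon>))) * (K2 * real n powr (- (3 / 2 + 2 * \<epsilon>))) * (C * (real m * real n) powr (1 / 2 + \<epsilon>))"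
          using K c0 mn by (intro mult_right_mono mult_mono c2) auto
        \<comment> \<open>The faster decay pays for the character sum bound: 3/2 + 2 \<epsilon>
          minus 1/2 + \<epsilon> leaves 1 + \<epsilon> in each variable, which is summable.\<close>
        also have "\<dots> = C * K2\<^sup>2 * ((real m powr (- (3 / 2 + 2 * \<epsilon>)) * real m powr (1/2 + \<epsilon>)) * (real n powr (- (3 / 2 + 2 * \<epsilon>)) * real n powr (1/2 + \<epsilon>)))"
          by (simp add: powr_mult power2_eq_square)
        also have "\<dots> = ?off" using mn by (simp flip: powr_add)
        finally show ?thesis using sqn[of 1 m n] sqn[of 2 m n] by linarith
      qed
    qed
  qed
  also have "\<dots> \<le> (\<Sum>m\<in>?I. \<Sum>n\<in>?I. ?sq 1 m n + ?sq 2 m n + C * K2\<^sup>2 * (real m powr (- (1 + \<epsilon>)) * real n powr (- (1 + \<epsilon>))))"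
  proof -
    have nn: "?sq 1 m n + ?sq 2 m n + C * K2\<^sup>2 * (real m powr (- (1 + \<epsilon>)) * real n powr (- (1 + \<epsilon>))) \<ge> 0" for m n
      using sqn K by (intro add_nonneg_nonneg mult_nonneg_nonneg) auto
    show ?thesis
      by (intro order_trans[OF sum_mono[OF sum_mono2] sum_mono2] sum_nonneg nn) auto
  qed
  also have "\<dots> = (\<Sum>m\<in>?I. \<Sum>n\<in>?I. ?sq 1 m n) + (\<Sum>m\<in>?I. \<Sum>n\<in>?I. ?sq 2 m n) + C * K2\<^sup>2 * (\<Sum>m\<in>?I. \<Sum>n\<in>?I. real m powr (- (1 + \<epsilon>)) * real n powr (- (1 + \<epsilon>)))"
    by (simp only: sum.distrib sum_distrib_left)
  also have "\<dots> \<le> R * K1\<^sup>2 * (2 powr (1 / 2 + \<epsilon>) * zsum (2 * (1 / 2 + \<epsilon>)) ^ 3) + R * K1\<^sup>2 * (2 powr (1 / 2 + \<epsilon>) * zsum (2 * (1 / 2 + \<epsilon>)) ^ 3) + C * K2\<^sup>2 * (zsum (1 + \<epsilon>) * zsum (1 + \<epsilon>))"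
  proof (intro add_mono)
    have sq: "(\<Sum>m\<in>?I. \<Sum>n\<in>?I. ?sq t m n) \<le> R * K1\<^sup>2 * (2 powr (1 / 2 + \<epsilon>) * zsum (2 * (1 / 2 + \<epsilon>)) ^ 3)" if t: "t \<in> {1,2}" for t
    proof -
      have "(\<Sum>m\<in>?I. \<Sum>n\<in>?I. ?sq t m n) = R * K1\<^sup>2 * (\<Sum>m\<in>?I. \<Sum>n | n \<in> ?I \<and> is_square (t * m * n). ?p m n)"
        unfolding sum_distrib_left
        by (rule sum.cong[OF refl], rule sum.inter_filter[symmetric]) simp
      also have "\<dots> \<le> R * K1\<^sup>2 * (2 powr (1 / 2 + \<epsilon>) * zsum (2 * (1 / 2 + \<epsilon>)) ^ 3)"
        using K e t by (intro mult_left_mono sum_square_pairs_le) auto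
      finally show ?thesis .
    qed
    show "(\<Sum>m\<in>?I. \<Sum>n\<in>?I. ?sq 1 m n) \<le> R * K1\<^sup>2 * (2 powr (1 / 2 + \<epsilon>) * zsum (2 * (1 / 2 + \<epsilon>)) ^ 3)" by (rule sq) simp
    show "(\<Sum>m\<in>?I. \<Sum>n\<in>?I. ?sq 2 m n) \<le> R * K1\<^sup>2 * (2 powr (1 / 2 + \<epsilon>) * zsum (2 * (1 / 2 + \<epsilon>)) ^ 3)" by (rule sq) simp
    have "(\<Sum>m\<in>?I. \<Sum>n\<in>?I. real m powr (- (1 + \<epsilon>)) * real n powr (- (1 + \<epsilon>))) = (\<Sum>m\<in>?I. real m powr (- (1 + \<epsilon>))) * (\<Sum>n\<in>?I. real n powr (- (1 + \<epsilon>)))"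
      by (simp only: sum_product)
    also have "\<dots> \<le> zsum (1 + \<epsilon>) * zsum (1 + \<epsilon>)"
      using e by (intro mult_mono sum_powr_le_zsum zsum_nonneg sum_nonneg) auto
    finally show "C * K2\<^sup>2 * (\<Sum>m\<in>?I. \<Sum>n\<in>?I. real m powr (- (1 + \<epsilon>)) * real n powr (- (1 + \<epsilon>))) \<le> C * K2\<^sup>2 * (zsum (1 + \<epsilon>) * zsum (1 + \<epsilon>))"
      using K by (intro mult_left_mono) auto
  qed
  also have "\<dots> \<le> R * K1\<^sup>2 * (4 * 2 powr \<epsilon> * zsum (1 + 2 * \<epsilon>) ^ 3) + C * K2\<^sup>2 * (zsum (1 + \<epsilon>))\<^sup>2"
  proof -
    have "2 powr (1/2) \<le> (2::real) powr 1" by (intro powr_mono) auto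
    hence "2 powr (1/2 + \<epsilon>) \<le> 2 * 2 powr \<epsilon>" by (simp add: powr_add mult_right_mono)
    hence "2 powr (1/2 + \<epsilon>) * zsum (1 + 2 * \<epsilon>) ^ 3 \<le> 2 * 2 powr \<epsilon> * zsum (1 + 2 * \<epsilon>) ^ 3"
      using e by (intro mult_right_mono zero_le_power zsum_nonneg) auto
    hence "R * K1\<^sup>2 * (2 powr (1/2 + \<epsilon>) * zsum (1 + 2 * \<epsilon>) ^ 3) \<le> R * K1\<^sup>2 * (2 * 2 powr \<epsilon> * zsum (1 + 2 * \<epsilon>) ^ 3)"
      using K by (intro mult_left_mono) auto
    moreover have "R * K1\<^sup>2 * (4 * 2 powr \<epsilon> * zsum (1 + 2 * \<epsilon>) ^ 3) = R * K1\<^sup>2 * (2 * 2 powr \<epsilon> * zsum (1 + 2 * \<epsilon>) ^ 3) + R * K1\<^sup>2 * (2 * 2 powr \<epsilon> * zsum (1 + 2 * \<epsilon>) ^ 3)"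
      by (simp add: algebra_simps)
    moreover have e2: "2 * (1/2 + \<epsilon>) = 1 + 2 * \<epsilon>" by simp
    ultimately show ?thesis unfolding e2 power2_eq_square[of "zsum (1 + \<epsilon>)"] by linarith
  qed
  finally show ?thesis .
qed

subsection \<open>The contribution of large u\<close>

lemma set_integral_mono_nonneg_set:
  fixes h :: "real \<Rightarrow> real"
  assumes h: "set_integrable lborel B h" and A: "A \<subseteq> B" "A \<in> sets borel" and nn: "\<And>u. u \<in> B \<Longrightarrow> h u \<ge> 0"
  shows "set_integrable lborel A h" "(LBINT u:A. h u) \<le> (LBINT u:B. h u)"
proof -
  show int: "set_integrable lborel A h" using h by (rule set_integrable_subset) (use A in auto)
  show "(LBINT u:A. h u) \<le> (LBINT u:B. h u)"
    unfolding set_lebesgue_integral_def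
    using int h nn A(1) by (intro integral_mono) (auto simp: set_integrable_def indicator_def)
qed

definition sieved_jac :: "nat set \<Rightarrow> int \<Rightarrow> nat \<Rightarrow> int" where
  "sieved_jac P d n = (if n \<in> P then jac d n else 0)"

lemma bounded_coeffs_sieved_jac: "bounded_coeffs (sieved_jac P d)"
  by standard (simp add: sieved_jac_def abs_jac_le)

text \<open>Members of P are at least 2 and at least y. The first gives n - 1 >= n / 2, so that a
  factor exp(-u) can be split off each term and still leave decay in n; the second converts a little
  of that decay into the saving y^(-\<epsilon>) for the pairs with nearly square product.\<close>

lemma mean_square_large_u:
  fixes q A B r :: int
  assumes q: "q > 0" and P: "\<And>n. n \<in> P \<Longrightarrow> n \<ge> 2 \<and> odd n \<and> coprime q (int n) \<and> real n \<ge> y"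
    and y: "y \<ge> 1" and e: "\<epsilon> > 0" "\<epsilon> \<le> 1/4" and u: "u > 0"
  defines "D \<equiv> {d. d \<in> {A..<B} \<and> [d = r] (mod q)}"
  shows "(\<Sum>d\<in>D. (psi (sieved_jac P d) u)\<^sup>2) \<le> exp (-2 * u) * 
     (real (card D) * (400 * u powr (- (1/2 + 2 * \<epsilon>)) * y powr (- \<epsilon>))\<^sup>2 * (4 * 2 powr \<epsilon> * zsum (1 + 2 * \<epsilon>) ^ 3)
      + 4 * (1 + 1 / \<epsilon>) * (400 * u powr (- (3/2 + 2 * \<epsilon>)))\<^sup>2 * (zsum (1 + \<epsilon>))\<^sup>2)"
proof (rule mean_square_le)
  define c where "c n = (if n \<in> P then exp (- (real n - 1) * u) else 0)" for n
  have fin: "finite D" unfolding D_def by (rule finite_subset[of _ "{A..<B}"]) auto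
  show "finite D" by fact
  let ?a = "\<lambda>n. exp (- real (Suc n) * u)"
  show "(\<lambda>n. of_int (sieved_jac P d (Suc n)) * ?a n) sums psi (sieved_jac P d) u" if "d \<in> D" for d
    by (rule bounded_coeffs.psi_sums[OF bounded_coeffs_sieved_jac u])
  show "?a n \<ge> 0" for n by simp
  fix N
  define b where "b m n = \<bar>\<Sum>d\<in>D. real_of_int (sieved_jac P d m) * real_of_int (sieved_jac P d n)\<bar>" for m n
  have c_small: "c n \<le> 400 * (real n * u) powr (- \<theta>)" if n: "n > 0" and \<theta>: "0 \<le> \<theta>" "\<theta> \<le> 4" for n \<theta>
  proof (cases "n \<in> P")
    case True
    hence "2 \<le> n" using P by blast
    hence "real n / 2 \<le> real n - 1" by linarith
    hence "real n / 2 * u \<le> (real n - 1) * u" using u by (intro mult_right_mono) auto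
    hence "exp (- (real n - 1) * u) \<le> exp (- (real n * u) / 2)" by (simp add: algebra_simps)
    also have "\<dots> \<le> 400 * (real n * u) powr (- \<theta>)" using n u \<theta> by (intro powr_four_le_exp) auto
    finally show ?thesis using True by (simp add: c_def)
  qed (simp add: c_def)
  have "(\<Sum>m<N. \<Sum>n<N. ?a m * ?a n * b (Suc m) (Suc n)) = exp (- 2 * u) * (\<Sum>m<N. \<Sum>n<N. c (Suc m) * c (Suc n) * b (Suc m) (Suc n))"
    unfolding sum_distrib_left
  proof (intro sum.cong refl)
    fix m n
    show "?a m * ?a n * b (Suc m) (Suc n) = exp (- 2 * u) * (c (Suc m) * c (Suc n) * b (Suc m) (Suc n))"
    proof (cases "Suc m \<in> P \<and> Suc n \<in> P")
      case True
      hence "exp (- 2 * u) * (c (Suc m) * c (Suc n)) = ?a m * ?a n"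
        by (simp add: c_def algebra_simps flip: exp_add)
      thus ?thesis by (simp only: mult.assoc[symmetric])
    next
      case False
      hence "b (Suc m) (Suc n) = 0" by (auto simp: b_def sieved_jac_def)
      thus ?thesis by simp
    qed
  qed
  also have "(\<Sum>m<N. \<Sum>n<N. c (Suc m) * c (Suc n) * b (Suc m) (Suc n)) = (\<Sum>m\<in>Suc ` {..<N}. \<Sum>n\<in>Suc ` {..<N}. c m * c n * b m n)"
    by (simp add: sum.reindex)
  also have "\<dots> \<le> (\<Sum>m<Suc N. \<Sum>n<Suc N. c m * c n * b m n)"
  proof -
    have nn: "c m * c n * b m n \<ge> 0" for m n by (simp add: c_def b_def)
    show ?thesis by (intro order_trans[OF sum_mono[OF sum_mono2] sum_mono2] sum_nonneg nn) auto
  qed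
  also have "\<dots> \<le> real (card D) * (400 * u powr (- (1/2 + 2 * \<epsilon>)) * y powr (- \<epsilon>))\<^sup>2 * (4 * 2 powr \<epsilon> * zsum (1 + 2 * \<epsilon>) ^ 3)
      + 4 * (1 + 1 / \<epsilon>) * (400 * u powr (- (3/2 + 2 * \<epsilon>)))\<^sup>2 * (zsum (1 + \<epsilon>))\<^sup>2"
  proof (rule correlation_sum_le)
    show "c n \<ge> 0" for n by (simp add: c_def)
    show "c 0 = 0" using P[of 0] by (auto simp: c_def)
    show "\<epsilon> > 0" by fact
    show "c n \<le> 400 * u powr (- (1/2 + 2 * \<epsilon>)) * y powr (- \<epsilon>) * real n powr (- (1/2 + \<epsilon>))" if n: "n > 0" for n
    proof (cases "n \<in> P")
      case True
      have "c n \<le> 400 * (real n * u) powr (- (1/2 + 2 * \<epsilon>))" using e n by (intro c_small) auto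
      also have "\<dots> = 400 * u powr (- (1/2 + 2 * \<epsilon>)) * (real n powr (- \<epsilon>) * real n powr (- (1/2 + \<epsilon>)))"
      proof -
        have "- \<epsilon> + (- (1/2 + \<epsilon>)) = - (1/2 + 2 * \<epsilon>)" by simp
        hence "real n powr (- (1/2 + 2 * \<epsilon>)) = real n powr (- \<epsilon>) * real n powr (- (1/2 + \<epsilon>))"
          by (simp only: powr_add[symmetric])
        thus ?thesis using n by (simp add: powr_mult)
      qed
      also have "\<dots> \<le> 400 * u powr (- (1/2 + 2 * \<epsilon>)) * (y powr (- \<epsilon>) * real n powr (- (1/2 + \<epsilon>)))"
        using y P[OF True] e by (intro mult_left_mono mult_right_mono powr_mono2') auto
      finally show ?thesis by (simp only: mult.assoc)
    qed (simp add: c_def)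
    show "c n \<le> 400 * u powr (- (3/2 + 2 * \<epsilon>)) * real n powr (- (3/2 + 2 * \<epsilon>))" if n: "n > 0" for n
      using c_small[OF n, of "3/2 + 2 * \<epsilon>"] e by (simp add: powr_mult mult_ac)
    show "0 \<le> 400 * u powr (- (1/2 + 2 * \<epsilon>)) * y powr (- \<epsilon>)" "0 \<le> 400 * u powr (- (3/2 + 2 * \<epsilon>))" "0 \<le> real (card D)" by simp_all
    show "0 \<le> 4 * (1 + 1 / \<epsilon>)" using e by simp
    show "b m n \<le> (if is_square (m * n) \<or> is_square (2 * m * n) then real (card D) else 4 * (1 + 1 / \<epsilon>) * (real m * real n) powr (1/2 + \<epsilon>))"
      if mn: "m > 0" "n > 0" "c m \<noteq> 0" "c n \<noteq> 0" for m n
    proof -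
      have mP: "m \<in> P" "n \<in> P" using mn by (auto simp: c_def split: if_splits)
      have b: "b m n = \<bar>real_of_int (\<Sum>d\<in>D. jac d (m * n))\<bar>"
        unfolding b_def using mP mn by (simp add: sieved_jac_def jac_mult_right)
      show ?thesis
      proof (cases "is_square (m * n) \<or> is_square (2 * m * n)")
        case True
        have "\<bar>real_of_int (\<Sum>d\<in>D. jac d (m * n))\<bar> \<le> (\<Sum>d\<in>D. \<bar>real_of_int (jac d (m * n))\<bar>)"
          by (simp only: of_int_sum sum_abs)
        also have "\<dots> \<le> (\<Sum>d\<in>D. 1)"
        proof (rule sum_mono)
          fix d show "\<bar>real_of_int (jac d (m * n))\<bar> \<le> 1" using abs_jac_le[of d "m * n"] by linarith
        qed
        finally show ?thesis using True b by simp
      next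
        case False
        have "b m n \<le> 4 * (1 + 1 / \<epsilon>) * real (m * n) powr (1/2 + \<epsilon>)"
          unfolding b D_def
        proof (rule character_sum_powr)
          show "odd (m * n)" using P[OF mP(1)] P[OF mP(2)] by simp
          show "\<not> is_square (m * n)" using False by simp
          show "coprime q (int (m * n))" using P[OF mP(1)] P[OF mP(2)] by simp
        qed (use q e in auto)
        thus ?thesis using False by simp
      qed
    qed
  qed
  finally show "(\<Sum>m<N. \<Sum>n<N. ?a m * ?a n * \<bar>\<Sum>d\<in>D. real_of_int (sieved_jac P d (Suc m)) * real_of_int (sieved_jac P d (Suc n))\<bar>) \<le> exp (-2 * u) * 
     (real (card D) * (400 * u powr (- (1/2 + 2 * \<epsilon>)) * y powr (- \<epsilon>))\<^sup>2 * (4 * 2 powr \<epsilon> * zsum (1 + 2 * \<epsilon>) ^ 3)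
      + 4 * (1 + 1 / \<epsilon>) * (400 * u powr (- (3/2 + 2 * \<epsilon>)))\<^sup>2 * (zsum (1 + \<epsilon>))\<^sup>2)"
    unfolding b_def by (simp add: mult_left_mono)
qed

text \<open>With weight u^(\<rho>/2-1) exp(-u) the square pairs leave u^(\<rho>/4-1), integrable at
  0 because \<sigma> > 1/2. The other pairs leave u^(\<rho>/8-1) times u^(\<rho>/8-2); the second
  power is not integrable and is replaced by its value at the lower limit v. The value \<epsilon> =
  \<rho>/16 leaves all three exponents of u positive after adding 1 where integrability is
  needed.\<close>

lemma large_u_contribution:
  fixes \<sigma> \<rho> :: real
  assumes \<sigma>: "1/2 < \<sigma>" "\<sigma> < 1" and \<rho>: "\<rho> = 2 * \<sigma> - 1"
  obtains C where "C > 0"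
    "\<And>q A B r P y v. q > 0 \<Longrightarrow> (\<And>n. n \<in> P \<Longrightarrow> n \<ge> 2 \<and> odd n \<and> coprime q (int n) \<and> real n \<ge> y) \<Longrightarrow> y \<ge> 1 \<Longrightarrow> v > 0 \<Longrightarrow>
      (\<Sum>d | d \<in> {A..<B} \<and> [d = r] (mod q). (LBINT u:{v<..}. psi (sieved_jac P d) u * u powr (\<sigma> - 1))\<^sup>2)
       \<le> C * (real (card {d. d \<in> {A..<B} \<and> [d = r] (mod q)}) * y powr (- \<rho> / 8) + v powr (\<rho> / 8 - 2))"
proof -
  have r: "0 < \<rho>" "\<rho> < 1" using \<sigma> \<rho> by auto
  define \<epsilon> where "\<epsilon> = \<rho> / 16"
  have e: "\<epsilon> > 0" "\<epsilon> \<le> 1/4" using r by (auto simp: \<epsilon>_def)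
  define a1 where "a1 = 400\<^sup>2 * (4 * 2 powr \<epsilon> * zsum (1 + 2 * \<epsilon>) ^ 3)"
  define a2 where "a2 = 4 * (1 + 1 / \<epsilon>) * 400\<^sup>2 * (zsum (1 + \<epsilon>))\<^sup>2"
  have a: "a1 \<ge> 0" "a2 \<ge> 0" unfolding a1_def a2_def using e by (auto intro!: mult_nonneg_nonneg zsum_nonneg zero_le_power)
  have G: "Gamma (\<rho>/2) > 0" "Gamma (\<rho>/4) > 0" "Gamma (\<rho>/8) > 0" using r by (auto intro!: Gamma_real_pos)
  define C where "C = Gamma (\<rho>/2) * (a1 * Gamma (\<rho>/4) + a2 * Gamma (\<rho>/8) + 1)"
  have "C > 0" unfolding C_def using G a by (intro mult_pos_pos add_nonneg_pos) auto
  moreover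
  {
    fix q A B r :: int and P y and v :: real
    assume q: "q > 0" and P: "\<And>n. n \<in> P \<Longrightarrow> n \<ge> 2 \<and> odd n \<and> coprime q (int n) \<and> real n \<ge> y" and y: "y \<ge> 1" and v: "v > 0"
    define D where "D = {d. d \<in> {A..<B} \<and> [d = r] (mod q)}"
    have fin: "finite D" unfolding D_def by (rule finite_subset[of _ "{A..<B}"]) auto
    define w where "w u = u powr (\<rho>/2 - 1) * exp (- 1 * u)" for u :: real
    define h1 where "h1 = a1 * (real (card D) * y powr (- \<rho>/8))"
    define h2 where "h2 = a2 * v powr (\<rho>/8 - 2)"
    have h0: "h1 \<ge> 0" "h2 \<ge> 0" unfolding h1_def h2_def using a by auto
    define h where "h u = h1 * (u powr (\<rho>/4 - 1) * exp (- 1 * u)) + h2 * (u powr (\<rho>/8 - 1) * exp (- 1 * u))" for u :: real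
    have hint: "set_integrable lborel {0<..} h" unfolding h_def[abs_def] using r
      by (intro set_integral_add set_integrable_mult_right set_integrable_real_Gamma) auto
    have hval: "(LBINT u:{0<..}. h u) = h1 * Gamma (\<rho>/4) + h2 * Gamma (\<rho>/8)"
      unfolding h_def using r
      by (subst set_integral_add) (auto intro!: set_integrable_mult_right set_integrable_real_Gamma[of _ 1, simplified] simp: LBINT_real_Gamma[of _ 1, simplified])
    have wint: "set_integrable lborel {0<..} w" unfolding w_def[abs_def] using r by (intro set_integrable_real_Gamma) auto
    have wval: "(LBINT u:{0<..}. w u) = Gamma (\<rho>/2)" unfolding w_def using r LBINT_real_Gamma[of "\<rho>/2" 1] by simp
    have "(\<Sum>d\<in>D. (LBINT u:{v<..}. psi (sieved_jac P d) u * u powr (\<sigma> - 1))\<^sup>2) \<le> Gamma (\<rho>/2) * (h1 * Gamma (\<rho>/4) + h2 * Gamma (\<rho>/8))"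
    proof (rule Cauchy_Schwarz_mean_square[OF fin])
      note [measurable] = bounded_coeffs.psi_measurable[OF bounded_coeffs_sieved_jac]
      show "{v<..} \<in> sets borel" by simp
      show "(\<lambda>u. psi (sieved_jac P d) u * u powr (\<sigma> - 1)) \<in> borel_measurable borel" for d by measurable
      show "w \<in> borel_measurable borel" unfolding w_def[abs_def] by measurable
      show "set_integrable lborel {v<..} w"
        by (rule set_integral_mono_nonneg_set(1)[OF wint]) (use v in \<open>auto simp: w_def\<close>)
      show "(LBINT u:{v<..}. w u) \<le> Gamma (\<rho>/2)"
        unfolding wval[symmetric] by (rule set_integral_mono_nonneg_set(2)[OF wint]) (use v in \<open>auto simp: w_def\<close>)
      show "set_integrable lborel {v<..} h"
        by (rule set_integral_mono_nonneg_set(1)[OF hint]) (use v h0 in \<open>auto simp: h_def\<close>)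
      show "(LBINT u:{v<..}. h u) \<le> h1 * Gamma (\<rho>/4) + h2 * Gamma (\<rho>/8)"
        unfolding hval[symmetric] by (rule set_integral_mono_nonneg_set(2)[OF hint]) (use v h0 in \<open>auto simp: h_def\<close>)
      show "w u > 0" if "u \<in> {v<..}" for u using that v by (auto simp: w_def)
      show "(\<Sum>d\<in>D. (psi (sieved_jac P d) u * u powr (\<sigma> - 1))\<^sup>2) \<le> h u * w u" if u: "u \<in> {v<..}" for u
      proof -
        have u0: "u > 0" using u v by auto
        have "(\<Sum>d\<in>D. (psi (sieved_jac P d) u * u powr (\<sigma> - 1))\<^sup>2) = (u powr (\<sigma> - 1))\<^sup>2 * (\<Sum>d\<in>D. (psi (sieved_jac P d) u)\<^sup>2)"
          by (simp add: power_mult_distrib sum_distrib_left mult.commute)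
        also have "\<dots> \<le> (u powr (\<sigma> - 1))\<^sup>2 * (exp (-2 * u) * 
           (real (card D) * (400 * u powr (- (1/2 + 2 * \<epsilon>)) * y powr (- \<epsilon>))\<^sup>2 * (4 * 2 powr \<epsilon> * zsum (1 + 2 * \<epsilon>) ^ 3)
            + 4 * (1 + 1 / \<epsilon>) * (400 * u powr (- (3/2 + 2 * \<epsilon>)))\<^sup>2 * (zsum (1 + \<epsilon>))\<^sup>2))"
          unfolding D_def by (intro mult_left_mono mean_square_large_u q P y e u0) auto
        also have "\<dots> = exp (-2 * u) * (a1 * (real (card D) * (y powr (- \<epsilon>))\<^sup>2) * ((u powr (\<sigma> - 1))\<^sup>2 * (u powr (- (1/2 + 2 * \<epsilon>)))\<^sup>2)
             + a2 * ((u powr (\<sigma> - 1))\<^sup>2 * (u powr (- (3/2 + 2 * \<epsilon>)))\<^sup>2))"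
          unfolding a1_def a2_def by (simp add: power_mult_distrib algebra_simps)
        also have "(y powr (- \<epsilon>))\<^sup>2 = y powr (- \<rho>/8)"
          by (simp add: power2_eq_square \<epsilon>_def flip: powr_add)
        also have "(u powr (\<sigma> - 1))\<^sup>2 * (u powr (- (1/2 + 2 * \<epsilon>)))\<^sup>2 = u powr (\<rho>/4 - 1) * u powr (\<rho>/2 - 1)"
          by (simp only: power2_eq_square powr_add[symmetric]) (rule arg_cong[of _ _ "\<lambda>x. u powr x"], simp add: \<rho> \<epsilon>_def field_simps)
        also have "(u powr (\<sigma> - 1))\<^sup>2 * (u powr (- (3/2 + 2 * \<epsilon>)))\<^sup>2 = u powr (\<rho>/8 - 2) * (u powr (\<rho>/8 - 1) * u powr (\<rho>/2 - 1))"
          by (simp only: power2_eq_square powr_add[symmetric]) (rule arg_cong[of _ _ "\<lambda>x. u powr x"], simp add: \<rho> \<epsilon>_def field_simps)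
        also have "exp (-2 * u) * (a1 * (real (card D) * y powr (- \<rho>/8)) * (u powr (\<rho>/4 - 1) * u powr (\<rho>/2 - 1)) +
             a2 * (u powr (\<rho>/8 - 2) * (u powr (\<rho>/8 - 1) * u powr (\<rho>/2 - 1))))
          \<le> exp (-2 * u) * (a1 * (real (card D) * y powr (- \<rho>/8)) * (u powr (\<rho>/4 - 1) * u powr (\<rho>/2 - 1)) +
             a2 * (v powr (\<rho>/8 - 2) * (u powr (\<rho>/8 - 1) * u powr (\<rho>/2 - 1))))"
          using a r u v by (intro mult_left_mono add_left_mono mult_right_mono powr_mono2') auto
        also have "exp (-2 * u) = exp (-1 * u) * exp (-1 * u)" by (simp flip: exp_add)
        also have "exp (-1 * u) * exp (-1 * u) * (a1 * (real (card D) * y powr (- \<rho>/8)) * (u powr (\<rho>/4 - 1) * u powr (\<rho>/2 - 1)) +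
             a2 * (v powr (\<rho>/8 - 2) * (u powr (\<rho>/8 - 1) * u powr (\<rho>/2 - 1)))) = h u * w u"
          unfolding h_def w_def h1_def h2_def by (simp add: algebra_simps)
        finally show ?thesis .
      qed
    qed
    also have "\<dots> \<le> C * (real (card D) * y powr (- \<rho>/8) + v powr (\<rho>/8 - 2))"
    proof -
      define s t where "s = real (card D) * y powr (- \<rho>/8)" and "t = v powr (\<rho>/8 - 2)"
      have st: "s \<ge> 0" "t \<ge> 0" by (auto simp: s_def t_def)
      have "a1 * s * Gamma (\<rho>/4) + a2 * t * Gamma (\<rho>/8) \<le> (a1 * Gamma (\<rho>/4) + a2 * Gamma (\<rho>/8) + 1) * s + (a1 * Gamma (\<rho>/4) + a2 * Gamma (\<rho>/8) + 1) * t"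
      proof (intro add_mono)
        show "a1 * s * Gamma (\<rho>/4) \<le> (a1 * Gamma (\<rho>/4) + a2 * Gamma (\<rho>/8) + 1) * s"
          using st a G by (simp add: algebra_simps)
        show "a2 * t * Gamma (\<rho>/8) \<le> (a1 * Gamma (\<rho>/4) + a2 * Gamma (\<rho>/8) + 1) * t"
          using st a G by (simp add: algebra_simps)
      qed
      hence "Gamma (\<rho>/2) * (a1 * s * Gamma (\<rho>/4) + a2 * t * Gamma (\<rho>/8)) \<le> Gamma (\<rho>/2) * ((a1 * Gamma (\<rho>/4) + a2 * Gamma (\<rho>/8) + 1) * s + (a1 * Gamma (\<rho>/4) + a2 * Gamma (\<rho>/8) + 1) * t)"
        using G by (intro mult_left_mono) auto
      thus ?thesis unfolding h1_def h2_def C_def s_def[symmetric] t_def[symmetric] by (simp add: algebra_simps)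
    qed
    finally have "(\<Sum>d | d \<in> {A..<B} \<and> [d = r] (mod q). (LBINT u:{v<..}. psi (sieved_jac P d) u * u powr (\<sigma> - 1))\<^sup>2)
       \<le> C * (real (card {d. d \<in> {A..<B} \<and> [d = r] (mod q)}) * y powr (- \<rho> / 8) + v powr (\<rho> / 8 - 2))"
      unfolding D_def .
  }
  ultimately show ?thesis by (rule that)
qed

subsection \<open>The reflection formula\<close>

text \<open>Differentiating Gamma(z) Gamma(1 - z) = pi / sin(pi z) and dividing by the function
  itself gives the formula.\<close>

lemma Digamma_reflection:
  fixes z :: complex
  assumes z: "z \<notin> \<int>"
  shows "Digamma (1 - z) - Digamma z = of_real pi * cos (of_real pi * z) / sin (of_real pi * z)"
proof -
  define p :: complex where "p = of_real pi"
  have z1: "z \<notin> \<int>\<^sub>\<le>\<^sub>0" "1 - z \<notin> \<int>\<^sub>\<le>\<^sub>0"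
    using z by (auto elim!: nonpos_Ints_cases) (metis Ints_1 Ints_diff Ints_of_int diff_diff_eq2 add_diff_cancel_left')
  have s0: "sin (p * z) \<noteq> 0" using z by (auto simp: p_def sin_eq_0 field_simps)
  have pne: "p / sin (p * z) \<noteq> 0" using s0 by (simp add: p_def)
  have "((\<lambda>z. Gamma z * Gamma (1 - z)) has_field_derivative (Gamma z * Digamma z * Gamma (1 - z) - Gamma z * (Gamma (1 - z) * Digamma (1 - z)))) (at z)"
    using z1 by (auto intro!: derivative_eq_intros)
  moreover have "((\<lambda>z. p / sin (p * z)) has_field_derivative (- (p * (cos (p * z) * p)) / (sin (p * z) * sin (p * z)))) (at z)"
    using s0 by (auto intro!: derivative_eq_intros)
  moreover have "(\<lambda>z. Gamma z * Gamma (1 - z)) = (\<lambda>z. p / sin (p * z))"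
    by (rule ext) (simp add: Gamma_reflection_complex p_def)
  ultimately have "Gamma z * Digamma z * Gamma (1 - z) - Gamma z * (Gamma (1 - z) * Digamma (1 - z)) = - (p * (cos (p * z) * p)) / (sin (p * z) * sin (p * z))"
    using DERIV_unique by metis
  hence "(Gamma z * Gamma (1 - z)) * (Digamma (1 - z) - Digamma z) = (p / sin (p * z)) * (p * cos (p * z) / sin (p * z))"
    by (simp add: algebra_simps)
  moreover have "Gamma z * Gamma (1 - z) = p / sin (p * z)" by (simp add: Gamma_reflection_complex p_def)
  ultimately have "(p / sin (p * z)) * (Digamma (1 - z) - Digamma z) = (p / sin (p * z)) * (p * cos (p * z) / sin (p * z))"
    by (simp only:)
  thus ?thesis unfolding p_def[symmetric] by (rule mult_left_cancel[OF pne, THEN iffD1])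
qed

text \<open>The series of the Digamma function at 1 - z and at z are subtracted; the terms 1 / (n +
  1) cancel.\<close>

lemma cot_sums:
  fixes z :: complex
  assumes z: "z \<notin> \<int>"
  shows "(\<lambda>n. inverse (z + of_nat n) - inverse (1 - z + of_nat n)) sums (of_real pi * cos (of_real pi * z) / sin (of_real pi * z))"
proof -
  have ne: "z \<noteq> 0" "1 - z \<noteq> 0" using z by auto
  have "(\<lambda>n. (inverse (of_nat (Suc n)) - inverse (1 - z + of_nat n)) - (inverse (of_nat (Suc n)) - inverse (z + of_nat n))) sums
     ((Digamma (1 - z) + euler_mascheroni) - (Digamma z + euler_mascheroni))"
    unfolding Digamma_def using summable_Digamma[OF ne(1)] summable_Digamma[OF ne(2)]
    by (intro sums_diff) (simp_all add: summable_sums del: of_nat_Suc)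
  thus ?thesis using Digamma_reflection[OF z] by simp
qed

text \<open>Half of the Fourier transform of exp(-u |x|) at t.\<close>

definition pker :: "real \<Rightarrow> real \<Rightarrow> real" where
  "pker u t = u / (u\<^sup>2 + 4 * pi\<^sup>2 * t\<^sup>2)"

lemma pker_eq_Re: assumes u: "u > 0" shows "pker u t = Re (\<i> / (2 * pi) * inverse (Complex t (u / (2 * pi))))"
proof -
  have "inverse (Complex t (u / (2 * pi))) = Complex (t / (t\<^sup>2 + (u / (2*pi))\<^sup>2)) (- (u / (2*pi)) / (t\<^sup>2 + (u / (2*pi))\<^sup>2))"
    by (simp add: complex_eq_iff)
  hence "Re (\<i> / (2 * pi) * inverse (Complex t (u / (2 * pi)))) = (u / (2 * pi)) / (t\<^sup>2 + (u / (2*pi))\<^sup>2) / (2 * pi)"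
    by (simp add: Re_divide Im_divide power2_eq_square)
  also have "\<dots> = pker u t"
  proof -
    have "t\<^sup>2 + (u / (2*pi))\<^sup>2 = (u\<^sup>2 + 4 * pi\<^sup>2 * t\<^sup>2) / (4 * pi\<^sup>2)"
      by (simp add: field_simps power2_eq_square)
    moreover have "(u / (2 * pi)) / (K / (4 * pi\<^sup>2)) / (2 * pi) = u / K" for K
      by (simp add: divide_simps power2_eq_square)
    ultimately show ?thesis by (simp only: pker_def)
  qed
  finally show ?thesis by simp
qed

text \<open>Poisson summation for exp(-u |x|), obtained from the cotangent: with z = \<theta> + i u
  / (2 pi) the cosine series is the real part of a geometric series in exp(2 pi i z), which is a
  cotangent, and its partial fractions give the kernels. The two kernels for each n belong to the
  integers n and -(n + 1).\<close>

lemma cos_series_eq_pker: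
  fixes u \<theta> :: real
  assumes u: "u > 0"
  shows "(\<lambda>n. pker u (real n + \<theta>) + pker u (real n + 1 - \<theta>)) sums (1/2 + (\<Sum>n. exp (- real (Suc n) * u) * cos (2 * pi * \<theta> * real (Suc n))))"
proof -
  define z where "z = Complex \<theta> (u / (2 * pi))"
  have zn: "z \<notin> \<int>" using u by (auto simp: z_def elim!: Ints_cases simp: complex_eq_iff)
  define E where "E = exp (2 * of_real pi * \<i> * z)"
  have Eexp: "E = exp (- of_real u) * cis (2 * pi * \<theta>)"
  proof -
    have "2 * of_real pi * \<i> * z = - of_real u + \<i> * of_real (2 * pi * \<theta>)"
      by (simp add: z_def complex_eq_iff)
    thus ?thesis unfolding E_def by (simp only: exp_add cis_conv_exp)
  qed
  have nE: "norm E < 1" using u by (simp add: Eexp norm_mult)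
  hence E1: "1 - E \<noteq> 0" by auto
  have "(\<lambda>n. E ^ n) sums (1 / (1 - E))" by (rule geometric_sums[OF nE])
  hence "(\<lambda>n. E * E ^ n) sums (E * (1 / (1 - E)))" by (rule sums_mult)
  hence S: "(\<lambda>n. E ^ Suc n) sums (E / (1 - E))" by simp
  have "Re (E ^ Suc n) = exp (- real (Suc n) * u) * cos (2 * pi * \<theta> * real (Suc n))" for n
  proof -
    have "E ^ Suc n = exp (- of_real u) ^ Suc n * cis (real (Suc n) * (2 * pi * \<theta>))"
      unfolding Eexp power_mult_distrib by (subst Complex.DeMoivre) (rule refl)
    also have "exp (- complex_of_real u) ^ Suc n = of_real (exp (- real (Suc n) * u))"
      by (simp only: exp_of_nat_mult[symmetric] exp_of_real[symmetric]) (simp add: algebra_simps)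
    finally show ?thesis by (simp add: mult_ac del: of_nat_Suc)
  qed
  hence R: "(\<lambda>n. exp (- real (Suc n) * u) * cos (2 * pi * \<theta> * real (Suc n))) sums Re (E / (1 - E))"
    using sums_Re[OF S] by simp
  have cotE: "\<i> / (2 * pi) * (of_real pi * cos (of_real pi * z) / sin (of_real pi * z)) = 1/2 + E / (1 - E)"
  proof -
    define e where "e = exp (\<i> * (of_real pi * z))"
    have e0: "e \<noteq> 0" by (simp add: e_def)
    have Ee: "E = e * e" by (simp add: E_def e_def mult_ac flip: exp_add)
    have cs: "cos (of_real pi * z) = (e + inverse e) / 2" "sin (of_real pi * z) = (e - inverse e) / (2 * \<i>)"
      unfolding cos_exp_eq sin_exp_eq e_def by (simp_all add: exp_minus)
    have ne: "e - inverse e \<noteq> 0" using E1 e0 by (auto simp: Ee field_simps)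
    have H: "\<i> / (2 * pi) * (of_real pi * (a / 2) / (b / (2 * \<i>))) = - (a / b) / 2" if "b \<noteq> 0" for a b :: complex
    proof -
      have "of_real pi * (a / 2) / (b / (2 * \<i>)) = of_real pi * (\<i> * (a / b))" using that by (simp add: field_simps)
      hence "\<i> / (2 * pi) * (of_real pi * (a / 2) / (b / (2 * \<i>))) = \<i> / (2 * pi) * (of_real pi * (\<i> * (a / b)))" by (simp only:)
      also have "\<dots> = (\<i> * \<i>) * (a / b) / 2" by (simp add: field_simps)
      finally show ?thesis by simp
    qed
    have R: "(e + inverse e) / (e - inverse e) = (e * e + 1) / (e * e - 1)"
    proof -
      have "(e + inverse e) / (e - inverse e) = (e * (e + inverse e)) / (e * (e - inverse e))" using e0 by simp
      also have "e * (e + inverse e) = e * e + 1" using e0 by (simp add: algebra_simps)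
      also have "e * (e - inverse e) = e * e - 1" using e0 by (simp add: algebra_simps)
      finally show ?thesis .
    qed
    have "\<i> / (2 * pi) * (of_real pi * cos (of_real pi * z) / sin (of_real pi * z)) = - ((e * e + 1) / (e * e - 1)) / 2"
      by (simp only: cs H[OF ne] R)
    also have "\<dots> = 1/2 + E / (1 - E)"
    proof -
      define D where "D = 1 - E"
      have E: "E = 1 - D" by (simp add: D_def)
      have "D \<noteq> 0" using E1 by (simp add: D_def)
      thus ?thesis unfolding Ee[symmetric] unfolding E by (simp add: field_simps)
    qed
    finally show ?thesis .
  qed
  have "(\<lambda>n. \<i> / (2 * pi) * (inverse (z + of_nat n) - inverse (1 - z + of_nat n))) sums (\<i> / (2 * pi) * (of_real pi * cos (of_real pi * z) / sin (of_real pi * z)))"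
    by (intro sums_mult cot_sums zn)
  hence "(\<lambda>n. Re (\<i> / (2 * pi) * (inverse (z + of_nat n) - inverse (1 - z + of_nat n)))) sums Re (1/2 + E / (1 - E))"
    unfolding cotE by (rule sums_Re)
  moreover have "Re (\<i> / (2 * pi) * (inverse (z + of_nat n) - inverse (1 - z + of_nat n))) = pker u (real n + \<theta>) + pker u (real n + 1 - \<theta>)" for n
  proof -
    have 1: "z + of_nat n = Complex (real n + \<theta>) (u / (2 * pi))" by (simp add: z_def complex_eq_iff)
    have 2: "1 - z + of_nat n = cnj (Complex (real n + 1 - \<theta>) (u / (2 * pi)))" by (simp add: z_def complex_eq_iff)
    have "Re (\<i> / (2 * pi) * inverse (cnj w)) = - Re (\<i> / (2 * pi) * inverse w)" for w
      by (simp add: Re_divide Im_divide complex_eq_iff)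
    thus ?thesis unfolding 1 2 pker_eq_Re[OF u] by (simp only: right_diff_distrib minus_complex.simps)
  qed
  moreover have "Re (1/2 + E / (1 - E)) = 1/2 + (\<Sum>n. exp (- real (Suc n) * u) * cos (2 * pi * \<theta> * real (Suc n)))"
    using sums_unique[OF R] by simp
  ultimately show ?thesis by simp
qed

lemma pker_nonneg: "u > 0 \<Longrightarrow> pker u t \<ge> 0" by (simp add: pker_def)

lemma pker_le: assumes "u > 0" "t \<noteq> 0" shows "pker u t \<le> u / t\<^sup>2"
proof -
  have "t\<^sup>2 \<le> 4 * pi\<^sup>2 * t\<^sup>2"
  proof -
    have "1 * t\<^sup>2 \<le> (4 * pi\<^sup>2) * t\<^sup>2"
      using pi_ge_two power_mono[of 2 pi 2] by (intro mult_right_mono) auto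
    thus ?thesis by simp
  qed
  thus ?thesis unfolding pker_def using assms by (intro divide_left_mono) (auto intro!: mult_pos_pos add_pos_nonneg add_increasing)
qed

text \<open>The series dual to \<open>psi\<close>. The factor 2 collects the two kernels of
  \<open>cos_series_eq_pker\<close>, which contribute equally because \<chi>_d is even for d = 1 mod
  4.\<close>

definition Phi :: "nat \<Rightarrow> real \<Rightarrow> real" where
  "Phi d w = (\<Sum>n. of_int (kronecker (int d) n) * (2 * pker w (real n)))"

lemma kronecker_le: "\<bar>real_of_int (kronecker d n)\<bar> \<le> 1"
  using kronecker_values[of d n] by auto

lemma pker_summable:
  assumes w: "w > 0" "c > 0"
  shows "summable (\<lambda>n. pker w (c * real n))"
proof (rule summable_comparison_test_ev)
  show "summable (\<lambda>n. w / c\<^sup>2 * inverse (real n ^ 2))"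
    by (intro summable_mult inverse_power_summable) auto
  show "eventually (\<lambda>n. norm (pker w (c * real n)) \<le> w / c\<^sup>2 * inverse (real n ^ 2)) sequentially"
    using eventually_gt_at_top[of 0]
  proof eventually_elim
    case (elim n)
    thus ?case using pker_le[OF w(1), of "c * real n"] pker_nonneg[OF w(1)] w by (simp add: power_mult_distrib field_simps)
  qed
qed

lemma Phi_sums: assumes w: "w > 0" shows "(\<lambda>n. of_int (kronecker (int d) n) * (2 * pker w (real n))) sums Phi d w"
  unfolding Phi_def
proof (rule summable_sums, rule summable_comparison_test)
  show "summable (\<lambda>n. 2 * pker w (1 * real n))" by (intro summable_mult pker_summable w) auto
  show "\<exists>N. \<forall>n\<ge>N. norm (of_int (kronecker (int d) n) * (2 * pker w (real n))) \<le> 2 * pker w (1 * real n)"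
    using mult_right_mono[OF kronecker_le[of "int d"]] pker_nonneg[OF w] by (auto simp: abs_mult)
qed

lemma kronecker_periodic:
  assumes d: "d mod 4 = 1" "d > 1"
  shows "kronecker (int d) n = jac (int n) d"
proof (cases "n = 0")
  case True
  have "jac 0 d = 0" using jac_eq_0_iff[of d 0] d by simp
  thus ?thesis using True d by (simp add: kronecker_def)
qed (use kronecker_eq_jac d in auto)

lemma periodic_coeffs_kronecker:
  assumes d: "d mod 4 = 1" "d > 1"
  shows "periodic_coeffs (kronecker (int d)) d"
proof
  show "\<bar>kronecker (int d) n\<bar> \<le> 1" for n using kronecker_values[of "int d" n] by auto
  show "0 < d" using d by simp
  show "kronecker (int d) (n + d) = kronecker (int d) n" for n
    unfolding kronecker_periodic[OF d] by (rule jac_cong) (simp add: cong_def)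
qed

text \<open>Only \<tau>^2 = d is known about the Gauss sum \<tau>, not its sign, and squares make
  this sufficient. Since \<tau> \<chi>_d(n) is a cosine sum over residues a, \<tau> times
  \<open>psi\<close> combines the series of \<open>cos_series_eq_pker\<close> at \<theta> = a / d,
  and n + a / d = b / d with b = n d + a regroups the kernels into the dual series.\<close>

theorem reflection_formula:
  assumes d: "d mod 4 = 1" "d > 1" "squarefree d" and u: "u > 0"
  shows "(psi (kronecker (int d)) u)\<^sup>2 = real d * (Phi d (real d * u))\<^sup>2"
proof -
  have od: "odd d" using d(1) by presburger
  interpret periodic_coeffs "kronecker (int d)" d by (rule periodic_coeffs_kronecker[OF d(1,2)])
  define \<tau> where "\<tau> = Re (gauss_sum d 1)"
  have real: "gauss_sum d 1 = of_real \<tau>"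
  proof -
    have "cnj (gauss_sum d 1) = gauss_sum d (-1)" unfolding gauss_sum_def cnj_sum by (simp add: cnj_ek)
    also have "\<dots> = gauss_sum d 1" using gauss_sum_eq[OF od d(3), of "-1"] jac_minus_one[OF od] d(1) by simp
    finally show ?thesis unfolding \<tau>_def by (metis Reals_cnj_iff of_real_Re)
  qed
  have tau: "\<tau>\<^sup>2 = real d"
  proof -
    have "\<bar>\<tau>\<bar> = sqrt (real d)" using norm_gauss_sum[OF od d(3)] unfolding real by simp
    hence "\<bar>\<tau>\<bar>\<^sup>2 = real d" by simp
    thus ?thesis by simp
  qed
  let ?I = "{0..<int d}"
  let ?c = "\<lambda>n. \<Sum>a\<in>?I. of_int (jac a d) * cos (2 * pi * (of_int a / real d) * real n)"
  have cosum: "?c n = \<tau> * of_int (kronecker (int d) n)" for n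
  proof -
    have "?c n = Re (gauss_sum d (int n))"
      unfolding gauss_sum_def ek_def by (simp add: mult_ac)
    also have "\<dots> = \<tau> * of_int (kronecker (int d) n)"
      unfolding gauss_sum_eq[OF od d(3), of "int n"] real kronecker_periodic[OF d(1,2)] by simp
    finally show ?thesis .
  qed
  \<comment> \<open>Because the symbol has mean zero, the constants 1/2 in the cosine series
    cancel.\<close>
  have zero: "(\<Sum>a\<in>?I. of_int (jac a d)) = (0::real)"
    using cosum[of 0] kronecker_periodic[OF d(1,2), of 0] jac_eq_0_iff[of d 0] d by simp
  let ?g = "\<lambda>n b. exp (- real (Suc n) * u) * cos (2 * pi * b * real (Suc n))"
  have gsum: "summable (\<lambda>n. ?g n b)" for b
  proof (rule summable_comparison_test[OF _ sums_summable[OF exp_geometric[OF u]]], intro exI allI impI)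
    fix n
    show "norm (?g n b) \<le> exp (- real (Suc n) * u)" by (simp add: abs_mult mult_left_le)
  qed
  have A: "(\<Sum>a\<in>?I. of_int (jac a d) * (\<Sum>n. ?g n (of_int a / real d))) = \<tau> * psi (kronecker (int d)) u"
  proof -
    have "(\<Sum>a\<in>?I. of_int (jac a d) * (\<Sum>n. ?g n (of_int a / real d))) = (\<Sum>a\<in>?I. \<Sum>n. of_int (jac a d) * ?g n (of_int a / real d))"
      by (intro sum.cong refl suminf_mult[symmetric] gsum)
    also have "\<dots> = (\<Sum>n. \<Sum>a\<in>?I. of_int (jac a d) * ?g n (of_int a / real d))"
      by (intro suminf_sum[symmetric] summable_mult gsum)
    also have "\<dots> = (\<Sum>n. \<tau> * (of_int (kronecker (int d) (Suc n)) * exp (- real (Suc n) * u)))"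
    proof (rule suminf_cong)
      fix n
      have "(\<Sum>a\<in>?I. of_int (jac a d) * ?g n (of_int a / real d)) = exp (- real (Suc n) * u) * ?c (Suc n)"
        by (simp only: sum_distrib_left mult.left_commute)
      thus "(\<Sum>a\<in>?I. of_int (jac a d) * ?g n (of_int a / real d)) = \<tau> * (of_int (kronecker (int d) (Suc n)) * exp (- real (Suc n) * u))"
        unfolding cosum by (simp only: mult_ac)
    qed
    also have "\<dots> = \<tau> * psi (kronecker (int d)) u"
      unfolding psi_def by (rule suminf_mult[OF sums_summable[OF psi_sums[OF u]]])
    finally show ?thesis .
  qed
  let ?k = "\<lambda>n a. pker u (real n + of_int a / real d)" and ?k' = "\<lambda>n a. pker u (real n + 1 - of_int a / real d)"
  have "(\<lambda>n. \<Sum>a\<in>?I. of_int (jac a d) * (?k n a + ?k' n a)) sums (\<Sum>a\<in>?I. of_int (jac a d) * (1/2 + (\<Sum>n. ?g n (of_int a / real d))))"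
    by (intro sums_sum sums_mult cos_series_eq_pker u)
  also have "(\<Sum>a\<in>?I. of_int (jac a d) * (1/2 + (\<Sum>n. ?g n (of_int a / real d)))) = \<tau> * psi (kronecker (int d)) u"
  proof -
    have H: "(\<Sum>a\<in>?I. of_int (jac a d) * (1/2 + h a)) = (\<Sum>a\<in>?I. of_int (jac a d)) * (1/2) + (\<Sum>a\<in>?I. of_int (jac a d) * h a)" for h :: "int \<Rightarrow> real"
      by (simp only: distrib_left sum.distrib sum_distrib_right)
    show ?thesis
      using H[of "\<lambda>a. \<Sum>n. ?g n (of_int a / real d)"] A zero by simp
  qed
  also have "(\<lambda>n. \<Sum>a\<in>?I. of_int (jac a d) * (?k n a + ?k' n a)) = (\<lambda>n. \<Sum>b\<in>{n * d..<n * d + d}. of_int (kronecker (int d) b) * (2 * pker u (real b / real d)))"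
  proof
    fix n
    have j0: "jac 0 d = 0" using jac_eq_0_iff[of d 0] d by simp
    \<comment> \<open>For d = 1 mod 4 the symbol takes the same value at a and d - a, and this
      substitution exchanges the two kernels.\<close>
    have refl: "(\<Sum>a\<in>?I. of_int (jac a d) * ?k' n a) = (\<Sum>a\<in>?I. of_int (jac a d) * ?k n a)"
    proof -
      have I: "?I = insert 0 {1..<int d}" using d by auto
      have "(\<Sum>a\<in>{1..<int d}. of_int (jac a d) * ?k' n a) = (\<Sum>a\<in>{1..<int d}. of_int (jac a d) * ?k n a)"
      proof (rule sum.reindex_bij_witness[of _ "\<lambda>a. int d - a" "\<lambda>a. int d - a"])
        fix a assume a: "a \<in> {1..<int d}"
        have "jac (int d - a) d = jac (-1 * a) d" by (rule jac_cong) (simp add: cong_def)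
        also have "\<dots> = jac a d" using od d(1) by (subst jac_mult_left) (auto simp: jac_minus_one)
        finally have "jac (int d - a) d = jac a d" .
        moreover have "real n + of_int (int d - a) / real d = real n + 1 - of_int a / real d"
          using d by (simp add: diff_divide_distrib)
        ultimately show "of_int (jac (int d - a) d) * ?k n (int d - a) = of_int (jac a d) * ?k' n a" by (simp only:)
      qed auto
      thus ?thesis unfolding I by (simp add: j0)
    qed
    have "(\<Sum>a\<in>?I. of_int (jac a d) * (?k n a + ?k' n a)) = (\<Sum>a\<in>?I. of_int (jac a d) * (2 * ?k n a))"
      using refl by (simp add: ring_distribs sum.distrib sum_distrib_left[symmetric] mult.left_commute[of _ 2])
    also have "\<dots> = (\<Sum>b\<in>{n * d..<n * d + d}. of_int (kronecker (int d) b) * (2 * pker u (real b / real d)))"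
    proof (rule sum.reindex_bij_witness[of _ "\<lambda>b. int b - int (n * d)" "\<lambda>a. nat a + n * d"])
      fix a assume a: "a \<in> ?I"
      hence eq: "int (nat a + n * d) = a + int (n * d)" by simp
      have "kronecker (int d) (nat a + n * d) = jac a d"
        unfolding kronecker_periodic[OF d(1,2)] eq by (rule jac_cong) (simp add: cong_def)
      moreover have "real (nat a + n * d) / real d = real n + of_int a / real d"
        using a d by (simp add: add_divide_distrib)
      ultimately show "of_int (kronecker (int d) (nat a + n * d)) * (2 * pker u (real (nat a + n * d) / real d)) = of_int (jac a d) * (2 * ?k n a)"
        by simp
    qed (auto simp del: of_nat_mult)
    finally show "(\<Sum>a\<in>?I. of_int (jac a d) * (?k n a + ?k' n a)) = \<dots>" .
  qed
  finally have grp: "(\<lambda>n. \<Sum>b\<in>{n * d..<n * d + d}. of_int (kronecker (int d) b) * (2 * pker u (real b / real d))) sums (\<tau> * psi (kronecker (int d)) u)" .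
  have "(\<lambda>b. of_int (kronecker (int d) b) * (2 * pker u (real b / real d))) sums (real d * Phi d (real d * u))"
  proof -
    have "pker u (real b / real d) = real d * pker (real d * u) (real b)" for b
    proof -
      have "u\<^sup>2 + 4 * pi\<^sup>2 * (real b / real d)\<^sup>2 = ((real d * u)\<^sup>2 + 4 * pi\<^sup>2 * (real b)\<^sup>2) / (real d)\<^sup>2"
        using d by (simp add: power_divide power_mult_distrib add_divide_distrib)
      thus ?thesis using d by (simp add: pker_def power2_eq_square)
    qed
    moreover have "(\<lambda>b. real d * (of_int (kronecker (int d) b) * (2 * pker (real d * u) (real b)))) sums (real d * Phi d (real d * u))"
      using d u by (intro sums_mult Phi_sums) auto
    ultimately show ?thesis by (simp add: mult_ac)
  qed
  hence "(\<lambda>n. \<Sum>b\<in>{n * d..<n * d + d}. of_int (kronecker (int d) b) * (2 * pker u (real b / real d))) sums (real d * Phi d (real d * u))"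
    using d by (intro sums_group) auto
  hence "\<tau> * psi (kronecker (int d)) u = real d * Phi d (real d * u)" using grp sums_unique2 by blast
  hence "(\<tau> * psi (kronecker (int d)) u)\<^sup>2 = (real d * Phi d (real d * u))\<^sup>2" by simp
  hence "real d * (psi (kronecker (int d)) u)\<^sup>2 = real d * (real d * (Phi d (real d * u))\<^sup>2)"
    by (simp add: power_mult_distrib tau power2_eq_square[of "real d"])
  thus ?thesis using d by simp
qed

subsection \<open>The contribution of small u\<close>

text \<open>Transfers squareness from the odd parts of m and n to m n or 2 m n, according to the
  parity of i + j.\<close>

lemma is_square_mult_power_two: "is_square (a * b) \<Longrightarrow> is_square ((2 ^ i * a) * (2 ^ j * b)) \<or> is_square (2 * (2 ^ i * a) * (2 ^ j * (b::nat)))"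
proof -
  assume "is_square (a * b)"
  then obtain c where c: "a * b = c\<^sup>2" by (auto simp: is_nth_power_def)
  show ?thesis
  proof (cases "even (i + j)")
    case True
    then obtain e where e: "i + j = 2 * e" by (elim evenE)
    have "(2 ^ i * a) * (2 ^ j * b) = 2 ^ (i + j) * (a * b)" by (simp add: power_add mult_ac)
    also have "\<dots> = (2 ^ e * c)\<^sup>2" by (simp only: e c power_mult_distrib power_mult[symmetric] mult.commute)
    finally show ?thesis by (auto simp: is_nth_power_def)
  next
    case False
    then obtain e where e: "i + j = 2 * e + 1" by (elim oddE)
    have "2 * (2 ^ i * a) * (2 ^ j * b) = 2 * 2 ^ (i + j) * (a * b)" by (simp add: power_add mult_ac)
    also have "2 * 2 ^ (i + j) = ((2::nat) ^ (e + 1))\<^sup>2"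
    proof -
      have "2 * 2 ^ (i + j) = (2::nat) ^ Suc (i + j)" by (rule power_Suc[symmetric])
      also have "Suc (i + j) = (e + 1) * 2" using e by simp
      finally show ?thesis by (simp only: power_mult)
    qed
    also have "((2::nat) ^ (e + 1))\<^sup>2 * (a * b) = (2 ^ (e + 1) * c)\<^sup>2" by (simp only: c power_mult_distrib)
    finally show ?thesis by (auto simp: is_nth_power_def)
  qed
qed

text \<open>The product w^(2-\<theta>) n^\<theta> is at most the larger of w^2 and n^2, hence at
  most the denominator of the kernel. The free exponent \<theta> later trades decay in n against
  growth in w.\<close>

lemma pker_le_powr:
  assumes w: "w > 0" and n: "n > 0" and \<theta>: "0 \<le> \<theta>" "\<theta> \<le> 2"
  shows "2 * pker w (real n) \<le> 2 * w powr (\<theta> - 1) * real n powr (- \<theta>)"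
proof -
  have "w powr (2 - \<theta>) * real n powr \<theta> \<le> w\<^sup>2 + 4 * pi\<^sup>2 * (real n)\<^sup>2"
  proof (cases "w \<le> real n")
    case True
    have "w powr (2 - \<theta>) * real n powr \<theta> \<le> real n powr (2 - \<theta>) * real n powr \<theta>"
      using w True \<theta> by (intro mult_right_mono powr_mono2) auto
    also have "\<dots> = (real n)\<^sup>2" using n by (simp flip: powr_add add: powr_numeral)
    also have "\<dots> \<le> 4 * pi\<^sup>2 * (real n)\<^sup>2"
    proof -
      have "1 * (real n)\<^sup>2 \<le> (4 * pi\<^sup>2) * (real n)\<^sup>2"
        using pi_ge_two power_mono[of 2 pi 2] by (intro mult_right_mono) auto
      thus ?thesis by simp
    qed
    finally show ?thesis by (simp add: add_increasing)
  next
    case False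
    have "w powr (2 - \<theta>) * real n powr \<theta> \<le> w powr (2 - \<theta>) * w powr \<theta>"
      using w False \<theta> by (intro mult_left_mono powr_mono2) auto
    also have "\<dots> = w\<^sup>2" using w by (simp flip: powr_add add: powr_numeral)
    finally show ?thesis by (simp add: add_increasing2)
  qed
  hence "pker w (real n) \<le> w / (w powr (2 - \<theta>) * real n powr \<theta>)"
    unfolding pker_def using w n by (intro divide_left_mono) (auto intro!: mult_pos_pos add_pos_nonneg)
  also have "\<dots> = w powr (\<theta> - 1) * real n powr (- \<theta>)"
  proof -
    have "w powr (\<theta> - 1) * w powr (2 - \<theta>) = w" using w by (simp flip: powr_add)
    thus ?thesis using w n by (simp add: powr_minus field_simps)
  qed
  finally show ?thesis by simp
qed

text \<open>Even n occur here. For d = 5 mod 8 the value \<chi>_d(2) is -1 whatever d is, so the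
  powers of 2 in m and n give a sign common to all d, and the character sum is governed by the odd
  parts.\<close>

lemma mean_square_Phi:
  fixes A B :: int
  assumes A: "A \<ge> 0" and e: "\<epsilon> > 0" "\<epsilon> \<le> 1/4" and w: "w > 0"
  defines "D \<equiv> {d. d \<in> {A..<B} \<and> [d = 5] (mod 8)}"
  shows "(\<Sum>d\<in>D. (Phi (nat d) w)\<^sup>2) \<le> real (card D) * (2 * w powr (\<epsilon> - 1/2))\<^sup>2 * (4 * 2 powr \<epsilon> * zsum (1 + 2 * \<epsilon>) ^ 3)
      + 4 * (1 + 1 / \<epsilon>) * (2 * w powr (1/2 + 2 * \<epsilon>))\<^sup>2 * (zsum (1 + \<epsilon>))\<^sup>2"
proof (rule mean_square_le)
  have fin: "finite D" unfolding D_def by (rule finite_subset[of _ "{A..<B}"]) auto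
  show "finite D" by fact
  have dnat: "int (nat d) = d" "d mod 8 = 5" if "d \<in> D" for d
    using that A unfolding D_def by (auto simp: cong_def)
  show "(\<lambda>n. real_of_int (kronecker d n) * (2 * pker w (real n))) sums Phi (nat d) w" if "d \<in> D" for d
    using Phi_sums[OF w, of "nat d"] dnat[OF that] by simp
  show "2 * pker w (real n) \<ge> 0" for n using pker_nonneg[OF w] by simp
  fix N
  define c where "c n = (if n = 0 then 0 else 2 * pker w (real n))" for n :: nat
  define b where "b m n = \<bar>\<Sum>d\<in>D. real_of_int (kronecker d m) * real_of_int (kronecker d n)\<bar>" for m n
  have k0: "kronecker d 0 = 0" if "d \<in> D" for d
  proof -
    have "\<bar>d\<bar> \<noteq> 1" using dnat(2)[OF that] by (auto simp: abs_if split: if_splits)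
    thus ?thesis by (simp add: kronecker_def)
  qed
  have "(\<Sum>m<N. \<Sum>n<N. 2 * pker w (real m) * (2 * pker w (real n)) * b m n) = (\<Sum>m<N. \<Sum>n<N. c m * c n * b m n)"
  proof (intro sum.cong refl)
    fix m n
    show "2 * pker w (real m) * (2 * pker w (real n)) * b m n = c m * c n * b m n"
    proof (cases "m = 0 \<or> n = 0")
      case True
      hence "b m n = 0" using k0 by (auto simp: b_def)
      thus ?thesis by simp
    qed (auto simp: c_def)
  qed
  also have "\<dots> \<le> real (card D) * (2 * w powr (\<epsilon> - 1/2))\<^sup>2 * (4 * 2 powr \<epsilon> * zsum (1 + 2 * \<epsilon>) ^ 3)
      + 4 * (1 + 1 / \<epsilon>) * (2 * w powr (1/2 + 2 * \<epsilon>))\<^sup>2 * (zsum (1 + \<epsilon>))\<^sup>2"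
  proof (rule correlation_sum_le)
    show "c n \<ge> 0" for n using pker_nonneg[OF w] by (simp add: c_def)
    show "c 0 = 0" by (simp add: c_def)
    show "\<epsilon> > 0" by fact
    show "c n \<le> 2 * w powr (\<epsilon> - 1/2) * real n powr (- (1/2 + \<epsilon>))" if "n > 0" for n
      using pker_le_powr[OF w that, of "1/2 + \<epsilon>"] e that by (simp add: c_def)
    show "c n \<le> 2 * w powr (1/2 + 2 * \<epsilon>) * real n powr (- (3/2 + 2 * \<epsilon>))" if "n > 0" for n
      using pker_le_powr[OF w that, of "3/2 + 2 * \<epsilon>"] e that by (simp add: c_def)
    show "0 \<le> 2 * w powr (\<epsilon> - 1/2)" "0 \<le> 2 * w powr (1/2 + 2 * \<epsilon>)" "0 \<le> real (card D)" by simp_all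
    show "0 \<le> 4 * (1 + 1 / \<epsilon>)" using e by simp
    show "b m n \<le> (if is_square (m * n) \<or> is_square (2 * m * n) then real (card D) else 4 * (1 + 1 / \<epsilon>) * (real m * real n) powr (1/2 + \<epsilon>))"
      if mn: "m > 0" "n > 0" for m n
    proof (cases "is_square (m * n) \<or> is_square (2 * m * n)")
      case True
      have "b m n \<le> (\<Sum>d\<in>D. \<bar>real_of_int (kronecker d m) * real_of_int (kronecker d n)\<bar>)"
        unfolding b_def by (rule sum_abs)
      also have "\<dots> \<le> (\<Sum>d\<in>D. 1)"
        using kronecker_le by (intro sum_mono) (auto simp: abs_mult intro!: mult_le_one)
      finally show ?thesis using True by simp
    next
      case False
      define i j where "i = multiplicity 2 m" and "j = multiplicity 2 n"
      obtain m' where m': "m = 2 ^ i * m'" "\<not> 2 dvd m'" using multiplicity_decompose'[of m 2] mn unfolding i_def by auto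
      obtain n' where n': "n = 2 ^ j * n'" "\<not> 2 dvd n'" using multiplicity_decompose'[of n 2] mn unfolding j_def by auto
      have pos: "m' > 0" "n' > 0" using m' n' mn by (auto intro!: Nat.gr0I)
      have kr: "kronecker d (2 ^ i * l) = (-1) ^ i * jac d l" if "d \<in> D" "odd l" for d i l
      proof -
        have od: "odd d" using dnat(2)[OF that(1)] by presburger
        have 2: "kronecker d 2 = -1" using dnat(2)[OF that(1)] od by (simp add: kronecker_prime_eq kronecker_prime_def)
        have "kronecker d (2 ^ i) = (-1) ^ i"
        proof (induction i)
          case (Suc k) thus ?case by (simp add: kronecker_mult 2)
        qed simp
        thus ?thesis using that by (simp add: kronecker_mult kronecker_odd odd_pos)
      qed
      have "b m n = \<bar>\<Sum>d\<in>D. (-1) ^ (i + j) * real_of_int (jac d (m' * n'))\<bar>"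
        unfolding b_def
        by (intro arg_cong[of _ _ abs] sum.cong refl) (use m' n' pos in \<open>simp add: kr jac_mult_right power_add\<close>)
      also have "\<dots> = \<bar>real_of_int (\<Sum>d\<in>D. jac d (m' * n'))\<bar>"
        by (simp add: sum_distrib_left[symmetric] abs_mult power_abs)
      also have "\<dots> \<le> 4 * (1 + 1 / \<epsilon>) * real (m' * n') powr (1/2 + \<epsilon>)"
        unfolding D_def
      proof (rule character_sum_powr)
        show odd: "odd (m' * n')" using m' n' by simp
        show "\<not> is_square (m' * n')" using False is_square_mult_power_two[of m' n' i j] m' n' by auto
        show "coprime (8::int) (int (m' * n'))"
        proof -
          have "coprime (2 ^ 3 :: int) (int (m' * n'))" using odd by (subst coprime_power_left_iff) simp
          thus ?thesis by simp
        qed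
      qed (use e in auto)
      also have "\<dots> \<le> 4 * (1 + 1 / \<epsilon>) * (real m * real n) powr (1/2 + \<epsilon>)"
      proof (intro mult_left_mono powr_mono2)
        have "m' \<le> m" "n' \<le> n" using m' n' by simp_all
        thus "real (m' * n') \<le> real m * real n" unfolding of_nat_mult by (intro mult_mono) auto
      qed (use e in auto)
      finally show ?thesis using False by simp
    qed
  qed
  finally show "(\<Sum>m<N. \<Sum>n<N. 2 * pker w (real m) * (2 * pker w (real n)) * \<bar>\<Sum>d\<in>D. real_of_int (kronecker d m) * real_of_int (kronecker d n)\<bar>) \<le>
     real (card D) * (2 * w powr (\<epsilon> - 1/2))\<^sup>2 * (4 * 2 powr \<epsilon> * zsum (1 + 2 * \<epsilon>) ^ 3)
      + 4 * (1 + 1 / \<epsilon>) * (2 * w powr (1/2 + 2 * \<epsilon>))\<^sup>2 * (zsum (1 + \<epsilon>))\<^sup>2"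
    unfolding b_def .
qed

lemma LBINT_scale:
  fixes g :: "real \<Rightarrow> real"
  assumes c: "c > 0"
  shows "(LBINT u:{u. c * u \<in> A \<and> u > 0}. g (c * u) * u powr s) = c powr (- s - 1) * (LBINT u:A \<inter> {0<..}. g u * u powr s)"
    and "set_integrable lborel {u. c * u \<in> A \<and> u > 0} (\<lambda>u. g (c * u) * u powr s) \<longleftrightarrow> set_integrable lborel (A \<inter> {0<..}) (\<lambda>u. g u * u powr s)"
proof -
  let ?f = "\<lambda>u. indicator (A \<inter> {0<..}) u *\<^sub>R (g u * u powr s)"
  have eq: "?f (0 + c * u) = c powr s * (indicator {u. c * u \<in> A \<and> u > 0} u *\<^sub>R (g (c * u) * u powr s))" for u
    using c by (auto simp: indicator_def powr_mult zero_less_mult_iff)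
  have "(LBINT u:A \<inter> {0<..}. g u * u powr s) = \<bar>c\<bar> *\<^sub>R (\<integral>u. ?f (0 + c * u) \<partial>lborel)"
    unfolding set_lebesgue_integral_def using c by (intro lborel_integral_real_affine) auto
  also have "\<dots> = c * (c powr s * (LBINT u:{u. c * u \<in> A \<and> u > 0}. g (c * u) * u powr s))"
    unfolding eq set_lebesgue_integral_def using c by simp
  also have "\<dots> = c powr (s + 1) * (LBINT u:{u. c * u \<in> A \<and> u > 0}. g (c * u) * u powr s)"
    using c by (simp add: powr_add)
  finally have "c powr (- s - 1) * (LBINT u:A \<inter> {0<..}. g u * u powr s) = (c powr (- s - 1) * c powr (s + 1)) * (LBINT u:{u. c * u \<in> A \<and> u > 0}. g (c * u) * u powr s)"
    by (simp only: mult.assoc)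
  moreover have "c powr (- s - 1) * c powr (s + 1) = 1" using c by (simp flip: powr_add)
  ultimately show "(LBINT u:{u. c * u \<in> A \<and> u > 0}. g (c * u) * u powr s) = c powr (- s - 1) * (LBINT u:A \<inter> {0<..}. g u * u powr s)" by simp
  have "integrable lborel ?f \<longleftrightarrow> integrable lborel (\<lambda>u. ?f (0 + c * u))"
    using lborel_integrable_real_affine_iff[of c ?f 0] c by simp
  also have "\<dots> \<longleftrightarrow> integrable lborel (\<lambda>u. indicator {u. c * u \<in> A \<and> u > 0} u *\<^sub>R (g (c * u) * u powr s))"
    unfolding eq using c by simp
  finally show "set_integrable lborel {u. c * u \<in> A \<and> u > 0} (\<lambda>u. g (c * u) * u powr s) \<longleftrightarrow> set_integrable lborel (A \<inter> {0<..}) (\<lambda>u. g u * u powr s)"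
    unfolding set_integrable_def by simp
qed


lemma LBINT_real_powr_0:
  fixes z b :: real
  assumes z: "z > 0" and b: "b > 0"
  shows "set_integrable lborel {0<..b} (\<lambda>u. u powr (z - 1))" "(LBINT u:{0<..b}. u powr (z - 1)) = b powr z / z"
proof -
  have "set_integrable lborel {0<..b} (\<lambda>u. norm (complex_of_real u powr (of_real z - 1)))"
    using z b by (intro set_integrable_norm LBINT_powr_0) auto
  thus "set_integrable lborel {0<..b} (\<lambda>u. u powr (z - 1))"
    by (rule set_integrable_cong[THEN iffD1, rotated -1]) (auto simp: norm_powr_real_powr)
  show "(LBINT u:{0<..b}. u powr (z - 1)) = b powr z / z"
    using LBINT_powr_0(3)[of "of_real z" b] z b by simp
qed

text \<open>Substituting w = d u and reflecting turns the integrand into \<open>Phi\<close> times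
  d^(1/2-\<sigma>), up to sign, so the square gains d^(-\<rho>) <= A^(-\<rho>). For A and B of the
  same order this saving outweighs the powers of W = v B when W is about the square root of
  B.\<close>

lemma small_u_contribution:
  fixes \<sigma> \<rho> :: real
  assumes \<sigma>: "1/2 < \<sigma>" "\<sigma> < 1" and \<rho>: "\<rho> = 2 * \<sigma> - 1"
  obtains C where "C > 0"
    "\<And>(A::int) (B::int) (v::real). A > 0 \<Longrightarrow> A < B \<Longrightarrow> v > 0 \<Longrightarrow>
      (\<Sum>d | d \<in> {A..<B} \<and> [d = 5] (mod 8) \<and> squarefree d. (LBINT u:{0<..v}. psi (kronecker d) u * u powr (\<sigma> - 1))\<^sup>2)
       \<le> C * (A powr (- \<rho>) * (real (card {d. d \<in> {A..<B} \<and> [d = 5] (mod 8)}) * (v * B) powr (9 * \<rho> / 8) + (v * B) powr (5 * \<rho> / 4 + 2)))"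
proof -
  have r: "0 < \<rho>" "\<rho> < 1" using \<sigma> \<rho> by auto
  define \<epsilon> where "\<epsilon> = \<rho> / 16"
  have e: "\<epsilon> > 0" "\<epsilon> \<le> 1/4" using r by (auto simp: \<epsilon>_def)
  define a1 where "a1 = 4 * (4 * 2 powr \<epsilon> * zsum (1 + 2 * \<epsilon>) ^ 3)"
  define a2 where "a2 = 4 * (1 + 1 / \<epsilon>) * 4 * (zsum (1 + \<epsilon>))\<^sup>2"
  have a: "a1 \<ge> 0" "a2 \<ge> 0" unfolding a1_def a2_def using e by (auto intro!: mult_nonneg_nonneg zsum_nonneg zero_le_power)
  define C where "C = 2 / \<rho> * (a1 * (8 / (5 * \<rho>)) + a2 + 1)"
  have "C > 0" unfolding C_def using r a by (intro mult_pos_pos add_nonneg_pos add_nonneg_nonneg mult_nonneg_nonneg) auto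
  moreover
  {
    fix A B :: int and v :: real
    assume AB: "A > 0" "A < B" and v: "v > 0"
    define D where "D = {d. d \<in> {A..<B} \<and> [d = 5] (mod 8)}"
    define Ds where "Ds = {d. d \<in> {A..<B} \<and> [d = 5] (mod 8) \<and> squarefree d}"
    have fin: "finite D" unfolding D_def by (rule finite_subset[of _ "{A..<B}"]) auto
    have sub: "Ds \<subseteq> D" unfolding D_def Ds_def by auto
    hence fins: "finite Ds" using fin finite_subset by blast
    define W where "W = v * B"
    have W: "W > 0" using AB v by (simp add: W_def)
    \<comment> \<open>After the substitution the upper limit v d depends on d; cutting the integrand
      off there puts all d on the common interval (0, W].\<close>
    define F where "F d w = of_int d powr (- \<sigma>) * ((if w \<le> v * of_int d then psi (kronecker d) (w / of_int d) else 0) * w powr (\<sigma> - 1))" for d :: int and w :: real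
    have bc: "bounded_coeffs (kronecker d)" for d
    proof
      fix n show "\<bar>kronecker d n\<bar> \<le> 1" using kronecker_values[of d n] by auto
    qed
    have trans: "(LBINT u:{0<..v}. psi (kronecker d) u * u powr (\<sigma> - 1)) = (LBINT w:{0<..W}. F d w)" if d: "d \<in> Ds" for d
    proof -
      have d0: "d > 0" "d < B" using d AB by (auto simp: Ds_def)
      let ?g = "\<lambda>w. psi (kronecker d) (w / of_int d)"
      have set1: "{u. of_int d * u \<in> {..v * of_int d} \<and> u > 0} = {0<..v}" using d0 by (auto simp: mult.commute)
      have "(LBINT u:{0<..v}. psi (kronecker d) u * u powr (\<sigma> - 1)) = (LBINT u:{u. of_int d * u \<in> {..v * of_int d} \<and> u > 0}. ?g (of_int d * u) * u powr (\<sigma> - 1))"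
        unfolding set1 using d0 by simp
      also have "\<dots> = of_int d powr (- \<sigma>) * (LBINT u:{..v * of_int d} \<inter> {0<..}. ?g u * u powr (\<sigma> - 1))"
        using d0 by (subst LBINT_scale) auto
      also have "(LBINT u:{..v * of_int d} \<inter> {0<..}. ?g u * u powr (\<sigma> - 1)) = (LBINT w:{0<..W}. (if w \<le> v * of_int d then ?g w else 0) * w powr (\<sigma> - 1))"
      proof -
        have "v * of_int d \<le> W" unfolding W_def using d0 v by (intro mult_left_mono) auto
        thus ?thesis unfolding set_lebesgue_integral_def
          by (intro Bochner_Integration.integral_cong refl) (auto simp: indicator_def)
      qed
      also have "of_int d powr (- \<sigma>) * \<dots> = (LBINT w:{0<..W}. F d w)"
        unfolding F_def by simp
      finally show ?thesis .
    qed
    define w where "w x = x powr (\<rho>/2 - 1)" for x :: real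
    define h1 where "h1 = A powr (- \<rho>) * (real (card D) * a1)"
    define h2 where "h2 = A powr (- \<rho>) * a2"
    have h0: "h1 \<ge> 0" "h2 \<ge> 0" unfolding h1_def h2_def using a by auto
    define h where "h x = h1 * x powr (5 * \<rho> / 8 - 1) + h2 * x powr ((3 * \<rho> / 4 + 2) - 1)" for x :: real
    have "(\<Sum>d\<in>Ds. (LBINT w:{0<..W}. F d w)\<^sup>2) \<le> (W powr (\<rho>/2) / (\<rho>/2)) * (h1 * (W powr (5 * \<rho> / 8) / (5 * \<rho> / 8)) + h2 * (W powr (3 * \<rho> / 4 + 2) / (3 * \<rho> / 4 + 2)))"
    proof (rule Cauchy_Schwarz_mean_square[OF fins])
      show "{0<..W} \<in> sets borel" by simp
      show "F d \<in> borel_measurable borel" for d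
      proof -
        note [measurable] = bounded_coeffs.psi_measurable[OF bc]
        show ?thesis unfolding F_def[abs_def] by measurable
      qed
      show "w \<in> borel_measurable borel" unfolding w_def[abs_def] by measurable
      show "set_integrable lborel {0<..W} w" unfolding w_def[abs_def] using r W by (intro LBINT_real_powr_0) auto
      show "(LBINT u:{0<..W}. w u) \<le> W powr (\<rho>/2) / (\<rho>/2)" unfolding w_def using r W by (subst LBINT_real_powr_0) auto
      show "w u > 0" if "u \<in> {0<..W}" for u using that by (auto simp: w_def)
      show "set_integrable lborel {0<..W} h" unfolding h_def[abs_def] using r W
        by (intro set_integral_add set_integrable_mult_right LBINT_real_powr_0) auto
      show "(LBINT u:{0<..W}. h u) \<le> h1 * (W powr (5 * \<rho> / 8) / (5 * \<rho> / 8)) + h2 * (W powr (3 * \<rho> / 4 + 2) / (3 * \<rho> / 4 + 2))"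
      proof -
        have "(LBINT u:{0<..W}. h u) = (LBINT u:{0<..W}. h1 * u powr (5 * \<rho> / 8 - 1)) + (LBINT u:{0<..W}. h2 * u powr ((3 * \<rho> / 4 + 2) - 1))"
          unfolding h_def using r W by (intro set_integral_add set_integrable_mult_right LBINT_real_powr_0) auto
        also have "\<dots> = h1 * (LBINT u:{0<..W}. u powr (5 * \<rho> / 8 - 1)) + h2 * (LBINT u:{0<..W}. u powr ((3 * \<rho> / 4 + 2) - 1))"
          by (simp only: set_integral_mult_right)
        also have "(LBINT u:{0<..W}. u powr (5 * \<rho> / 8 - 1)) = W powr (5 * \<rho> / 8) / (5 * \<rho> / 8)"
          using r W by (intro LBINT_real_powr_0) auto
        also have "(LBINT u:{0<..W}. u powr ((3 * \<rho> / 4 + 2) - 1)) = W powr (3 * \<rho> / 4 + 2) / (3 * \<rho> / 4 + 2)"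
          using r W by (intro LBINT_real_powr_0) auto
        finally show ?thesis by simp
      qed
      show "(\<Sum>d\<in>Ds. (F d x)\<^sup>2) \<le> h x * w x" if x: "x \<in> {0<..W}" for x
      proof -
        have x0: "x > 0" using x by simp
        have "(\<Sum>d\<in>Ds. (F d x)\<^sup>2) \<le> (\<Sum>d\<in>Ds. A powr (- \<rho>) * (x powr (\<sigma> - 1))\<^sup>2 * (Phi (nat d) x)\<^sup>2)"
        proof (rule sum_mono)
          fix d assume d: "d \<in> Ds"
          have d0: "d > 0" "d \<ge> A" and d8: "d mod 8 = 5" and sf: "squarefree d" using d AB by (auto simp: Ds_def cong_def)
          have nd: "int (nat d) = d" using d0 by simp
          have "nat d mod 8 = 5" using d8 d0 by (metis nat_mod_distrib nat_numeral zero_le_numeral less_imp_le)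
          hence "nat d mod 8 mod 4 = 1" by simp
          hence nd4: "nat d mod 4 = 1" by (simp add: mod_mod_cancel)
          have sfn: "squarefree (nat d)"
          proof (rule squarefreeI)
            fix y assume "y\<^sup>2 dvd nat d"
            hence "(int y)\<^sup>2 dvd d" using nd by (metis int_dvd_int_iff of_nat_power)
            hence "int y dvd 1" using sf by (auto dest: squarefreeD)
            thus "y dvd 1" by simp
          qed
          have "d \<ge> 5" using d8 d0 by presburger
          hence nd1: "nat d > 1" by simp
          have refl: "(psi (kronecker d) (x / of_int d))\<^sup>2 = of_int d * (Phi (nat d) x)\<^sup>2"
            using reflection_formula[OF nd4 nd1 sfn, of "x / of_int d"] nd d0 x0 by simp
          have "(F d x)\<^sup>2 \<le> (of_int d powr (- \<sigma>))\<^sup>2 * ((psi (kronecker d) (x / of_int d))\<^sup>2 * (x powr (\<sigma> - 1))\<^sup>2)"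
            by (simp add: F_def power_mult_distrib)
          also have "\<dots> = ((of_int d powr (- \<sigma>))\<^sup>2 * of_int d) * ((x powr (\<sigma> - 1))\<^sup>2 * (Phi (nat d) x)\<^sup>2)"
            unfolding refl by simp
          also have "(of_int d powr (- \<sigma>))\<^sup>2 * of_int d = of_int d powr (- \<rho>)"
          proof -
            have "of_int d = of_int d powr (1::real)" using d0 by simp
            hence "(of_int d powr (- \<sigma>))\<^sup>2 * of_int d = of_int d powr (- \<sigma>) * of_int d powr (- \<sigma>) * of_int d powr (1::real)"
              by (simp add: power2_eq_square)
            also have "\<dots> = of_int d powr (- \<rho>)" by (simp only: powr_add[symmetric] \<rho>) simp
            finally show ?thesis .
          qed
          also have "of_int d powr (- \<rho>) * ((x powr (\<sigma> - 1))\<^sup>2 * (Phi (nat d) x)\<^sup>2) \<le> A powr (- \<rho>) * ((x powr (\<sigma> - 1))\<^sup>2 * (Phi (nat d) x)\<^sup>2)"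
            using r d0 AB by (intro mult_right_mono powr_mono2') auto
          finally show "(F d x)\<^sup>2 \<le> A powr (- \<rho>) * (x powr (\<sigma> - 1))\<^sup>2 * (Phi (nat d) x)\<^sup>2" by (simp only: mult.assoc)
        qed
        \<comment> \<open>Reflection needed squarefree d; now squares are summed, so by positivity
          the sum may run over the whole class, where character sums are controlled.\<close>
        also have "\<dots> \<le> A powr (- \<rho>) * (x powr (\<sigma> - 1))\<^sup>2 * (\<Sum>d\<in>D. (Phi (nat d) x)\<^sup>2)"
          unfolding sum_distrib_left[symmetric] by (intro mult_left_mono sum_mono2 fin sub) auto
        also have "\<dots> \<le> A powr (- \<rho>) * (x powr (\<sigma> - 1))\<^sup>2 * (real (card D) * (2 * x powr (\<epsilon> - 1/2))\<^sup>2 * (4 * 2 powr \<epsilon> * zsum (1 + 2 * \<epsilon>) ^ 3)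
            + 4 * (1 + 1 / \<epsilon>) * (2 * x powr (1/2 + 2 * \<epsilon>))\<^sup>2 * (zsum (1 + \<epsilon>))\<^sup>2)"
          unfolding D_def using AB by (intro mult_left_mono mean_square_Phi e x0) auto
        also have "\<dots> = h1 * ((x powr (\<sigma> - 1))\<^sup>2 * (x powr (\<epsilon> - 1/2))\<^sup>2) + h2 * ((x powr (\<sigma> - 1))\<^sup>2 * (x powr (1/2 + 2 * \<epsilon>))\<^sup>2)"
          unfolding a1_def a2_def h1_def h2_def by (simp add: power_mult_distrib algebra_simps)
        also have "(x powr (\<sigma> - 1))\<^sup>2 * (x powr (\<epsilon> - 1/2))\<^sup>2 = x powr (5 * \<rho> / 8 - 1) * x powr (\<rho>/2 - 1)"
          by (simp only: power2_eq_square powr_add[symmetric]) (rule arg_cong[of _ _ "\<lambda>y. x powr y"], simp add: \<rho> \<epsilon>_def field_simps)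
        also have "(x powr (\<sigma> - 1))\<^sup>2 * (x powr (1/2 + 2 * \<epsilon>))\<^sup>2 = x powr ((3 * \<rho> / 4 + 2) - 1) * x powr (\<rho>/2 - 1)"
          by (simp only: power2_eq_square powr_add[symmetric]) (rule arg_cong[of _ _ "\<lambda>y. x powr y"], simp add: \<rho> \<epsilon>_def field_simps)
        also have "h1 * (x powr (5 * \<rho> / 8 - 1) * x powr (\<rho>/2 - 1)) + h2 * (x powr ((3 * \<rho> / 4 + 2) - 1) * x powr (\<rho>/2 - 1)) = h x * w x"
          unfolding h_def w_def by (simp only: distrib_right mult.assoc)
        finally show ?thesis .
      qed
    qed
    also have "\<dots> \<le> C * (A powr (- \<rho>) * (real (card D) * W powr (9 * \<rho> / 8) + W powr (5 * \<rho> / 4 + 2)))"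
    proof -
      define X1 X2 where "X1 = W powr (9 * \<rho> / 8)" and "X2 = W powr (5 * \<rho> / 4 + 2)"
      have X: "X1 \<ge> 0" "X2 \<ge> 0" by (auto simp: X1_def X2_def)
      have m1: "W powr (\<rho>/2) * W powr (5 * \<rho> / 8) = X1" unfolding X1_def powr_add[symmetric]
        by (rule arg_cong[of _ _ "\<lambda>y. W powr y"]) (simp add: field_simps)
      have m2: "W powr (\<rho>/2) * W powr (3 * \<rho> / 4 + 2) = X2" unfolding X2_def powr_add[symmetric]
        by (rule arg_cong[of _ _ "\<lambda>y. W powr y"]) (simp add: field_simps)
      have "(W powr (\<rho>/2) / (\<rho>/2)) * (h1 * (W powr (5 * \<rho> / 8) / (5 * \<rho> / 8)) + h2 * (W powr (3 * \<rho> / 4 + 2) / (3 * \<rho> / 4 + 2)))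
         = 2 / \<rho> * (h1 * (8 / (5 * \<rho>)) * (W powr (\<rho>/2) * W powr (5 * \<rho> / 8)) + h2 * (1 / (3 * \<rho> / 4 + 2)) * (W powr (\<rho>/2) * W powr (3 * \<rho> / 4 + 2)))"
        using r by (simp add: ring_distribs mult_ac)
      also have "\<dots> = 2 / \<rho> * (h1 * (8 / (5 * \<rho>)) * X1 + h2 * (1 / (3 * \<rho> / 4 + 2)) * X2)" unfolding m1 m2 ..
      also have "\<dots> \<le> 2 / \<rho> * (h1 * (8 / (5 * \<rho>)) * X1 + h2 * 1 * X2)"
        using r h0 X by (intro mult_left_mono add_left_mono mult_right_mono) auto
      also have "\<dots> = 2 / \<rho> * (A powr (- \<rho>) * ((a1 * (8 / (5 * \<rho>))) * (real (card D) * X1) + a2 * X2))"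
        unfolding h1_def h2_def by (simp add: ring_distribs mult_ac)
      also have "\<dots> \<le> 2 / \<rho> * (A powr (- \<rho>) * ((a1 * (8 / (5 * \<rho>)) + a2 + 1) * (real (card D) * X1) + (a1 * (8 / (5 * \<rho>)) + a2 + 1) * X2))"
        using r a X by (intro mult_left_mono add_mono mult_right_mono) auto
      also have "\<dots> = C * (A powr (- \<rho>) * (real (card D) * X1 + X2))"
        unfolding C_def by (simp add: ring_distribs mult_ac)
      finally show ?thesis unfolding X1_def X2_def .
    qed
    finally have "(\<Sum>d\<in>Ds. (LBINT u:{0<..v}. psi (kronecker d) u * u powr (\<sigma> - 1))\<^sup>2) \<le> C * (A powr (- \<rho>) * (real (card D) * W powr (9 * \<rho> / 8) + W powr (5 * \<rho> / 4 + 2)))"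
      using trans by simp
    hence "(\<Sum>d | d \<in> {A..<B} \<and> [d = 5] (mod 8) \<and> squarefree d. (LBINT u:{0<..v}. psi (kronecker d) u * u powr (\<sigma> - 1))\<^sup>2)
       \<le> C * (A powr (- \<rho>) * (real (card {d. d \<in> {A..<B} \<and> [d = 5] (mod 8)}) * (v * B) powr (9 * \<rho> / 8) + (v * B) powr (5 * \<rho> / 4 + 2)))"
      unfolding D_def Ds_def W_def .
  }
  ultimately show ?thesis by (rule that)
qed

subsection \<open>Sieving out small primes\<close>

definition sift :: "nat set \<Rightarrow> (nat \<Rightarrow> int) \<Rightarrow> nat \<Rightarrow> int" where
  "sift S f n = (if \<exists>p\<in>S. p dvd n then 0 else f n)"

lemma sift_empty [simp]: "sift {} f = f" by (simp add: sift_def fun_eq_iff)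

locale multiplicative_coeffs = bounded_coeffs +
  assumes f_mult: "m > 0 \<Longrightarrow> n > 0 \<Longrightarrow> f (m * n) = f m * f n"
begin

lemma bounded_sift: "bounded_coeffs (sift S f)"
  by standard (use f_le in \<open>auto simp: sift_def\<close>)

text \<open>The terms removed by p sit at multiples p k. There f(p k) = f(p) f(k), and the
  conditions for S on p k are those on k, so together they form f(p) times the same series at p
  u.\<close>

lemma psi_sift_insert:
  assumes p: "prime p" "p \<notin> S" "\<And>s. s \<in> S \<Longrightarrow> prime s" and u: "u > 0"
  shows "psi (sift (insert p S) f) u = psi (sift S f) u - of_int (f p) * psi (sift S f) (real p * u)"
proof -
  have p0: "p > 0" using p by (simp add: prime_gt_0_nat)
  let ?t = "\<lambda>g n. real_of_int (g (Suc n)) * exp (- real (Suc n) * u)"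
  let ?h = "\<lambda>n. if p dvd Suc n then ?t (sift S f) n else 0"
  have "(\<lambda>n. ?t (sift S f) n - ?t (sift (insert p S) f) n) sums (psi (sift S f) u - psi (sift (insert p S) f) u)"
    by (intro sums_diff bounded_coeffs.psi_sums[OF bounded_sift] u)
  also have "(\<lambda>n. ?t (sift S f) n - ?t (sift (insert p S) f) n) = ?h"
    by (rule ext) (simp add: sift_def)
  finally have h: "?h sums (psi (sift S f) u - psi (sift (insert p S) f) u)" .
  let ?g = "\<lambda>k. p * Suc k - 1"
  have gS: "Suc (?g k) = p * Suc k" for k using p0 by simp
  have "strict_mono ?g"
  proof (rule strict_monoI)
    fix i j :: nat assume "i < j"
    hence "p * Suc i < p * Suc j" using p0 by simp
    thus "?g i < ?g j" using p0 by (metis gS Suc_less_eq)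
  qed
  moreover have "?h n = 0" if "n \<notin> range ?g" for n
  proof -
    have "\<not> p dvd Suc n"
    proof
      assume "p dvd Suc n"
      then obtain k where k: "Suc n = p * k" by (auto elim: dvdE)
      hence "k > 0" by (intro Nat.gr0I) auto
      then obtain k' where "k = Suc k'" by (cases k) auto
      hence "n = ?g k'" using k by simp
      thus False using that by blast
    qed
    thus ?thesis by simp
  qed
  ultimately have "(\<lambda>k. ?h (?g k)) sums (psi (sift S f) u - psi (sift (insert p S) f) u)"
    using h sums_mono_reindex[of ?g ?h] by blast
  also have "(\<lambda>k. ?h (?g k)) = (\<lambda>k. of_int (f p) * (real_of_int (sift S f (Suc k)) * exp (- real (Suc k) * (real p * u))))"
  proof
    fix k
    have "(\<exists>s\<in>S. s dvd p * Suc k) \<longleftrightarrow> (\<exists>s\<in>S. s dvd Suc k)"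
    proof (rule bex_cong[OF refl])
      fix s assume s: "s \<in> S"
      hence "coprime s p" using p by (metis primes_coprime)
      thus "s dvd p * Suc k \<longleftrightarrow> s dvd Suc k" by (rule coprime_dvd_mult_right_iff)
    qed
    hence *: "sift S f (p * Suc k) = f p * sift S f (Suc k)" using f_mult[OF p0, of "Suc k"] by (simp add: sift_def)
    show "?h (?g k) = of_int (f p) * (real_of_int (sift S f (Suc k)) * exp (- real (Suc k) * (real p * u)))"
    proof -
      have e: "- real (p * Suc k) * u = - real (Suc k) * (real p * u)" by (simp add: algebra_simps)
      show ?thesis by (simp only: gS * e dvd_triv_left if_True of_int_mult mult.assoc)
    qed
  qed
  finally have "(\<lambda>k. of_int (f p) * (real_of_int (sift S f (Suc k)) * exp (- real (Suc k) * (real p * u)))) sums (psi (sift S f) u - psi (sift (insert p S) f) u)" .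
  moreover have "(\<lambda>k. of_int (f p) * (real_of_int (sift S f (Suc k)) * exp (- real (Suc k) * (real p * u)))) sums (of_int (f p) * psi (sift S f) (real p * u))"
    using p0 u by (intro sums_mult bounded_coeffs.psi_sums[OF bounded_sift]) auto
  ultimately have "psi (sift S f) u - psi (sift (insert p S) f) u = of_int (f p) * psi (sift S f) (real p * u)"
    by (rule sums_unique2)
  thus ?thesis by simp
qed

lemma sift_mellin_insert:
  fixes A :: "real set"
  assumes p: "prime p" "p \<notin> S" "\<And>s. s \<in> S \<Longrightarrow> prime s"
    and A: "A \<subseteq> {0<..}" "A \<in> sets borel" "A' = (\<lambda>u. real p * u) ` A"
    and int: "set_integrable lborel A (\<lambda>u. psi (sift S f) u * u powr (\<sigma> - 1))" "set_integrable lborel A' (\<lambda>u. psi (sift S f) u * u powr (\<sigma> - 1))"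
  shows "set_integrable lborel A (\<lambda>u. psi (sift (insert p S) f) u * u powr (\<sigma> - 1))"
    and "(LBINT u:A. psi (sift (insert p S) f) u * u powr (\<sigma> - 1)) = (LBINT u:A. psi (sift S f) u * u powr (\<sigma> - 1))
      - of_int (f p) * real p powr (- \<sigma>) * (LBINT u:A'. psi (sift S f) u * u powr (\<sigma> - 1))"
proof -
  have p0: "real p > 0" using p by (simp add: prime_gt_0_nat)
  have A1: "{u. real p * u \<in> A' \<and> u > 0} = A" using A p0 by auto
  have A2: "A' \<inter> {0<..} = A'" using A p0 by auto
  note sc = LBINT_scale[OF p0, of A' "psi (sift S f)" "\<sigma> - 1", unfolded A1 A2]
  have int3: "set_integrable lborel A (\<lambda>u. psi (sift S f) (real p * u) * u powr (\<sigma> - 1))" using sc(2) int(2) by simp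
  have eq: "psi (sift (insert p S) f) u * u powr (\<sigma> - 1) = psi (sift S f) u * u powr (\<sigma> - 1) - of_int (f p) * (psi (sift S f) (real p * u) * u powr (\<sigma> - 1))" if "u \<in> A" for u
  proof -
    have "u > 0" using that A by auto
    from psi_sift_insert[OF p this] show ?thesis by (simp add: left_diff_distrib mult.assoc)
  qed
  have int4: "set_integrable lborel A (\<lambda>u. psi (sift S f) u * u powr (\<sigma> - 1) - of_int (f p) * (psi (sift S f) (real p * u) * u powr (\<sigma> - 1)))"
    by (intro set_integral_diff(1) int set_integrable_mult_right int3)
  show "set_integrable lborel A (\<lambda>u. psi (sift (insert p S) f) u * u powr (\<sigma> - 1))"
    using int4 by (rule set_integrable_cong[THEN iffD1, rotated -1]) (auto simp: eq)
  have "(LBINT u:A. psi (sift (insert p S) f) u * u powr (\<sigma> - 1)) = (LBINT u:A. psi (sift S f) u * u powr (\<sigma> - 1) - of_int (f p) * (psi (sift S f) (real p * u) * u powr (\<sigma> - 1)))"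
    using A by (intro set_lebesgue_integral_cong) (auto simp: eq)
  also have "\<dots> = (LBINT u:A. psi (sift S f) u * u powr (\<sigma> - 1)) - (LBINT u:A. of_int (f p) * (psi (sift S f) (real p * u) * u powr (\<sigma> - 1)))"
    by (intro set_integral_diff(2) int set_integrable_mult_right int3)
  also have "(LBINT u:A. of_int (f p) * (psi (sift S f) (real p * u) * u powr (\<sigma> - 1))) = of_int (f p) * real p powr (- \<sigma>) * (LBINT u:A'. psi (sift S f) u * u powr (\<sigma> - 1))"
    unfolding set_integral_mult_right sc(1) by simp
  finally show "(LBINT u:A. psi (sift (insert p S) f) u * u powr (\<sigma> - 1)) = (LBINT u:A. psi (sift S f) u * u powr (\<sigma> - 1))
      - of_int (f p) * real p powr (- \<sigma>) * (LBINT u:A'. psi (sift S f) u * u powr (\<sigma> - 1))" .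
qed

text \<open>The half-line is invariant under u -> p u, so each prime multiplies the integral by
  exactly its Euler factor. Euler factors are thus removed inside the critical strip without an
  Euler product there.\<close>

lemma sift_mellin_total:
  assumes S: "finite S" "\<And>s. s \<in> S \<Longrightarrow> prime s"
    and int: "set_integrable lborel {0<..} (\<lambda>u. psi f u * u powr (\<sigma> - 1))"
  shows "set_integrable lborel {0<..} (\<lambda>u. psi (sift S f) u * u powr (\<sigma> - 1)) \<and>
    (LBINT u:{0<..}. psi (sift S f) u * u powr (\<sigma> - 1)) = (\<Prod>p\<in>S. 1 - of_int (f p) * real p powr (- \<sigma>)) * (LBINT u:{0<..}. psi f u * u powr (\<sigma> - 1))"
  using S
proof (induction S rule: finite_induct)
  case empty
  thus ?case using int by simp
next
  case (insert p S)
  hence p: "prime p" "p \<notin> S" "\<And>s. s \<in> S \<Longrightarrow> prime s" by auto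
  have p0: "real p > 0" using p by (simp add: prime_gt_0_nat)
  have im: "{0<..} = (\<lambda>u. real p * u) ` {0<..}"
  proof (intro equalityI subsetI)
    fix x :: real assume "x \<in> {0<..}"
    thus "x \<in> (\<lambda>u. real p * u) ` {0<..}" using p0 by (intro image_eqI[of _ _ "x / real p"]) auto
  qed (use p0 in auto)
  note IH = insert.IH[OF p(3)]
  note ins = sift_mellin_insert[OF p _ _ im, of \<sigma>]
  show ?case using IH ins p insert.hyps by (simp add: algebra_simps)
qed

end

text \<open>On (0, v] the dilation by p moves the endpoint to p v, so the bound M is required for
  all endpoints up to v times the product of S. Each prime replaces an integral a by a - c b with
  |c| <= 1, and (a - c b)^2 <= 2 a^2 + 2 b^2 costs a factor 4.\<close>

lemma sift_mellin_mean_square: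
  fixes f :: "'d \<Rightarrow> nat \<Rightarrow> int"
  assumes f: "\<And>d. d \<in> D \<Longrightarrow> multiplicative_coeffs (f d)"
    and int: "\<And>d. d \<in> D \<Longrightarrow> set_integrable lborel {0<..} (\<lambda>u. psi (f d) u * u powr (\<sigma> - 1))"
    and M: "\<And>v. 0 < v \<Longrightarrow> v \<le> V \<Longrightarrow> (\<Sum>d\<in>D. (LBINT u:{0<..v}. psi (f d) u * u powr (\<sigma> - 1))\<^sup>2) \<le> M"
    and S: "finite S" "\<And>s. s \<in> S \<Longrightarrow> prime s" and \<sigma>: "\<sigma> \<ge> 0"
    and v: "0 < v" "v * real (\<Prod>S) \<le> V"
  shows "(\<Sum>d\<in>D. (LBINT u:{0<..v}. psi (sift S (f d)) u * u powr (\<sigma> - 1))\<^sup>2) \<le> 4 ^ card S * M"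
  using S v
proof (induction S arbitrary: v rule: finite_induct)
  case empty
  thus ?case using M[of v] by simp
next
  case (insert p S)
  hence p: "prime p" "p \<notin> S" "\<And>s. s \<in> S \<Longrightarrow> prime s" by auto
  have p1: "real p \<ge> 1" using prime_gt_0_nat[OF p(1)] by simp
  let ?T = "\<lambda>S v d. (LBINT u:{0<..v}. psi (sift S (f d)) u * u powr (\<sigma> - 1))"
  have prod0: "real (\<Prod>S) \<ge> 0" by (rule of_nat_0_le_iff)
  have eq: "v * real (\<Prod>(insert p S)) = (real p * v) * real (\<Prod>S)" using insert.hyps by simp
  have "v * real (\<Prod>S) \<le> (real p * v) * real (\<Prod>S)"
    using p1 insert.prems prod0 by (intro mult_right_mono) auto
  hence v1: "v * real (\<Prod>S) \<le> V" using insert.prems eq by linarith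
  have v2: "(real p * v) * real (\<Prod>S) \<le> V" using insert.prems eq by linarith
  have IH1: "(\<Sum>d\<in>D. (?T S v d)\<^sup>2) \<le> 4 ^ card S * M" using insert.IH[OF p(3) insert.prems(2) v1] by simp
  have IH2: "(\<Sum>d\<in>D. (?T S (real p * v) d)\<^sup>2) \<le> 4 ^ card S * M"
    using insert.IH[OF p(3) _ v2] insert.prems(2) p1 by simp
  have im: "{0<..real p * v} = (\<lambda>u. real p * u) ` {0<..v}"
  proof (intro equalityI subsetI)
    fix x :: real assume "x \<in> {0<..real p * v}"
    thus "x \<in> (\<lambda>u. real p * u) ` {0<..v}" using p1 by (intro image_eqI[of _ _ "x / real p"]) (auto simp: field_simps)
  qed (use p1 in auto)
  have "(?T (insert p S) v d)\<^sup>2 \<le> 2 * (?T S v d)\<^sup>2 + 2 * (?T S (real p * v) d)\<^sup>2" if d: "d \<in> D" for d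
  proof -
    interpret multiplicative_coeffs "f d" by (rule f[OF d])
    have I: "set_integrable lborel {0<..} (\<lambda>u. psi (sift S (f d)) u * u powr (\<sigma> - 1))"
      using sift_mellin_total[OF insert.hyps(1) p(3) int[OF d]] by simp
    have I1: "set_integrable lborel {0<..x} (\<lambda>u. psi (sift S (f d)) u * u powr (\<sigma> - 1))" for x
      using I by (rule set_integrable_subset) auto
    define c where "c = real_of_int (f d p) * real p powr (- \<sigma>)"
    have "real p powr (- \<sigma>) \<le> real p powr 0" using p1 \<sigma> by (intro powr_mono) auto
    hence "real p powr (- \<sigma>) \<le> 1" using p1 by simp
    hence "\<bar>c\<bar> \<le> 1 * 1" unfolding c_def abs_mult using f_le' by (intro mult_mono) auto
    hence c: "c\<^sup>2 \<le> 1" by (simp add: abs_square_le_1)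
    have "?T (insert p S) v d = ?T S v d - c * ?T S (real p * v) d"
      unfolding c_def by (rule sift_mellin_insert(2)[OF p _ _ im I1 I1]) auto
    moreover have "(a - c * b)\<^sup>2 \<le> 2 * a\<^sup>2 + 2 * b\<^sup>2" for a b :: real
    proof -
      have "(a - c * b)\<^sup>2 + (a + c * b)\<^sup>2 = 2 * a\<^sup>2 + 2 * (c\<^sup>2 * b\<^sup>2)" by (simp add: power2_eq_square algebra_simps)
      moreover have "c\<^sup>2 * b\<^sup>2 \<le> 1 * b\<^sup>2" using c by (intro mult_right_mono) auto
      moreover have "(a + c * b)\<^sup>2 \<ge> 0" by simp
      ultimately show ?thesis by linarith
    qed
    ultimately show ?thesis by simp
  qed
  hence "(\<Sum>d\<in>D. (?T (insert p S) v d)\<^sup>2) \<le> (\<Sum>d\<in>D. 2 * (?T S v d)\<^sup>2 + 2 * (?T S (real p * v) d)\<^sup>2)"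
    by (intro sum_mono) auto
  also have "\<dots> = 2 * (\<Sum>d\<in>D. (?T S v d)\<^sup>2) + 2 * (\<Sum>d\<in>D. (?T S (real p * v) d)\<^sup>2)"
    by (simp add: sum.distrib sum_distrib_left)
  also have "\<dots> \<le> 4 ^ card (insert p S) * M" using IH1 IH2 insert.hyps by simp
  finally show ?case .
qed

subsection \<open>Quadratic L-functions on the real axis\<close>

lemma multiplicative_coeffs_kronecker: "multiplicative_coeffs (kronecker d)"
proof
  fix m n :: nat
  show "\<bar>kronecker d n\<bar> \<le> 1" using kronecker_values[of d n] by auto
  show "m > 0 \<Longrightarrow> n > 0 \<Longrightarrow> kronecker d (m * n) = kronecker d m * kronecker d n" by (rule kronecker_mult)
qed

text \<open>The sum over a period is the Gauss sum at frequency 0, a multiple of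
  \<open>jac 0 d\<close>, which vanishes. This is the condition under which the Mellin integral
  represents the L-function on Re s > 0.\<close>

lemma sum_kronecker_period:
  assumes d: "d mod 4 = 1" "d > 1" "squarefree d"
  shows "(\<Sum>r<d. kronecker (int d) (Suc r)) = 0"
proof -
  have od: "odd d" using d(1) by presburger
  have j0: "jac 0 d = 0" using jac_eq_0_iff[of d 0] d by simp
  have "(\<Sum>a\<in>{0..<int d}. complex_of_int (jac a d)) = 0"
    using gauss_sum_eq[OF od d(3), of 0] j0 by (simp add: gauss_sum_def)
  hence "complex_of_int (\<Sum>a\<in>{0..<int d}. jac a d) = of_int 0" by simp
  hence z: "(\<Sum>a\<in>{0..<int d}. jac a d) = 0" by (simp only: of_int_eq_iff)
  have jd: "jac (int d) d = jac 0 d" by (rule jac_cong) (simp add: cong_def)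
  have "(\<Sum>r<d. kronecker (int d) (Suc r)) = (\<Sum>n<Suc d. jac (int n) d) - jac 0 d"
    unfolding sum.lessThan_Suc_shift by (simp add: kronecker_periodic[OF d(1,2)])
  also have "\<dots> = (\<Sum>n<d. jac (int n) d)" using jd by simp
  also have "\<dots> = (\<Sum>a\<in>{0..<int d}. jac a d)" by (simp add: sum_int_atLeastLessThan)
  finally show ?thesis using z by simp
qed

lemma kronecker_L_real:
  assumes d: "d mod 4 = 1" "d > 1" "squarefree d" and \<sigma>: "\<sigma> > 0"
  obtains l where "Dirichlet_L (kronecker (int d)) (of_real \<sigma>) = of_real l"
    "l * Gamma \<sigma> = (LBINT u:{0<..}. psi (kronecker (int d)) u * u powr (\<sigma> - 1))"
    "set_integrable lborel {0<..} (\<lambda>u. psi (kronecker (int d)) u * u powr (\<sigma> - 1))"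
proof -
  interpret periodic_coeffs "kronecker (int d)" d by (rule periodic_coeffs_kronecker[OF d(1,2)])
  note z = sum_kronecker_period[OF d]
  have eq: "complex_of_real (psi (kronecker (int d)) u) * complex_of_real u powr (of_real \<sigma> - 1) = of_real (psi (kronecker (int d)) u * u powr (\<sigma> - 1))" if "u \<in> {0<..}" for u
    using that by (simp flip: powr_of_real)
  have I: "set_integrable lborel {0<..} (\<lambda>u. complex_of_real (psi (kronecker (int d)) u * u powr (\<sigma> - 1)))"
  proof -
    have "set_integrable lborel {0<..} (\<lambda>u. complex_of_real (psi (kronecker (int d)) u) * complex_of_real u powr (of_real \<sigma> - 1))"
      using z \<sigma> by (intro L_eq(2)) simp
    thus ?thesis by (rule set_integrable_cong[THEN iffD1, rotated -1]) (use eq in auto)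
  qed
  hence int: "set_integrable lborel {0<..} (\<lambda>u. psi (kronecker (int d)) u * u powr (\<sigma> - 1))"
    using integrable_Re[OF I[unfolded set_integrable_def]] by (simp add: set_integrable_def)
  have "Dirichlet_L (kronecker (int d)) (of_real \<sigma>) * Gamma (of_real \<sigma>) = (LBINT u:{0<..}. complex_of_real (psi (kronecker (int d)) u) * complex_of_real u powr (of_real \<sigma> - 1))"
    using Dirichlet_L_mellin(2)[of "of_real \<sigma>"] z \<sigma> by simp
  also have "\<dots> = (LBINT u:{0<..}. complex_of_real (psi (kronecker (int d)) u * u powr (\<sigma> - 1)))"
    by (intro set_lebesgue_integral_cong) (use eq in auto)
  also have "\<dots> = complex_of_real (LBINT u:{0<..}. psi (kronecker (int d)) u * u powr (\<sigma> - 1))"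
    unfolding set_lebesgue_integral_def by (simp add: scaleR_conv_of_real flip: integral_complex_of_real)
  finally have E: "Dirichlet_L (kronecker (int d)) (of_real \<sigma>) * of_real (Gamma \<sigma>) = complex_of_real (LBINT u:{0<..}. psi (kronecker (int d)) u * u powr (\<sigma> - 1))"
    by (simp add: Gamma_complex_of_real)
  have G: "Gamma \<sigma> > 0" using \<sigma> by (rule Gamma_real_pos)
  show ?thesis
  proof (rule that[OF _ _ int])
    show "(LBINT u:{0<..}. psi (kronecker (int d)) u * u powr (\<sigma> - 1)) / Gamma \<sigma> * Gamma \<sigma> = (LBINT u:{0<..}. psi (kronecker (int d)) u * u powr (\<sigma> - 1))"
      using G by simp
    show "Dirichlet_L (kronecker (int d)) (of_real \<sigma>) = of_real ((LBINT u:{0<..}. psi (kronecker (int d)) u * u powr (\<sigma> - 1)) / Gamma \<sigma>)"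
      using E G by (simp add: field_simps)
  qed
qed

subsection \<open>A lower bound for the number of primes\<close>

definition primes_le :: "real \<Rightarrow> nat set" where "primes_le y = {p. prime p \<and> real p \<le> y}"

lemma finite_primes_le [simp]: "finite (primes_le y)"
proof (rule finite_subset)
  show "primes_le y \<subseteq> {..nat \<lfloor>y\<rfloor>}" unfolding primes_le_def by (auto simp: le_nat_floor)
qed auto

text \<open>Nair's argument: the integral of \<open>x\<^sup>n (1 - x)\<^sup>n\<close> over the unit interval is a positive
  rational number below \<open>4\<^sup>-\<^sup>n\<close> whose denominator divides every common multiple of
  \<open>1, \<dots>, 2n + 1\<close>.\<close>

lemma four_power_le_common_multiple:
  assumes M: "\<And>m. m \<in> {1..2 * n + 1} \<Longrightarrow> m dvd M" and M0: "M > 0"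
  shows "4 ^ n \<le> (M::nat)"
proof -
  define I where "I = (\<Sum>k\<le>n. (-1) ^ k * real (n choose k) / real (n + k + 1))"
  have poly: "x ^ n * (1 - x) ^ n = (\<Sum>k\<le>n. (-1) ^ k * real (n choose k) * x ^ (n + k))" for x :: real
  proof -
    have "(1 - x) ^ n = (\<Sum>k\<le>n. real (n choose k) * (- x) ^ k * 1 ^ (n - k))"
      using binomial_ring[of "- x" 1 n] by (simp add: add.commute)
    thus ?thesis by (simp add: sum_distrib_left power_minus[of x] power_add mult_ac)
  qed
  have "((\<lambda>x. \<Sum>k\<le>n. (-1) ^ k * real (n choose k) * x ^ (n + k)) has_integral I) {0..1}"
    unfolding I_def
  proof (rule has_integral_sum)
    fix k
    have "((\<lambda>x::real. x ^ (n + k)) has_integral (1 ^ Suc (n + k) / real (Suc (n + k)) - 0 ^ Suc (n + k) / real (Suc (n + k)))) {0..1}"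
      by (rule fundamental_theorem_of_calculus)
         (auto intro!: derivative_eq_intros simp flip: has_real_derivative_iff_has_vector_derivative simp del: power_Suc of_nat_Suc)
    hence "((\<lambda>x::real. x ^ (n + k)) has_integral (1 / real (n + k + 1))) {0..1}" by simp
    from has_integral_mult_right[OF this, of "(-1) ^ k * real (n choose k)"]
    show "((\<lambda>x. (-1) ^ k * real (n choose k) * x ^ (n + k)) has_integral ((-1) ^ k * real (n choose k) / real (n + k + 1))) {0..1}"
      by simp
  qed auto
  hence I: "((\<lambda>x. x ^ n * (1 - x) ^ n) has_integral I) {0..1}" by (simp only: poly)
  have "I \<le> (1/4) ^ n"
  proof -
    have c: "((\<lambda>x::real. (1/4::real) ^ n) has_integral (1/4) ^ n) {0..1}"
      using has_integral_const_real[of "(1/4::real) ^ n" 0 1] by simp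
    have "x ^ n * (1 - x) ^ n \<le> (1/4) ^ n" if "x \<in> {0..1}" for x :: real
    proof -
      have "0 \<le> (x - 1/2)\<^sup>2" by simp
      hence "x * (1 - x) \<le> 1/4" by (simp add: power2_eq_square algebra_simps)
      thus ?thesis using that unfolding power_mult_distrib[symmetric] by (intro power_mono) auto
    qed
    thus ?thesis by (intro has_integral_le[OF I c]) auto
  qed
  moreover have "I > 0"
  proof (rule ccontr)
    assume "\<not> I > 0"
    moreover have "I \<ge> 0" by (rule has_integral_nonneg[OF I]) auto
    ultimately have "I = 0" by simp
    have "(1/2) ^ n * (1 - 1/2) ^ n = (0::real)"
    proof (rule has_integral_0_cbox_imp_0[where f = "\<lambda>x::real. x ^ n * (1 - x) ^ n" and a = 0 and b = 1 and x = "1/2"])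
      show "continuous_on (cbox 0 1) (\<lambda>x::real. x ^ n * (1 - x) ^ n)" by (intro continuous_intros)
      show "((\<lambda>x::real. x ^ n * (1 - x) ^ n) has_integral 0) (cbox 0 1)" using I \<open>I = 0\<close> by simp
    qed auto
    thus False by simp
  qed
  moreover have "\<exists>z::int. real M * I = of_int z"
  proof -
    have "\<exists>z::int. real M * ((-1) ^ k * real (n choose k) / real (n + k + 1)) = of_int z" if k: "k \<le> n" for k
    proof -
      have "n + k + 1 dvd M" using k by (intro M) auto
      then obtain c where "M = (n + k + 1) * c" by (auto elim: dvdE)
      hence "real M * ((-1) ^ k * real (n choose k) / real (n + k + 1)) = of_int ((-1) ^ k * int (n choose k) * int c)"
        by (simp add: field_simps)
      thus ?thesis by blast
    qed
    then obtain z where z: "\<And>k. k \<le> n \<Longrightarrow> real M * ((-1) ^ k * real (n choose k) / real (n + k + 1)) = of_int (z k :: int)"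
      by metis
    have "real M * I = of_int (\<Sum>k\<le>n. z k)"
      unfolding I_def sum_distrib_left of_int_sum by (intro sum.cong refl z) auto
    thus ?thesis by blast
  qed
  then obtain z :: int where z: "real M * I = of_int z" by blast
  ultimately have "of_int z > (0::real)" using M0 by (metis mult_pos_pos of_nat_0_less_iff)
  hence "1 \<le> real M * I" unfolding z by simp
  also have "\<dots> \<le> real M * (1/4) ^ n" using \<open>I \<le> (1/4) ^ n\<close> by (intro mult_left_mono) auto
  finally have "4 ^ n \<le> real M" by (simp add: field_simps)
  thus ?thesis by (metis of_nat_le_iff of_nat_numeral of_nat_power)
qed

text \<open>The product M of the largest powers p^(e p) <= N is divisible by every m <= N, and each
  of its factors is at most N; the lower bound for common multiples therefore bounds the number of
  factors.\<close>

lemma four_power_le_primes: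
  assumes N: "N = 2 * n + 1"
  shows "4 ^ n \<le> N ^ card (primes_le (real N))"
proof -
  let ?P = "primes_le (real N)"
  have N0: "N \<ge> 1" using N by simp
  define e where "e p = Max {k. p ^ k \<le> N}" for p
  have fin: "finite {k. p ^ k \<le> N}" if "prime p" for p
  proof (rule finite_subset)
    show "{k. p ^ k \<le> N} \<subseteq> {..N}"
    proof
      fix k assume "k \<in> {k. p ^ k \<le> N}"
      moreover have "k < p ^ k" using that using prime_gt_1_nat[of p] by (intro power_gt_expt) auto
      ultimately show "k \<in> {..N}" by simp
    qed
  qed auto
  have eN: "p ^ e p \<le> N" if "prime p" for p
  proof -
    have "e p \<in> {k. p ^ k \<le> N}" unfolding e_def using N0 by (intro Max_in fin[OF that]) (auto intro!: exI[of _ 0])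
    thus ?thesis by simp
  qed
  define M where "M = (\<Prod>p\<in>?P. p ^ e p)"
  have prP: "prime p" if "p \<in> ?P" for p using that by (simp add: primes_le_def)
  have M0: "M > 0" unfolding M_def by (intro prod_pos) (auto simp: prP prime_gt_0_nat)
  have "m dvd M" if m: "m \<in> {1..2 * n + 1}" for m
  proof (rule multiplicity_le_imp_dvd)
    show "m \<noteq> 0" using m by simp
    fix p :: nat assume p: "prime p"
    have "p ^ multiplicity p m dvd m" by (rule multiplicity_dvd)
    hence le: "p ^ multiplicity p m \<le> m" using m by (intro dvd_imp_le) auto
    hence "multiplicity p m \<in> {k. p ^ k \<le> N}" using m N by simp
    hence mle: "multiplicity p m \<le> e p" unfolding e_def using fin[OF p] by (intro Max_ge)
    show "multiplicity p m \<le> multiplicity p M"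
    proof (cases "p \<in> ?P")
      case True
      have "multiplicity p M = e p"
        unfolding M_def using True prP by (subst multiplicity_prod_prime_powers) auto
      thus ?thesis using mle by simp
    next
      case False
      hence "p > m" using p m N by (auto simp: primes_le_def)
      hence "\<not> p dvd m" using m by (auto dest: dvd_imp_le)
      thus ?thesis by (simp add: not_dvd_imp_multiplicity_0)
    qed
  qed
  hence "4 ^ n \<le> M" using M0 by (rule four_power_le_common_multiple)
  also have "M \<le> (\<Prod>p\<in>?P. N)" unfolding M_def by (intro prod_mono) (auto simp: eN prP)
  finally show ?thesis by simp
qed

lemma card_primes_le_ge:
  assumes y: "y \<ge> 3"
  shows "(y - 3) * ln 2 / ln y \<le> real (card (primes_le y))"
proof -
  \<comment> \<open>The largest n with 2 n + 1 <= y, so that 2 n > y - 3.\<close>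
  define n where "n = nat \<lfloor>(y - 1) / 2\<rfloor>"
  define N where "N = 2 * n + 1"
  have n: "real n \<le> (y - 1) / 2" "(y - 1) / 2 < real n + 1"
  proof -
    have "real n = of_int \<lfloor>(y - 1) / 2\<rfloor>" using y by (simp add: n_def)
    thus "real n \<le> (y - 1) / 2" "(y - 1) / 2 < real n + 1" by linarith+
  qed
  have Ny: "real N \<le> y" unfolding N_def using n by simp
  have "1 \<le> (y - 1) / 2" using y by simp
  also note n(2)
  finally have "n \<ge> 1" by simp
  hence N3: "N \<ge> 3" by (simp add: N_def)
  have "4 ^ n \<le> N ^ card (primes_le (real N))" by (rule four_power_le_primes) (simp add: N_def)
  hence "(4::real) ^ n \<le> real N ^ card (primes_le (real N))" by (metis of_nat_le_iff of_nat_numeral of_nat_power)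
  hence "ln ((4::real) ^ n) \<le> ln (real N ^ card (primes_le (real N)))" using N3 by (subst ln_le_cancel_iff) auto
  hence 1: "real n * ln 4 \<le> real (card (primes_le (real N))) * ln (real N)" using N3 by (simp add: ln_realpow)
  have "card (primes_le (real N)) \<le> card (primes_le y)"
    using Ny by (intro card_mono finite_primes_le) (auto simp: primes_le_def)
  hence "real (card (primes_le (real N))) * ln (real N) \<le> real (card (primes_le y)) * ln y"
    using Ny N3 y by (intro mult_mono) auto
  moreover have "(y - 3) * ln 2 \<le> real n * ln 4"
  proof -
    have "ln (4::real) = 2 * ln 2" using ln_realpow[of 2 2] by simp
    moreover have "(y - 3) * ln 2 \<le> (real n * 2) * ln 2" using n by (intro mult_right_mono) auto
    ultimately show ?thesis by simp
  qed
  ultimately have "(y - 3) * ln 2 \<le> real (card (primes_le y)) * ln y" using 1 by linarith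
  thus ?thesis using y by (subst pos_divide_le_eq) auto
qed

text \<open>Every p^(-\<sigma>) is at least y^(-\<sigma>), and 1 + t >= exp(t / 2) for t in [0, 1],
  so only the number of primes matters. The constant lost is harmless because the choice of y leaves
  room in the exponent of log x.\<close>

lemma prod_primes_le_exp:
  assumes \<sigma>: "0 < \<sigma>" "\<sigma> < 1" and y: "y \<ge> 3"
  shows "(\<Prod>p\<in>primes_le y. 1 + real p powr (- \<sigma>)) \<ge> exp ((y - 3) * y powr (- \<sigma>) * ln 2 / (2 * ln y))"
proof -
  have "exp ((y - 3) * y powr (- \<sigma>) * ln 2 / (2 * ln y)) = exp ((y - 3) * ln 2 / ln y * (y powr (- \<sigma>) / 2))"
    by (simp add: mult_ac)
  also have "\<dots> \<le> exp (real (card (primes_le y)) * (y powr (- \<sigma>) / 2))"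
    using card_primes_le_ge[OF y] by (subst exp_le_cancel_iff, intro mult_right_mono) auto
  also have "\<dots> = (\<Prod>p\<in>primes_le y. exp (y powr (- \<sigma>) / 2))" by (simp only: prod_constant exp_of_nat_mult)
  also have "\<dots> \<le> (\<Prod>p\<in>primes_le y. 1 + real p powr (- \<sigma>))"
  proof (rule prod_mono, safe)
    fix p assume p: "p \<in> primes_le y"
    hence p1: "real p \<ge> 1" "real p \<le> y" by (auto simp: primes_le_def prime_gt_0_nat Suc_leI)
    define t where "t = real p powr (- \<sigma>)"
    have "t \<le> real p powr 0" unfolding t_def using p1 \<sigma> by (intro powr_mono) auto
    hence t: "0 \<le> t" "t \<le> 1" using p1 by (auto simp: t_def)
    have "y powr (- \<sigma>) \<le> t" unfolding t_def using p1 \<sigma> by (intro powr_mono2') auto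
    hence "exp (y powr (- \<sigma>) / 2) \<le> exp (t / 2)" by simp
    also have "exp (t / 2) \<le> 1 + t / 2 + (t / 2)\<^sup>2" using t by (intro exp_bound) auto
    also have "\<dots> \<le> 1 + t"
    proof -
      have "t * t \<le> t * 1" using t by (intro mult_left_mono) auto
      thus ?thesis using t by (simp add: power2_eq_square)
    qed
    finally show "exp (y powr (- \<sigma>) / 2) \<le> 1 + real p powr (- \<sigma>)" by (simp add: t_def)
  qed auto
  finally show ?thesis .
qed

subsection \<open>A residue class with prescribed quadratic characters\<close>

lemma finite_int_interval_filter [simp]:
  "finite {d. d \<in> {A..<B::int} \<and> P d}" "finite {d. A \<le> d \<and> d < (B::int) \<and> P d}"
  by (rule finite_subset[of _ "{A..<B}"]; auto)+

lemma prime_modulus_coprime: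
  assumes "prime p" "prime p'" "p \<noteq> p'"
  shows "coprime (if p = 2 then 8 else p) (if p' = 2 then 8 else p' :: nat)"
proof -
  have c: "coprime p p'" using assms by (rule primes_coprime)
  have 8: "coprime (8::nat) x" if "coprime 2 x" for x
    using coprime_power_left_iff[of 2 3 x] that by simp
  show ?thesis using c assms(3) 8[of p] 8[of p'] by (auto simp: coprime_commute)
qed

text \<open>The class 5 modulo 8 settles both d = 1 mod 4 and \<chi>_d(2) = -1; modulo an odd p a
  nonresidue is chosen, and the Chinese remainder theorem combines them. As 2 is in S, the moduli 8
  and p multiply to 4 times the product of S.\<close>

lemma ex_prescribed_class:
  assumes S: "finite S" "\<And>p. p \<in> S \<Longrightarrow> prime p" "2 \<in> S"
  obtains r :: int where "\<And>d. [d = r] (mod int (4 * \<Prod>S)) \<Longrightarrow> [d = 5] (mod 8) \<and> (\<forall>p\<in>S. kronecker d p = -1)"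
proof -
  define m where "m p = (if p = 2 then 8 else p :: nat)" for p
  have "\<exists>u. p \<noteq> 2 \<longrightarrow> Legendre u (int p) = -1" if "p \<in> S" for p
    using ex_nonresidue[of p] S(2)[OF that] primes_dvd_imp_eq[of 2 p] by (cases "p = 2") auto
  then obtain u where u: "\<And>p. p \<in> S \<Longrightarrow> p \<noteq> 2 \<Longrightarrow> Legendre (u p) (int p) = -1" by metis
  define t where "t p = (if p = 2 then 5 else nat (u p mod int p))" for p
  have "\<exists>x. \<forall>i\<in>S. [x = t i] (mod m i)"
  proof (rule chinese_remainder_nat[OF S(1)])
    show "\<forall>i\<in>S. \<forall>j\<in>S. i \<noteq> j \<longrightarrow> coprime (m i) (m j)"
      unfolding m_def using prime_modulus_coprime S(2) by blast
  qed
  then obtain x where x: "\<And>p. p \<in> S \<Longrightarrow> [x = t p] (mod m p)" by blast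
  have Q: "4 * \<Prod>S = (\<Prod>p\<in>S. m p)"
  proof -
    have "S = insert 2 (S - {2})" using S by auto
    hence "\<Prod>S = 2 * \<Prod>(S - {2})" "(\<Prod>p\<in>S. m p) = 8 * (\<Prod>p\<in>S - {2}. m p)"
      using S prod.remove[of S 2 "\<lambda>p. p"] prod.remove[of S 2 m] by (auto simp: m_def)
    moreover have "(\<Prod>p\<in>S - {2}. m p) = \<Prod>(S - {2})" by (intro prod.cong) (auto simp: m_def)
    ultimately show ?thesis by simp
  qed
  show ?thesis
  proof (rule that[of "int x"])
    fix d assume d: "[d = int x] (mod int (4 * \<Prod>S))"
    have dm: "[d = int (t p)] (mod int (m p))" if "p \<in> S" for p
    proof -
      have "m p dvd 4 * \<Prod>S" unfolding Q using S that by (intro dvd_prodI) auto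
      hence "[d = int x] (mod int (m p))" using d by (meson cong_dvd_modulus int_dvd_int_iff)
      moreover have "[int x = int (t p)] (mod int (m p))" using x[OF that] by (simp add: cong_int_iff)
      ultimately show ?thesis by (rule cong_trans)
    qed
    have d5: "[d = 5] (mod 8)" using dm[OF S(3)] by (simp add: m_def t_def)
    hence d8: "d mod 8 = 5" by (simp add: cong_def)
    have "kronecker d p = -1" if p: "p \<in> S" for p
    proof (cases "p = 2")
      case True
      have "odd d" using d8 by presburger
      thus ?thesis using True d8 by (simp add: kronecker_prime_eq kronecker_prime_def)
    next
      case False
      have p0: "int p > 0" using S(2)[OF p] by (simp add: prime_gt_0_nat)
      have "[d = u p mod int p] (mod int p)" using dm[OF p] False p0 by (simp add: m_def t_def)
      hence "[d = u p] (mod int p)" by (simp add: cong_def)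
      hence "Legendre d (int p) = -1" using u[OF p False] Legendre_cong by metis
      thus ?thesis using False S(2)[OF p] by (simp add: kronecker_prime_eq kronecker_prime_def)
    qed
    thus "[d = 5] (mod 8) \<and> (\<forall>p\<in>S. kronecker d p = -1)" using d5 by blast
  qed
qed

lemma sum_inverse_squares_le:
  assumes "(a::nat) \<ge> 2" shows "(\<Sum>n\<in>{a..b}. 1 / (real n)\<^sup>2) \<le> 1 / (real a - 1)"
proof -
  \<comment> \<open>The maximum makes the telescoped bound 0 on the empty range b < a, where the
    induction starts.\<close>
  have "(\<Sum>n\<in>{a..b}. 1 / (real n)\<^sup>2) \<le> 1 / (real a - 1) - 1 / (real (max (a - 1) b))"
  proof (induction b)
    case 0
    thus ?case using assms by (simp add: of_nat_diff max_def)
  next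
    case (Suc b)
    show ?case
    proof (cases "Suc b < a")
      case True
      hence "max (a - 1) (Suc b) = a - 1" by simp
      thus ?thesis using assms True by (simp add: of_nat_diff)
    next
      case False
      have b1: "b \<ge> 1" using False assms by simp
      have "1 / (real (Suc b))\<^sup>2 \<le> 1 / real b - 1 / real (Suc b)"
      proof -
        have "1 / (real (Suc b))\<^sup>2 \<le> 1 / (real b * real (Suc b))"
          unfolding power2_eq_square using b1 by (intro divide_left_mono mult_right_mono) auto
        also have "\<dots> = 1 / real b - 1 / real (Suc b)" using b1 by (simp add: field_simps)
        finally show ?thesis .
      qed
      moreover have "max (a - 1) b = b" "max (a - 1) (Suc b) = Suc b" using False by auto
      moreover have "{a..Suc b} = insert (Suc b) {a..b}" using False by auto
      ultimately show ?thesis using Suc by simp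
    qed
  qed
  also have "\<dots> \<le> 1 / (real a - 1)" by simp
  finally show ?thesis .
qed

lemma card_progression_ge:
  fixes A B r q :: int
  assumes q: "q > 0" and AB: "A \<le> B"
  shows "real (card {d. d \<in> {A..<B} \<and> [d = r] (mod q)}) \<ge> (B - A) / q - 1"
proof -
  define d0 where "d0 = A + (r - A) mod q"
  define K where "K = (B - A) div q"
  have K0: "K \<ge> 0" unfolding K_def using q AB by (simp add: pos_imp_zdiv_nonneg_iff)
  have d0: "A \<le> d0" "d0 < A + q" unfolding d0_def using q by auto
  have cong: "[d0 = r] (mod q)"
    unfolding d0_def cong_def by (simp add: mod_simps)
  have inj: "inj_on (\<lambda>k. d0 + q * k) {0..<K}" using q by (auto intro!: inj_onI)
  have "(\<lambda>k. d0 + q * k) ` {0..<K} \<subseteq> {d. d \<in> {A..<B} \<and> [d = r] (mod q)}"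
  proof safe
    fix k assume k: "k \<in> {0..<K}"
    have "q * k \<le> q * (K - 1)" using k q by (intro mult_left_mono) auto
    hence "q * k \<le> q * K - q" by (simp add: algebra_simps)
    moreover have "q * K \<le> B - A" unfolding K_def using q by (metis minus_mod_eq_mult_div add_le_same_cancel1 diff_le_eq le_add_same_cancel1 pos_mod_sign)
    moreover have "q * k \<ge> 0" using k q by auto
    ultimately show "d0 + q * k \<in> {A..<B}" using d0 by auto
    show "[d0 + q * k = r] (mod q)" using cong by (simp add: cong_def)
  qed
  hence "card ((\<lambda>k. d0 + q * k) ` {0..<K}) \<le> card {d. d \<in> {A..<B} \<and> [d = r] (mod q)}"
    by (intro card_mono) simp_all
  hence "nat K \<le> card {d. d \<in> {A..<B} \<and> [d = r] (mod q)}" by (simp add: card_image[OF inj])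
  hence "real_of_int K \<le> real (card {d. d \<in> {A..<B} \<and> [d = r] (mod q)})" using K0 by linarith
  moreover have "(B - A) / q - 1 \<le> real_of_int K" unfolding K_def using real_of_int_div3[of "B - A" q] by linarith
  ultimately show ?thesis by linarith
qed

text \<open>A d in the class that is not squarefree is divisible by p^2 for a prime p > y, as
  smaller primes are excluded by the class, and p <= sqrt B. The classes modulo q p^2 remove at most
  a proportion 2 / y in total, and the rounding errors, one for each p, add up to at most sqrt
  B.\<close>

lemma card_squarefree_progression:
  fixes A B r q :: int and y :: real
  assumes q: "q > 0" and AB: "0 < A" "A \<le> B" and y: "y \<ge> 2"
    and small: "\<And>p d. prime p \<Longrightarrow> real p \<le> y \<Longrightarrow> [d = r] (mod q) \<Longrightarrow> \<not> int p dvd d"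
    and cop: "\<And>p. prime p \<Longrightarrow> real p > y \<Longrightarrow> coprime q (int p)"
  shows "real (card {d. d \<in> {A..<B} \<and> [d = r] (mod q) \<and> squarefree d}) \<ge> (B - A) / q * (1 - 2 / y) - 1 - sqrt B"
proof -
  let ?D = "{d. d \<in> {A..<B} \<and> [d = r] (mod q)}" and ?S = "{d. d \<in> {A..<B} \<and> [d = r] (mod q) \<and> squarefree d}"
  define a b where "a = nat \<lfloor>y\<rfloor> + 1" and "b = nat \<lfloor>sqrt B\<rfloor>"
  define T where "T n = {d \<in> ?D. int n ^ 2 dvd d}" for n :: nat
  let ?P = "{n. prime n \<and> n \<in> {a..b}}"
  have fin: "finite ?D" by (rule finite_subset[of _ "{A..<B}"]) auto
  have ay: "real n > y" if "n \<ge> a" for n using that y unfolding a_def by linarith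
  have a2: "a \<ge> 3" using y unfolding a_def by (simp add: le_nat_iff le_floor_iff)
  have sub: "?D \<subseteq> ?S \<union> (\<Union>n\<in>?P. T n)"
  proof
    fix d assume d: "d \<in> ?D"
    show "d \<in> ?S \<union> (\<Union>n\<in>?P. T n)"
    proof (cases "squarefree d")
      case False
      then obtain x where x: "x\<^sup>2 dvd d" "\<not> is_unit x" by (rule not_squarefreeE)
      have d0: "d > 0" "d < B" using d AB by auto
      hence "x \<noteq> 0" using x by auto
      hence "nat \<bar>x\<bar> \<noteq> 1" using x by auto
      then obtain p where p: "prime p" "p dvd nat \<bar>x\<bar>" using prime_factor_nat by blast
      hence "int p dvd x" by (metis dvd_abs_iff int_dvd_int_iff int_nat_eq abs_ge_zero)
      hence pd: "int p ^ 2 dvd d" using x by (meson dvd_power_same dvd_trans)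
      hence "int p dvd d" by (meson dvd_power dvd_trans zero_less_numeral)
      hence "\<not> real p \<le> y" using small[OF p(1)] d by blast
      hence pa: "p \<ge> a" using y unfolding a_def by (auto simp: not_le) linarith
      have "int p ^ 2 \<le> d" using pd d0 by (intro zdvd_imp_le) auto
      hence "real_of_int (int p ^ 2) \<le> real_of_int B" using d0 by linarith
      hence "real p \<le> sqrt B" by (intro real_le_rsqrt) simp
      hence pb: "p \<le> b" unfolding b_def by (intro le_nat_floor)
      show ?thesis using p(1) pa pb d pd by (auto simp: T_def)
    qed (use d in auto)
  qed
  have cT: "real (card (T n)) \<le> (B - A) / q * (1 / (real n)\<^sup>2) + 1" if n: "n \<in> ?P" for n
  proof (cases "T n = {}")
    case True
    thus ?thesis using AB q by simp
  next
    case False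
    then obtain d0 where d0: "d0 \<in> T n" by blast
    have "coprime q (int n)" using cop[of n] ay[of n] n by auto
    hence co: "coprime q (int n ^ 2)" by simp
    have n0: "int n ^ 2 > 0" using n by (auto simp: prime_gt_0_nat)
    have "T n \<subseteq> {d. d \<in> {A..<B} \<and> [d = d0] (mod (q * int n ^ 2))}"
    proof
      fix d assume d: "d \<in> T n"
      have "[d = d0] (mod q)" using d d0 unfolding T_def by (auto intro: cong_trans cong_sym)
      moreover have "[d = d0] (mod (int n ^ 2))" using d d0 unfolding T_def by (auto simp: cong_iff_dvd_diff)
      ultimately have "[d = d0] (mod (q * int n ^ 2))" using co by (rule coprime_cong_mult)
      thus "d \<in> {d. d \<in> {A..<B} \<and> [d = d0] (mod (q * int n ^ 2))}" using d by (auto simp: T_def)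
    qed
    hence "card (T n) \<le> card {d. d \<in> {A..<B} \<and> [d = d0] (mod (q * int n ^ 2))}"
      by (intro card_mono) simp_all
    hence "real (card (T n)) \<le> real (card {d. d \<in> {A..<B} \<and> [d = d0] (mod (q * int n ^ 2))})" by simp
    also have "\<dots> \<le> (B - A) / (q * int n ^ 2) + 1" using q n0 AB by (intro card_progression_le) auto
    finally show ?thesis by simp
  qed
  have finP: "finite ?P" by (rule finite_subset[of _ "{a..b}"]) auto
  have "real (card ?D) \<le> real (card (?S \<union> (\<Union>n\<in>?P. T n)))"
    using sub finP by (intro of_nat_mono card_mono) (auto simp: T_def)
  also have "\<dots> \<le> real (card ?S + card (\<Union>n\<in>?P. T n))" by (intro of_nat_mono card_Un_le)
  also have "\<dots> \<le> real (card ?S + (\<Sum>n\<in>?P. card (T n)))" by (intro of_nat_mono add_left_mono card_UN_le finP)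
  also have "\<dots> = real (card ?S) + (\<Sum>n\<in>?P. real (card (T n)))" by simp
  also have "(\<Sum>n\<in>?P. real (card (T n))) \<le> (\<Sum>n\<in>?P. (B - A) / q * (1 / (real n)\<^sup>2) + 1)" by (intro sum_mono cT)
  also have "\<dots> \<le> (\<Sum>n\<in>{a..b}. (B - A) / q * (1 / (real n)\<^sup>2) + 1)"
    using AB q by (intro sum_mono2) auto
  also have "\<dots> = (B - A) / q * (\<Sum>n\<in>{a..b}. 1 / (real n)\<^sup>2) + real (Suc b - a)"
    by (simp only: sum.distrib sum_distrib_left) simp
  also have "\<dots> \<le> (B - A) / q * (2 / y) + sqrt B"
  proof (intro add_mono mult_left_mono)
    have "(\<Sum>n\<in>{a..b}. 1 / (real n)\<^sup>2) \<le> 1 / (real a - 1)" using a2 by (intro sum_inverse_squares_le) auto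
    also have "\<dots> \<le> 2 / y"
    proof -
      have "real a > y" by (rule ay) simp
      hence "real a - 1 \<ge> y / 2" using y by linarith
      thus ?thesis using y by (simp add: field_simps)
    qed
    finally show "(\<Sum>n\<in>{a..b}. 1 / (real n)\<^sup>2) \<le> 2 / y" .
    have "real (Suc b - a) \<le> real b" using a2 by simp
    also have "\<dots> \<le> sqrt B" unfolding b_def using AB by (simp add: of_nat_floor)
    finally show "real (Suc b - a) \<le> sqrt B" .
    show "0 \<le> (B - A) / q" using AB q by simp
  qed
  finally have "real (card ?D) \<le> real (card ?S) + ((B - A) / q * (2 / y) + sqrt B)" by simp
  moreover have "real (card ?D) \<ge> (B - A) / q - 1" using q AB by (intro card_progression_ge) auto
  moreover have "(B - A) / q * (1 - 2 / y) = (B - A) / q - (B - A) / q * (2 / y)" by (simp only: right_diff_distrib mult_1_right)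
  ultimately show ?thesis by linarith
qed

subsection \<open>Small nonzero values\<close>

lemma eventually_powr_small:
  assumes "c > 0" "e > 0" shows "eventually (\<lambda>x::real. x powr (- c) \<le> e) at_top"
proof -
  have "((\<lambda>x::real. x powr (- c)) \<longlongrightarrow> 0) at_top" using assms by (intro tendsto_neg_powr filterlim_ident) auto
  hence "eventually (\<lambda>x::real. x powr (- c) < e) at_top" using assms by (intro order_tendstoD) auto
  thus ?thesis by eventually_elim simp
qed

lemma two_power_card_le_prod:
  assumes "finite S" "\<And>p. p \<in> S \<Longrightarrow> prime p" shows "2 ^ card S \<le> (\<Prod>S :: nat)"
proof -
  have "(\<Prod>p\<in>S. 2) \<le> (\<Prod>p\<in>S. p)" using assms by (intro prod_mono) (auto simp: prime_ge_2_nat)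
  thus ?thesis by simp
qed

lemma sifted_psi_split:
  assumes S: "2 \<in> S" and S1: "\<And>p. p \<in> S \<Longrightarrow> prime p" and u: "u > 0"
  shows "psi (sift S (kronecker d)) u = psi (sieved_jac {n. n \<ge> 2 \<and> (\<forall>p\<in>S. \<not> p dvd n)} d) u + exp (- u)"
proof -
  let ?P = "{n. n \<ge> 2 \<and> (\<forall>p\<in>S. \<not> p dvd n)}"
  interpret multiplicative_coeffs "kronecker d" by (rule multiplicative_coeffs_kronecker)
  have "(\<lambda>n. real_of_int (sift S (kronecker d) (Suc n)) * exp (- real (Suc n) * u) - real_of_int (sieved_jac ?P d (Suc n)) * exp (- real (Suc n) * u))
     sums (psi (sift S (kronecker d)) u - psi (sieved_jac ?P d) u)"
    by (intro sums_diff bounded_coeffs.psi_sums[OF bounded_sift u] bounded_coeffs.psi_sums[OF bounded_coeffs_sieved_jac u])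
  also have "(\<lambda>n. real_of_int (sift S (kronecker d) (Suc n)) * exp (- real (Suc n) * u) - real_of_int (sieved_jac ?P d (Suc n)) * exp (- real (Suc n) * u))
      = (\<lambda>n. if n = 0 then exp (- u) else 0)"
  proof
    fix n
    show "real_of_int (sift S (kronecker d) (Suc n)) * exp (- real (Suc n) * u) - real_of_int (sieved_jac ?P d (Suc n)) * exp (- real (Suc n) * u) = (if n = 0 then exp (- u) else 0)"
    proof (cases "n = 0")
      case True
      have "\<not> (\<exists>p\<in>S. p dvd 1)" using S1 not_prime_unit by blast
      thus ?thesis using True by (simp add: sift_def sieved_jac_def)
    next
      case False
      show ?thesis
      proof (cases "\<exists>p\<in>S. p dvd Suc n")
        case True
        thus ?thesis using False by (auto simp: sift_def sieved_jac_def)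
      next
        case ndvd: False
        hence "odd (Suc n)" using S by blast
        thus ?thesis using ndvd False by (simp add: sift_def sieved_jac_def kronecker_odd)
      qed
    qed
  qed
  finally have "(\<lambda>n. if n = 0 then exp (- u) else 0) sums (psi (sift S (kronecker d)) u - psi (sieved_jac ?P d) u)" .
  moreover have "(\<lambda>n. if n = 0 then exp (- u) else 0) sums (exp (- u))" using sums_single[of 0 "\<lambda>_. exp (-u)"] by simp
  ultimately show ?thesis using sums_unique2 by fastforce
qed

text \<open>With G = Gamma(\<sigma>) and PS the product over primes up to y, the mean square of l PS
  G - G over the admissible d is below (G/2)^2. So l PS lies between 1/2 and 3/2 for some d: the
  lower bound makes l positive, the upper bound makes it small.\<close>

theorem exists_small_L_value:
  fixes \<sigma> \<rho> :: real
  assumes \<sigma>: "1/2 < \<sigma>" "\<sigma> < 1" and \<rho>: "\<rho> = 2 * \<sigma> - 1"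
  obtains X0 Y0 where
    "\<And>x y. x \<ge> X0 \<Longrightarrow> y \<ge> Y0 \<Longrightarrow> 4 * real (\<Prod>(primes_le y)) \<le> x powr (\<rho> / 64) \<Longrightarrow>
      \<exists>d l. d mod 8 = 5 \<and> squarefree (d::nat) \<and> x \<le> real d \<and> real d \<le> 5/2 * x \<and>
        Dirichlet_L (kronecker (int d)) (of_real \<sigma>) = of_real l \<and> 0 < l \<and> l * (\<Prod>p\<in>primes_le y. 1 + real p powr (- \<sigma>)) \<le> 3/2"
proof -
  have r: "0 < \<rho>" "\<rho> < 1" using \<sigma> \<rho> by auto
  obtain C1 where C1: "C1 > 0" and large: "\<And>q A B r P y v. q > 0 \<Longrightarrow> (\<And>n. n \<in> P \<Longrightarrow> n \<ge> 2 \<and> odd n \<and> coprime q (int n) \<and> real n \<ge> y) \<Longrightarrow> y \<ge> 1 \<Longrightarrow> v > 0 \<Longrightarrow>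
      (\<Sum>d | d \<in> {A..<B} \<and> [d = r] (mod q). (LBINT u:{v<..}. psi (sieved_jac P d) u * u powr (\<sigma> - 1))\<^sup>2)
       \<le> C1 * (real (card {d. d \<in> {A..<B} \<and> [d = r] (mod q)}) * y powr (- \<rho> / 8) + v powr (\<rho> / 8 - 2))"
    using large_u_contribution[OF \<sigma> \<rho>] by blast
  obtain C2 where C2: "C2 > 0" and small: "\<And>(A::int) (B::int) (v::real). A > 0 \<Longrightarrow> A < B \<Longrightarrow> v > 0 \<Longrightarrow>
      (\<Sum>d | d \<in> {A..<B} \<and> [d = 5] (mod 8) \<and> squarefree d. (LBINT u:{0<..v}. psi (kronecker d) u * u powr (\<sigma> - 1))\<^sup>2)
       \<le> C2 * (A powr (- \<rho>) * (real (card {d. d \<in> {A..<B} \<and> [d = 5] (mod 8)}) * (v * B) powr (9 * \<rho> / 8) + (v * B) powr (5 * \<rho> / 4 + 2)))"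
    using small_u_contribution[OF \<sigma> \<rho>] by blast
  define G where "G = Gamma \<sigma>"
  have G: "G > 0" unfolding G_def using \<sigma> by (intro Gamma_real_pos) auto
  have "eventually (\<lambda>y::real. y powr (- (\<rho>/8)) \<le> G\<^sup>2 / (576 * C1) \<and> y \<ge> 20) at_top"
    using r G C1 by (intro eventually_conj eventually_powr_small eventually_ge_at_top) auto
  then obtain Y0 where Y0: "\<And>y. y \<ge> Y0 \<Longrightarrow> y powr (- (\<rho>/8)) \<le> G\<^sup>2 / (576 * C1) \<and> y \<ge> 20"
    unfolding eventually_at_top_linorder by blast
  \<comment> \<open>One condition for each later estimate: the power \<sigma>/2 for E, 3\<rho>/64
    for the large-u part W, 15\<rho>/64 for the small-u part T, and the last two for counting the
    d.\<close>
  have "eventually (\<lambda>x::real. x powr (- (\<sigma>/2)) \<le> \<sigma> * G / 7 \<and> x powr (- (3 * \<rho> / 64)) \<le> G\<^sup>2 / (192 * C1) \<and>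
     x powr (- (15 * \<rho> / 64)) \<le> G\<^sup>2 / (96 * 162 * C2) \<and> x powr (- (1/4)) \<le> 1/10 \<and> x \<ge> 100) at_top"
    using r G C1 C2 \<sigma> by (intro eventually_conj eventually_powr_small eventually_ge_at_top) auto
  then obtain X0 where X0: "\<And>x::real. x \<ge> X0 \<Longrightarrow> x powr (- (\<sigma>/2)) \<le> \<sigma> * G / 7 \<and> x powr (- (3 * \<rho> / 64)) \<le> G\<^sup>2 / (192 * C1) \<and>
     x powr (- (15 * \<rho> / 64)) \<le> G\<^sup>2 / (96 * 162 * C2) \<and> x powr (- (1/4)) \<le> 1/10 \<and> x \<ge> 100"
    unfolding eventually_at_top_linorder by blast
  show ?thesis
  proof (rule that[of X0 Y0])
    fix x y assume x: "x \<ge> X0" and y: "y \<ge> Y0" and Qx: "4 * real (\<Prod>(primes_le y)) \<le> x powr (\<rho> / 64)"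
    note X = X0[OF x] and Y = Y0[OF y]
    have x100: "x \<ge> 100" and y20: "y \<ge> 20" using X Y by auto
    define S where "S = primes_le y"
    have S: "finite S" "\<And>p. p \<in> S \<Longrightarrow> prime p" "2 \<in> S" using y20 by (auto simp: S_def) (auto simp: primes_le_def)
    define Q where "Q = int (4 * \<Prod>S)"
    have prodS: "\<Prod>S > 0" using S by (intro prod_pos) (auto simp: prime_gt_0_nat)
    have Q0: "Q > 0" using prodS by (simp add: Q_def del: of_nat_prod)
    have Q1: "real_of_int Q \<ge> 1" using Q0 by linarith
    have Qle: "real_of_int Q \<le> x powr (\<rho>/64)" using Qx by (simp add: Q_def S_def)
    obtain r0 where r0: "\<And>d. [d = r0] (mod Q) \<Longrightarrow> [d = 5] (mod 8) \<and> (\<forall>p\<in>S. kronecker d p = -1)"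
      using ex_prescribed_class[OF S] unfolding Q_def by blast
    define A B where "A = \<lceil>x\<rceil>" and "B = \<lfloor>5/2 * x\<rfloor> + 1"
    have AB: "real_of_int A \<ge> x" "real_of_int A \<le> x + 1" "real_of_int B \<le> 5/2 * x + 1" "real_of_int B > 5/2 * x"
      unfolding A_def B_def by linarith+
    have A0: "A > 0" "A < B" using AB x100 by linarith+
    define Dr where "Dr = {d. d \<in> {A..<B} \<and> [d = r0] (mod Q)}"
    define Ds where "Ds = {d. d \<in> {A..<B} \<and> [d = r0] (mod Q) \<and> squarefree d}"
    have fin: "finite Dr" "finite Ds" by (simp_all add: Dr_def Ds_def)
    have x14: "x powr (1/4) \<ge> 10"
    proof -
      have "x powr (1/4) * x powr (- (1/4)) = 1" using x100 by (simp flip: powr_add)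
      moreover have "x powr (1/4) * x powr (- (1/4)) \<le> x powr (1/4) * (1/10)" using X by (intro mult_left_mono) auto
      ultimately show ?thesis by linarith
    qed
    have Q14: "real_of_int Q \<le> x powr (1/4)"
    proof -
      have "x powr (\<rho>/64) \<le> x powr (1/4)" using x100 r by (intro powr_mono) auto
      thus ?thesis using Qle by linarith
    qed
    have xQ: "x / Q \<ge> 10 * x powr (1/2)"
    proof -
      have "10 * x powr (1/2) * Q \<le> x powr (1/4) * x powr (1/2) * x powr (1/4)" 
        using x14 Q14 Q1 by (intro mult_mono) auto
      also have "\<dots> = x" using x100 by (simp flip: powr_add)
      finally show ?thesis using Q0 by (simp add: field_simps)
    qed
    have xh: "x powr (1/2) = sqrt x" using x100 by (simp add: powr_half_sqrt)
    have sq10: "sqrt x \<ge> 10" using x100 by (intro real_le_rsqrt) simp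
    have BAQ: "(B - A) / Q \<ge> 7/5 * (x / Q)" "(B - A) / Q \<le> 8/5 * (x / Q)"
    proof -
      have "7/5 * x \<le> B - A" "B - A \<le> 8/5 * x" using AB x100 by linarith+
      hence "(7/5 * x) / Q \<le> (B - A) / Q" "(B - A) / Q \<le> (8/5 * x) / Q"
        using Q0 by (intro divide_right_mono; simp)+
      thus "(B - A) / Q \<ge> 7/5 * (x / Q)" "(B - A) / Q \<le> 8/5 * (x / Q)" by simp_all
    qed
    have cardDr: "real (card Dr) \<le> 3 * (x / Q)"
    proof -
      have "real (card Dr) \<le> (B - A) / Q + 1" unfolding Dr_def using A0 Q0 by (intro card_progression_le) auto
      thus ?thesis using BAQ xQ xh sq10 by linarith
    qed
    have cardDs: "real (card Ds) \<ge> 1/2 * (x / Q)"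
    proof -
      have "real (card Ds) \<ge> (B - A) / Q * (1 - 2 / y) - 1 - sqrt B"
        unfolding Ds_def
      proof (rule card_squarefree_progression)
        show "\<not> int p dvd d" if "prime p" "real p \<le> y" "[d = r0] (mod Q)" for p d
        proof
          assume pd: "int p dvd d"
          have pS: "p \<in> S" using that by (simp add: S_def primes_le_def)
          have "kronecker d p = -1" using r0[OF that(3)] pS by blast
          hence k: "kronecker_prime d p = -1" using kronecker_prime_eq[OF that(1), of d] by simp
          show False
          proof (cases "p = 2")
            case True
            thus ?thesis using k pd by (simp add: kronecker_prime_def)
          next
            case False
            thus ?thesis using k pd Legendre_eq_0_iff[of d "int p"] by (simp add: kronecker_prime_def)
          qed
        qed
        show "coprime Q (int p)" if p: "prime p" "real p > y" for p
        proof -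
          have "coprime s p" if "s \<in> S" for s
          proof (rule primes_coprime)
            show "s \<noteq> p" using that p by (auto simp: S_def primes_le_def)
          qed (use S that p in auto)
          hence "coprime (\<Prod>S) p" by (intro prod_coprime_left)
          moreover have "coprime (4::nat) p"
          proof -
            have "coprime 2 p" using p y20 by (intro primes_coprime) auto
            thus ?thesis using coprime_power_left_iff[of 2 2 p] by simp
          qed
          ultimately have "coprime (4 * \<Prod>S) p" by simp
          thus ?thesis unfolding Q_def by (simp only: coprime_int_iff)
        qed
      qed (use Q0 A0 y20 in auto)
      moreover have "(B - A) / Q * (1 - 2 / y) \<ge> (7/5 * (x / Q)) * (9/10)"
      proof (intro mult_mono BAQ)
        show "9/10 \<le> 1 - 2 / y" using y20 by (simp add: field_simps)
      qed (use BAQ x100 Q0 in auto)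
      moreover have "sqrt B \<le> 2 * sqrt x"
      proof -
        have "real_of_int B \<le> 2\<^sup>2 * x" using AB x100 by simp
        hence "sqrt B \<le> sqrt (2\<^sup>2 * x)" by simp
        thus ?thesis by (simp add: real_sqrt_mult)
      qed
      moreover have "1/2 * t \<le> c" if "c \<ge> z - 1 - b" "z \<ge> (7/5 * t) * (9/10)" "b \<le> 2 * s" "t \<ge> 10 * s" "s \<ge> 10" for b c s t z :: real
        using that by linarith
      ultimately show ?thesis using xQ[unfolded xh] sq10 by blast
    qed
    have Dspos: "real (card Ds) > 0" using cardDs x100 Q0 by (smt (verit) divide_pos_pos of_int_0_less_iff zero_less_mult_iff)
    \<comment> \<open>At v = x^(-1/2) the error for large u is v^(\<rho>/8-2) = x^(1-\<rho>/16), and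
      for small u the length v B is of order x^(1/2). Both errors are then smaller than x / Q, which
      is the order of the number of d.\<close>
    define v where "v = x powr (- (1/2))"
    have v0: "v > 0" using x100 by (simp add: v_def)
    define P where "P = {n. n \<ge> 2 \<and> (\<forall>p\<in>S. \<not> p dvd n)}"
    \<comment> \<open>The sifted integral splits into T for u <= v and, for u > v, into W plus the
      term n = 1. That term is the Gamma integral G except for the piece E over (0, v].\<close>
    define T where "T d = (LBINT u:{0<..v}. psi (sift S (kronecker d)) u * u powr (\<sigma> - 1))" for d
    define W where "W d = (LBINT u:{v<..}. psi (sieved_jac P d) u * u powr (\<sigma> - 1))" for d
    define E where "E = (LBINT u:{0<..v}. u powr (\<sigma> - 1) * exp (- 1 * u))"
    define PS where "PS = (\<Prod>p\<in>S. 1 + real p powr (- \<sigma>))"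
    have SW: "(\<Sum>d\<in>Ds. (W d)\<^sup>2) \<le> real (card Ds) * G\<^sup>2 / 48"
    proof -
      \<comment> \<open>Correlations are bounded over full progressions only, so squarefreeness is
        dropped by positivity.\<close>
      have "(\<Sum>d\<in>Ds. (W d)\<^sup>2) \<le> (\<Sum>d\<in>Dr. (W d)\<^sup>2)" by (intro sum_mono2 fin) (auto simp: Dr_def Ds_def)
      also have "\<dots> \<le> C1 * (real (card Dr) * y powr (- \<rho> / 8) + v powr (\<rho> / 8 - 2))"
        unfolding W_def Dr_def
      proof (rule large)
        fix n assume n: "n \<in> P"
        have n2: "n \<ge> 2" and nS: "\<And>p. p \<in> S \<Longrightarrow> \<not> p dvd n" using n by (auto simp: P_def)
        have on: "odd n" using nS[OF S(3)] by simp
        have "coprime s n" if "s \<in> S" for s using S(2)[OF that] nS[OF that] by (rule prime_imp_coprime)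
        hence "coprime (\<Prod>S) n" by (intro prod_coprime_left)
        moreover have "coprime (4::nat) n" using on coprime_power_left_iff[of 2 2 n] by simp
        ultimately have "coprime (4 * \<Prod>S) n" by simp
        hence cop: "coprime Q (int n)" unfolding Q_def by (simp only: coprime_int_iff)
        obtain p where p: "prime p" "p dvd n" using n2 prime_factor_nat[of n] by auto
        have "p \<notin> S" using p nS by blast
        hence "real p > y" using p(1) by (auto simp: S_def primes_le_def)
        moreover have "p \<le> n" using p n2 by (intro dvd_imp_le) auto
        ultimately show "n \<ge> 2 \<and> odd n \<and> coprime Q (int n) \<and> real n \<ge> y" using n2 on cop by auto
      qed (use Q0 y20 v0 in auto)
      also have "v powr (\<rho> / 8 - 2) = x powr (1 - \<rho>/16)" unfolding v_def powr_powr by (rule arg_cong[of _ _ "\<lambda>t. x powr t"]) (simp add: field_simps)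
      \<comment> \<open>The constants add up to 3/576 + 1/192 = (1/2) (1/48), where the 1/2 matches
        the lower bound for the number of d.\<close>
      also have "C1 * (real (card Dr) * y powr (- \<rho> / 8) + x powr (1 - \<rho>/16)) \<le> C1 * (3 * (x / Q) * (G\<^sup>2 / (576 * C1)) + (x / Q) * (G\<^sup>2 / (192 * C1)))"
      proof (intro mult_left_mono add_mono mult_mono cardDr)
        show "y powr (- \<rho> / 8) \<le> G\<^sup>2 / (576 * C1)" using Y by simp
        have "x powr (1 - \<rho>/16) * Q \<le> x powr (1 - \<rho>/16) * x powr (\<rho>/64)" using Qle by (intro mult_left_mono) auto
        also have "\<dots> = x powr (1 + (- (3 * \<rho> / 64)))" unfolding powr_add[symmetric] by (rule arg_cong[of _ _ "\<lambda>t. x powr t"]) (simp add: field_simps)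
        also have "\<dots> = x * x powr (- (3 * \<rho> / 64))" using x100 by (subst powr_add) simp
        also have "\<dots> \<le> x * (G\<^sup>2 / (192 * C1))" using X x100 by (intro mult_left_mono) auto
        finally have "x powr (1 - \<rho>/16) \<le> x * (G\<^sup>2 / (192 * C1)) / Q" using Q0 by (subst pos_le_divide_eq) auto
        thus "x powr (1 - \<rho>/16) \<le> (x / Q) * (G\<^sup>2 / (192 * C1))" by (simp only: times_divide_eq_left)
      qed (use C1 x100 Q0 in auto)
      also have "\<dots> = (1/2 * (x / Q)) * G\<^sup>2 / 48" using C1 by (simp add: field_simps)
      also have "\<dots> \<le> real (card Ds) * G\<^sup>2 / 48" using cardDs by (intro divide_right_mono mult_right_mono) auto
      finally show ?thesis .
    qed
    have dprops: "nat d mod 4 = 1" "nat d mod 8 = 5" "nat d > 1" "squarefree (nat d)" "int (nat d) = d" if d: "d \<in> Ds" for d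
    proof -
      have d0: "d > 0" using d A0 by (auto simp: Ds_def)
      show nd: "int (nat d) = d" using d0 by simp
      have "[d = 5] (mod 8)" using d r0 by (auto simp: Ds_def)
      hence d8: "d mod 8 = 5" by (simp add: cong_def)
      show n8: "nat d mod 8 = 5" using d8 d0 by (metis nat_mod_distrib nat_numeral zero_le_numeral less_imp_le)
      hence "nat d mod 8 mod 4 = 1" by simp
      thus "nat d mod 4 = 1" by (simp add: mod_mod_cancel)
      show "nat d > 1" using n8 by (metis One_nat_def mod_less neq0_conv less_one linorder_neqE_nat mod_0 numeral_eq_one_iff one_less_numeral_iff semiring_norm(76) semiring_norm(77) zero_neq_numeral order_less_trans num.distinct(3))
      show "squarefree (nat d)"
      proof (rule squarefreeI)
        fix z assume "z\<^sup>2 dvd nat d"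
        hence "(int z)\<^sup>2 dvd d" using nd by (metis int_dvd_int_iff of_nat_power)
        hence "int z dvd 1" using d by (auto simp: Ds_def dest: squarefreeD)
        thus "z dvd 1" by simp
      qed
    qed
    have dint: "set_integrable lborel {0<..} (\<lambda>u. psi (kronecker d) u * u powr (\<sigma> - 1))" if d: "d \<in> Ds" for d
      using kronecker_L_real[OF dprops(1,3,4)[OF d], of \<sigma>] \<sigma> dprops(5)[OF d] by (metis less_trans zero_less_divide_1_iff zero_less_numeral)
    have ST: "(\<Sum>d\<in>Ds. (T d)\<^sup>2) \<le> real (card Ds) * G\<^sup>2 / 48"
    proof -
      define V where "V = v * real (\<Prod>S)"
      define M where "M = C2 * (A powr (- \<rho>) * (real (card {d. d \<in> {A..<B} \<and> [d = 5] (mod 8)}) * (V * B) powr (9 * \<rho> / 8) + (V * B) powr (5 * \<rho> / 4 + 2)))"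
      have "(\<Sum>d\<in>Ds. (T d)\<^sup>2) \<le> 4 ^ card S * M"
        unfolding T_def
      proof (rule sift_mellin_mean_square[where V = V])
        show "multiplicative_coeffs (kronecker d)" for d by (rule multiplicative_coeffs_kronecker)
        fix v' assume v': "0 < v'" "v' \<le> V"
        \<comment> \<open>The condition modulo Q is relaxed to d = 5 mod 8. This loses about a
          factor Q <= x^(\<rho>/64), which the saving from reflection affords.\<close>
        have "(\<Sum>d\<in>Ds. (LBINT u:{0<..v'}. psi (kronecker d) u * u powr (\<sigma> - 1))\<^sup>2) \<le> (\<Sum>d | d \<in> {A..<B} \<and> [d = 5] (mod 8) \<and> squarefree d. (LBINT u:{0<..v'}. psi (kronecker d) u * u powr (\<sigma> - 1))\<^sup>2)"
          using r0 by (intro sum_mono2) (auto simp: Ds_def)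
        also have "\<dots> \<le> C2 * (A powr (- \<rho>) * (real (card {d. d \<in> {A..<B} \<and> [d = 5] (mod 8)}) * (v' * B) powr (9 * \<rho> / 8) + (v' * B) powr (5 * \<rho> / 4 + 2)))"
          by (rule small[OF A0 v'(1)])
        also have "\<dots> \<le> M" unfolding M_def
          using C2 v' A0 r by (intro mult_left_mono add_mono powr_mono2 mult_right_mono) auto
        finally show "(\<Sum>d\<in>Ds. (LBINT u:{0<..v'}. psi (kronecker d) u * u powr (\<sigma> - 1))\<^sup>2) \<le> M" .
      qed (use dint S v0 \<sigma> in \<open>auto simp: V_def\<close>)
      also have "\<dots> \<le> x powr (\<rho>/32) * (162 * C2 * x powr (1 - \<rho>/4 - \<rho>/32))"
      proof (rule mult_mono)
        have "(2::real) ^ card S \<le> real (\<Prod>S)"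
          using two_power_card_le_prod[OF S(1,2)] by (metis of_nat_le_iff of_nat_numeral of_nat_power)
        also have "\<dots> \<le> Q" by (simp add: Q_def del: of_nat_prod)
        also have "\<dots> \<le> x powr (\<rho>/64)" by (rule Qle)
        finally have "((2::real) ^ card S)\<^sup>2 \<le> (x powr (\<rho>/64))\<^sup>2" by (intro power_mono) auto
        also have "(x powr (\<rho>/64))\<^sup>2 = x powr (\<rho>/32)" unfolding power2_eq_square powr_add[symmetric] by (rule arg_cong[of _ _ "\<lambda>t. x powr t"]) (simp add: field_simps)
        also have "((2::real) ^ card S)\<^sup>2 = 4 ^ card S" by (simp add: power2_eq_square flip: power_mult_distrib)
        finally show "4 ^ card S \<le> x powr (\<rho>/32)" .
        define Z where "Z = 3 * x powr (1/2 + \<rho>/64)"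
        have Z1: "Z > 0" using x100 by (simp add: Z_def)
        have VB: "V * B \<le> Z"
        proof -
          have "V \<le> v * x powr (\<rho>/64)" 
          proof -
            have "real (\<Prod>S) \<le> Q" by (simp add: Q_def del: of_nat_prod)
            hence "real (\<Prod>S) \<le> x powr (\<rho>/64)" using Qle by linarith
            thus ?thesis unfolding V_def using v0 by (intro mult_left_mono) auto
          qed
          moreover have "real_of_int B \<le> 3 * x" using AB x100 by linarith
          ultimately have "V * B \<le> (v * x powr (\<rho>/64)) * (3 * x)" using A0 v0 by (intro mult_mono) auto
          also have "\<dots> = 3 * (x powr (- (1/2)) * x powr (\<rho>/64) * x powr 1)" using x100 by (simp add: v_def)
          also have "x powr (- (1/2)) * x powr (\<rho>/64) * x powr 1 = x powr (1/2 + \<rho>/64)"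
            unfolding powr_add[symmetric] by (rule arg_cong[of _ _ "\<lambda>t. x powr t"]) (simp add: field_simps)
          finally show ?thesis by (simp add: Z_def)
        qed
        have VB0: "V * B > 0" unfolding V_def using v0 prodS A0 by (auto intro!: mult_pos_pos simp del: of_nat_prod)
        \<comment> \<open>Both exponents of V B that occur lie between 0 and 4, so the factor 3 in Z
          costs at most 3^4 = 81.\<close>
        have Zp: "(V * B) powr t \<le> 81 * x powr ((1/2 + \<rho>/64) * t)" if t: "0 \<le> t" "t \<le> 4" for t
        proof -
          have "(V * B) powr t \<le> Z powr t" using VB VB0 t by (intro powr_mono2) auto
          also have "\<dots> = 3 powr t * x powr ((1/2 + \<rho>/64) * t)" unfolding Z_def using x100 by (simp add: powr_mult powr_powr)
          also have "(3::real) powr t \<le> 3 powr 4" using t by (intro powr_mono) auto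
          also have "(3::real) powr 4 = 81" by simp
          finally show ?thesis by (simp add: mult_right_mono)
        qed
        have card5: "real (card {d. d \<in> {A..<B} \<and> [d = 5] (mod 8)}) \<le> x"
        proof -
          have "real (card {d. d \<in> {A..<B} \<and> [d = 5] (mod 8)}) \<le> real_of_int (B - A) / real_of_int 8 + 1" using A0 by (intro card_progression_le) auto
          moreover have "real_of_int (B - A) \<le> 8/5 * x" using AB x100 by linarith
          hence "real_of_int (B - A) / real_of_int 8 \<le> (8/5 * x) / real_of_int 8" by (intro divide_right_mono) auto
          moreover have "(8/5 * x) / real_of_int 8 + 1 \<le> x" using x100 by simp
          ultimately show ?thesis by linarith
        qed
        have Ap: "A powr (- \<rho>) \<le> x powr (- \<rho>)" using AB x100 r by (intro powr_mono2') auto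
        have "M \<le> C2 * (x powr (- \<rho>) * (x * (81 * x powr ((1/2 + \<rho>/64) * (9 * \<rho> / 8))) + 81 * x powr ((1/2 + \<rho>/64) * (5 * \<rho> / 4 + 2))))"
          unfolding M_def using C2 r x100 by (intro mult_left_mono mult_mono add_mono Ap card5 Zp) auto
        also have "\<dots> = 81 * C2 * (x powr (- \<rho>) * x powr 1 * x powr ((1/2 + \<rho>/64) * (9 * \<rho> / 8)) + x powr (- \<rho>) * x powr ((1/2 + \<rho>/64) * (5 * \<rho> / 4 + 2)))"
          using x100 by (simp add: algebra_simps)
        also have "\<dots> \<le> 81 * C2 * (x powr (1 - \<rho>/4 - \<rho>/32) + x powr (1 - \<rho>/4 - \<rho>/32))"
        proof (intro mult_left_mono add_mono)
          \<comment> \<open>The terms quadratic in \<rho>, which come from the exponent 1/2 +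
            \<rho>/64, are absorbed into linear ones. The target 1 - \<rho>/4 - \<rho>/32 is chosen
            to combine with the factor x^(\<rho>/32) that bounds 4^(card S).\<close>
          have rr: "\<rho> * \<rho> \<le> \<rho>" using r by (intro mult_left_le) auto
          show "x powr (- \<rho>) * x powr 1 * x powr ((1/2 + \<rho>/64) * (9 * \<rho> / 8)) \<le> x powr (1 - \<rho>/4 - \<rho>/32)"
            unfolding powr_add[symmetric] using x100 rr r by (intro powr_mono) (auto simp: algebra_simps)
          show "x powr (- \<rho>) * x powr ((1/2 + \<rho>/64) * (5 * \<rho> / 4 + 2)) \<le> x powr (1 - \<rho>/4 - \<rho>/32)"
            unfolding powr_add[symmetric] using x100 rr r by (intro powr_mono) (auto simp: algebra_simps)
        qed (use C2 in auto)
        finally show "M \<le> 162 * C2 * x powr (1 - \<rho>/4 - \<rho>/32)" by simp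
        show "0 \<le> M" unfolding M_def using C2 by (intro mult_nonneg_nonneg add_nonneg_nonneg) auto
      qed auto
      also have "\<dots> = 162 * C2 * (x powr (\<rho>/32) * x powr (1 - \<rho>/4 - \<rho>/32))" by simp
      also have "x powr (\<rho>/32) * x powr (1 - \<rho>/4 - \<rho>/32) = x powr (1 - \<rho>/4)"
        unfolding powr_add[symmetric] by (rule arg_cong[of _ _ "\<lambda>t. x powr t"]) (simp add: field_simps)
      also have "162 * C2 * x powr (1 - \<rho>/4) \<le> (1/2 * (x / Q)) * G\<^sup>2 / 48"
      proof -
        have "162 * C2 * (x powr (1 - \<rho>/4) * Q) \<le> 162 * C2 * (x powr (1 - \<rho>/4) * x powr (\<rho>/64))" using Qle C2 by (intro mult_left_mono) auto
        also have "x powr (1 - \<rho>/4) * x powr (\<rho>/64) = x powr (1 + (- (15 * \<rho> / 64)))" unfolding powr_add[symmetric] by (rule arg_cong[of _ _ "\<lambda>t. x powr t"]) (simp add: field_simps)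
        also have "\<dots> = x * x powr (- (15 * \<rho> / 64))" using x100 by (subst powr_add) simp
        also have "162 * C2 * (x * x powr (- (15 * \<rho> / 64))) \<le> 162 * C2 * (x * (G\<^sup>2 / (96 * 162 * C2)))" using X x100 C2 by (intro mult_left_mono) auto
        also have "\<dots> = x * G\<^sup>2 / 96" using C2 by (simp add: field_simps)
        finally show ?thesis using Q0 by (simp add: field_simps)
      qed
      also have "\<dots> \<le> real (card Ds) * G\<^sup>2 / 48" using cardDs by (intro divide_right_mono mult_right_mono) auto
      finally show ?thesis .
    qed
    have Gint: "set_integrable lborel {0<..} (\<lambda>u. u powr (\<sigma> - 1) * exp (- 1 * u))" using \<sigma> by (intro set_integrable_real_Gamma) auto
    have E: "0 \<le> E" "E \<le> G / 7"
    proof -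
      have I1: "set_integrable lborel {0<..v} (\<lambda>u. u powr (\<sigma> - 1) * exp (- 1 * u))" using Gint by (rule set_integrable_subset) auto
      have I2: "set_integrable lborel {0<..v} (\<lambda>u. u powr (\<sigma> - 1))" using \<sigma> v0 by (intro LBINT_real_powr_0) auto
      show "0 \<le> E" unfolding E_def set_lebesgue_integral_def by (intro integral_nonneg_AE AE_I2) (auto simp: indicator_def)
      have "E \<le> (LBINT u:{0<..v}. u powr (\<sigma> - 1))"
        unfolding E_def by (rule set_integral_mono[OF I1 I2]) (auto intro!: mult_left_le)
      also have "\<dots> = v powr \<sigma> / \<sigma>" using \<sigma> v0 by (intro LBINT_real_powr_0) auto
      also have "v powr \<sigma> = x powr (- (\<sigma>/2))" unfolding v_def powr_powr by (rule arg_cong[of _ _ "\<lambda>t. x powr t"]) (simp add: field_simps)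
      also have "x powr (- (\<sigma>/2)) / \<sigma> \<le> (\<sigma> * G / 7) / \<sigma>" using X \<sigma> by (intro divide_right_mono) auto
      also have "\<dots> = G / 7" using \<sigma> by simp
      finally show "E \<le> G / 7" .
    qed
    have main: "\<exists>l. Dirichlet_L (kronecker d) (of_real \<sigma>) = of_real l \<and> l * PS * G - G = T d + W d - E" if d: "d \<in> Ds" for d
    proof -
      obtain l where l: "Dirichlet_L (kronecker d) (of_real \<sigma>) = of_real l" "l * G = (LBINT u:{0<..}. psi (kronecker d) u * u powr (\<sigma> - 1))"
        using kronecker_L_real[OF dprops(1,3,4)[OF d], of \<sigma>] \<sigma> dprops(5)[OF d] unfolding G_def by (metis less_trans zero_less_divide_1_iff zero_less_numeral)
      interpret multiplicative_coeffs "kronecker d" by (rule multiplicative_coeffs_kronecker)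
      have un: "{0<..} = {0<..v} \<union> {v<..}" using v0 by auto
      note tot = sift_mellin_total[OF S(1,2) dint[OF d]]
      have I: "set_integrable lborel {0<..} (\<lambda>u. psi (sift S (kronecker d)) u * u powr (\<sigma> - 1))" using tot by blast
      have I1: "set_integrable lborel {0<..v} (\<lambda>u. psi (sift S (kronecker d)) u * u powr (\<sigma> - 1))"
        "set_integrable lborel {v<..} (\<lambda>u. psi (sift S (kronecker d)) u * u powr (\<sigma> - 1))"
        using I v0 by (auto intro: set_integrable_subset)
      have J: "set_integrable lborel {0<..v} (\<lambda>u. u powr (\<sigma> - 1) * exp (- 1 * u))" "set_integrable lborel {v<..} (\<lambda>u. u powr (\<sigma> - 1) * exp (- 1 * u))"
        using Gint v0 by (auto intro: set_integrable_subset)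
      have "(\<Prod>p\<in>S. 1 - of_int (kronecker d p) * real p powr (- \<sigma>)) = PS"
        unfolding PS_def using d r0 by (intro prod.cong refl) (auto simp: Ds_def)
      hence "PS * (l * G) = (LBINT u:{0<..}. psi (sift S (kronecker d)) u * u powr (\<sigma> - 1))" using tot l(2) by simp
      also have "\<dots> = T d + (LBINT u:{v<..}. psi (sift S (kronecker d)) u * u powr (\<sigma> - 1))"
        unfolding un T_def by (rule set_integral_Un[OF _ I1]) auto
      also have "(LBINT u:{v<..}. psi (sift S (kronecker d)) u * u powr (\<sigma> - 1)) = W d + (LBINT u:{v<..}. u powr (\<sigma> - 1) * exp (- 1 * u))"
      proof -
        have eq: "psi (sift S (kronecker d)) u * u powr (\<sigma> - 1) - u powr (\<sigma> - 1) * exp (- 1 * u) = psi (sieved_jac P d) u * u powr (\<sigma> - 1)" if "u \<in> {v<..}" for u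
          using sifted_psi_split[OF S(3,2), of u d] that v0 by (simp add: P_def algebra_simps)
        have "W d = (LBINT u:{v<..}. psi (sift S (kronecker d)) u * u powr (\<sigma> - 1) - u powr (\<sigma> - 1) * exp (- 1 * u))"
          unfolding W_def by (intro set_lebesgue_integral_cong) (use eq in auto)
        also have "\<dots> = (LBINT u:{v<..}. psi (sift S (kronecker d)) u * u powr (\<sigma> - 1)) - (LBINT u:{v<..}. u powr (\<sigma> - 1) * exp (- 1 * u))"
          by (rule set_integral_diff(2)[OF I1(2) J(2)])
        finally show ?thesis by simp
      qed
      also have "(LBINT u:{v<..}. u powr (\<sigma> - 1) * exp (- 1 * u)) = G - E"
      proof -
        have "G = (LBINT u:{0<..}. u powr (\<sigma> - 1) * exp (- 1 * u))" unfolding G_def using LBINT_real_Gamma[of \<sigma> 1] \<sigma> by simp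
        also have "\<dots> = E + (LBINT u:{v<..}. u powr (\<sigma> - 1) * exp (- 1 * u))"
          unfolding un E_def by (rule set_integral_Un[OF _ J]) auto
        finally show ?thesis by simp
      qed
      finally have "l * PS * G - G = T d + W d - E" by (simp add: mult_ac)
      thus ?thesis using l(1) by blast
    qed
    \<comment> \<open>Otherwise the mean square would be at least G^2 / 4, whereas (T + W - E)^2 <=
      3 (T^2 + W^2 + E^2) bounds it by (3/48 + 3/48 + 3/49) G^2.\<close>
    have "\<exists>d\<in>Ds. (T d + W d - E)\<^sup>2 < (G/2)\<^sup>2"
    proof (rule ccontr)
      assume "\<not> (\<exists>d\<in>Ds. (T d + W d - E)\<^sup>2 < (G/2)\<^sup>2)"
      hence "(\<Sum>d\<in>Ds. (G/2)\<^sup>2) \<le> (\<Sum>d\<in>Ds. (T d + W d - E)\<^sup>2)" by (intro sum_mono) auto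
      also have "\<dots> \<le> (\<Sum>d\<in>Ds. 3 * (T d)\<^sup>2 + 3 * (W d)\<^sup>2 + 3 * E\<^sup>2)"
      proof (rule sum_mono)
        fix d
        have "(T d + W d - E)\<^sup>2 + ((T d - W d)\<^sup>2 + (T d + E)\<^sup>2 + (W d + E)\<^sup>2) = 3 * (T d)\<^sup>2 + 3 * (W d)\<^sup>2 + 3 * E\<^sup>2"
          by (simp add: power2_eq_square algebra_simps)
        moreover have "(T d - W d)\<^sup>2 + (T d + E)\<^sup>2 + (W d + E)\<^sup>2 \<ge> 0" by simp
        ultimately show "(T d + W d - E)\<^sup>2 \<le> 3 * (T d)\<^sup>2 + 3 * (W d)\<^sup>2 + 3 * E\<^sup>2" by linarith
      qed
      also have "\<dots> = 3 * (\<Sum>d\<in>Ds. (T d)\<^sup>2) + 3 * (\<Sum>d\<in>Ds. (W d)\<^sup>2) + real (card Ds) * (3 * E\<^sup>2)"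
        by (simp add: sum.distrib sum_distrib_left)
      also have "\<dots> \<le> 3 * (real (card Ds) * G\<^sup>2 / 48) + 3 * (real (card Ds) * G\<^sup>2 / 48) + real (card Ds) * (3 * (G/7)\<^sup>2)"
        using ST SW E by (intro add_mono mult_left_mono power_mono) auto
      finally have "real (card Ds) * G\<^sup>2 * (1/4) \<le> real (card Ds) * G\<^sup>2 * (3/48 + 3/48 + 3/49)"
        by (simp add: power_divide algebra_simps)
      moreover have "real (card Ds) * G\<^sup>2 > 0" using Dspos G by simp
      ultimately show False by simp
    qed
    then obtain d where d: "d \<in> Ds" "(T d + W d - E)\<^sup>2 < (G/2)\<^sup>2" by blast
    obtain l where l: "Dirichlet_L (kronecker d) (of_real \<sigma>) = of_real l" "l * PS * G - G = T d + W d - E" using main[OF d(1)] by blast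
    have "\<bar>l * PS * G - G\<bar> < G/2" unfolding l(2) using d(2) G by (intro power2_less_imp_less[of "\<bar>T d + W d - E\<bar>" "G/2"]) auto
    hence "l * PS * G - G < G/2" "- (l * PS * G - G) < G/2" by (simp_all only: abs_less_iff)
    hence "l * PS * G > 1/2 * G" "l * PS * G < 3/2 * G" by linarith+
    hence lP: "l * PS > 1/2" "l * PS < 3/2" using G by (simp_all only: mult_less_cancel_right_pos)
    have "PS > 0" unfolding PS_def by (intro prod_pos) (auto intro: add_pos_nonneg)
    hence "l > 0" using lP(1) by (metis less_trans zero_less_divide_1_iff zero_less_numeral zero_less_mult_pos2)
    moreover have "x \<le> real (nat d) \<and> real (nat d) \<le> 5/2 * x"
    proof -
      have "d \<ge> A" "d \<le> \<lfloor>5/2 * x\<rfloor>" using d(1) by (auto simp: Ds_def B_def)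
      hence "real_of_int d \<ge> x" "real_of_int d \<le> 5/2 * x" unfolding A_def by linarith+
      thus ?thesis using dprops(5)[OF d(1)] by (metis of_int_of_nat_eq)
    qed
    ultimately show "\<exists>d l. d mod 8 = 5 \<and> squarefree (d::nat) \<and> x \<le> real d \<and> real d \<le> 5/2 * x \<and>
        Dirichlet_L (kronecker (int d)) (of_real \<sigma>) = of_real l \<and> 0 < l \<and> l * (\<Prod>p\<in>primes_le y. 1 + real p powr (- \<sigma>)) \<le> 3/2"
      using l(1) lP(2) dprops[OF d(1)] unfolding PS_def S_def by (intro exI[of _ "nat d"] exI[of _ l]) auto
  qed
qed

section \<open>The choice of the sieving range y\<close>

lemma prod_primes_le:
  assumes y: "y \<ge> 1" shows "real (\<Prod>(primes_le y)) \<le> y powr y"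
proof -
  have "real (\<Prod>(primes_le y)) = (\<Prod>p\<in>primes_le y. real p)" by simp
  also have "\<dots> \<le> (\<Prod>p\<in>primes_le y. y)" by (intro prod_mono) (auto simp: primes_le_def)
  also have "\<dots> = y powr real (card (primes_le y))" using y by (simp add: powr_realpow)
  also have "\<dots> \<le> y powr y"
  proof (rule powr_mono)
    have "primes_le y \<subseteq> {1..nat \<lfloor>y\<rfloor>}" by (auto simp: primes_le_def le_nat_floor prime_gt_0_nat Suc_leI)
    hence "card (primes_le y) \<le> card {1..nat \<lfloor>y\<rfloor>}" by (intro card_mono) auto
    thus "real (card (primes_le y)) \<le> y" using y by (simp add: le_nat_floor) linarith
  qed (use y in auto)
  finally show ?thesis .
qed

text \<open>With t = ln x and y = t^a this is the logarithm of 4 y^y <= x^c, so it bounds the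
  modulus; it holds because a < 1.\<close>

lemma asymp1: fixes a c :: real assumes "0 < a" "a < 1" "0 < c"
  shows "eventually (\<lambda>t. ln 4 + t powr a * ln (t powr a) \<le> c * t) at_top"
  using assms by real_asymp

lemma asymp2: fixes b c e k :: real assumes "0 < b" "b < e" "0 < c" "0 < k"
  shows "eventually (\<lambda>t. ln (3/2) * ln t + c * t powr b \<le> k * t powr e) at_top"
  using assms by real_asymp

text \<open>With t = ln x and y = t^a the right side is the exponent gained from the primes up to y,
  of order t^(a (1 - s)) / ln t. Since b < a (1 - s), it beats t^b / ln t with every constant
  c.\<close>

lemma asymp3: fixes a b c s :: real assumes a: "0 < a" "b < a * (1 - s)" "0 < b" "0 < c"
  shows "eventually (\<lambda>t. ln (3/2) + c * (t powr b / ln t) \<le> (t powr a - 3) * (t powr a) powr (- s) * ln 2 / (2 * ln (t powr a))) at_top"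
proof -
  define k where "k = ln 2 / (4 * a)"
  have "k > 0" using a by (simp add: k_def)
  hence "eventually (\<lambda>t. ln (3/2) * ln t + c * t powr b \<le> k * t powr (a * (1 - s))) at_top"
    using a by (intro asymp2) auto
  moreover have "filterlim (\<lambda>t::real. t powr a) at_top at_top" using a(1) by real_asymp
  hence "eventually (\<lambda>t. t powr a \<ge> 6) at_top" by (simp only: filterlim_at_top)
  ultimately show ?thesis using eventually_gt_at_top[of 1]
  proof eventually_elim
    case (elim t)
    have lt: "ln t > 0" using elim by simp
    have "ln (3/2) + c * (t powr b / ln t) = (ln (3/2) * ln t + c * t powr b) / ln t"
      using lt by (simp add: add_divide_distrib)
    also have "\<dots> \<le> (k * t powr (a * (1 - s))) / ln t" using elim lt by (intro divide_right_mono) auto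
    also have "\<dots> = (t powr a / 2) * (t powr a) powr (- s) * ln 2 / (2 * (a * ln t))"
    proof -
      have "t powr (a * (1 - s)) = t powr a * (t powr a) powr (- s)"
        unfolding powr_powr powr_add[symmetric] by (simp add: algebra_simps)
      thus ?thesis by (simp add: k_def mult_ac)
    qed
    also have "\<dots> \<le> (t powr a - 3) * (t powr a) powr (- s) * ln 2 / (2 * (a * ln t))"
      using elim lt a by (intro divide_right_mono mult_right_mono) auto
    also have "a * ln t = ln (t powr a)" using elim by (simp add: ln_powr)
    finally show ?case .
  qed
qed

theorem small_L_values:
  fixes \<sigma> :: real
  assumes \<sigma>: "1/2 < \<sigma>" "\<sigma> < 1"
  shows "eventually (\<lambda>x. \<exists>d l. d mod 8 = 5 \<and> squarefree (d::nat) \<and> x \<le> real d \<and> real d \<le> 5/2 * x \<and>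
        Dirichlet_L (kronecker (int d)) (of_real \<sigma>) = of_real l \<and> 0 < l \<and>
        l \<le> exp (- (4 * \<sigma>) * (ln x powr ((1 - \<sigma>) / (2 * \<sigma>)) / ln (ln x)))) at_top"
proof -
  define \<rho> where "\<rho> = 2 * \<sigma> - 1"
  obtain X0 Y0 where main: "\<And>x y. x \<ge> X0 \<Longrightarrow> y \<ge> Y0 \<Longrightarrow> 4 * real (\<Prod>(primes_le y)) \<le> x powr (\<rho> / 64) \<Longrightarrow>
      \<exists>d l. d mod 8 = 5 \<and> squarefree (d::nat) \<and> x \<le> real d \<and> real d \<le> 5/2 * x \<and>
        Dirichlet_L (kronecker (int d)) (of_real \<sigma>) = of_real l \<and> 0 < l \<and> l * (\<Prod>p\<in>primes_le y. 1 + real p powr (- \<sigma>)) \<le> 3/2"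
    using exists_small_L_value[OF \<sigma> \<rho>_def] by blast
  define a where "a = (1 / (2 * \<sigma>) + 1) / 2"
  define b where "b = (1 - \<sigma>) / (2 * \<sigma>)"
  have s: "1 / (2 * \<sigma>) < 1" using \<sigma> by (simp add: field_simps)
  have a: "0 < a" "a < 1" "1 / (2 * \<sigma>) < a" 
  proof -
    define w where "w = 1 / (2 * \<sigma>)"
    have "0 < w" "w < 1" using s \<sigma> by (auto simp: w_def)
    thus "0 < a" "a < 1" "1 / (2 * \<sigma>) < a" unfolding a_def w_def[symmetric] by auto
  qed
  have "b = (1 - \<sigma>) * (1 / (2 * \<sigma>))" by (simp add: b_def)
  also have "\<dots> < (1 - \<sigma>) * a" using a \<sigma> by (intro mult_strict_left_mono) auto
  finally have b: "b < a * (1 - \<sigma>)" "0 < b" using \<sigma> by (simp_all add: mult.commute b_def)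
  have "eventually (\<lambda>t. (ln 4 + t powr a * ln (t powr a) \<le> (\<rho>/64) * t \<and>
      ln (3/2) + 4 * \<sigma> * (t powr b / ln t) \<le> (t powr a - 3) * (t powr a) powr (- \<sigma>) * ln 2 / (2 * ln (t powr a))) \<and>
      t powr a \<ge> max Y0 3 \<and> t > 0) at_top"
  proof (intro eventually_conj)
    show "eventually (\<lambda>t. ln 4 + t powr a * ln (t powr a) \<le> (\<rho>/64) * t) at_top"
      using a \<sigma> by (intro asymp1) (auto simp: \<rho>_def)
    show "eventually (\<lambda>t. ln (3/2) + 4 * \<sigma> * (t powr b / ln t) \<le> (t powr a - 3) * (t powr a) powr (- \<sigma>) * ln 2 / (2 * ln (t powr a))) at_top"
      using a b \<sigma> by (intro asymp3) auto
    have "filterlim (\<lambda>t::real. t powr a) at_top at_top" using a(1) by real_asymp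
    thus "eventually (\<lambda>t::real. t powr a \<ge> max Y0 3) at_top" by (simp only: filterlim_at_top)
  qed (rule eventually_gt_at_top)
  hence "eventually (\<lambda>x. (ln 4 + ln x powr a * ln (ln x powr a) \<le> (\<rho>/64) * ln x \<and>
      ln (3/2) + 4 * \<sigma> * (ln x powr b / ln (ln x)) \<le> (ln x powr a - 3) * (ln x powr a) powr (- \<sigma>) * ln 2 / (2 * ln (ln x powr a))) \<and>
      ln x powr a \<ge> max Y0 3 \<and> ln x > 0) at_top"
    by (rule eventually_compose_filterlim[OF _ ln_at_top])
  moreover have "eventually (\<lambda>x. x \<ge> max X0 1) at_top" by (rule eventually_ge_at_top)
  ultimately show ?thesis
  proof eventually_elim
    case (elim x)
    define y where "y = ln x powr a"
    have y: "y \<ge> Y0" "y \<ge> 3" using elim by (auto simp: y_def)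
    have x: "x \<ge> X0" "x \<ge> 1" using elim by auto
    have "4 * real (\<Prod>(primes_le y)) \<le> 4 * y powr y" using y by (intro mult_left_mono prod_primes_le) auto
    also have "\<dots> = exp (ln 4 + y * ln y)" using y by (simp add: exp_add powr_def)
    also have "\<dots> \<le> exp ((\<rho>/64) * ln x)" using elim by (simp add: y_def)
    also have "\<dots> = x powr (\<rho>/64)" using x by (simp add: powr_def)
    finally obtain d l where dl: "d mod 8 = 5" "squarefree (d::nat)" "x \<le> real d" "real d \<le> 5/2 * x"
        "Dirichlet_L (kronecker (int d)) (of_real \<sigma>) = of_real l" "0 < l" "l * (\<Prod>p\<in>primes_le y. 1 + real p powr (- \<sigma>)) \<le> 3/2"
      using main[OF x(1) y(1)] by blast
    let ?e = "(y - 3) * y powr (- \<sigma>) * ln 2 / (2 * ln y)"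
    have "l * exp ?e \<le> l * (\<Prod>p\<in>primes_le y. 1 + real p powr (- \<sigma>))"
      using dl(6) y \<sigma> by (intro mult_left_mono prod_primes_le_exp) auto
    hence "l * exp ?e \<le> 3/2" using dl(7) by linarith
    hence "l * exp ?e * exp (- ?e) \<le> 3/2 * exp (- ?e)" by (intro mult_right_mono) auto
    hence "l \<le> 3/2 * exp (- ?e)" by (simp add: mult.assoc flip: exp_add)
    also have "\<dots> = exp (ln (3/2) - ?e)" by (simp add: exp_diff exp_minus field_simps)
    also have "\<dots> \<le> exp (- (4 * \<sigma>) * (ln x powr ((1 - \<sigma>) / (2 * \<sigma>)) / ln (ln x)))"
      using elim unfolding y_def b_def by (subst exp_le_cancel_iff) linarith
    finally show ?case using dl by blast
  qed
qed

subsection \<open>Counting ideals of quadratic orders by norm\<close>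

definition multiplicative :: "(nat \<Rightarrow> int) \<Rightarrow> bool" where
  "multiplicative f \<longleftrightarrow> f 1 = 1 \<and> (\<forall>m n. m > 0 \<longrightarrow> n > 0 \<longrightarrow> coprime m n \<longrightarrow> f (m * n) = f m * f n)"

definition dconv :: "(nat \<Rightarrow> int) \<Rightarrow> (nat \<Rightarrow> int) \<Rightarrow> nat \<Rightarrow> int" where
  "dconv f g n = (\<Sum>k | k dvd n. f k * g (n div k))"

lemma bij_betw_divisors_mult:
  assumes "coprime m (n::nat)"
  shows "bij_betw (\<lambda>(a, b). a * b) ({a. a dvd m} \<times> {b. b dvd n}) {k. k dvd m * n}"
proof -
  have *: "gcd (a * b) m = a" "gcd (a * b) n = b" if "a dvd m" "b dvd n" for a b
  proof -
    have c: "coprime b m" "coprime a n"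
      using assms that by (meson coprime_divisors coprime_commute dvd_refl)+
    show "gcd (a * b) m = a"
      using that c by (metis gcd.commute gcd_mult_left_right_cancel gcd_nat.absorb1 gcd_mult_right_right_cancel gcd_mult_right_left_cancel coprime_commute)
    show "gcd (a * b) n = b"
      using that c by (metis gcd.commute gcd_mult_left_right_cancel gcd_nat.absorb1 gcd_mult_right_right_cancel gcd_mult_right_left_cancel coprime_commute mult.commute)
  qed
  have "inj_on (\<lambda>(a, b). a * b) ({a. a dvd m} \<times> {b. b dvd n})"
    by (rule inj_onI) (use * in auto, metis *, metis *)
  moreover have "(\<lambda>(a, b). a * b) ` ({a. a dvd m} \<times> {b. b dvd n}) = {k. k dvd m * n}"
  proof (intro equalityI subsetI)
    fix k assume "k \<in> {k. k dvd m * n}"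
    then obtain a b where "k = a * b" "a dvd m" "b dvd n" using division_decomp[of k m n] by blast
    thus "k \<in> (\<lambda>(a, b). a * b) ` ({a. a dvd m} \<times> {b. b dvd n})" by auto
  qed (auto intro: mult_dvd_mono)
  ultimately show ?thesis by (simp add: bij_betw_def)
qed

lemma div_dvd_self: "(a::nat) dvd m \<Longrightarrow> m div a dvd m"
  by (metis dvd_div_mult_self dvd_triv_left)

lemma multiplicative_dconv:
  assumes f: "multiplicative f" and g: "multiplicative g"
  shows "multiplicative (dconv f g)"
  unfolding multiplicative_def
proof (intro conjI allI impI)
  show "dconv f g 1 = 1" using f g by (simp add: dconv_def multiplicative_def)
  fix m n :: nat assume mn: "m > 0" "n > 0" "coprime m n"
  have "dconv f g (m * n) = (\<Sum>(a,b)\<in>{a. a dvd m} \<times> {b. b dvd n}. f (a * b) * g (m * n div (a * b)))"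
    unfolding dconv_def
    by (subst sum.reindex_bij_betw[OF bij_betw_divisors_mult[OF mn(3)], symmetric]) (simp add: case_prod_unfold)
  also have "\<dots> = (\<Sum>(a,b)\<in>{a. a dvd m} \<times> {b. b dvd n}. (f a * g (m div a)) * (f b * g (n div b)))"
  proof (rule sum.cong[OF refl], clarify)
    fix a b assume ab: "a dvd m" "b dvd n"
    have 1: "a > 0" "b > 0" "m div a > 0" "n div b > 0" using ab mn by (auto simp: dvd_div_eq_0_iff intro!: Nat.gr0I)
    have 2: "coprime a b" using ab mn by (meson coprime_divisors)
    have 3: "coprime (m div a) (n div b)" 
      using coprime_divisors[OF div_dvd_self[OF ab(1)] div_dvd_self[OF ab(2)] mn(3)] .
    have 4: "m * n div (a * b) = (m div a) * (n div b)" using ab by (simp add: div_mult_div_if_dvd)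
    show "f (a * b) * g (m * n div (a * b)) = (f a * g (m div a)) * (f b * g (n div b))"
      using f g 1 2 3 unfolding multiplicative_def 4 by simp
  qed
  also have "\<dots> = dconv f g m * dconv f g n"
    by (simp add: dconv_def sum_product sum.cartesian_product)
  finally show "dconv f g (m * n) = dconv f g m * dconv f g n" .
qed

lemma multiplicative_eqI:
  assumes f: "multiplicative f" and g: "multiplicative g"
    and eq: "\<And>p k. prime p \<Longrightarrow> f (p ^ k) = g (p ^ k)" and "n > 0"
  shows "f n = g n"
  using \<open>n > 0\<close>
proof (induction n rule: less_induct)
  case (less n)
  show ?case
  proof (cases "n = 1")
    case True thus ?thesis using f g by (simp add: multiplicative_def)
  next
    case False
    then obtain p where p: "prime p" "p dvd n" using prime_factor_nat by blast
    obtain m where m: "n = p ^ multiplicity p n * m" "\<not> p dvd m"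
      using multiplicity_decompose'[of n p] less.prems p by (metis less_irrefl not_prime_unit)
    let ?k = "multiplicity p n"
    have k: "?k > 0" using p less.prems by (simp add: prime_multiplicity_gt_zero_iff)
    have c: "coprime (p ^ ?k) m" using m(2) p(1) by (simp add: prime_imp_coprime)
    have pos: "p ^ ?k > 0" "m > 0" using p m(1) less.prems by (auto simp: prime_gt_0_nat intro!: Nat.gr0I)
    have "p ^ ?k > 1" using k prime_gt_1_nat[OF p(1)] by (simp add: one_less_power del: One_nat_def)
    hence "m < p ^ ?k * m" using pos by simp
    hence "m < n" using m(1) by simp
    hence "f m = g m" using less.IH pos by blast
    hence "f (p ^ ?k * m) = g (p ^ ?k * m)"
      using f g pos c eq[OF p(1)] unfolding multiplicative_def by metis
    thus ?thesis using m(1) by simp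
  qed
qed

lemma dconv_prime_power:
  assumes "prime p"
  shows "dconv f g (p ^ k) = (\<Sum>i\<le>k. f (p ^ i) * g (p ^ (k - i)))"
proof -
  have p1: "p > 1" using assms by (rule prime_gt_1_nat)
  have "{j. j dvd p ^ k} = (\<lambda>i. p ^ i) ` {..k}"
    using divides_primepow_nat[OF assms] by auto
  moreover have "inj_on (\<lambda>i. p ^ i) {..k}" using p1 by (auto intro!: inj_onI)
  ultimately have "dconv f g (p ^ k) = (\<Sum>i\<le>k. f (p ^ i) * g (p ^ k div p ^ i))"
    by (simp add: dconv_def sum.reindex)
  also have "\<dots> = (\<Sum>i\<le>k. f (p ^ i) * g (p ^ (k - i)))"
    using p1 by (intro sum.cong refl) (simp add: power_diff)
  finally show ?thesis .
qed

text \<open>Its Dirichlet series is zeta(2s); it accounts for the scalar factor g of the lattices,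
  which contributes g^2 to the index.\<close>

definition square_ind :: "nat \<Rightarrow> int" where "square_ind n = (if \<exists>g. n = g\<^sup>2 then 1 else 0)"

lemma multiplicative_square_ind: "multiplicative square_ind"
proof -
  have "(\<exists>g. m * n = g\<^sup>2) \<longleftrightarrow> (\<exists>g. m = g\<^sup>2) \<and> (\<exists>g. n = g\<^sup>2)" if "coprime m n" for m n :: nat
    using is_nth_power_mult_coprime_nat_iff[OF that, of 2] unfolding is_nth_power_def by auto
  moreover have "\<exists>g::nat. 1 = g\<^sup>2" by (rule exI[of _ 1]) simp
  ultimately show ?thesis by (simp add: multiplicative_def square_ind_def)
qed

lemma square_ind_prime_power: "prime p \<Longrightarrow> square_ind (p ^ k) = (if even k then 1 else 0)"
proof -
  assume p: "prime p"
  have "(\<exists>g. p ^ k = g\<^sup>2) \<longleftrightarrow> even k"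
  proof
    assume "\<exists>g. p ^ k = g\<^sup>2"
    then obtain g where "p ^ k = g\<^sup>2" by blast
    hence "multiplicity p (p ^ k) = multiplicity p (g\<^sup>2)" by simp
    moreover have "g \<noteq> 0" using \<open>p ^ k = g\<^sup>2\<close> p by (metis not_prime_0 power_not_zero zero_power2)
    ultimately have "k = 2 * multiplicity p g"
      using p by (simp add: prime_elem_multiplicity_power_distrib)
    thus "even k" by simp
  next
    assume "even k"
    then obtain j where "k = 2 * j" by (elim evenE)
    hence "p ^ k = (p ^ j)\<^sup>2" by (metis mult.commute power_mult)
    thus "\<exists>g. p ^ k = g\<^sup>2" by blast
  qed
  thus ?thesis by (simp add: square_ind_def)
qed

text \<open>If \<omega>^2 = \<omega> + D, then b^2 + b - D is the norm of b + \<omega>; these b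
  parametrise the lattices \<int> a + \<int> (b + \<omega>) that are closed under \<omega>.\<close>

definition roots_mod :: "int \<Rightarrow> nat \<Rightarrow> int set" where
  "roots_mod D a = {b. 0 \<le> b \<and> b < int a \<and> int a dvd b\<^sup>2 + b - D}"

lemma finite_roots_mod [simp]: "finite (roots_mod D a)"
  by (rule finite_subset[of _ "{0..<int a}"]) (auto simp: roots_mod_def)

lemma quad_diff: "(b\<^sup>2 + b - D) - (c\<^sup>2 + c - D) = (b - c) * (b + c + 1)" for b :: int
  by (simp add: power2_eq_square algebra_simps)

lemma quad_dvd_cong:
  fixes a b c D :: int
  assumes "a dvd b - c" shows "a dvd b\<^sup>2 + b - D \<longleftrightarrow> a dvd c\<^sup>2 + c - D"
  using assms quad_diff[of b D c] by (metis dvd_diff_right_iff dvd_mult2 dvd_diff_left_iff)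

lemma quad_dvd_mod: "int a dvd (b mod int a)\<^sup>2 + b mod int a - D \<longleftrightarrow> int a dvd b\<^sup>2 + b - D"
  by (rule quad_dvd_cong) (metis dvd_minus_mod dvd_diff_commute)

lemma mod_in_roots_mod: "a > 0 \<Longrightarrow> int a dvd b\<^sup>2 + b - D \<Longrightarrow> b mod int a \<in> roots_mod D a"
  by (simp add: roots_mod_def quad_dvd_mod)

lemma multiplicative_roots_mod: "multiplicative (\<lambda>a. int (card (roots_mod D a)))"
  unfolding multiplicative_def
proof (intro conjI allI impI)
  have "roots_mod D 1 = {0}" by (auto simp: roots_mod_def)
  thus "int (card (roots_mod D 1)) = 1" by simp
  fix m n :: nat assume mn: "m > 0" "n > 0" "coprime m n"
  have cop: "coprime (int m) (int n)" using mn(3) by simp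
  have "bij_betw (\<lambda>b. (b mod int m, b mod int n)) (roots_mod D (m * n)) (roots_mod D m \<times> roots_mod D n)"
    unfolding bij_betw_def
  proof (intro conjI inj_onI equalityI subsetI)
    fix b c assume bc: "b \<in> roots_mod D (m * n)" "c \<in> roots_mod D (m * n)"
      "(b mod int m, b mod int n) = (c mod int m, c mod int n)"
    hence "int m dvd b - c" "int n dvd b - c" by (auto simp: mod_eq_dvd_iff)
    hence "int m * int n dvd b - c" using cop by (simp add: divides_mult)
    hence "b mod (int m * int n) = c mod (int m * int n)" by (simp add: mod_eq_dvd_iff)
    thus "b = c" using bc by (simp add: roots_mod_def)
  next
    fix z assume "z \<in> (\<lambda>b. (b mod int m, b mod int n)) ` roots_mod D (m * n)"
    then obtain b where b: "z = (b mod int m, b mod int n)" "b \<in> roots_mod D (m * n)" by blast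
    have "int m * int n dvd b\<^sup>2 + b - D" using b by (simp add: roots_mod_def)
    hence "int m dvd b\<^sup>2 + b - D" "int n dvd b\<^sup>2 + b - D" by (auto elim: dvd_mult_left dvd_mult_right)
    thus "z \<in> roots_mod D m \<times> roots_mod D n" using b mn by (simp add: mod_in_roots_mod)
  next
    fix z assume z: "z \<in> roots_mod D m \<times> roots_mod D n"
    obtain u v where uv: "z = (u, v)" by fastforce
    obtain x where x: "[x = u] (mod int m)" "[x = v] (mod int n)"
      using binary_chinese_remainder_int[OF cop] by blast
    let ?b = "x mod int (m * n)"
    have b1: "?b mod int m = x mod int m" "?b mod int n = x mod int n"
      by (simp_all add: mod_mod_cancel)
    have b2: "x mod int m = u" "x mod int n = v"
      using x z uv by (auto simp: cong_def roots_mod_def)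
    have "int m dvd x\<^sup>2 + x - D" "int n dvd x\<^sup>2 + x - D"
      using z uv b2 by (metis (no_types, lifting) SigmaE2 mem_Collect_eq quad_dvd_mod roots_mod_def)+
    hence "int (m * n) dvd x\<^sup>2 + x - D" using cop by (simp add: divides_mult)
    hence "?b \<in> roots_mod D (m * n)" using mn by (intro mod_in_roots_mod) auto
    moreover have "z = (?b mod int m, ?b mod int n)" using b1 b2 uv by simp
    ultimately show "z \<in> (\<lambda>b. (b mod int m, b mod int n)) ` roots_mod D (m * n)" by blast
  qed
  thus "int (card (roots_mod D (m * n))) = int (card (roots_mod D m)) * int (card (roots_mod D n))"
    by (simp add: bij_betw_same_card card_cartesian_product)
qed

lemma disc_identity:
  fixes D :: int assumes "int d = 4 * D + 1"
  shows "(2 * b + 1)\<^sup>2 = 4 * (b\<^sup>2 + b - D) + int d"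
  using assms by (simp add: power2_eq_square algebra_simps)

lemma roots_mod_not_dvd:
  assumes d: "int d = 4 * D + 1" and p: "prime p" "\<not> p dvd d" and "int p dvd b\<^sup>2 + b - D"
  shows "\<not> int p dvd 2 * b + 1"
proof
  assume "int p dvd 2 * b + 1"
  hence "int p dvd (2 * b + 1)\<^sup>2 - 4 * (b\<^sup>2 + b - D)" using assms(4) by (simp add: power2_eq_square dvd_mult del: right_diff_distrib_numeral)
  hence "int p dvd int d" using disc_identity[OF d, of b] by simp
  thus False using p by simp
qed

text \<open>Hensel lifting. A root b satisfies (2 b + 1)^2 = d modulo p, so the derivative 2 b + 1
  is a unit when p does not divide d, and each root modulo p^k lifts in exactly one way.\<close>

lemma hensel_roots_mod:
  assumes d: "int d = 4 * D + 1" and p: "prime p" "\<not> p dvd d" and k: "k > 0"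
  shows "card (roots_mod D (p ^ Suc k)) = card (roots_mod D (p ^ k))"
proof -
  let ?q = "int p ^ k"
  have p0: "p > 0" using p by (simp add: prime_gt_0_nat)
  have pr: "prime (int p)" using p by simp
  have pq: "int p dvd ?q" using k by (simp add: dvd_power)
  have "bij_betw (\<lambda>b. b mod ?q) (roots_mod D (p ^ Suc k)) (roots_mod D (p ^ k))"
    unfolding bij_betw_def
  proof (intro conjI inj_onI equalityI subsetI)
    fix b c assume bc: "b \<in> roots_mod D (p ^ Suc k)" "c \<in> roots_mod D (p ^ Suc k)" "b mod ?q = c mod ?q"
    have q: "int p ^ Suc k dvd b\<^sup>2 + b - D" "int p ^ Suc k dvd c\<^sup>2 + c - D"
      using bc by (simp_all add: roots_mod_def)
    have cb: "?q dvd b - c" using bc(3) by (simp add: mod_eq_dvd_iff)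
    have "int p dvd b\<^sup>2 + b - D" using q(1) by (metis dvd_mult_left power_Suc)
    hence "\<not> int p dvd 2 * b + 1" using roots_mod_not_dvd[OF d p] by blast
    moreover have "int p dvd b - c" using pq cb by (rule dvd_trans)
    ultimately have "\<not> int p dvd b + c + 1"
      using dvd_add_right_iff[of "int p" "b - c" "b + c + 1"] by (simp add: algebra_simps)
    hence "coprime (int p) (b + c + 1)" using pr by (simp add: prime_imp_coprime)
    hence "coprime (int p ^ Suc k) (b + c + 1)" by simp
    moreover have "int p ^ Suc k dvd (b - c) * (b + c + 1)"
      using q unfolding quad_diff[of b D c, symmetric] by (rule dvd_diff)
    ultimately have "int p ^ Suc k dvd b - c" by (simp only: coprime_dvd_mult_left_iff)
    hence "b mod int p ^ Suc k = c mod int p ^ Suc k" by (simp only: mod_eq_dvd_iff)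
    thus "b = c" using bc(1,2) by (simp add: roots_mod_def)
  next
    fix c assume "c \<in> (\<lambda>b. b mod ?q) ` roots_mod D (p ^ Suc k)"
    then obtain b where b: "c = b mod ?q" "b \<in> roots_mod D (p ^ Suc k)" by blast
    have "int p * ?q dvd b\<^sup>2 + b - D" using b by (simp add: roots_mod_def)
    hence "?q dvd b\<^sup>2 + b - D" by (rule dvd_mult_right)
    thus "c \<in> roots_mod D (p ^ k)" using mod_in_roots_mod[of "p ^ k" b D] b p0 by simp
  next
    fix b assume b: "b \<in> roots_mod D (p ^ k)"
    have qb: "?q dvd b\<^sup>2 + b - D" using b by (simp add: roots_mod_def)
    then obtain u where u: "b\<^sup>2 + b - D = ?q * u" by blast
    have "int p dvd b\<^sup>2 + b - D" using pq qb by (rule dvd_trans)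
    hence "coprime (2 * b + 1) (int p)"
      using roots_mod_not_dvd[OF d p] pr by (simp add: prime_imp_coprime coprime_commute)
    then obtain v where v: "[(2 * b + 1) * v = 1] (mod int p)" using cong_solve_coprime_int by blast
    \<comment> \<open>The Newton correction: v inverts the derivative 2 b + 1 modulo p, and u is the
      value at b divided by p^k.\<close>
    define t where "t = - u * v"
    let ?c = "b + t * ?q"
    have "(2 * b + 1) * v - 1 = 0 \<or> int p dvd (2 * b + 1) * v - 1" using v by (simp add: cong_iff_dvd_diff)
    hence "int p dvd (2 * b + 1) * v - 1" by auto
    hence "int p dvd - u * ((2 * b + 1) * v - 1)" by simp
    hence 1: "int p dvd u + t * (2 * b + 1)" by (simp add: t_def algebra_simps)
    have "?c\<^sup>2 + ?c - D = ?q * (u + t * (2 * b + 1)) + ?q * ?q * t\<^sup>2"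
      using u by (simp add: power2_eq_square algebra_simps)
    moreover have "?q * int p dvd ?q * (u + t * (2 * b + 1))" using 1 by (intro mult_dvd_mono) auto
    moreover have "?q * int p dvd ?q * ?q * t\<^sup>2" using pq by (intro dvd_mult2 mult_dvd_mono) auto
    ultimately have "?q * int p dvd ?c\<^sup>2 + ?c - D" by simp
    hence "?c mod int (p ^ Suc k) \<in> roots_mod D (p ^ Suc k)"
      using p0 by (intro mod_in_roots_mod) (auto simp: mult.commute)
    moreover have "?c mod int (p ^ Suc k) mod ?q = b"
      using b by (simp add: mod_mod_cancel roots_mod_def)
    ultimately show "b \<in> (\<lambda>b. b mod ?q) ` roots_mod D (p ^ Suc k)" by force
  qed
  thus ?thesis by (rule bij_betw_same_card)
qed

text \<open>From (2 b + 1)^2 = 4 (b^2 + b - D) + d, a root modulo p forces p to divide 2 b + 1, so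
  (p - 1)/2 is the only one; a root modulo p^2 would force p^2 to divide the squarefree d.\<close>

lemma roots_mod_ramified:
  assumes d: "int d = 4 * D + 1" and p: "prime p" "p dvd d" and sq: "squarefree d"
  shows "card (roots_mod D p) = 1" "card (roots_mod D (p ^ Suc (Suc k))) = 0"
proof -
  have pr: "prime (int p)" using p by simp
  have "odd (int d)" using d by simp
  hence "odd d" by simp
  hence odd: "odd p" using p(2) dvd_trans by blast
  have ndvd2: "\<not> int p dvd 2" using odd p(1) by (metis int_dvd_int_iff of_nat_numeral primes_dvd_imp_eq two_is_prime_nat even_numeral dvd_refl)
  have key: "int p dvd 2 * b + 1" if "int p dvd b\<^sup>2 + b - D" for b
  proof -
    have "int p dvd (2 * b + 1)\<^sup>2" unfolding disc_identity[OF d, of b] using that p(2) by (intro dvd_add dvd_mult) auto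
    thus ?thesis using pr prime_dvd_power by blast
  qed
  define b0 where "b0 = (int p - 1) div 2"
  have b0: "2 * b0 + 1 = int p" using odd unfolding b0_def by (auto elim!: oddE)
  have "int p dvd 4 * (b0\<^sup>2 + b0 - D)"
    using disc_identity[OF d, of b0] p(2) b0
    by (metis dvd_add_left_iff dvd_refl dvd_power zero_less_numeral int_dvd_int_iff)
  moreover have "\<not> int p dvd 4" using ndvd2 pr prime_dvd_mult_iff[OF pr, of 2 2] by simp
  ultimately have "int p dvd b0\<^sup>2 + b0 - D" using pr prime_dvd_mult_iff by blast
  moreover have "0 \<le> b0" "b0 < int p" using b0 p(1) prime_gt_0_nat[of p] by linarith+
  ultimately have 1: "b0 \<in> roots_mod D p" by (simp add: roots_mod_def)
  have "b = b0" if "b \<in> roots_mod D p" for b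
  proof -
    have "int p dvd (2 * b + 1) - (2 * b0 + 1)" using key that b0 by (simp add: roots_mod_def)
    hence "int p dvd 2 * (b - b0)" by (simp add: algebra_simps)
    hence "int p dvd b - b0" using ndvd2 pr prime_dvd_mult_iff by blast
    hence "b mod int p = b0 mod int p" by (simp add: mod_eq_dvd_iff)
    thus ?thesis using that 1 by (simp add: roots_mod_def)
  qed
  hence "roots_mod D p = {b0}" using 1 by blast
  thus "card (roots_mod D p) = 1" by simp
  have "roots_mod D (p ^ Suc (Suc k)) = {}"
  proof (rule ccontr)
    assume "\<not> ?thesis"
    then obtain b where w: "int (p ^ Suc (Suc k)) dvd b\<^sup>2 + b - D" by (auto simp: roots_mod_def)
    hence 2: "(int p)\<^sup>2 dvd b\<^sup>2 + b - D" by (intro dvd_trans[OF _ w]) (auto intro!: le_imp_power_dvd simp del: power_Suc)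
    hence "int p dvd b\<^sup>2 + b - D" by (intro dvd_trans[OF _ 2]) simp
    hence "int p dvd 2 * b + 1" by (rule key)
    hence "(int p)\<^sup>2 dvd (2 * b + 1)\<^sup>2" by (rule dvd_power_same)
    hence "(int p)\<^sup>2 dvd int d" unfolding disc_identity[OF d, of b] dvd_add_right_iff[OF dvd_mult[OF 2]] .
    hence "p\<^sup>2 dvd d" by (metis int_dvd_int_iff of_nat_power)
    thus False using sq p(1) by (meson squarefreeD not_prime_unit)
  qed
  thus "card (roots_mod D (p ^ Suc (Suc k))) = 0" by simp
qed

text \<open>At p = 2 the condition d = 5 mod 8 makes D odd while b^2 + b is even, so there is no
  root. At odd p completing the square turns roots into square roots of d, and a root b is
  accompanied by the distinct root -1 - b.\<close>

lemma card_roots_mod_prime: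
  assumes d: "int d = 4 * D + 1" "d mod 8 = 5" and p: "prime p" "\<not> p dvd d"
  shows "int (card (roots_mod D p)) = 1 + kronecker (int d) p"
proof (cases "p = 2")
  case True
  have "(4 * D + 1) mod 8 = 5" using d by (metis of_nat_mod of_nat_numeral)
  hence "odd D" by presburger
  hence "roots_mod D 2 = {}" by (auto simp: roots_mod_def power2_eq_square)
  moreover have "int d mod 8 = 5" using d(2) by (metis of_nat_mod of_nat_numeral)
  hence "kronecker (int d) 2 = -1" unfolding kronecker_prime_eq[OF two_is_prime_nat]
    by (auto simp: kronecker_prime_def) presburger
  ultimately show ?thesis using True by simp
next
  case False
  have pr: "prime (int p)" using p by simp
  have p2: "p > 2" using False p(1) prime_ge_2_nat[of p] by linarith
  have odd: "odd p" using p(1) p2 by (simp add: prime_odd_nat)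
  have nd: "\<not> int p dvd int d" using p by simp
  have kr: "kronecker (int d) p = Legendre (int d) (int p)"
    using False p(1) by (simp add: kronecker_prime_eq kronecker_prime_def)
  have ndvd4: "coprime (int p) 4" using odd p(1)
    by (metis coprime_left_2_iff_odd coprime_commute even_of_nat coprime_mult_right_iff numeral_Bit0_eq_double numeral_Bit0 mult_2 numeral_times_numeral semiring_norm(11,13) of_nat_numeral coprime_int_iff)
  show ?thesis
  proof (cases "roots_mod D p = {}")
    case True
    have "\<not> QuadRes (int p) (int d)"
    proof
      assume "QuadRes (int p) (int d)"
      then obtain y where y: "[y\<^sup>2 = int d] (mod int p)" by (auto simp: QuadRes_def)
      obtain v where v: "[2 * v = 1] (mod int p)"
        using cong_solve_coprime_int[of 2 "int p"] odd by auto
      define b where "b = (y - 1) * v"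
      have "[2 * b + 1 = (y - 1) * (2 * v) + 1] (mod int p)" by (simp add: b_def mult_ac)
      also have "[(y - 1) * (2 * v) + 1 = (y - 1) * 1 + 1] (mod int p)" by (intro cong_add cong_mult cong_refl v)
      finally have "[(2 * b + 1)\<^sup>2 = y\<^sup>2] (mod int p)" by (intro cong_pow) simp
      hence "[(2 * b + 1)\<^sup>2 = int d] (mod int p)" using y by (rule cong_trans)
      hence "int p dvd 4 * (b\<^sup>2 + b - D)" using disc_identity[OF d(1), of b] by (simp add: cong_iff_dvd_diff)
      hence "int p dvd b\<^sup>2 + b - D" using ndvd4 by (simp only: coprime_dvd_mult_right_iff)
      hence "b mod int p \<in> roots_mod D p" using p2 by (intro mod_in_roots_mod) auto
      thus False using True by blast
    qed
    thus ?thesis using nd kr True by (simp add: Legendre_def cong_0_iff)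
  next
    case False
    then obtain b where b: "b \<in> roots_mod D p" by blast
    hence bd: "int p dvd b\<^sup>2 + b - D" by (simp add: roots_mod_def)
    have nb: "\<not> int p dvd 2 * b + 1" by (rule roots_mod_not_dvd[OF d(1) p bd])
    have "[(2 * b + 1)\<^sup>2 = int d] (mod int p)"
      unfolding disc_identity[OF d(1), of b] using dvd_mult[OF bd, of 4] by (simp only: cong_iff_dvd_diff add_diff_cancel_right')
    hence "QuadRes (int p) (int d)" by (auto simp: QuadRes_def)
    hence k1: "kronecker (int d) p = 1" using nd kr by (simp add: Legendre_def cong_0_iff)
    let ?c = "(- 1 - b) mod int p"
    have "int p dvd (- 1 - b)\<^sup>2 + (- 1 - b) - D" using bd by (simp add: power2_eq_square algebra_simps)
    hence c: "?c \<in> roots_mod D p" using p2 by (intro mod_in_roots_mod) auto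
    have "b \<noteq> ?c"
    proof
      assume "b = ?c"
      hence "b mod int p = (- 1 - b) mod int p" by (metis mod_mod_trivial)
      hence "int p dvd b - (- 1 - b)" by (simp only: mod_eq_dvd_iff)
      thus False using nb by (simp add: algebra_simps)
    qed
    moreover have "e = b \<or> e = ?c" if e: "e \<in> roots_mod D p" for e
    proof -
      have "int p dvd (e - b) * (e + b + 1)"
        unfolding quad_diff[of e D b, symmetric] by (rule dvd_diff) (use e bd in \<open>auto simp: roots_mod_def\<close>)
      hence "int p dvd e - b \<or> int p dvd e - (- 1 - b)" unfolding prime_dvd_mult_iff[OF pr] by (simp add: algebra_simps)
      hence "e mod int p = b mod int p \<or> e mod int p = (- 1 - b) mod int p" by (simp only: mod_eq_dvd_iff)
      thus ?thesis using e b by (simp add: roots_mod_def)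
    qed
    ultimately have "roots_mod D p = {b, ?c}" "b \<noteq> ?c" using b c by blast+
    thus ?thesis using k1 by simp
  qed
qed

text \<open>The coefficient form of zeta(2s) times the Dirichlet series of the root counts r being
  zeta(s) L(s, \<chi>_d). Both sides are multiplicative. On powers of p with c = \<chi>_d(p),
  passing from p^k to p^(k+2) adds r(p^(k+2)) = 1 + c on the left and 1 + c on the right if c is
  nonzero; for c = 0 both sides stay at 1.\<close>

theorem dconv_square_roots_eq:
  assumes d: "int d = 4 * D + 1" "d mod 8 = 5" "squarefree d" and n: "n > 0"
  shows "dconv square_ind (\<lambda>a. int (card (roots_mod D a))) n = dconv (kronecker (int d)) (\<lambda>_. 1) n"
proof (rule multiplicative_eqI[OF _ _ _ n])
  let ?r = "\<lambda>a. int (card (roots_mod D a))"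
  let ?F = "dconv square_ind ?r" and ?G = "dconv (kronecker (int d)) (\<lambda>_. 1)"
  show "multiplicative ?F"
    by (intro multiplicative_dconv multiplicative_square_ind multiplicative_roots_mod)
  show "multiplicative ?G"
    by (intro multiplicative_dconv) (auto simp: multiplicative_def kronecker_mult)
  fix p k :: nat assume p: "prime p"
  define c where "c = kronecker (int d) p"
  have cp: "kronecker (int d) (p ^ i) = c ^ i" for i
    by (induction i) (auto simp: c_def kronecker_mult prime_gt_0_nat[OF p])
  have r0: "?r (p ^ 0) = 1" using multiplicative_roots_mod[of D] by (simp add: multiplicative_def)
  have c0: "c = 0 \<longleftrightarrow> p dvd d"
  proof -
    have "odd d" using d(2) by presburger
    hence "p = 2 \<Longrightarrow> \<not> p dvd d" by simp
    moreover have "odd (int d)" using \<open>odd d\<close> by simp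
    ultimately show ?thesis using p unfolding c_def
      by (auto simp: kronecker_prime_eq kronecker_prime_def Legendre_eq_0_iff)
  qed
  have c1: "c * c = 1" if "c \<noteq> 0" using that kronecker_values[of "int d" p] by (auto simp: c_def)
  have rr: "?r (p ^ Suc (Suc k)) = (if c = 0 then 0 else 1 + c)" for k
  proof (cases "p dvd d")
    case True thus ?thesis using roots_mod_ramified(2)[OF d(1) p True d(3)] c0 by simp
  next
    case False
    have "?r (p ^ Suc k) = 1 + c" for k
    proof (induction k)
      case 0 thus ?case using card_roots_mod_prime[OF d(1,2) p False] by (simp add: c_def)
    next
      case (Suc k) thus ?case using hensel_roots_mod[OF d(1) p False, of "Suc k"] by simp
    qed
    from this[of "Suc k"] show ?thesis using False c0 by simp
  qed
  have r1: "?r (p ^ 1) = 1 + c"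
  proof (cases "p dvd d")
    case True thus ?thesis using roots_mod_ramified(1)[OF d(1) p True d(3)] c0 by simp
  next
    case False thus ?thesis using card_roots_mod_prime[OF d(1,2) p False] by (simp add: c_def)
  qed
  have F: "?F (p ^ k) = (\<Sum>i\<le>k. (if even i then 1 else 0) * ?r (p ^ (k - i)))" for k
    using dconv_prime_power[OF p, of square_ind ?r k] square_ind_prime_power[OF p] by simp
  have G: "?G (p ^ k) = (\<Sum>i\<le>k. c ^ i)" for k
    using dconv_prime_power[OF p, of "kronecker (int d)" "\<lambda>_. 1" k] cp by simp
  show "?F (p ^ k) = ?G (p ^ k)"
  proof (induction k rule: induct_nat_012)
    case 0 show ?case using r0 unfolding F G by simp
  next
    case 1 show ?case using r0 r1 unfolding F G by simp
  next
    case (ge2 k)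
    have "?F (p ^ Suc (Suc k)) = ?r (p ^ Suc (Suc k)) + ?F (p ^ k)"
      unfolding F by (simp add: sum.atMost_Suc_shift del: sum.atMost_Suc power_Suc)
    moreover have "?G (p ^ Suc (Suc k)) = 1 + c + c * c * ?G (p ^ k)"
      unfolding G by (simp add: sum.atMost_Suc_shift sum_distrib_left mult_ac del: sum.atMost_Suc)
    moreover have "?G (p ^ k) = 1" if "c = 0" unfolding G using that by (simp add: power_0_left sum.delta)
    ultimately show ?case using ge2(1) rr c1 by (cases "c = 0") auto
  qed
qed

text \<open>Sorting the triples by g turns the count into a convolution of the indicator of squares
  with the root counts.\<close>

theorem card_lattices_of_index:
  assumes d: "int d = 4 * D + 1" "d mod 8 = 5" "squarefree d" and n: "n > 0"
  shows "finite {(g, a, b). a > 0 \<and> b \<in> roots_mod D a \<and> g\<^sup>2 * a = n}"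
    and "int (card {(g, a, b). a > 0 \<and> b \<in> roots_mod D a \<and> g\<^sup>2 * a = n}) = (\<Sum>k | k dvd n. kronecker (int d) k)"
proof -
  let ?T = "{(g, a, b). a > 0 \<and> b \<in> roots_mod D a \<and> g\<^sup>2 * a = n}"
  let ?A = "{g. g\<^sup>2 dvd n}"
  have finA: "finite ?A"
    by (rule finite_subset[of _ "{..n}"]) (use n in \<open>auto dest!: dvd_imp_le intro: order_trans[OF power2_nat_le_imp_le]\<close>)
  let ?f = "\<lambda>(g, b). (g, n div g\<^sup>2, b)"
  have T: "?T = ?f ` (SIGMA g:?A. roots_mod D (n div g\<^sup>2))"
  proof (intro equalityI subsetI)
    fix t assume "t \<in> ?T"
    then obtain g a b where t: "t = (g, a, b)" "a > 0" "b \<in> roots_mod D a" "g\<^sup>2 * a = n" by blast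
    have "g\<^sup>2 > 0" using t n by (auto intro!: Nat.gr0I)
    hence "n div g\<^sup>2 = a" using t(4) by (metis nonzero_mult_div_cancel_left less_irrefl)
    thus "t \<in> ?f ` (SIGMA g:?A. roots_mod D (n div g\<^sup>2))" using t by (auto intro!: image_eqI[of _ _ "(g, b)"] dvdI[of _ _ a])
  next
    fix t assume "t \<in> ?f ` (SIGMA g:?A. roots_mod D (n div g\<^sup>2))"
    then obtain g b where t: "t = (g, n div g\<^sup>2, b)" "g\<^sup>2 dvd n" "b \<in> roots_mod D (n div g\<^sup>2)" by auto
    moreover have "g\<^sup>2 * (n div g\<^sup>2) = n" using t by simp
    moreover have "n div g\<^sup>2 > 0" using t(2) n by (auto simp: dvd_div_eq_0_iff intro!: Nat.gr0I)
    ultimately show "t \<in> ?T" by blast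
  qed
  have inj: "inj_on ?f (SIGMA g:?A. roots_mod D (n div g\<^sup>2))" by (auto simp: inj_on_def)
  show "finite ?T" unfolding T using finA by auto
  have "int (card ?T) = (\<Sum>g\<in>?A. int (card (roots_mod D (n div g\<^sup>2))))"
    unfolding T card_image[OF inj] using finA by simp
  also have "\<dots> = (\<Sum>k\<in>(\<lambda>g. g\<^sup>2) ` ?A. int (card (roots_mod D (n div k))))"
    by (subst sum.reindex) (auto simp: inj_on_def)
  also have "\<dots> = (\<Sum>k | k dvd n. square_ind k * int (card (roots_mod D (n div k))))"
    by (rule sum.mono_neutral_cong_left) (use n in \<open>auto simp: square_ind_def\<close>)
  also have "\<dots> = dconv (kronecker (int d)) (\<lambda>_. 1) n"
    using dconv_square_roots_eq[OF d n] by (simp add: dconv_def)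
  finally show "int (card ?T) = (\<Sum>k | k dvd n. kronecker (int d) k)" by (simp add: dconv_def)
qed

subsection \<open>Ideals of a real quadratic order as lattices\<close>

lemma int_subgroup_eq_multiples:
  fixes S :: "int set"
  assumes "0 \<in> S" and diff: "\<And>x y. x \<in> S \<Longrightarrow> y \<in> S \<Longrightarrow> x - y \<in> S"
  shows "\<exists>m\<ge>0. S = {x. m dvd x}"
proof (cases "S = {0}")
  case True thus ?thesis by (intro exI[of _ 0]) auto
next
  case False
  then obtain z where z: "z \<in> S" "z \<noteq> 0" using assms(1) by blast
  have neg: "- x \<in> S" if "x \<in> S" for x using diff[OF assms(1) that] by simp
  have add: "x + y \<in> S" if "x \<in> S" "y \<in> S" for x y using diff[OF that(1) neg[OF that(2)]] by simp
  have "\<exists>n::nat. n > 0 \<and> int n \<in> S"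
    using z neg[of z] by (intro exI[of _ "nat \<bar>z\<bar>"]) (auto simp: abs_if)
  then obtain n :: nat where n: "n > 0" "int n \<in> S" and least: "\<And>k. k < n \<Longrightarrow> \<not> (k > 0 \<and> int k \<in> S)"
    using exists_least_iff[of "\<lambda>n::nat. n > 0 \<and> int n \<in> S"] by auto
  have mult: "int k * int n \<in> S" for k :: nat
    by (induction k) (use assms(1) n add in \<open>auto simp: algebra_simps\<close>)
  have multi: "k * int n \<in> S" for k :: int
    using mult[of "nat k"] neg[OF mult[of "nat (- k)"]] by (cases "k \<ge> 0") auto
  have "int n dvd x" if "x \<in> S" for x
  proof -
    have "x mod int n \<in> S" using diff[OF that multi[of "x div int n"]] by (simp add: minus_div_mult_eq_mod)
    moreover have "x mod int n \<ge> 0" "x mod int n < int n" using n by simp_all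
    ultimately have "\<not> x mod int n > 0" using least[of "nat (x mod int n)"] by auto
    thus ?thesis using \<open>x mod int n \<ge> 0\<close> by (simp add: dvd_eq_mod_eq_0)
  qed
  moreover have "x \<in> S" if "int n dvd x" for x using that multi by (metis dvdE mult.commute)
  ultimately show ?thesis by (intro exI[of _ "int n"]) auto
qed

locale quadratic_order =
  fixes d :: nat and D :: int
  assumes dD: "int d = 4 * D + 1" and d8: "d mod 8 = 5" and sqf: "squarefree d"
begin

text \<open>If y were nonzero, d would be a perfect square, but 5 is not a square modulo 8.\<close>

lemma d_not_square:
  fixes x y :: int assumes "x\<^sup>2 = int d * y\<^sup>2" shows "y = 0"
proof (rule ccontr)
  assume y: "y \<noteq> 0"
  have "y\<^sup>2 dvd x\<^sup>2" using assms by simp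
  hence "y dvd x" by simp
  then obtain k where "x = y * k" by blast
  hence "y\<^sup>2 * k\<^sup>2 = y\<^sup>2 * int d" using assms by (simp add: power_mult_distrib mult.commute)
  hence "k\<^sup>2 = int d" using y by simp
  moreover have "int d mod 8 = 5" using d8 by (metis of_nat_mod of_nat_numeral)
  ultimately have k8: "k\<^sup>2 mod 8 = 5" by simp
  have "k mod 8 = 0 \<or> k mod 8 = 1 \<or> k mod 8 = 2 \<or> k mod 8 = 3 \<or> k mod 8 = 4 \<or> k mod 8 = 5 \<or> k mod 8 = 6 \<or> k mod 8 = 7"
    by presburger
  moreover have "k\<^sup>2 mod 8 = (k mod 8)\<^sup>2 mod 8" by (simp add: power_mod)
  ultimately show False using k8 by auto
qed

text \<open>The pair (x, y) stands for x + y \<omega> with \<omega>^2 = \<omega> + D, and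
  multiplication by \<omega> sends it to (D y, x + y). Integer pairs keep the lattice arguments
  apart from the complex numbers.\<close>

definition omega_module :: "(int \<times> int) set \<Rightarrow> bool" where
  "omega_module J \<longleftrightarrow> (0, 0) \<in> J \<and> (\<forall>x y u v. (x, y) \<in> J \<longrightarrow> (u, v) \<in> J \<longrightarrow> (x - u, y - v) \<in> J)
     \<and> (\<forall>x y. (x, y) \<in> J \<longrightarrow> (D * y, x + y) \<in> J)"

text \<open>The lattice g (\<int> a + \<int> (b + \<omega>)) in the coordinates of 1 and \<omega>:
  the second coordinate is a multiple of g, and subtracting b times it must leave a multiple of g
  a.\<close>

definition qlattice :: "nat \<times> nat \<times> int \<Rightarrow> (int \<times> int) set" where
  "qlattice = (\<lambda>(g, a, b). {(x, y). int g dvd y \<and> int g * int a dvd x - b * y})"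

definition lattice_params :: "(nat \<times> nat \<times> int) set" where
  "lattice_params = {(g, a, b). g > 0 \<and> a > 0 \<and> b \<in> roots_mod D a}"

lemma omega_module_lattice:
  assumes "t \<in> lattice_params" shows "omega_module (qlattice t)"
proof -
  obtain g a b where t: "t = (g, a, b)" "a > 0" "b \<in> roots_mod D a"
    using assms by (auto simp: lattice_params_def)
  have ab: "int a dvd b\<^sup>2 + b - D" using t by (simp add: roots_mod_def)
  have "int g dvd x + y \<and> int g * int a dvd D * y - b * (x + y)"
    if xy: "int g dvd y" "int g * int a dvd x - b * y" for x y
  proof
    have "int g dvd x - b * y" using xy(2) by (rule dvd_mult_left)
    hence "int g dvd (x - b * y) + (b + 1) * y" using xy(1) by simp
    thus "int g dvd x + y" by (simp add: algebra_simps)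
    have "int g * int a dvd y * (b\<^sup>2 + b - D)" using xy(1) ab by (rule mult_dvd_mono)
    hence "int g * int a dvd - (y * (b\<^sup>2 + b - D)) - b * (x - b * y)" using xy(2) by (intro dvd_diff) auto
    also have "- (y * (b\<^sup>2 + b - D)) - b * (x - b * y) = D * y - b * (x + y)"
      by (simp add: power2_eq_square algebra_simps)
    finally show "int g * int a dvd D * y - b * (x + y)" .
  qed
  moreover have "int g * int a dvd (x - u) - b * (y - v)"
    if "int g * int a dvd x - b * y" "int g * int a dvd u - b * v" for x y u v
    using dvd_diff[OF that] by (simp add: algebra_simps)
  ultimately show ?thesis unfolding omega_module_def t qlattice_def by auto
qed

lemma inj_on_lattice: "inj_on qlattice lattice_params"
proof -
  have key: "g' dvd g \<and> (g' = g \<longrightarrow> a' dvd a \<and> int a' dvd b - b')"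
    if "(g, a, b) \<in> lattice_params" "(g', a', b') \<in> lattice_params"
      "qlattice (g, a, b) = qlattice (g', a', b')" for g a b g' a' b'
  proof -
    have "(int g * b, int g) \<in> qlattice (g, a, b)" "(int g * int a, 0) \<in> qlattice (g, a, b)"
      by (auto simp: qlattice_def)
    hence *: "int g' dvd int g" "int g' * int a' dvd int g * b - b' * int g" "int g' * int a' dvd int g * int a"
      unfolding that(3) by (auto simp: qlattice_def)
    have "g > 0" using that by (simp add: lattice_params_def)
    moreover have "int g * b - b' * int g = int g * (b - b')" by (simp add: algebra_simps)
    ultimately show ?thesis using * by auto
  qed
  show ?thesis
  proof (rule inj_onI)
    fix t t' assume A: "t \<in> lattice_params" "t' \<in> lattice_params" "qlattice t = qlattice t'"
    obtain g a b g' a' b' where t: "t = (g, a, b)" "t' = (g', a', b')" by (metis prod_cases3)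
    have "g = g'" using key[of g a b g' a' b'] key[of g' a' b' g a b] A unfolding t by (simp add: dvd_antisym)
    hence "a = a'" using key[of g a b g' a' b'] key[of g' a' b' g a b] A unfolding t by (simp add: dvd_antisym)
    have "int a' dvd b - b'" using key[of g a b g' a' b'] A \<open>g = g'\<close> unfolding t by simp
    hence "b mod int a' = b' mod int a'" by (simp only: mod_eq_dvd_iff)
    hence "b = b'" using A \<open>a = a'\<close> unfolding t by (simp add: lattice_params_def roots_mod_def)
    thus "t = t'" using t \<open>g = g'\<close> \<open>a = a'\<close> by simp
  qed
qed

lemma omega_module_add:
  assumes "omega_module J" "(x, y) \<in> J" "(u, v) \<in> J" shows "(x + u, y + v) \<in> J"
proof -
  have "(0 - u, 0 - v) \<in> J" using assms unfolding omega_module_def by blast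
  hence "(x - (0 - u), y - (0 - v)) \<in> J" using assms unfolding omega_module_def by blast
  thus ?thesis by simp
qed

lemma omega_module_scale:
  assumes "omega_module J" "(x, y) \<in> J" shows "(k * x, k * y) \<in> J"
proof -
  have nat: "(int n * x, int n * y) \<in> J" for n
  proof (induction n)
    case 0 thus ?case using assms by (simp add: omega_module_def)
  next
    case (Suc n) thus ?case using omega_module_add[OF assms(1) Suc assms(2)] by (simp add: algebra_simps)
  qed
  have neg: "(0 - int n * x, 0 - int n * y) \<in> J" for n
    using nat[of n] assms(1) unfolding omega_module_def by blast
  show ?thesis
  proof (cases "k \<ge> 0")
    case True thus ?thesis using nat[of "nat k"] by simp
  next
    case False thus ?thesis using neg[of "nat (- k)"] by simp
  qed
qed

text \<open>Hermite normal form. \<alpha> generates the rational integers in J and \<gamma>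
  generates the second coordinates; closure under \<omega> forces \<gamma> to divide \<alpha> and
  \<beta>, so \<gamma> is the scalar g. Closure of the basis vector b + \<omega> under \<omega> then
  gives the divisibility of its norm by a.\<close>

lemma omega_module_eq_lattice:
  assumes J: "omega_module J" and ne: "J \<noteq> {(0, 0)}"
  shows "\<exists>t\<in>lattice_params. J = qlattice t"
proof -
  have J0: "(0, 0) \<in> J" and Jd: "\<And>x y u v. (x, y) \<in> J \<Longrightarrow> (u, v) \<in> J \<Longrightarrow> (x - u, y - v) \<in> J"
    and Jw: "\<And>x y. (x, y) \<in> J \<Longrightarrow> (D * y, x + y) \<in> J"
    using J unfolding omega_module_def by blast+
  obtain \<alpha> where \<alpha>: "\<alpha> \<ge> 0" "{x. (x, 0) \<in> J} = {x. \<alpha> dvd x}"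
    using int_subgroup_eq_multiples[of "{x. (x, 0) \<in> J}"] J0 Jd by fastforce
  have "\<exists>m\<ge>0. {y. \<exists>x. (x, y) \<in> J} = {x. m dvd x}"
    by (rule int_subgroup_eq_multiples) (use J0 Jd in blast)+
  then obtain \<gamma> where \<gamma>: "\<gamma> \<ge> 0" "{y. \<exists>x. (x, y) \<in> J} = {y. \<gamma> dvd y}" by blast
  have \<alpha>D: "(x, 0) \<in> J \<longleftrightarrow> \<alpha> dvd x" for x using \<alpha>(2) by blast
  have \<gamma>D: "\<gamma> dvd y" if "(x, y) \<in> J" for x y using \<gamma>(2) that by blast
  obtain x y where xy: "(x, y) \<in> J" "(x, y) \<noteq> (0, 0)" using J0 ne by auto
  \<comment> \<open>Multiplying x + y \<omega> by its conjugate (x + y) - y \<omega> gives its norm,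
    a nonzero rational integer in J; hence \<alpha> > 0.\<close>
  have "((x + y) * x - y * (D * y), (x + y) * y - y * (x + y)) \<in> J"
    by (intro Jd omega_module_scale[OF J] Jw xy)
  hence "(x\<^sup>2 + x * y - D * y\<^sup>2, 0) \<in> J" by (simp add: algebra_simps power2_eq_square)
  moreover have "x\<^sup>2 + x * y - D * y\<^sup>2 \<noteq> 0"
  proof
    assume 0: "x\<^sup>2 + x * y - D * y\<^sup>2 = 0"
    have "(2 * x + y)\<^sup>2 - int d * y\<^sup>2 = 4 * (x\<^sup>2 + x * y - D * y\<^sup>2)"
      unfolding dD by (simp add: power2_eq_square algebra_simps)
    hence "(2 * x + y)\<^sup>2 = int d * y\<^sup>2" using 0 by simp
    hence "y = 0" by (rule d_not_square)
    thus False using 0 xy(2) by simp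
  qed
  ultimately have \<alpha>0: "\<alpha> > 0" using \<alpha>(1) \<alpha>D by (cases "\<alpha> = 0") auto
  have "(D * 0, \<alpha> + 0) \<in> J" using \<alpha>D[of \<alpha>] by (intro Jw) simp
  hence "\<gamma> dvd \<alpha>" using \<gamma>D by fastforce
  then obtain a where a: "\<alpha> = \<gamma> * a" by blast
  have \<gamma>0: "\<gamma> > 0" using \<gamma>(1) \<alpha>0 a by (cases "\<gamma> = 0") auto
  have a0: "a > 0" using \<alpha>0 \<gamma>0 a by (simp add: zero_less_mult_iff)
  have "\<gamma> \<in> {y. \<exists>x. (x, y) \<in> J}" unfolding \<gamma>(2) by simp
  then obtain \<beta> where \<beta>: "(\<beta>, \<gamma>) \<in> J" by blast
  have "\<gamma> dvd \<beta> + \<gamma>" using \<gamma>D[OF Jw[OF \<beta>]] .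
  hence "\<gamma> dvd \<beta>" by simp
  then obtain b0 where b0: "\<beta> = \<gamma> * b0" by blast
  define b where "b = b0 mod a"
  have bb: "(\<gamma> * b, \<gamma>) \<in> J"
  proof -
    have "(\<gamma> * a * (b0 div a), 0) \<in> J" using \<alpha>D a by simp
    hence "(\<gamma> * b0 - \<gamma> * a * (b0 div a), \<gamma> - 0) \<in> J" using \<beta> b0 Jd by blast
    moreover have "\<gamma> * b0 - \<gamma> * a * (b0 div a) = \<gamma> * b"
      unfolding b_def mult.assoc right_diff_distrib[symmetric] minus_mult_div_eq_mod ..
    ultimately show ?thesis by simp
  qed
  have mem: "(x, y) \<in> J \<longleftrightarrow> \<gamma> dvd y \<and> \<gamma> * a dvd x - b * y" for x y
  proof
    assume xy: "(x, y) \<in> J"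
    then obtain n where n: "y = \<gamma> * n" using \<gamma>D by blast
    have "(x - n * (\<gamma> * b), y - n * \<gamma>) \<in> J" by (intro Jd xy omega_module_scale[OF J] bb)
    hence "(x - b * y, 0) \<in> J" using n by (simp add: mult_ac)
    thus "\<gamma> dvd y \<and> \<gamma> * a dvd x - b * y" using \<alpha>D a n by simp
  next
    assume A: "\<gamma> dvd y \<and> \<gamma> * a dvd x - b * y"
    then obtain n where n: "y = \<gamma> * n" by blast
    have "(x - b * y, 0) \<in> J" using A \<alpha>D a by simp
    hence "((x - b * y) + n * (\<gamma> * b), 0 + n * \<gamma>) \<in> J"
      by (intro omega_module_add[OF J] omega_module_scale[OF J] bb)
    thus "(x, y) \<in> J" using n by (simp add: mult_ac)
  qed
  have "(D * \<gamma>, \<gamma> * b + \<gamma>) \<in> J" by (rule Jw[OF bb])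
  hence "\<gamma> * a dvd D * \<gamma> - b * (\<gamma> * b + \<gamma>)" using mem by blast
  also have "D * \<gamma> - b * (\<gamma> * b + \<gamma>) = \<gamma> * (- (b\<^sup>2 + b - D))" by (simp add: power2_eq_square algebra_simps)
  finally have "a dvd - (b\<^sup>2 + b - D)" using \<gamma>0 by (simp only: dvd_mult_cancel_left) auto
  hence "a dvd b\<^sup>2 + b - D" by (simp only: dvd_minus_iff)
  hence "b \<in> roots_mod D (nat a)" using a0 by (simp add: roots_mod_def b_def)
  hence "(nat \<gamma>, nat a, b) \<in> lattice_params" using a0 \<gamma>0 by (simp add: lattice_params_def)
  moreover have "J = qlattice (nat \<gamma>, nat a, b)" using mem a0 \<gamma>0 by (auto simp: qlattice_def)
  ultimately show ?thesis by blast
qed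

definition lattice_index :: "nat \<times> nat \<times> int \<Rightarrow> nat" where
  "lattice_index = (\<lambda>(g, a, b). g\<^sup>2 * a)"

text \<open>A box of g a by g points is a fundamental domain: the second coordinate is reduced
  modulo g first, and the first one modulo g a after subtracting b times the change in the
  second.\<close>

lemma lattice_representatives:
  assumes "t \<in> lattice_params"
  obtains R where "finite R" "card R = lattice_index t"
    "\<And>x y u v. (x, y) \<in> R \<Longrightarrow> (u, v) \<in> R \<Longrightarrow> (x - u, y - v) \<in> qlattice t \<Longrightarrow> (x, y) = (u, v)"
    "\<And>x y. \<exists>u v. (u, v) \<in> R \<and> (x - u, y - v) \<in> qlattice t"
proof -
  obtain g a b where t: "t = (g, a, b)" "a > 0" "g > 0"
    using assms by (auto simp: lattice_params_def)
  let ?R = "{0..<int (g * a)} \<times> {0..<int g}"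
  show ?thesis
  proof (rule that[of ?R])
    show "finite ?R" by simp
    show "card ?R = lattice_index t" by (simp add: t lattice_index_def power2_eq_square mult_ac card_cartesian_product nat_mult_distrib)
    fix x y u v assume A: "(x, y) \<in> ?R" "(u, v) \<in> ?R" "(x - u, y - v) \<in> qlattice t"
    have "int g dvd y - v" using A t by (simp add: qlattice_def)
    hence "y mod int g = v mod int g" by (simp only: mod_eq_dvd_iff)
    hence yv: "y = v" using A by simp
    hence "int (g * a) dvd x - u" using A t by (simp add: qlattice_def)
    hence "x mod int (g * a) = u mod int (g * a)" by (simp only: mod_eq_dvd_iff)
    hence "x = u" using A by simp
    thus "(x, y) = (u, v)" using yv by simp
  next
    fix x y
    let ?v = "y mod int g"
    let ?u = "(x - b * (y - ?v)) mod int (g * a)"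
    have "int g dvd y - ?v" by simp
    moreover have "int (g * a) dvd (x - b * (y - ?v)) - ?u" by (rule dvd_minus_mod)
    hence "int g * int a dvd (x - ?u) - b * (y - ?v)" by (simp add: algebra_simps)
    ultimately have "(x - ?u, y - ?v) \<in> qlattice t" unfolding t qlattice_def by blast
    moreover have "(?u, ?v) \<in> ?R" using t by simp
    ultimately show "\<exists>u v. (u, v) \<in> ?R \<and> (x - u, y - v) \<in> qlattice t" by blast
  qed
qed

end

subsection \<open>Real quadratic fields\<close>

lemma ring_of_type_algebra_simps [simp]:
  "carrier (ring_of_type_algebra\<lparr>carrier := A\<rparr>) = A"
  "carrier (ring_of_type_algebra :: 'a::ring_1 ring) = UNIV"
  "x \<otimes>\<^bsub>ring_of_type_algebra\<^esub> y = x * y" "x \<oplus>\<^bsub>ring_of_type_algebra\<^esub> y = x + y"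
  "\<one>\<^bsub>ring_of_type_algebra\<^esub> = (1::'a)" "\<zero>\<^bsub>ring_of_type_algebra\<^esub> = (0::'a)"
  "x \<otimes>\<^bsub>ring_of_type_algebra\<lparr>carrier := A\<rparr>\<^esub> y = x * y"
  "x \<oplus>\<^bsub>ring_of_type_algebra\<lparr>carrier := A\<rparr>\<^esub> y = x + y"
  "\<one>\<^bsub>ring_of_type_algebra\<lparr>carrier := A\<rparr>\<^esub> = (1::'a)"
  "\<zero>\<^bsub>ring_of_type_algebra\<lparr>carrier := A\<rparr>\<^esub> = (0::'a)"
  by (simp_all add: ring_of_type_algebra_def)

lemma a_inv_ring_of_type_algebra [simp]: "\<ominus>\<^bsub>ring_of_type_algebra\<^esub> x = - (x::'a::field)"
proof -
  interpret field "ring_of_type_algebra :: 'a ring" by (rule field_from_type_algebra)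
  show ?thesis using sum_zero_eq_neg[of x "- x"] minus_equality[of "- x" x] by simp
qed

lemma m_inv_ring_of_type_algebra [simp]: "x \<noteq> 0 \<Longrightarrow> inv\<^bsub>ring_of_type_algebra\<^esub> x = inverse (x::'a::field)"
proof -
  assume "x \<noteq> 0"
  interpret field "ring_of_type_algebra :: 'a ring" by (rule field_from_type_algebra)
  show ?thesis using comm_inv_char[of x "inverse x"] \<open>x \<noteq> 0\<close> by simp
qed

lemma subring_ring_of_type_algebraI:
  fixes A :: "'a::field set"
  assumes "1 \<in> A" "\<And>x y. x \<in> A \<Longrightarrow> y \<in> A \<Longrightarrow> x - y \<in> A" "\<And>x y. x \<in> A \<Longrightarrow> y \<in> A \<Longrightarrow> x * y \<in> A"
  shows "subring A ring_of_type_algebra"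
proof -
  interpret field "ring_of_type_algebra :: 'a ring" by (rule field_from_type_algebra)
  have 0: "0 \<in> A" using assms(2)[OF assms(1) assms(1)] by simp
  have neg: "- x \<in> A" if "x \<in> A" for x using assms(2)[OF 0 that] by simp
  have add: "x + y \<in> A" if "x \<in> A" "y \<in> A" for x y using assms(2)[OF that(1) neg[OF that(2)]] by simp
  show ?thesis by (rule subringI) (use assms neg add in auto)
qed

lemma ring_hom_of_rat:
  fixes h :: "complex \<Rightarrow> complex"
  assumes add: "\<And>x y. x \<in> K \<Longrightarrow> y \<in> K \<Longrightarrow> h (x + y) = h x + h y"
    and mult: "\<And>x y. x \<in> K \<Longrightarrow> y \<in> K \<Longrightarrow> h (x * y) = h x * h y" and one: "h 1 = 1"
    and K: "\<rat> \<subseteq> K" and q: "q \<in> \<rat>"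
  shows "h q = q"
proof -
  have zero: "h 0 = 0" using add[of 0 0] K by auto
  have nat: "h (of_nat n) = of_nat n" for n
  proof (induction n)
    case (Suc n)
    have "h (of_nat n + 1) = h (of_nat n) + h 1" using K by (intro add) auto
    thus ?case using Suc one by (simp add: add.commute)
  qed (use zero in simp)
  have neg: "h (- of_nat n) = - of_nat n" for n
  proof -
    have "h (of_nat n + (- of_nat n)) = h (of_nat n) + h (- of_nat n)" using K by (intro add) auto
    thus ?thesis using zero nat by (simp add: add_eq_0_iff)
  qed
  have int: "h (of_int k) = of_int k" for k
    using nat[of "nat k"] neg[of "nat (- k)"] by (cases "k \<ge> 0") auto
  obtain a b where ab: "b > 0" "q = of_int a / of_int b" using q by (auto elim: Rats_cases')
  have "h (q * of_int b) = h q * h (of_int b)" using K q by (intro mult) auto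
  moreover have "q * of_int b = of_int a" using ab by simp
  ultimately have "h q * of_int b = of_int a" using int by simp
  hence "h q = of_int a / of_int b" using ab(1) by (simp add: eq_divide_eq)
  thus ?thesis unfolding ab(2)[symmetric] .
qed

text \<open>Every power v^k of the reduced denominator v divides c; for v >= 2 this fails at k = c,
  since 2^c > c.\<close>

lemma rat_powers_bounded_denominator:
  fixes r :: rat
  assumes c: "c > 0" and "\<And>k. of_int c * r ^ k \<in> \<int>"
  shows "r \<in> \<int>"
proof -
  obtain u v where uv: "quotient_of r = (u, v)" by fastforce
  have v0: "v > 0" and cop: "coprime u v" and r: "r = of_int u / of_int v"
    using quotient_of_denom_pos[OF uv] quotient_of_coprime[OF uv] quotient_of_div[OF uv] by simp_all
  have dvd: "v ^ k dvd c" for k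
  proof -
    obtain m where "of_int c * r ^ k = of_int m" using assms(2)[of k] by (auto elim: Ints_cases)
    hence "(of_int (c * u ^ k) :: rat) = of_int (m * v ^ k)" using v0 by (simp add: r power_divide field_simps)
    hence "c * u ^ k = m * v ^ k" by (simp only: of_int_eq_iff)
    hence "v ^ k dvd c * u ^ k" by simp
    moreover have "coprime (v ^ k) (u ^ k)" using cop by (simp add: coprime_commute)
    ultimately show ?thesis by (simp add: coprime_dvd_mult_left_iff)
  qed
  have "v = 1"
  proof (rule ccontr)
    assume "v \<noteq> 1"
    hence v2: "v \<ge> 2" using v0 by simp
    have "c < 2 ^ nat c" using c of_nat_less_two_power[of "nat c", where 'a = int] by simp
    also have "(2::int) ^ nat c \<le> v ^ nat c" using v2 by (intro power_mono) auto
    also have "v ^ nat c \<le> c" using dvd[of "nat c"] c by (intro zdvd_imp_le) auto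
    finally show False by simp
  qed
  thus ?thesis using r by simp
qed

context quadratic_order
begin

definition \<omega> :: complex where "\<omega> = (1 + of_real (sqrt (real d))) / 2"

lemma omega_sq: "\<omega> * \<omega> = \<omega> + of_int D"
proof -
  have "complex_of_real (sqrt (real d)) * of_real (sqrt (real d)) = of_nat d"
    by (metis of_real_mult of_real_of_nat_eq of_nat_0_le_iff real_sqrt_mult_self abs_of_nat)
  also have "(of_nat d :: complex) = of_int (4 * D + 1)" by (metis dD of_int_of_nat_eq)
  finally show ?thesis by (simp add: \<omega>_def field_simps)
qed

lemma rat_norm_nonzero:
  fixes a b :: rat assumes "a\<^sup>2 + a * b - of_int D * b\<^sup>2 = 0" shows "b = 0" "a = 0"
proof -
  obtain u m where u: "m > 0" "2 * a + b = of_int u / of_int m"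
    using quotient_of_denom_pos' quotient_of_div by (metis surj_pair snd_conv)
  obtain v n where v: "n > 0" "b = of_int v / of_int n"
    using quotient_of_denom_pos' quotient_of_div by (metis surj_pair snd_conv)
  have "(2 * a + b)\<^sup>2 - of_int (4 * D + 1) * b\<^sup>2 = 4 * (a\<^sup>2 + a * b - of_int D * b\<^sup>2)"
    by (simp add: power2_eq_square algebra_simps)
  hence "(2 * a + b)\<^sup>2 = of_int (int d) * b\<^sup>2" using assms dD by simp
  hence "(of_int u / of_int m)\<^sup>2 = of_int (int d) * (of_int v / of_int n :: rat)\<^sup>2"
    unfolding u(2)[symmetric] v(2)[symmetric] .
  hence "(of_int ((u * n)\<^sup>2) :: rat) = of_int (int d * (v * m)\<^sup>2)"
    using u(1) v(1) by (simp add: field_simps power2_eq_square)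
  hence "(u * n)\<^sup>2 = int d * (v * m)\<^sup>2" by (simp only: of_int_eq_iff)
  hence "v * m = 0" by (rule d_not_square)
  thus "b = 0" using u v by simp
  thus "a = 0" using assms by simp
qed

definition K :: "complex set" where "K = {of_rat a + of_rat b * \<omega> | a b. True}"

lemma K_I: "of_rat a + of_rat b * \<omega> \<in> K" by (auto simp: K_def)

lemma K_mult: "(of_rat a + of_rat b * \<omega>) * (of_rat a' + of_rat b' * \<omega>) =
    of_rat (a * a' + of_int D * b * b') + of_rat (a * b' + b * a' + b * b') * \<omega>"
proof -
  have "(of_rat a + of_rat b * \<omega>) * (of_rat a' + of_rat b' * \<omega>) =
    of_rat a * of_rat a' + (of_rat a * of_rat b' + of_rat b * of_rat a') * \<omega> + of_rat b * of_rat b' * (\<omega> * \<omega>)"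
    by (simp add: algebra_simps)
  thus ?thesis unfolding omega_sq by (simp add: of_rat_mult of_rat_add algebra_simps)
qed

lemma K_eq_0:
  assumes "of_rat a + of_rat b * \<omega> = 0" shows "a = 0" "b = 0"
proof -
  have "0 = (of_rat a + of_rat b * \<omega>) * (of_rat (a + b) + of_rat (- b) * \<omega>)" using assms by simp
  also have "\<dots> = of_rat (a\<^sup>2 + a * b - of_int D * b\<^sup>2)"
    unfolding K_mult by (simp add: algebra_simps power2_eq_square)
  finally have "a\<^sup>2 + a * b - of_int D * b\<^sup>2 = 0" by simp
  from rat_norm_nonzero[OF this] show "a = 0" "b = 0" by simp_all
qed

lemma K_eq_iff: "of_rat a + of_rat b * \<omega> = of_rat a' + of_rat b' * \<omega> \<longleftrightarrow> a = a' \<and> b = b'"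
  using K_eq_0[of "a - a'" "b - b'"] by (auto simp: of_rat_diff algebra_simps)

lemma K_diff: "x \<in> K \<Longrightarrow> y \<in> K \<Longrightarrow> x - y \<in> K"
proof -
  assume "x \<in> K" "y \<in> K"
  then obtain a b a' b' where "x = of_rat a + of_rat b * \<omega>" "y = of_rat a' + of_rat b' * \<omega>"
    by (auto simp: K_def)
  hence "x - y = of_rat (a - a') + of_rat (b - b') * \<omega>" by (simp add: of_rat_diff algebra_simps)
  thus ?thesis by (simp only: K_I)
qed

lemma K_times: "x \<in> K \<Longrightarrow> y \<in> K \<Longrightarrow> x * y \<in> K"
  unfolding K_def using K_mult by blast

lemma Rats_subset_K: "\<rat> \<subseteq> K"
proof
  fix q :: complex assume "q \<in> \<rat>"
  then obtain r where "q = of_rat r" by (auto elim: Rats_cases)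
  thus "q \<in> K" using K_I[of r 0] by simp
qed

lemma K_inverse: assumes "x \<in> K" shows "inverse x \<in> K"
proof (cases "x = 0")
  case True thus ?thesis using Rats_subset_K by auto
next
  case False
  obtain a b where x: "x = of_rat a + of_rat b * \<omega>" using assms by (auto simp: K_def)
  define n where "n = a\<^sup>2 + a * b - of_int D * b\<^sup>2"
  let ?y = "of_rat (a + b) + of_rat (- b) * \<omega>"
  have xy: "x * ?y = of_rat n"
    unfolding K_mult x by (simp add: n_def algebra_simps power2_eq_square)
  have "n \<noteq> 0" using rat_norm_nonzero[of a b] False x unfolding n_def by auto
  hence "x * (?y * of_rat (inverse n)) = 1"
    using xy by (simp add: mult.assoc[symmetric] of_rat_inverse)
  hence "inverse x = ?y * of_rat (inverse n)" by (rule inverse_unique)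
  also have "\<dots> \<in> K" using K_I Rats_subset_K by (intro K_times) auto
  finally show ?thesis .
qed

lemma number_field_K: "number_field K"
proof -
  interpret F: field "ring_of_type_algebra :: complex ring" by (rule field_from_type_algebra)
  have "subfield K ring_of_type_algebra"
  proof (rule F.subfieldI')
    show "subring K ring_of_type_algebra"
      using Rats_subset_K by (intro subring_ring_of_type_algebraI K_diff K_times) auto
  qed (use K_inverse in auto)
  moreover have "F.finite_dimension \<rat> K"
  proof (rule F.finite_dimensionI)
    have "F.line_extension \<rat> 1 {0} = \<rat>"
      using F.line_extension_mem_iff[of _ \<rat> 1 "{0}"] by auto
    hence 1: "F.dimension (Suc 0) \<rat> \<rat>"
      using F.Suc_dim[of 1 "{0}" 0 \<rat>] F.zero_dim[of \<rat>] by simp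
    have "\<omega> \<notin> \<rat>"
    proof
      assume "\<omega> \<in> \<rat>"
      then obtain r where "\<omega> = of_rat r" by (auto elim: Rats_cases)
      thus False using K_eq_0[of "- r" 1] by (simp add: of_rat_minus)
    qed
    hence "F.dimension (Suc (Suc 0)) \<rat> (F.line_extension \<rat> \<omega> \<rat>)" using 1 by (intro F.Suc_dim) auto
    moreover have "F.line_extension \<rat> \<omega> \<rat> = K"
    proof (intro equalityI subsetI)
      fix x assume "x \<in> F.line_extension \<rat> \<omega> \<rat>"
      then obtain k v where "k \<in> \<rat>" "v \<in> \<rat>" "x = k * \<omega> + v"
        using F.line_extension_mem_iff[of x \<rat> \<omega> \<rat>] by auto
      then obtain r s where "x = of_rat s + of_rat r * \<omega>" by (auto elim!: Rats_cases simp: add.commute)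
      thus "x \<in> K" by (simp only: K_I)
    next
      fix x assume "x \<in> K"
      then obtain a b where "x = of_rat a + of_rat b * \<omega>" by (auto simp: K_def)
      thus "x \<in> F.line_extension \<rat> \<omega> \<rat>"
        unfolding F.line_extension_mem_iff
        by (intro bexI[of _ "of_rat b"] bexI[of _ "of_rat a"]) (auto simp: add.commute)
    qed
    ultimately show "F.dimension (Suc (Suc 0)) \<rat> K" by simp
  qed
  ultimately show ?thesis by (simp add: number_field_def)
qed

section \<open>The maximal order and its ideals\<close>

definition emb :: "int \<times> int \<Rightarrow> complex" where "emb = (\<lambda>(x, y). of_int x + of_int y * \<omega>)"

lemma emb_rat: "emb (x, y) = of_rat (of_int x) + of_rat (of_int y) * \<omega>" by (simp add: emb_def)

lemma inj_emb: "inj emb"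
  by (rule injI, clarify) (simp only: emb_rat K_eq_iff of_int_eq_iff simp_thms)

lemma emb_diff: "emb (x, y) - emb (u, v) = emb (x - u, y - v)"
  by (simp add: emb_def algebra_simps)

lemma emb_add: "emb (x, y) + emb (u, v) = emb (x + u, y + v)"
  by (simp add: emb_def algebra_simps)

lemma emb_mult: "emb (x, y) * emb (u, v) = emb (x * u + D * y * v, x * v + y * u + y * v)"
  unfolding emb_rat K_mult by simp

lemma emb_int: "emb (x, 0) = of_int x" by (simp add: emb_def)

lemma range_emb_closed:
  "0 \<in> range emb" "1 \<in> range emb" "of_int k \<in> range emb"
  "p \<in> range emb \<Longrightarrow> q \<in> range emb \<Longrightarrow> p + q \<in> range emb"
  "p \<in> range emb \<Longrightarrow> q \<in> range emb \<Longrightarrow> p - q \<in> range emb"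
  "p \<in> range emb \<Longrightarrow> q \<in> range emb \<Longrightarrow> p * q \<in> range emb"
proof -
  show int: "of_int k \<in> range emb" for k using emb_int[of k] by (metis rangeI)
  show "0 \<in> range emb" "1 \<in> range emb" using int[of 0] int[of 1] by simp_all
  show "p + q \<in> range emb" "p - q \<in> range emb" "p * q \<in> range emb" if "p \<in> range emb" "q \<in> range emb"
  proof -
    obtain x y u v where "p = emb (x, y)" "q = emb (u, v)" using \<open>p \<in> range emb\<close> \<open>q \<in> range emb\<close> by (metis imageE surj_pair)
    thus "p + q \<in> range emb" "p - q \<in> range emb" "p * q \<in> range emb"
      using emb_add emb_diff emb_mult by (metis rangeI)+
  qed
qed

lemma range_emb_sum: "(\<And>i. i \<in> A \<Longrightarrow> f i \<in> range emb) \<Longrightarrow> sum f A \<in> range emb"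
  by (induction A rule: infinite_finite_induct) (auto intro: range_emb_closed)

lemma range_emb_power: "x \<in> range emb \<Longrightarrow> x ^ n \<in> range emb"
  by (induction n) (auto intro: range_emb_closed)

lemma range_emb_subset: "range emb \<subseteq> {x \<in> K. algebraic_int x}"
proof (safe)
  fix x y :: int
  show "emb (x, y) \<in> K" by (simp only: emb_rat K_I)
  define T N where "T = 2 * x + y" and "N = x\<^sup>2 + x * y - D * y\<^sup>2"
  let ?p = "[:of_int N, - of_int T, 1:] :: complex poly"
  have root: "poly ?p (emb (x, y)) = 0"
  proof -
    have "poly ?p (emb (x, y)) = emb (N, 0) - emb (T, 0) * emb (x, y) + emb (x, y) * emb (x, y)"
      by (simp add: emb_int algebra_simps)
    also have "\<dots> = emb (0, 0)" unfolding emb_mult emb_diff emb_add N_def T_def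
      by (simp add: algebra_simps power2_eq_square)
    finally show ?thesis by (simp add: emb_def)
  qed
  show "algebraic_int (emb (x, y))"
  proof (rule algebraic_int.intros[OF _ _ root])
    show "Polynomial.lead_coeff ?p = 1" by simp
    show "\<forall>i. Polynomial.coeff ?p i \<in> \<int>" by (auto simp: coeff_pCons split: nat.split)
  qed
qed

text \<open>If q x lies in the order and n is the degree of a monic integer equation of x, then q^n
  clears the denominators of x^k for k <= n. The equation expresses higher powers through lower ones
  with integer coefficients, so q^n clears those as well.\<close>

lemma algebraic_int_bounded_denominator:
  assumes x: "x \<in> K" and "algebraic_int x"
  shows "\<exists>c>0. \<forall>k. of_int c * x ^ k \<in> range emb"
proof -
  obtain p where p: "Polynomial.lead_coeff p = 1" "\<And>i. Polynomial.coeff p i \<in> \<int>" "poly p x = 0"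
    using assms(2) by (auto elim: algebraic_int.cases)
  let ?n = "Polynomial.degree p"
  obtain a b where ab: "x = of_rat a + of_rat b * \<omega>" using x by (auto simp: K_def)
  obtain u m where u: "m > 0" "a = of_int u / of_int m"
    using quotient_of_denom_pos' quotient_of_div by (metis surj_pair snd_conv)
  obtain v n where v: "n > 0" "b = of_int v / of_int n"
    using quotient_of_denom_pos' quotient_of_div by (metis surj_pair snd_conv)
  define q where "q = m * n"
  have q: "q > 0" using u v by (simp add: q_def)
  have "of_int q * x = emb (u * n, v * m)"
  proof -
    have *: "(y * z) * (U / y + V / z * w) = U * z + V * y * w" if "y \<noteq> 0" "z \<noteq> 0" for y z U V w :: complex
      using that by (simp add: distrib_left)
    show ?thesis
      unfolding ab u(2) v(2) q_def emb_def using *[of "of_int m" "of_int n"] u(1) v(1)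
      by (simp add: of_rat_divide)
  qed
  hence qx: "of_int q * x \<in> range emb" by simp
  have small: "of_int (q ^ ?n) * x ^ k \<in> range emb" if "k \<le> ?n" for k
  proof -
    have "of_int (q ^ ?n) * x ^ k = of_int (q ^ (?n - k)) * (of_int q * x) ^ k"
      using that by (simp add: power_mult_distrib flip: power_add mult.assoc)
    thus ?thesis using qx by (auto intro: range_emb_closed range_emb_power)
  qed
  have "of_int (q ^ ?n) * x ^ k \<in> range emb" for k
  proof (induction k rule: less_induct)
    case (less k)
    show ?case
    proof (cases "k \<le> ?n")
      case True thus ?thesis by (rule small)
    next
      case False
      have "poly p x = (\<Sum>i<?n. Polynomial.coeff p i * x ^ i) + x ^ ?n"
        using p(1) by (simp add: poly_altdef lessThan_Suc_atMost[symmetric])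
      hence "x ^ ?n = - (\<Sum>i<?n. Polynomial.coeff p i * x ^ i)" using p(3) by (simp add: add_eq_0_iff)
      moreover have "x ^ k = x ^ (k - ?n) * x ^ ?n" using False by (simp flip: power_add)
      ultimately have "of_int (q ^ ?n) * x ^ k = 0 - (\<Sum>i<?n. Polynomial.coeff p i * (of_int (q ^ ?n) * x ^ (k - ?n + i)))"
        by (simp add: sum_distrib_left power_add mult_ac sum_negf)
      also have "\<dots> \<in> range emb"
      proof (rule range_emb_closed(5)[OF range_emb_closed(1) range_emb_sum], rule range_emb_closed(6))
        fix i assume "i \<in> {..<?n}"
        show "Polynomial.coeff p i \<in> range emb" using p(2)[of i] by (auto elim!: Ints_cases intro: range_emb_closed)
        show "of_int (q ^ ?n) * x ^ (k - ?n + i) \<in> range emb"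
          using \<open>i \<in> {..<?n}\<close> False by (intro less.IH) auto
      qed
      finally show ?thesis .
    qed
  qed
  thus ?thesis using q by (intro exI[of _ "q ^ ?n"]) simp
qed

text \<open>Conjugation is multiplicative, so the norm of x^k is the k-th power of the norm of x. If
  c x^k lies in the order, then c^2 times this power is an integer for every k, and bounded
  denominators force the norm to be an integer.\<close>

lemma norm_integral:
  assumes c: "c > 0" and *: "\<And>k. of_int c * (of_rat a + of_rat b * \<omega>) ^ k \<in> range emb"
  shows "a\<^sup>2 + a * b - of_int D * b\<^sup>2 \<in> \<int>"
proof (rule rat_powers_bounded_denominator[of "c\<^sup>2"])
  show "c\<^sup>2 > 0" using c by simp
  let ?x = "of_rat a + of_rat b * \<omega>" and ?y = "of_rat (a + b) + of_rat (- b) * \<omega>"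
  have xy: "?x * ?y = of_rat (a\<^sup>2 + a * b - of_int D * b\<^sup>2)"
    unfolding K_mult by (simp add: algebra_simps power2_eq_square)
  have conj: "\<exists>r s. ?x ^ k = of_rat r + of_rat s * \<omega> \<and> ?y ^ k = of_rat (r + s) + of_rat (- s) * \<omega>" for k
  proof (induction k)
    case 0 show ?case by (intro exI[of _ 1] exI[of _ 0]) simp
  next
    case (Suc k)
    then obtain r s where rs: "?x ^ k = of_rat r + of_rat s * \<omega>" "?y ^ k = of_rat (r + s) + of_rat (- s) * \<omega>"
      by blast
    show ?case unfolding power_Suc rs K_mult
      by (intro exI conjI, rule refl) (simp add: K_eq_iff algebra_simps)
  qed
  fix k
  obtain r s where rs: "?x ^ k = of_rat r + of_rat s * \<omega>" "?y ^ k = of_rat (r + s) + of_rat (- s) * \<omega>"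
    using conj by blast
  obtain u v where uv: "of_int c * ?x ^ k = emb (u, v)" using *[of k] by (metis imageE surj_pair)
  hence "of_rat (of_int c * r) + of_rat (of_int c * s) * \<omega> = of_rat (of_int u) + of_rat (of_int v) * \<omega>"
    unfolding rs emb_rat by (simp add: of_rat_mult algebra_simps)
  hence cr: "of_int c * r = of_int u" "of_int c * s = of_int v" unfolding K_eq_iff by simp_all
  have "of_rat ((a\<^sup>2 + a * b - of_int D * b\<^sup>2) ^ k) = ?x ^ k * ?y ^ k"
    by (simp add: of_rat_power flip: xy power_mult_distrib)
  also have "\<dots> = of_rat (r\<^sup>2 + r * s - of_int D * s\<^sup>2)"
    unfolding rs K_mult by (simp add: algebra_simps power2_eq_square)
  finally have "(a\<^sup>2 + a * b - of_int D * b\<^sup>2) ^ k = r\<^sup>2 + r * s - of_int D * s\<^sup>2" by (simp only: of_rat_eq_iff)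
  hence "of_int (c\<^sup>2) * (a\<^sup>2 + a * b - of_int D * b\<^sup>2) ^ k = of_int (c\<^sup>2) * (r\<^sup>2 + r * s - of_int D * s\<^sup>2)"
    by simp
  also have "\<dots> = (of_int c * r)\<^sup>2 + (of_int c * r) * (of_int c * s) - of_int D * (of_int c * s)\<^sup>2"
    by (simp add: algebra_simps power2_eq_square)
  also have "\<dots> \<in> \<int>" unfolding cr by simp
  finally show "of_int (c\<^sup>2) * (a\<^sup>2 + a * b - of_int D * b\<^sup>2) ^ k \<in> \<int>" .
qed

text \<open>With trace t and norm n, d b^2 = t^2 - 4 n is an integer; since d is squarefree, b has
  denominator 1. A parity argument then shows that 2 a = t - b is even.\<close>

lemma rat_integral_basis:
  fixes a b :: rat
  assumes N: "a\<^sup>2 + a * b - of_int D * b\<^sup>2 \<in> \<int>" and T: "2 * a + b \<in> \<int>"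
  shows "a \<in> \<int>" "b \<in> \<int>"
proof -
  obtain u v where uv: "quotient_of b = (u, v)" by fastforce
  have v0: "v > 0" and cop: "coprime u v" and b: "b = of_int u / of_int v"
    using quotient_of_denom_pos[OF uv] quotient_of_coprime[OF uv] quotient_of_div[OF uv] by simp_all
  obtain t n where t: "2 * a + b = of_int t" and n: "a\<^sup>2 + a * b - of_int D * b\<^sup>2 = of_int n"
    using N T by (auto elim!: Ints_cases)
  have "(2 * a + b)\<^sup>2 - of_int (4 * D + 1) * b\<^sup>2 = 4 * (a\<^sup>2 + a * b - of_int D * b\<^sup>2)"
    by (simp add: power2_eq_square algebra_simps)
  hence "(of_int t)\<^sup>2 - of_int (int d) * b\<^sup>2 = 4 * of_int n" unfolding dD[symmetric] t n .
  hence "of_int (int d * u\<^sup>2) = (of_int ((t\<^sup>2 - 4 * n) * v\<^sup>2) :: rat)"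
    unfolding b using v0 by (simp add: field_simps power2_eq_square)
  hence "int d * u\<^sup>2 = (t\<^sup>2 - 4 * n) * v\<^sup>2" by (simp only: of_int_eq_iff)
  hence "v\<^sup>2 dvd int d * u\<^sup>2" by simp
  moreover have "coprime (v\<^sup>2) (u\<^sup>2)" using cop by (simp add: coprime_commute)
  ultimately have "v\<^sup>2 dvd int d" by (simp add: coprime_dvd_mult_left_iff)
  hence "int ((nat v)\<^sup>2) dvd int d" using v0 by simp
  hence "(nat v)\<^sup>2 dvd d" by (simp only: int_dvd_int_iff)
  hence "nat v dvd 1" using sqf by (rule squarefreeD[rotated])
  hence "v = 1" using v0 by simp
  thus bZ: "b \<in> \<int>" using b by simp
  have bu: "b = of_int u" using b \<open>v = 1\<close> by simp
  have a2: "2 * a = of_int (t - u)" using t bu by simp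
  have "(2 * a)\<^sup>2 + 2 * ((2 * a) * b) - 4 * of_int D * b\<^sup>2 = 4 * of_int n"
    using n by (simp add: power2_eq_square algebra_simps)
  hence "of_int ((t - u)\<^sup>2 + 2 * ((t - u) * u) - 4 * D * u\<^sup>2) = (of_int (4 * n) :: rat)"
    unfolding a2 bu by simp
  hence "(t - u)\<^sup>2 + 2 * ((t - u) * u) - 4 * D * u\<^sup>2 = 4 * n" by (simp only: of_int_eq_iff)
  hence "(t - u)\<^sup>2 = 2 * (2 * n + 2 * D * u\<^sup>2 - (t - u) * u)" by simp
  hence "even ((t - u)\<^sup>2)" by simp
  hence "even (t - u)" by simp
  then obtain w where "t - u = 2 * w" by blast
  hence "a = of_int w" using a2 by simp
  thus "a \<in> \<int>" by simp
qed

lemma integers_K: "{x \<in> K. algebraic_int x} = range emb"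
proof (intro equalityI range_emb_subset subsetI)
  fix x assume "x \<in> {x \<in> K. algebraic_int x}"
  hence x: "x \<in> K" "algebraic_int x" by auto
  obtain c where c: "c > 0" "\<And>k. of_int c * x ^ k \<in> range emb"
    using algebraic_int_bounded_denominator[OF x] by blast
  obtain a b where ab: "x = of_rat a + of_rat b * \<omega>" using x by (auto simp: K_def)
  have c': "of_int c * (x + 1) ^ k \<in> range emb" for k
  proof -
    have "of_int c * (x + 1) ^ k = (\<Sum>i\<le>k. of_int (int (k choose i)) * (of_int c * x ^ i))"
      by (simp add: binomial_ring sum_distrib_left mult_ac)
    also have "\<dots> \<in> range emb" by (intro range_emb_sum range_emb_closed(6) range_emb_closed(3) c(2))
    finally show ?thesis .
  qed
  have x1: "x + 1 = of_rat (a + 1) + of_rat b * \<omega>" by (simp add: ab of_rat_add)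
  have N: "a\<^sup>2 + a * b - of_int D * b\<^sup>2 \<in> \<int>" using norm_integral[OF c(1)] c(2) ab by simp
  have N1: "(a + 1)\<^sup>2 + (a + 1) * b - of_int D * b\<^sup>2 \<in> \<int>" using norm_integral[OF c(1)] c' x1 by simp
  \<comment> \<open>The trace 2 a + b is N(x + 1) - N(x) - 1, so its integrality follows from that
    of norms.\<close>
  have "((a + 1)\<^sup>2 + (a + 1) * b - of_int D * b\<^sup>2) - (a\<^sup>2 + a * b - of_int D * b\<^sup>2) - 1 \<in> \<int>"
    by (intro Ints_diff[OF Ints_diff[OF N1 N]] Ints_1)
  hence "2 * a + b \<in> \<int>" by (simp add: algebra_simps power2_eq_square)
  from rat_integral_basis[OF N this] obtain u v where "a = of_int u" "b = of_int v" by (auto elim!: Ints_cases)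
  hence "x = emb (u, v)" using ab by (simp add: emb_def)
  thus "x \<in> range emb" by simp
qed

text \<open>An isomorphism fixes the rationals and sends \<omega> to a root of X^2 - X - D, that is,
  to \<omega> or 1 - \<omega>; in both cases the image inside the complex numbers is K
  again.\<close>

lemma isomorphic_K:
  assumes iso: "complex_subring K \<simeq> complex_subring L"
  shows "L = K"
proof -
  obtain h where h: "h \<in> ring_iso (complex_subring K) (complex_subring L)"
    using iso by (auto simp: is_ring_iso_def)
  have hom: "h \<in> ring_hom (complex_subring K) (complex_subring L)" and bij: "bij_betw h K L"
    using h by (auto simp: ring_iso_def)
  have add: "h (x + y) = h x + h y" and mult: "h (x * y) = h x * h y" if "x \<in> K" "y \<in> K" for x y
    using that ring_hom_add[OF hom, of x y] ring_hom_mult[OF hom, of x y] by simp_all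
  have rat: "h q = q" if "q \<in> \<rat>" for q
    using ring_hom_of_rat[of K h q] add mult ring_hom_one[OF hom] Rats_subset_K that by simp
  have w: "\<omega> \<in> K" using K_I[of 0 1] by simp
  have lin: "h (of_rat a + of_rat b * \<omega>) = of_rat a + of_rat b * h \<omega>" for a b
    using add[of "of_rat a" "of_rat b * \<omega>"] mult[of "of_rat b" \<omega>] w Rats_subset_K rat K_times
    by (simp add: subset_iff)
  have "h \<omega> * h \<omega> = h \<omega> + of_int D"
  proof -
    have "of_int D \<in> K" using Rats_subset_K by auto
    thus ?thesis using mult[OF w w] add[OF w, of "of_int D"] rat[of "of_int D"] by (simp add: omega_sq)
  qed
  hence "(h \<omega> - \<omega>) * (h \<omega> - (1 - \<omega>)) = 0" using omega_sq by (simp add: algebra_simps)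
  hence cases: "h \<omega> = \<omega> \<or> h \<omega> = 1 - \<omega>" by auto
  have "h ` K = {of_rat a + of_rat b * h \<omega> | a b. True}"
    unfolding K_def using lin by (auto simp: image_def) metis
  also have "\<dots> = K"
    using cases
  proof
    assume w1: "h \<omega> = 1 - \<omega>"
    have 1: "of_rat a + of_rat b * h \<omega> = of_rat (a + b) + of_rat (- b) * \<omega>" for a b
      by (simp add: w1 of_rat_add of_rat_minus algebra_simps)
    have 2: "of_rat a + of_rat b * \<omega> = of_rat (a + b) + of_rat (- b) * h \<omega>" for a b
      by (simp add: w1 of_rat_add of_rat_minus algebra_simps)
    show ?thesis
    proof (intro equalityI subsetI)
      fix x assume "x \<in> {of_rat a + of_rat b * h \<omega> | a b. True}"
      thus "x \<in> K" using 1 K_I by auto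
    next
      fix x assume "x \<in> K"
      thus "x \<in> {of_rat a + of_rat b * h \<omega> | a b. True}" unfolding K_def using 2 by blast
    qed
  qed (simp add: K_def)
  finally show ?thesis using bij by (simp add: bij_betw_def)
qed

text \<open>Because the class of K is a singleton, the choice of a representative in
  \<open>zeta_height\<close> can only return K.\<close>

lemma number_field_class_K: "{K} \<in> number_field_classes"
proof -
  let ?r = "{(K, L). number_field K \<and> number_field L \<and> complex_subring K \<simeq> complex_subring L}"
  have "id \<in> ring_iso (complex_subring K) (complex_subring K)"
    by (auto simp: ring_iso_def ring_hom_def)
  hence "complex_subring K \<simeq> complex_subring K" by (auto simp: is_ring_iso_def)
  hence "?r `` {K} = {K}" using isomorphic_K number_field_K by auto
  thus ?thesis using number_field_K unfolding number_field_classes_def quotient_def by auto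
qed

abbreviation OK where "OK \<equiv> ring_of_integers K"

lemma OK_eq: "OK = ring_of_type_algebra\<lparr>carrier := range emb\<rparr>"
  by (simp add: ring_of_integers_def integers_K)

lemma ring_OK: "ring OK"
proof -
  interpret F: field "ring_of_type_algebra :: complex ring" by (rule field_from_type_algebra)
  show ?thesis unfolding OK_eq
    by (intro F.subring_is_ring subring_ring_of_type_algebraI) (auto intro: range_emb_closed)
qed

lemma ideal_emb_image:
  assumes J: "omega_module J" shows "ideal (emb ` J) OK"
proof (rule idealI[OF ring_OK])
  have J0: "(0, 0) \<in> J" and Jd: "\<And>x y u v. (x, y) \<in> J \<Longrightarrow> (u, v) \<in> J \<Longrightarrow> (x - u, y - v) \<in> J"
    and Jw: "\<And>x y. (x, y) \<in> J \<Longrightarrow> (D * y, x + y) \<in> J"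
    using J unfolding omega_module_def by blast+
  interpret ring OK by (rule ring_OK)
  show "subgroup (emb ` J) (add_monoid OK)"
  proof (rule add.subgroupI)
    show "emb ` J \<subseteq> carrier OK" by (auto simp: OK_eq)
    show "emb ` J \<noteq> {}" using J0 by auto
    fix p assume "p \<in> emb ` J"
    then obtain x y where p: "p = emb (x, y)" "(x, y) \<in> J" by auto
    have m: "emb (0 - x, 0 - y) \<in> emb ` J" using Jd[OF J0 p(2)] by blast
    have "\<ominus>\<^bsub>OK\<^esub> p = emb (0 - x, 0 - y)"
      by (rule minus_equality) (auto simp: OK_eq p emb_add, simp add: emb_def)
    thus "\<ominus>\<^bsub>OK\<^esub> p \<in> emb ` J" using m by simp
    fix q assume "q \<in> emb ` J"
    then obtain u v where q: "q = emb (u, v)" "(u, v) \<in> J" by auto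
    have "(x + u, y + v) \<in> J" by (rule omega_module_add[OF J p(2) q(2)])
    thus "p \<oplus>\<^bsub>OK\<^esub> q \<in> emb ` J" by (auto simp: OK_eq p q emb_add)
  qed
  have *: "q * p \<in> emb ` J" if pq: "p \<in> emb ` J" "q \<in> range emb" for p q
  proof -
    obtain x y where p: "p = emb (x, y)" "(x, y) \<in> J" using pq(1) by auto
    obtain u v where q: "q = emb (u, v)" using pq(2) by auto
    have "(u * x + v * (D * y), u * y + v * (x + y)) \<in> J"
      by (intro omega_module_add[OF J] omega_module_scale[OF J] Jw p)
    moreover have "q * p = emb (u * x + v * (D * y), u * y + v * (x + y))"
      unfolding p q emb_mult by (simp add: algebra_simps)
    ultimately show ?thesis by simp
  qed
  fix a x assume "a \<in> emb ` J" "x \<in> carrier OK"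
  thus "x \<otimes>\<^bsub>OK\<^esub> a \<in> emb ` J" "a \<otimes>\<^bsub>OK\<^esub> x \<in> emb ` J"
    using *[of a x] by (simp_all add: OK_eq mult.commute)
qed

lemma ideal_imp_emb_image:
  assumes "ideal I OK" obtains J where "omega_module J" "I = emb ` J"
proof (rule that[of "emb -` I"])
  interpret ideal I OK by (rule assms)
  have sub: "I \<subseteq> range emb" using a_subset by (simp add: OK_eq)
  show "I = emb ` (emb -` I)" using sub by auto
  have 0: "0 \<in> I" using additive_subgroup.zero_closed[OF is_additive_subgroup] by (simp add: OK_eq)
  have mult: "q * p \<in> I" if "p \<in> I" "q \<in> range emb" for p q using I_l_closed[of p q] that by (simp add: OK_eq)
  have add: "p + q \<in> I" if "p \<in> I" "q \<in> I" for p q using additive_subgroup.a_closed[OF is_additive_subgroup that] by (simp add: OK_eq)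
  have diff: "p - q \<in> I" if "p \<in> I" "q \<in> I" for p q
    using add[OF that(1) mult[OF that(2) range_emb_closed(3)[of "-1"]]] by simp
  show "omega_module (emb -` I)"
    unfolding omega_module_def
  proof (intro conjI allI impI)
    show "(0, 0) \<in> emb -` I" using 0 by (simp add: emb_def)
    show "(x - u, y - v) \<in> emb -` I" if "(x, y) \<in> emb -` I" "(u, v) \<in> emb -` I" for x y u v
      using diff[of "emb (x, y)" "emb (u, v)"] that by (simp add: emb_diff)
    show "(D * y, x + y) \<in> emb -` I" if "(x, y) \<in> emb -` I" for x y
      using mult[of "emb (x, y)" "emb (0, 1)"] that by (simp add: emb_mult)
  qed
qed

lemma emb_image_zero: "emb ` J = {0} \<longleftrightarrow> J = {(0, 0)}"
proof -
  have "emb ` {(0, 0)} = {0}" by (simp add: emb_def)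
  thus ?thesis using inj_image_eq_iff[OF inj_emb, of J "{(0, 0)}"] by simp
qed

theorem bij_betw_ideals:
  "bij_betw (\<lambda>t. emb ` qlattice t) lattice_params {I. ideal I OK \<and> I \<noteq> {0}}"
  unfolding bij_betw_def
proof (intro conjI equalityI subsetI)
  show "inj_on (\<lambda>t. emb ` qlattice t) lattice_params"
    using inj_on_lattice by (auto simp: inj_on_def inj_image_eq_iff[OF inj_emb])
  fix I assume "I \<in> (\<lambda>t. emb ` qlattice t) ` lattice_params"
  then obtain t where t: "t \<in> lattice_params" "I = emb ` qlattice t" by blast
  obtain g a b where gab: "t = (g, a, b)" by (metis prod_cases3)
  have "(int g * int a, 0) \<in> qlattice t" by (simp add: qlattice_def gab)
  moreover have "int g * int a \<noteq> 0" using t(1) by (simp add: lattice_params_def gab)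
  ultimately have "qlattice t \<noteq> {(0, 0)}" by (metis Pair_inject singletonD)
  thus "I \<in> {I. ideal I OK \<and> I \<noteq> {0}}"
    using t ideal_emb_image[OF omega_module_lattice[OF t(1)]] by (simp add: emb_image_zero)
next
  fix I assume "I \<in> {I. ideal I OK \<and> I \<noteq> {0}}"
  hence "ideal I OK" and ne: "I \<noteq> {0}" by auto
  then obtain J where J: "omega_module J" "I = emb ` J" by (metis ideal_imp_emb_image)
  hence "J \<noteq> {(0, 0)}" using ne by (simp add: emb_image_zero)
  then obtain t where "t \<in> lattice_params" "J = qlattice t" using omega_module_eq_lattice J(1) by blast
  thus "I \<in> (\<lambda>t. emb ` qlattice t) ` lattice_params" using J(2) by blast
qed

theorem ideal_norm_lattice:
  assumes t: "t \<in> lattice_params"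
  shows "ideal_norm K (emb ` qlattice t) = lattice_index t"
proof -
  let ?I = "emb ` qlattice t"
  interpret ideal ?I OK by (rule ideal_emb_image[OF omega_module_lattice[OF t]])
  have coset: "?I +>\<^bsub>OK\<^esub> p = (\<lambda>h. h + p) ` ?I" for p
    by (auto simp: a_r_coset_def' OK_eq)
  obtain R where R: "finite R" "card R = lattice_index t"
    "\<And>x y u v. (x, y) \<in> R \<Longrightarrow> (u, v) \<in> R \<Longrightarrow> (x - u, y - v) \<in> qlattice t \<Longrightarrow> (x, y) = (u, v)"
    "\<And>x y. \<exists>u v. (u, v) \<in> R \<and> (x - u, y - v) \<in> qlattice t"
    using lattice_representatives[OF t] by metis
  have eq: "?I +>\<^bsub>OK\<^esub> emb (x, y) = ?I +>\<^bsub>OK\<^esub> emb (u, v) \<longleftrightarrow> (x - u, y - v) \<in> qlattice t" for x y u v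
  proof
    assume "?I +>\<^bsub>OK\<^esub> emb (x, y) = ?I +>\<^bsub>OK\<^esub> emb (u, v)"
    moreover have "emb (x, y) \<in> ?I +>\<^bsub>OK\<^esub> emb (x, y)" by (rule a_rcos_self) (simp add: OK_eq)
    ultimately obtain z w where zw: "emb (x, y) = emb (z, w) + emb (u, v)" "(z, w) \<in> qlattice t"
      unfolding coset by auto
    hence "emb (x - u, y - v) = emb (z, w)" by (simp flip: emb_diff)
    thus "(x - u, y - v) \<in> qlattice t" using zw(2) inj_emb by (auto dest: injD)
  next
    assume "(x - u, y - v) \<in> qlattice t"
    hence "emb (x - u, y - v) + emb (u, v) \<in> ?I +>\<^bsub>OK\<^esub> emb (u, v)" unfolding coset by blast
    hence "emb (x, y) \<in> ?I +>\<^bsub>OK\<^esub> emb (u, v)" by (simp add: emb_add)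
    thus "?I +>\<^bsub>OK\<^esub> emb (x, y) = ?I +>\<^bsub>OK\<^esub> emb (u, v)"
      by (intro a_repr_independence'[symmetric]) (auto simp: OK_eq)
  qed
  have "carrier (OK Quot ?I) = (\<lambda>p. ?I +>\<^bsub>OK\<^esub> p) ` range emb"
    by (auto simp: FactRing_def A_RCOSETS_def' OK_eq)
  also have "\<dots> = (\<lambda>v. ?I +>\<^bsub>OK\<^esub> emb v) ` R"
  proof (intro equalityI subsetI)
    fix C assume "C \<in> (\<lambda>p. ?I +>\<^bsub>OK\<^esub> p) ` range emb"
    then obtain x y where C: "C = ?I +>\<^bsub>OK\<^esub> emb (x, y)" by auto
    obtain u v where "(u, v) \<in> R" "(x - u, y - v) \<in> qlattice t" using R(4) by blast
    thus "C \<in> (\<lambda>v. ?I +>\<^bsub>OK\<^esub> emb v) ` R" unfolding C using eq[of x y u v] by blast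
  qed auto
  finally have "ideal_norm K ?I = card ((\<lambda>v. ?I +>\<^bsub>OK\<^esub> emb v) ` R)" by (simp add: ideal_norm_def)
  also have "\<dots> = card R"
  proof (rule card_image, rule inj_onI)
    fix z w assume A: "z \<in> R" "w \<in> R" "?I +>\<^bsub>OK\<^esub> emb z = ?I +>\<^bsub>OK\<^esub> emb w"
    obtain x y u v where zw: "z = (x, y)" "w = (u, v)" by fastforce
    show "z = w" using A R(3)[of x y u v] eq[of x y u v] unfolding zw by blast
  qed
  finally show ?thesis using R(2) by simp
qed

end

subsection \<open>The Dedekind zeta function of a real quadratic field\<close>

context bounded_coeffs
begin

lemma has_sum_Dirichlet_L:
  assumes "Re s > 1"
  shows "((\<lambda>n. of_int (f n) * of_nat n powr (-s)) has_sum (\<Sum>n. of_int (f (Suc n)) * of_nat (Suc n) powr (-s) :: complex)) {0<..}"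
proof -
  have bij: "bij_betw Suc UNIV {0<..}"
    by (rule bij_betwI[where g = "\<lambda>n. n - 1"]) auto
  have "((\<lambda>n. of_int (f (Suc n)) * of_nat (Suc n) powr (-s)) has_sum (\<Sum>n. of_int (f (Suc n)) * of_nat (Suc n) powr (-s) :: complex)) UNIV"
    by (intro norm_summable_imp_has_sum summable_dirichlet assms summable_sums summable_norm_cancel[OF summable_dirichlet[OF assms]])
  thus ?thesis
    using has_sum_reindex_bij_betw[OF bij, of "\<lambda>n. of_int (f n) * of_nat n powr (-s) :: complex"] by simp
qed

end

lemma has_sum_product_complex:
  fixes u :: "'a \<Rightarrow> complex" and v :: "'b \<Rightarrow> complex"
  assumes u: "(u has_sum U) A" and v: "(v has_sum V) B"
  shows "((\<lambda>(x, y). u x * v y) has_sum (U * V)) (A \<times> B)"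
proof -
  have au: "(\<lambda>x. norm (u x)) summable_on A" and av: "(\<lambda>y. norm (v y)) summable_on B"
    using u v summable_on_iff_abs_summable_on_complex has_sum_imp_summable by blast+
  have "(\<lambda>p. norm (case p of (x, y) \<Rightarrow> u x * v y)) summable_on (A \<times> B)"
    unfolding Infinite_Sum.abs_summable_on_Sigma_iff
  proof (intro conjI ballI)
    show "(\<lambda>y. norm (case (x, y) of (x, y) \<Rightarrow> u x * v y)) summable_on B" for x
      using summable_on_cmult_right[OF av, of "norm (u x)"] by (simp add: norm_mult)
    have "(\<lambda>x. norm (norm (u x) * (\<Sum>\<^sub>\<infinity>y\<in>B. norm (v y)))) summable_on A"
      using summable_on_cmult_left[OF au, of "\<Sum>\<^sub>\<infinity>y\<in>B. norm (v y)"] infsum_nonneg[of B "\<lambda>y. norm (v y)"]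
      by (simp add: abs_mult)
    thus "(\<lambda>x. norm (\<Sum>\<^sub>\<infinity>y\<in>B. norm (case (x, y) of (x, y) \<Rightarrow> u x * v y))) summable_on A"
      by (simp add: norm_mult infsum_cmult_right')
  qed
  hence "(\<lambda>(x, y). u x * v y) summable_on (A \<times> B)" by (rule abs_summable_summable)
  then obtain S where S: "((\<lambda>(x, y). u x * v y) has_sum S) (A \<times> B)" by (auto simp: summable_on_def)
  have "((\<lambda>x. u x * V) has_sum S) A"
    by (rule has_sum_SigmaD[OF S]) (use has_sum_cmult_right[OF v] in auto)
  moreover have "((\<lambda>x. u x * V) has_sum (U * V)) A" by (rule has_sum_cmult_left[OF u])
  ultimately have "S = U * V" by (rule has_sum_unique)
  thus ?thesis using S by simp
qed

lemma has_sum_divisor_sum: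
  assumes s: "Re s > 1" and f: "bounded_coeffs f" and one: "bounded_coeffs (\<lambda>_. 1)"
  shows "((\<lambda>n. of_int (\<Sum>k | k dvd n. f k) * of_nat n powr (-s)) has_sum
     ((\<Sum>n. of_nat (Suc n) powr (-s)) * (\<Sum>n. of_int (f (Suc n)) * of_nat (Suc n) powr (-s) :: complex))) {0<..}"
    (is "(_ has_sum ?S) _")
proof -
  let ?g = "\<lambda>(n, m). (n div m, m :: nat)"
  have "((\<lambda>(k, m). (of_int 1 * of_nat k powr (-s)) * (of_int (f m) * of_nat m powr (-s))) has_sum ?S) ({0<..} \<times> {0<..})"
    using has_sum_product_complex[OF bounded_coeffs.has_sum_Dirichlet_L[OF one s] bounded_coeffs.has_sum_Dirichlet_L[OF f s]] by simp
  moreover have "bij_betw ?g (SIGMA n:{0<..}. {m. m dvd n}) ({0<..} \<times> {0<..})"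
    by (rule bij_betwI[where g = "\<lambda>(k, m). (k * m, m)"]) (auto intro!: Nat.gr0I simp: dvd_div_eq_0_iff)
  ultimately have "((\<lambda>z. (\<lambda>(k, m). (of_int 1 * of_nat k powr (-s)) * (of_int (f m) * of_nat m powr (-s))) (?g z)) has_sum ?S) (SIGMA n:{0<..}. {m. m dvd n})"
    by (subst has_sum_reindex_bij_betw)
  also have "?this \<longleftrightarrow> ((\<lambda>(n, m). of_int (f m) * of_nat n powr (-s)) has_sum ?S) (SIGMA n:{0<..}. {m. m dvd n})"
  proof (intro has_sum_cong, clarify)
    fix n m :: nat assume n: "n > 0" "m dvd n"
    then obtain k where k: "n = m * k" by blast
    have "of_nat n powr (-s) = of_nat k powr (-s) * (of_nat m powr (-s) :: complex)"
      using powr_times_real[of "of_nat k" "of_nat m" "-s"] by (simp add: k mult.commute)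
    moreover have "n div m = k" using k n by simp
    ultimately show "(of_int 1 * of_nat (n div m) powr (-s)) * (of_int (f m) * of_nat m powr (-s)) = of_int (f m) * (of_nat n powr (-s) :: complex)"
      by (simp add: mult_ac)
  qed
  finally show ?thesis
  proof (rule has_sum_SigmaD)
    fix n :: nat assume "n \<in> {0<..}"
    hence fin: "finite {m. m dvd n}" by simp
    show "((\<lambda>y. case (n, y) of (n, m) \<Rightarrow> of_int (f m) * of_nat n powr (-s)) has_sum
        of_int (\<Sum>k | k dvd n. f k) * (of_nat n powr (-s) :: complex)) {m. m dvd n}"
      using has_sum_finite[OF fin, of "\<lambda>m. of_int (f m) * (of_nat n powr (-s) :: complex)"]
      by (simp add: sum_distrib_right)
  qed
qed

text \<open>A factor that is analytic and nonzero at z has Laurent subdegree 0, so the leading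
  coefficients multiply. Working with leading coefficients covers the possibility that Z has a zero
  or a pole at z.\<close>

lemma first_laurent_coeff_mult_analytic:
  assumes Z: "Z meromorphic_on UNIV" and nz: "\<not> eventually (\<lambda>s. Z s = 0) (at z)"
    and L: "L analytic_on {z}" "L z \<noteq> 0"
  shows "first_laurent_coeff (remove_sings (\<lambda>s. Z s * L s)) z = first_laurent_coeff Z z * L z"
    and "first_laurent_coeff Z z \<noteq> 0"
proof -
  define F where "F = laurent_expansion Z z"
  define G where "G = fps_to_fls (fps_expansion L z)"
  have F: "(\<lambda>w. Z (z + w)) has_laurent_expansion F"
    unfolding F_def using Z by (rule meromorphic_on_imp_has_laurent_expansion) auto
  have "(\<lambda>w. L (z + w)) has_fps_expansion fps_expansion L z"
    using L(1) by (rule analytic_at_imp_has_fps_expansion)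
  hence G: "(\<lambda>w. L (z + w)) has_laurent_expansion G"
    unfolding G_def by (rule has_laurent_expansion_fps)
  have "(\<lambda>w. Z (z + w) * L (z + w)) has_laurent_expansion F * G"
    by (rule has_laurent_expansion_mult[OF F G])
  from this have "remove_sings (\<lambda>w. Z (z + w) * L (z + w)) has_laurent_expansion F * G"
    by (rule remove_sings_has_laurent_expansion)
  also have "remove_sings (\<lambda>w. Z (z + w) * L (z + w)) = (\<lambda>w. remove_sings (\<lambda>s. Z s * L s) (z + w))"
    using remove_sings_shift_0[of "\<lambda>w. Z (z + w) * L (z + w)"] remove_sings_shift_0[of "\<lambda>s. Z s * L s"]
    by (intro ext) (simp only: add.assoc)
  finally have FG: "laurent_expansion (remove_sings (\<lambda>s. Z s * L s)) z = F * G" by (rule laurent_expansion_eqI)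
  have F0: "F \<noteq> 0" using nz has_laurent_expansion_eventually_zero_iff[OF F] by simp
  have "fls_nth G 0 = L z" by (simp add: G_def fps_expansion_def)
  moreover from this have G0: "G \<noteq> 0" "fls_subdegree G = 0"
    using L(2) by (metis fls_zero_nth, auto simp: G_def intro!: fls_subdegree_eqI)
  ultimately show "first_laurent_coeff (remove_sings (\<lambda>s. Z s * L s)) z = first_laurent_coeff Z z * L z"
    unfolding first_laurent_coeff_def FG using F0 fls_times_base[of F G]
    by (simp add: F_def[symmetric])
  show "first_laurent_coeff Z z \<noteq> 0" using F0 by (simp add: first_laurent_coeff_def F_def)
qed

lemma periodic_coeffs_one: "periodic_coeffs (\<lambda>_. 1) 1"
  by standard auto

text \<open>Local vanishing would spread by the identity theorem to a neighbourhood of 2, where the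
  function is the positive sum of n^(-2). This is what makes the leading coefficient of zeta nonzero
  at every point.\<close>

lemma Dirichlet_L_one_not_zero: "\<not> eventually (\<lambda>s. Dirichlet_L (\<lambda>_. 1) s = 0) (at z)"
proof
  let ?Z = "Dirichlet_L (\<lambda>_. 1)"
  assume ev: "eventually (\<lambda>s. ?Z s = 0) (at z)"
  interpret periodic_coeffs "\<lambda>_. 1" 1 by (rule periodic_coeffs_one)
  have nice: "?Z nicely_meromorphic_on UNIV" by (rule Dirichlet_L_meromorphic)
  hence mero: "?Z meromorphic_on UNIV" by (simp add: nicely_meromorphic_on_def)
  have "(\<forall>\<^sub>\<approx>s\<in>UNIV. ?Z s = 0) \<or> (\<forall>\<^sub>\<approx>s\<in>UNIV. ?Z s \<noteq> 0)"
    by (rule meromorphic_imp_constant_or_avoid[OF mero]) auto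
  moreover have "\<not> (\<forall>\<^sub>\<approx>s\<in>UNIV. ?Z s \<noteq> 0)"
  proof
    assume "\<forall>\<^sub>\<approx>s\<in>UNIV. ?Z s \<noteq> 0"
    hence "eventually (\<lambda>s. ?Z s \<noteq> 0) (at z)" by (simp add: eventually_cosparse_open_eq)
    hence "eventually (\<lambda>s. False) (at z)" using ev by eventually_elim simp
    thus False by simp
  qed
  ultimately have "\<forall>\<^sub>\<approx>s\<in>UNIV. ?Z s = 0" by blast
  hence "eventually (\<lambda>s. ?Z s = 0) (at 2)" by (simp add: eventually_cosparse_open_eq)
  hence "?Z \<midarrow>2\<rightarrow> 0" by (rule tendsto_eventually)
  moreover have ne: "?Z 2 \<noteq> 0"
  proof -
    have sm: "summable (\<lambda>n. real (Suc n) powr (-2))"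
      using summable_dirichlet[of 2] by (simp add: norm_powr_real_powr)
    have "?Z 2 = (\<Sum>n. complex_of_real (real (Suc n) powr (-2)))"
      using Dirichlet_L_series[of 2] by (simp flip: powr_of_real)
    also have "\<dots> = of_real (\<Sum>n. real (Suc n) powr (-2))" using sm by (rule suminf_of_real[symmetric])
    finally have "?Z 2 = of_real (\<Sum>n. real (Suc n) powr (-2))" .
    moreover have "(\<Sum>n. real (Suc n) powr (-2)) > 0" using sm by (rule suminf_pos) simp
    ultimately show ?thesis by simp
  qed
  moreover have "(is_pole ?Z 2 \<and> ?Z 2 = 0) \<or> ?Z \<midarrow>2\<rightarrow> ?Z 2"
    using nice unfolding nicely_meromorphic_on_def by auto
  ultimately show False using LIM_unique by blast
qed

context quadratic_order
begin

lemma d_gt_1: "d > 1" using d8 by (cases "d = 0 \<or> d = 1") auto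

lemma d_mod_4: "d mod 4 = 1" using d8 by presburger

lemma index_fibre:
  assumes "n > 0"
  shows "finite {t \<in> lattice_params. lattice_index t = n}"
    and "int (card {t \<in> lattice_params. lattice_index t = n}) = (\<Sum>k | k dvd n. kronecker (int d) k)"
proof -
  have "{t \<in> lattice_params. lattice_index t = n} = {(g, a, b). a > 0 \<and> b \<in> roots_mod D a \<and> g\<^sup>2 * a = n}"
    using assms by (auto simp: lattice_params_def lattice_index_def intro!: Nat.gr0I)
  thus "finite {t \<in> lattice_params. lattice_index t = n}"
    "int (card {t \<in> lattice_params. lattice_index t = n}) = (\<Sum>k | k dvd n. kronecker (int d) k)"
    using card_lattices_of_index[OF dD d8 sqf assms] by simp_all
qed

text \<open>Ideals are grouped by norm n, and \<open>index_fibre\<close> counts each group as the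
  divisor sum of \<chi>_d. Being a cardinality, this sum is nonnegative, which turns summability
  over n into absolute summability over all ideals and so permits the regrouping.\<close>

theorem dedekind_sum_eq:
  assumes s: "Re s > 1"
  shows "(\<Sum>\<^sub>\<infinity>I\<in>{I. ideal I OK \<and> I \<noteq> {0}}. of_nat (ideal_norm K I) powr (-s)) =
    Dirichlet_L (\<lambda>_. 1) s * Dirichlet_L (kronecker (int d)) s"
proof -
  interpret Z: periodic_coeffs "\<lambda>_. 1" 1 by (rule periodic_coeffs_one)
  interpret L: periodic_coeffs "kronecker (int d)" d by (rule periodic_coeffs_kronecker[OF d_mod_4 d_gt_1])
  let ?T = "\<lambda>n. {t \<in> lattice_params. lattice_index t = n}"
  let ?H = "\<lambda>n. \<Sum>k | k dvd n. kronecker (int d) k"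
  have H: "((\<lambda>n. of_int (?H n) * of_nat n powr (-s)) has_sum (Dirichlet_L (\<lambda>_. 1) s * Dirichlet_L (kronecker (int d)) s)) {0<..}"
    using has_sum_divisor_sum[OF s L.bounded_coeffs_axioms Z.bounded_coeffs_axioms]
    by (simp add: Z.Dirichlet_L_series[OF s] L.Dirichlet_L_series[OF s])
  have inner: "(\<Sum>t\<in>?T n. c) = of_int (?H n) * c" if "n > 0" for n and c :: "'z::comm_ring_1"
    unfolding index_fibre(2)[OF that, symmetric] by simp
  have Hnn: "?H n \<ge> 0" if "n > 0" for n using index_fibre(2)[OF that] by simp
  let ?g = "\<lambda>(n, t). of_nat n powr (-s) :: complex"
  have abs: "(\<lambda>p. norm (?g p)) summable_on (SIGMA n:{0<..}. ?T n)"
    unfolding Infinite_Sum.abs_summable_on_Sigma_iff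
  proof (intro conjI ballI)
    fix n :: nat assume "n \<in> {0<..}"
    thus "(\<lambda>y. norm (?g (n, y))) summable_on ?T n" using index_fibre by simp
  next
    have "(\<lambda>n. norm (of_int (?H n) * of_nat n powr (-s) :: complex)) summable_on {0<..}"
      using has_sum_imp_summable[OF H] by (simp only: summable_on_iff_abs_summable_on_complex)
    also have "?this \<longleftrightarrow> (\<lambda>n. norm (\<Sum>\<^sub>\<infinity>t\<in>?T n. norm (?g (n, t)))) summable_on {0<..}"
    proof (rule summable_on_cong)
      fix n :: nat assume "n \<in> {0<..}"
      thus "norm (of_int (?H n) * of_nat n powr (-s) :: complex) = norm (\<Sum>\<^sub>\<infinity>t\<in>?T n. norm (?g (n, t)))"
        using index_fibre[of n] Hnn[of n] inner[of n "norm (of_nat n powr (-s) :: complex)"]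
        by (simp add: norm_mult abs_mult del: of_int_sum)
    qed
    finally show "(\<lambda>n. norm (\<Sum>\<^sub>\<infinity>t\<in>?T n. norm (?g (n, t)))) summable_on {0<..}" .
  qed
  then obtain S where S: "(?g has_sum S) (SIGMA n:{0<..}. ?T n)"
    using abs_summable_summable unfolding summable_on_def by blast
  have "((\<lambda>n. of_int (?H n) * of_nat n powr (-s)) has_sum S) {0<..}"
  proof (rule has_sum_SigmaD[OF S])
    fix n :: nat assume "n \<in> {0<..}"
    thus "((\<lambda>t. ?g (n, t)) has_sum of_int (?H n) * of_nat n powr (-s)) (?T n)"
      using has_sum_finite[OF index_fibre(1), of n "\<lambda>t. of_nat n powr (-s) :: complex"] inner[of n "of_nat n powr (-s) :: complex"]
      by (simp del: of_int_sum sum_constant)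
  qed
  hence Seq: "S = Dirichlet_L (\<lambda>_. 1) s * Dirichlet_L (kronecker (int d)) s" using H by (rule has_sum_unique)
  have "bij_betw (\<lambda>t. (lattice_index t, t)) lattice_params (SIGMA n:{0<..}. ?T n)"
    by (rule bij_betwI[where g = snd]) (auto simp: lattice_params_def lattice_index_def)
  hence "((\<lambda>t. ?g (lattice_index t, t)) has_sum S) lattice_params" using S by (subst has_sum_reindex_bij_betw)
  hence "((\<lambda>t. of_nat (ideal_norm K (emb ` qlattice t)) powr (-s)) has_sum S) lattice_params"
    by (rule has_sum_cong[THEN iffD1, rotated]) (simp add: ideal_norm_lattice)
  hence "((\<lambda>I. of_nat (ideal_norm K I) powr (-s)) has_sum S) {I. ideal I OK \<and> I \<noteq> {0}}"
    using has_sum_reindex_bij_betw[OF bij_betw_ideals, of "\<lambda>I. of_nat (ideal_norm K I) powr (-s)"] by simp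
  thus ?thesis using Seq by (simp add: infsumI)
qed

theorem dedekind_zeta_eq:
  "dedekind_zeta K = remove_sings (\<lambda>s. Dirichlet_L (\<lambda>_. 1) s * Dirichlet_L (kronecker (int d)) s)"
  unfolding dedekind_zeta_def
proof (rule meromorphic_continuation_eqI)
  interpret Z: periodic_coeffs "\<lambda>_. 1" 1 by (rule periodic_coeffs_one)
  interpret L: periodic_coeffs "kronecker (int d)" d by (rule periodic_coeffs_kronecker[OF d_mod_4 d_gt_1])
  show "(\<lambda>s. Dirichlet_L (\<lambda>_. 1) s * Dirichlet_L (kronecker (int d)) s) meromorphic_on UNIV"
    using Z.Dirichlet_L_meromorphic L.Dirichlet_L_meromorphic
    by (intro meromorphic_on_mult) (auto simp: nicely_meromorphic_on_def)
  show eq: "Dirichlet_L (\<lambda>_. 1) s * Dirichlet_L (kronecker (int d)) s =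
      (\<Sum>\<^sub>\<infinity>I\<in>{I. ideal I OK \<and> I \<noteq> {0}}. of_nat (ideal_norm K I) powr (-s))" if "Re s > 1" for s
    using dedekind_sum_eq[OF that] by simp
  have "(\<lambda>s. (\<Sum>n. of_int 1 * of_nat (Suc n) powr (-s)) * (\<Sum>n. of_int (kronecker (int d) (Suc n)) * of_nat (Suc n) powr (-s) :: complex)) holomorphic_on {s. Re s > 1}"
    by (intro holomorphic_on_mult Z.dirichlet_holomorphic L.dirichlet_holomorphic)
  thus "(\<lambda>s. \<Sum>\<^sub>\<infinity>I\<in>{I. ideal I OK \<and> I \<noteq> {0}}. of_nat (ideal_norm K I) powr (-s)) holomorphic_on {s. Re s > 1}"
    by (rule holomorphic_transform)
      (use dedekind_sum_eq Z.Dirichlet_L_series L.Dirichlet_L_series in simp)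
qed

theorem zeta_height_K:
  assumes "Re s > 0" and "Dirichlet_L (kronecker (int d)) s \<noteq> 0"
  shows "zeta_height s {K} = norm (first_laurent_coeff (Dirichlet_L (\<lambda>_. 1)) s) * norm (Dirichlet_L (kronecker (int d)) s)"
proof -
  interpret Z: periodic_coeffs "\<lambda>_. 1" 1 by (rule periodic_coeffs_one)
  interpret L: periodic_coeffs "kronecker (int d)" d by (rule periodic_coeffs_kronecker[OF d_mod_4 d_gt_1])
  have "Dirichlet_L (\<lambda>_. 1) meromorphic_on UNIV"
    using Z.Dirichlet_L_meromorphic by (simp add: nicely_meromorphic_on_def)
  moreover have "Dirichlet_L (kronecker (int d)) analytic_on {s}"
    by (rule L.Dirichlet_L_mellin(1)[OF assms(1) sum_kronecker_period[OF d_mod_4 d_gt_1 sqf]])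
  ultimately show ?thesis
    unfolding zeta_height_def dedekind_zeta_eq[symmetric]
    using first_laurent_coeff_mult_analytic(1)[where Z = "Dirichlet_L (\<lambda>_. 1)" and L = "Dirichlet_L (kronecker (int d))" and z = s] assms(2) Dirichlet_L_one_not_zero
    by (simp add: dedekind_zeta_eq norm_mult)
qed

end

lemma norm_first_laurent_coeff_zeta_pos: "norm (first_laurent_coeff (Dirichlet_L (\<lambda>_. 1)) s) > 0"
proof -
  interpret Z: periodic_coeffs "\<lambda>_. 1" 1 by (rule periodic_coeffs_one)
  have "Dirichlet_L (\<lambda>_. 1) meromorphic_on UNIV"
    using Z.Dirichlet_L_meromorphic by (simp add: nicely_meromorphic_on_def)
  from first_laurent_coeff_mult_analytic(2)[OF this _, of s "\<lambda>_. 1"] Dirichlet_L_one_not_zero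
  show ?thesis by simp
qed

theorem mainTheorem3:
  fixes \<sigma> :: real
  assumes "1 / 2 < \<sigma>" and "\<sigma> < 1"
  shows "(\<exists>\<epsilon> :: real \<Rightarrow> real. (\<epsilon> \<longlongrightarrow> 0) at_top \<and>
           (\<exists>c\<^sub>1 :: real. \<forall>x :: real. x \<ge> c\<^sub>1 \<longrightarrow>
             (\<exists>d :: nat. fundamental_discriminant (int d) \<and>
                x \<le> real d \<and> real d \<le> 5 / 2 * x \<and>
                0 < norm (Dirichlet_L (kronecker (int d)) (complex_of_real \<sigma>)) \<and>
                norm (Dirichlet_L (kronecker (int d)) (complex_of_real \<sigma>))
                  \<le> exp (- (4 * \<sigma> + \<epsilon> x) * (ln x powr ((1 - \<sigma>) / (2 * \<sigma>)) / ln (ln x))))))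
         \<and> Inf (zeta_height (complex_of_real \<sigma>) ` number_field_classes) = 0
         \<and> \<not> bogomolov_property (zeta_height (complex_of_real \<sigma>)) number_field_classes"
proof (intro conjI)
  let ?L = "\<lambda>d. Dirichlet_L (kronecker (int d)) (complex_of_real \<sigma>)"
  let ?B = "\<lambda>x. exp (- (4 * \<sigma>) * (ln x powr ((1 - \<sigma>) / (2 * \<sigma>)) / ln (ln x)))"
  obtain c\<^sub>1 where c1: "\<And>x. x \<ge> c\<^sub>1 \<Longrightarrow> \<exists>d l. d mod 8 = 5 \<and> squarefree (d::nat) \<and> x \<le> real d \<and> real d \<le> 5/2 * x \<and>
        ?L d = of_real l \<and> 0 < l \<and> l \<le> ?B x"
    using small_L_values[OF assms] unfolding eventually_at_top_linorder by blast
  have small: "\<exists>d. d mod 8 = 5 \<and> squarefree (d::nat) \<and> x \<le> real d \<and> real d \<le> 5/2 * x \<and>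
      0 < norm (?L d) \<and> norm (?L d) \<le> ?B x" if x: "x \<ge> c\<^sub>1" for x
  proof -
    obtain d l where "d mod 8 = 5" "squarefree (d::nat)" "x \<le> real d" "real d \<le> 5/2 * x"
      "?L d = of_real l" "0 < l" "l \<le> ?B x" using c1[OF x] by blast
    thus ?thesis by (intro exI[of _ d]) simp
  qed
  show "\<exists>\<epsilon> :: real \<Rightarrow> real. (\<epsilon> \<longlongrightarrow> 0) at_top \<and>
           (\<exists>c\<^sub>1 :: real. \<forall>x :: real. x \<ge> c\<^sub>1 \<longrightarrow>
             (\<exists>d :: nat. fundamental_discriminant (int d) \<and>
                x \<le> real d \<and> real d \<le> 5 / 2 * x \<and>
                0 < norm (?L d) \<and>
                norm (?L d) \<le> exp (- (4 * \<sigma> + \<epsilon> x) * (ln x powr ((1 - \<sigma>) / (2 * \<sigma>)) / ln (ln x)))))"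
  \<comment> \<open>The bound of \<open>small_L_values\<close> already holds with the constant 4
    \<sigma> itself.\<close>
  proof (intro exI[of _ "\<lambda>_. 0"] conjI exI[of _ c\<^sub>1] allI impI)
    fix x :: real assume "x \<ge> c\<^sub>1"
    then obtain d where d: "d mod 8 = 5" "squarefree (d::nat)" "x \<le> real d" "real d \<le> 5/2 * x"
      "0 < norm (?L d)" "norm (?L d) \<le> ?B x" using small by blast
    have "int d mod 4 = 1" "d \<noteq> 1" using d(1) by presburger+
    moreover have "squarefree (int d)"
    proof (rule squarefreeI)
      fix y assume "y\<^sup>2 dvd int d"
      hence "int ((nat \<bar>y\<bar>)\<^sup>2) dvd int d" by simp
      hence "(nat \<bar>y\<bar>)\<^sup>2 dvd d" by (simp only: int_dvd_int_iff)
      hence "nat \<bar>y\<bar> dvd 1" using d(2) by (rule squarefreeD[rotated])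
      thus "y dvd 1" by auto
    qed
    ultimately have "fundamental_discriminant (int d)" by (simp add: fundamental_discriminant_def)
    thus "\<exists>d :: nat. fundamental_discriminant (int d) \<and> x \<le> real d \<and> real d \<le> 5 / 2 * x \<and> 0 < norm (?L d) \<and>
        norm (?L d) \<le> exp (- (4 * \<sigma> + 0) * (ln x powr ((1 - \<sigma>) / (2 * \<sigma>)) / ln (ln x)))"
      using d by (intro exI[of _ d]) simp
  qed simp
  let ?h = "zeta_height (complex_of_real \<sigma>)"
  define c where "c = norm (first_laurent_coeff (Dirichlet_L (\<lambda>_. 1)) (complex_of_real \<sigma>))"
  have c: "c > 0" unfolding c_def by (rule norm_first_laurent_coeff_zeta_pos)
  have "(?B \<longlongrightarrow> 0) at_top" using assms by real_asymp
  \<comment> \<open>Heights that are positive and arbitrarily small give both remaining claims: the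
    infimum is 0, and no interval to the right of 0 is free of values.\<close>
  have arb: "\<exists>C\<in>number_field_classes. 0 < ?h C \<and> ?h C < e" if "e > 0" for e
  proof -
    have "eventually (\<lambda>x. ?B x < e / c) at_top"
      using \<open>(?B \<longlongrightarrow> 0) at_top\<close> c \<open>e > 0\<close> by (intro order_tendstoD) auto
    hence "eventually (\<lambda>x. x \<ge> c\<^sub>1 \<and> ?B x < e / c) at_top"
      using eventually_ge_at_top[of c\<^sub>1] by eventually_elim simp
    then obtain x where x: "x \<ge> c\<^sub>1" "?B x < e / c" using eventually_happens' by force
    obtain d where d: "d mod 8 = 5" "squarefree (d::nat)" "0 < norm (?L d)" "norm (?L d) \<le> ?B x"
      using small[OF x(1)] by blast
    interpret quadratic_order d "(int d - 1) div 4"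
      using d by unfold_locales presburger+
    have eq: "?h {K} = c * norm (?L d)"
      unfolding c_def using zeta_height_K[of "of_real \<sigma>"] assms d(3) by simp
    have "norm (?L d) < e / c" using d(4) x(2) by simp
    hence "c * norm (?L d) < e" using c by (simp add: field_simps)
    thus ?thesis using number_field_class_K eq c d(3) by (intro bexI[of _ "{K}"]) auto
  qed
  have nonneg: "?h C \<ge> 0" for C by (simp add: zeta_height_def)
  have ne: "number_field_classes \<noteq> {}" using arb[of 1] by auto
  show Inf0: "Inf (?h ` number_field_classes) = 0"
  proof (rule antisym)
    show "0 \<le> Inf (?h ` number_field_classes)" using ne nonneg by (intro cInf_greatest) auto
    show "Inf (?h ` number_field_classes) \<le> 0"
    proof (rule field_le_epsilon)
      fix e :: real assume "e > 0"
      then obtain C where "C \<in> number_field_classes" "?h C < e" using arb by blast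
      moreover from this have "Inf (?h ` number_field_classes) \<le> ?h C"
        using nonneg by (intro cInf_lower) (auto intro!: bdd_belowI[of _ 0])
      ultimately show "Inf (?h ` number_field_classes) \<le> 0 + e" by simp
    qed
  qed
  show "\<not> bogomolov_property ?h number_field_classes"
    unfolding bogomolov_property_def Inf0 using arb by fastforce
qed

end
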